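(* Let $X_1,X_2>0$, $\Omega=(0,X_1)\times(0,X_2)$, $\gamma_L=\{0\}\times(0,X_2)$, $\gamma_T=(0,X_1)\times\{X_2\}$, and let $A\in\mathbb{C}^{n\times n}$, $B\in\mathbb{C}^{n\times m}$ with $n=2$. If $\gamma=\gamma_L\cup\gamma_T$ and $\ker(\theta-A^* )\cap\ker B^*=\{0\}$ for every eigenvalue $\theta$ of $A^*$, then the system $$\left\{\begin{array}{ll} \partial_t y = \overrightarrow{\Delta} y + A y & \text{in } (0,T)\times\Omega,\\ y = 1_\gamma B g & \text{on } (0,T)\times\partial\Omega,\\ y(0)=y_0 & \text{in }\Omega,\end{array}\right.$$ is approximately controllable.
   Context: $\overrightarrow{\Delta}$ is the Laplacian acting componentwise on $\mathbb{C}^n$-valued functions. $A^*,B^*$ are conjugate transposes and $\partial_n$ is the outward normal derivative. Solutions: for $y_0\in H^{-1}(\Omega)^n$ and $g\in L^2(0,T;L^2(\partial\Omega)^m)$ there is a unique solution by transposition $y\in C^0([0,T];H^{-1}(\Omega)^n)\cap L^2(0,T;L^2(\Omega)^n)$, characterized by: for all $\tau\in[0,T]$ and $\zeta\in H^1_0(\Omega)^n$, $\langle y(\tau),\zeta\rangle-\langle y_0,z(0)\rangle=-\int_0^\tau\int_\gamma Bg\cdot\overline{\partial_n z}$, where $z$ solves $-\partial_t z=\overrightarrow{\Delta}z+A^*z$ in $(0,\tau)\times\Omega$, $z=0$ on $\partial\Omega$, $z(\tau)=\zeta$. Approximate controllability: the system is approximately controllable at time $T$ if for all $y_0,y_1\in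 H^{-1}(\Omega)^n$ and $\epsilon>0$ there is $g\in L^2(0,T;L^2(\partial\Omega)^m)$ whose solution satisfies $\|y(T)-y_1\|_{H^{-1}(\Omega)^n}\le\epsilon$; it is approximately controllable if this holds for every $T>0$. *)

theory Defs
  imports "HOL-Analysis.Analysis"
begin

section \<open>Matrices\<close>

definition conj_transpose :: "complex^'m^'n \<Rightarrow> complex^'n^'m" where
  "conj_transpose M = (\<chi> i j. cnj (M $ j $ i))"

definition matrix_kernel :: "complex^'m^'n \<Rightarrow> (complex^'m) set" where
  "matrix_kernel M = {v. M *v v = 0}"

definition matrix_eigenvalue :: "complex^'n^'n \<Rightarrow> complex \<Rightarrow> bool" where
  "matrix_eigenvalue M \<theta> \<longleftrightarrow> (\<exists>v. v \<noteq> 0 \<and> M *v v = \<theta> *s v)"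

definition cdot :: "complex^'n \<Rightarrow> complex^'n \<Rightarrow> complex" where
  "cdot u v = (\<Sum>i\<in>UNIV. u $ i * cnj (v $ i))"


section \<open>Square-integrable functions\<close>

text \<open>
  Elements of \<open>L\<^sup>2\<close> and of the Sobolev spaces are represented by Borel functions;
  every class modulo null sets contains one.  All norms below are therefore seminorms on functions.
\<close>

definition L2_space :: "'a measure \<Rightarrow> ('a \<Rightarrow> 'b::euclidean_space) set" where
  "L2_space M = {u \<in> borel_measurable M. integrable M (\<lambda>x. (norm (u x))\<^sup>2)}"

definition L2_norm :: "'a measure \<Rightarrow> ('a \<Rightarrow> 'b::euclidean_space) \<Rightarrow> real" where
  "L2_norm M u = sqrt (\<integral>x. (norm (u x))\<^sup>2 \<partial>M)"

abbreviation lborel_on :: "'a::euclidean_space set \<Rightarrow> 'a measure" where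
  "lborel_on S \<equiv> restrict_space lborel S"


section \<open>Sobolev spaces on an open set\<close>

primrec C_k :: "nat \<Rightarrow> ('a::euclidean_space \<Rightarrow> 'b::euclidean_space) \<Rightarrow> bool" where
  "C_k 0 f \<longleftrightarrow> continuous_on UNIV f"
| "C_k (Suc k) f \<longleftrightarrow> f differentiable_on UNIV \<and>
     (\<forall>i\<in>Basis. C_k k (\<lambda>x. frechet_derivative f (at x) i))"

definition C_inf :: "('a::euclidean_space \<Rightarrow> 'b::euclidean_space) \<Rightarrow> bool" where
  "C_inf f \<longleftrightarrow> (\<forall>k. C_k k f)"

definition test_functions :: "'a::euclidean_space set \<Rightarrow> ('a \<Rightarrow> 'b::euclidean_space) set" where
  "test_functions \<Omega> = {\<phi>. C_inf \<phi> \<and> compact (closure {x. \<phi> x \<noteq> 0}) \<and> closure {x. \<phi> x \<noteq> 0} \<subseteq> \<Omega>}"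

text \<open>\<open>v\<close> is the weak partial derivative of \<open>u\<close> in the coordinate direction \<open>i\<close>.\<close>

definition has_weak_partial ::
  "'a::euclidean_space set \<Rightarrow> 'a \<Rightarrow> ('a \<Rightarrow> 'b::euclidean_space) \<Rightarrow> ('a \<Rightarrow> 'b) \<Rightarrow> bool" where
  "has_weak_partial \<Omega> i u v \<longleftrightarrow>
     (\<forall>\<phi>::'a \<Rightarrow> real. \<phi> \<in> test_functions \<Omega> \<longrightarrow>
        (\<integral>x. frechet_derivative \<phi> (at x) i *\<^sub>R u x \<partial>lborel_on \<Omega>) =
        - (\<integral>x. \<phi> x *\<^sub>R v x \<partial>lborel_on \<Omega>))"

text \<open>Unique up to null sets whenever it exists; all uses below are insensitive to the choice.\<close>

definition weak_partial ::
  "'a::euclidean_space set \<Rightarrow> 'a \<Rightarrow> ('a \<Rightarrow> 'b::euclidean_space) \<Rightarrow> 'a \<Rightarrow> 'b" where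
  "weak_partial \<Omega> i u = (SOME v. v \<in> L2_space (lborel_on \<Omega>) \<and> has_weak_partial \<Omega> i u v)"

definition Sobolev_H1 :: "'a::euclidean_space set \<Rightarrow> ('a \<Rightarrow> 'b::euclidean_space) set" where
  "Sobolev_H1 \<Omega> = {u \<in> L2_space (lborel_on \<Omega>).
     \<forall>i\<in>Basis. \<exists>v \<in> L2_space (lborel_on \<Omega>). has_weak_partial \<Omega> i u v}"

definition Sobolev_H2 :: "'a::euclidean_space set \<Rightarrow> ('a \<Rightarrow> 'b::euclidean_space) set" where
  "Sobolev_H2 \<Omega> = {u \<in> Sobolev_H1 \<Omega>. \<forall>i\<in>Basis. weak_partial \<Omega> i u \<in> Sobolev_H1 \<Omega>}"

definition H1_norm :: "'a::euclidean_space set \<Rightarrow> ('a \<Rightarrow> 'b::euclidean_space) \<Rightarrow> real" where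
  "H1_norm \<Omega> u = sqrt ((L2_norm (lborel_on \<Omega>) u)\<^sup>2 +
     (\<Sum>i\<in>Basis. (L2_norm (lborel_on \<Omega>) (weak_partial \<Omega> i u))\<^sup>2))"

definition Sobolev_H10 :: "'a::euclidean_space set \<Rightarrow> ('a \<Rightarrow> 'b::euclidean_space) set" where
  "Sobolev_H10 \<Omega> = {u \<in> Sobolev_H1 \<Omega>.
     \<exists>\<phi>. (\<forall>k::nat. \<phi> k \<in> test_functions \<Omega>) \<and> (\<lambda>k. H1_norm \<Omega> (\<lambda>x. \<phi> k x - u x)) \<longlonglongrightarrow> 0}"

definition laplacian :: "'a::euclidean_space set \<Rightarrow> ('a \<Rightarrow> 'b::euclidean_space) \<Rightarrow> 'a \<Rightarrow> 'b" where
  "laplacian \<Omega> u x = (\<Sum>i\<in>Basis. weak_partial \<Omega> i (weak_partial \<Omega> i u) x)"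

text \<open>
  \<open>H\<^sup>-\<^sup>1(\<Omega>)\<^sup>n\<close> is the space of bounded antilinear functionals on \<open>H\<^sup>1\<^sub>0(\<Omega>)\<^sup>n\<close>, so that
  \<open>F \<zeta>\<close> is the bracket \<open>\<langle>F, \<zeta>\<rangle>\<close>, and \<open>y \<in> L\<^sup>2(\<Omega>)\<^sup>n\<close> acts by \<open>\<zeta> \<mapsto> \<integral> y \<cdot> cnj \<zeta>\<close>.  Only the values on
  \<open>H\<^sup>1\<^sub>0(\<Omega>)\<^sup>n\<close> matter; boundedness makes \<open>F\<close> well defined modulo null sets.
\<close>

definition Sobolev_Hm1 :: "'a::euclidean_space set \<Rightarrow> (('a \<Rightarrow> complex^'n) \<Rightarrow> complex) set" where
  "Sobolev_Hm1 \<Omega> = {F.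
     (\<forall>u\<in>Sobolev_H10 \<Omega>. \<forall>v\<in>Sobolev_H10 \<Omega>. F (\<lambda>x. u x + v x) = F u + F v) \<and>
     (\<forall>c. \<forall>u\<in>Sobolev_H10 \<Omega>. F (\<lambda>x. c *s u x) = cnj c * F u) \<and>
     (\<exists>C. \<forall>u\<in>Sobolev_H10 \<Omega>. norm (F u) \<le> C * H1_norm \<Omega> u)}"

definition Hm1_norm :: "'a::euclidean_space set \<Rightarrow> (('a \<Rightarrow> complex^'n) \<Rightarrow> complex) \<Rightarrow> real" where
  "Hm1_norm \<Omega> F = (SUP \<zeta>\<in>{\<zeta> \<in> Sobolev_H10 \<Omega>. H1_norm \<Omega> \<zeta> \<le> 1}. norm (F \<zeta>))"


section \<open>Boundary traces\<close>

text \<open>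
  In this section \<open>\<sigma>\<close> is the surface measure of the boundary and \<open>\<nu>\<close> its outward unit normal field.
  The trace is the continuous extension to \<open>H\<^sup>1(\<Omega>)\<close> of the restriction map of functions smooth up to
  the boundary, with values in \<open>L\<^sup>2(\<sigma>)\<close>.
\<close>

definition has_trace :: "'a::euclidean_space set \<Rightarrow> 'a measure \<Rightarrow>
    ('a \<Rightarrow> 'b::euclidean_space) \<Rightarrow> ('a \<Rightarrow> 'b) \<Rightarrow> bool" where
  "has_trace \<Omega> \<sigma> u h \<longleftrightarrow> u \<in> Sobolev_H1 \<Omega> \<and> h \<in> L2_space \<sigma> \<and>
     (\<exists>\<phi>. (\<forall>k::nat. C_inf (\<phi> k)) \<and>
        (\<lambda>k. H1_norm \<Omega> (\<lambda>x. \<phi> k x - u x)) \<longlonglongrightarrow> 0 \<and>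
        (\<lambda>k. L2_norm \<sigma> (\<lambda>x. \<phi> k x - h x)) \<longlonglongrightarrow> 0)"

definition has_normal_derivative :: "'a::euclidean_space set \<Rightarrow> 'a measure \<Rightarrow> ('a \<Rightarrow> 'a) \<Rightarrow>
    ('a \<Rightarrow> 'b::euclidean_space) \<Rightarrow> ('a \<Rightarrow> 'b) \<Rightarrow> bool" where
  "has_normal_derivative \<Omega> \<sigma> \<nu> u h \<longleftrightarrow> u \<in> Sobolev_H2 \<Omega> \<and>
     (\<exists>G. (\<forall>i\<in>Basis. has_trace \<Omega> \<sigma> (weak_partial \<Omega> i u) (G i)) \<and>
          (AE x in \<sigma>. h x = (\<Sum>i\<in>Basis. (\<nu> x \<bullet> i) *\<^sub>R G i x)))"


section \<open>The controlled system\<close>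

text \<open>
  \<open>z\<close> is the solution on \<open>[0,\<tau>]\<close> of \<open>-\<partial>\<^sub>t z = \<Delta> z + A\<^sup>* z\<close>, \<open>z = 0\<close> on the boundary, \<open>z(\<tau>) = \<zeta>\<close>, for
  \<open>\<zeta> \<in> H\<^sup>1\<^sub>0(\<Omega>)\<^sup>n\<close>: it is continuous into \<open>H\<^sup>1\<^sub>0\<close>, and on \<open>(0,\<tau>)\<close> it is differentiable into \<open>L\<^sup>2\<close>,
  takes values in \<open>H\<^sup>2\<close> and satisfies the equation in \<open>L\<^sup>2\<close>.
\<close>

definition adjoint_solution :: "'a::euclidean_space set \<Rightarrow> complex^'n^'n \<Rightarrow> real \<Rightarrow>
    ('a \<Rightarrow> complex^'n) \<Rightarrow> (real \<Rightarrow> 'a \<Rightarrow> complex^'n) \<Rightarrow> bool" where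
  "adjoint_solution \<Omega> A \<tau> \<zeta> z \<longleftrightarrow>
     (\<forall>t\<in>{0..\<tau>}. z t \<in> Sobolev_H10 \<Omega> \<and>
        ((\<lambda>s. H1_norm \<Omega> (\<lambda>x. z s x - z t x)) \<longlongrightarrow> 0) (at t within {0..\<tau>})) \<and>
     (\<forall>t\<in>{0<..<\<tau>}. z t \<in> Sobolev_H2 \<Omega> \<and>
        ((\<lambda>s. L2_norm (lborel_on \<Omega>)
            (\<lambda>x. (z s x - z t x) /\<^sub>R (s - t) + (laplacian \<Omega> (z t) x + conj_transpose A *v z t x)))
          \<longlongrightarrow> 0) (at t)) \<and>
     (AE x in lborel_on \<Omega>. z \<tau> x = \<zeta> x)"

text \<open>\<open>L\<^sup>2(0,T; L\<^sup>2(\<partial>\<Omega>)\<^sup>m)\<close>, identified with \<open>L\<^sup>2((0,T) \<times> \<partial>\<Omega>)\<^sup>m\<close>.\<close>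

definition boundary_L2 :: "real \<Rightarrow> 'a::euclidean_space measure \<Rightarrow> (real \<Rightarrow> 'a \<Rightarrow> complex^'m) set" where
  "boundary_L2 T \<sigma> = {g. (\<lambda>(t, x). g t x) \<in> L2_space (lborel_on {0<..<T} \<Otimes>\<^sub>M \<sigma>)}"

text \<open>
  The solution by transposition of \<open>\<partial>\<^sub>t y = \<Delta> y + A y\<close>, \<open>y = 1\<^sub>\<gamma> B g\<close> on the boundary, \<open>y(0) = y0\<close>.
  The three conjuncts say \<open>y \<in> C\<^sup>0([0,T]; H\<^sup>-\<^sup>1)\<close>, \<open>y \<in> L\<^sup>2(0,T; L\<^sup>2)\<close> (through the embedding of
  \<open>L\<^sup>2\<close> in \<open>H\<^sup>-\<^sup>1\<close>), and the duality identity; in the latter, \<open>h\<close> is the normal derivative of \<open>z\<close>.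
\<close>

definition transposition_solution :: "'a::euclidean_space set \<Rightarrow> 'a measure \<Rightarrow> ('a \<Rightarrow> 'a) \<Rightarrow> 'a set \<Rightarrow>
    complex^'n^'n \<Rightarrow> complex^'m^'n \<Rightarrow> real \<Rightarrow> (('a \<Rightarrow> complex^'n) \<Rightarrow> complex) \<Rightarrow>
    (real \<Rightarrow> 'a \<Rightarrow> complex^'m) \<Rightarrow> (real \<Rightarrow> ('a \<Rightarrow> complex^'n) \<Rightarrow> complex) \<Rightarrow> bool" where
  "transposition_solution \<Omega> \<sigma> \<nu> \<gamma> A B T y0 g y \<longleftrightarrow>
     (\<forall>t\<in>{0..T}. y t \<in> Sobolev_Hm1 \<Omega> \<and>
        ((\<lambda>s. Hm1_norm \<Omega> (\<lambda>\<zeta>. y s \<zeta> - y t \<zeta>)) \<longlongrightarrow> 0) (at t within {0..T})) \<and>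
     (\<exists>w. (\<lambda>(t, x). w t x) \<in> L2_space (lborel_on {0<..<T} \<Otimes>\<^sub>M lborel_on \<Omega>) \<and>
        (AE t in lborel_on {0<..<T}. \<forall>\<zeta>\<in>Sobolev_H10 \<Omega>.
           y t \<zeta> = (\<integral>x. cdot (w t x) (\<zeta> x) \<partial>lborel_on \<Omega>))) \<and>
     (\<forall>\<tau>\<in>{0..T}. \<forall>\<zeta>\<in>Sobolev_H10 \<Omega>. \<forall>z h.
        adjoint_solution \<Omega> A \<tau> \<zeta> z \<longrightarrow>
        h \<in> boundary_L2 \<tau> \<sigma> \<longrightarrow>
        (AE t in lborel_on {0<..<\<tau>}. has_normal_derivative \<Omega> \<sigma> \<nu> (z t) (h t)) \<longrightarrow>
        y \<tau> \<zeta> - y0 (z 0) =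
          - (LINT t:{0<..<\<tau>}|lborel. LINT x:\<gamma>|\<sigma>. cdot (B *v g t x) (h t x)))"

definition approximately_controllable_at :: "'a::euclidean_space set \<Rightarrow> 'a measure \<Rightarrow> ('a \<Rightarrow> 'a) \<Rightarrow>
    'a set \<Rightarrow> complex^'n^'n \<Rightarrow> complex^'m^'n \<Rightarrow> real \<Rightarrow> bool" where
  "approximately_controllable_at \<Omega> \<sigma> \<nu> \<gamma> A B T \<longleftrightarrow>
     (\<forall>y0\<in>Sobolev_Hm1 \<Omega>. \<forall>y1\<in>Sobolev_Hm1 \<Omega>. \<forall>\<epsilon>>0. \<exists>g\<in>boundary_L2 T \<sigma>. \<exists>y.
        transposition_solution \<Omega> \<sigma> \<nu> \<gamma> A B T y0 g y \<and>
        Hm1_norm \<Omega> (\<lambda>\<zeta>. y T \<zeta> - y1 \<zeta>) \<le> \<epsilon>)"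

definition approximately_controllable :: "'a::euclidean_space set \<Rightarrow> 'a measure \<Rightarrow> ('a \<Rightarrow> 'a) \<Rightarrow>
    'a set \<Rightarrow> complex^'n^'n \<Rightarrow> complex^'m^'n \<Rightarrow> bool" where
  "approximately_controllable \<Omega> \<sigma> \<nu> \<gamma> A B \<longleftrightarrow>
     (\<forall>T>0. approximately_controllable_at \<Omega> \<sigma> \<nu> \<gamma> A B T)"


section \<open>The rectangle\<close>

definition rect :: "real \<Rightarrow> real \<Rightarrow> (real \<times> real) set" where
  "rect X1 X2 = {0<..<X1} \<times> {0<..<X2}"

definition rect_left :: "real \<Rightarrow> real \<Rightarrow> (real \<times> real) set" where
  "rect_left X1 X2 = {0} \<times> {0<..<X2}"

definition rect_top :: "real \<Rightarrow> real \<Rightarrow> (real \<times> real) set" where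
  "rect_top X1 X2 = {0<..<X1} \<times> {X2}"

text \<open>Arc length on the boundary; the corners form a null set.\<close>

definition rect_surface :: "real \<Rightarrow> real \<Rightarrow> (real \<times> real) measure" where
  "rect_surface X1 X2 = measure_of UNIV (sets borel) (\<lambda>S.
     emeasure lborel {s \<in> {0<..<X2}. (0, s) \<in> S} + emeasure lborel {s \<in> {0<..<X2}. (X1, s) \<in> S} +
     emeasure lborel {s \<in> {0<..<X1}. (s, 0) \<in> S} + emeasure lborel {s \<in> {0<..<X1}. (s, X2) \<in> S})"

text \<open>Outward unit normal; its values at the corners and off the boundary are irrelevant.\<close>

definition rect_normal :: "real \<Rightarrow> real \<Rightarrow> real \<times> real \<Rightarrow> real \<times> real" where
  "rect_normal X1 X2 x =
     (if fst x = 0 then (-1, 0) else if fst x = X1 then (1, 0)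
      else if snd x = 0 then (0, -1) else (0, 1))"

lemma sets_rect_surface [simp]: "sets (rect_surface X1 X2) = sets borel"
  and space_rect_surface [simp]: "space (rect_surface X1 X2) = UNIV"
  unfolding rect_surface_def
  using sets.sigma_sets_eq[of "borel :: (real \<times> real) measure"] by simp_all

lemma emeasure_rect_surface:
  assumes S: "S \<in> sets borel"
  shows "emeasure (rect_surface X1 X2) S =
     emeasure lborel {s \<in> {0<..<X2}. (0, s) \<in> S} + emeasure lborel {s \<in> {0<..<X2}. (X1, s) \<in> S} +
     emeasure lborel {s \<in> {0<..<X1}. (s, 0) \<in> S} + emeasure lborel {s \<in> {0<..<X1}. (s, X2) \<in> S}"
proof -
  have piece: "{s \<in> {0<..<X}. f s \<in> S} \<in> sets lborel"
    if "S \<in> sets borel" "f \<in> borel_measurable borel"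
    for X :: real and f :: "real \<Rightarrow> real \<times> real" and S
  proof -
    have "f -` S \<inter> space borel \<in> sets borel" using that by (rule measurable_sets[rotated])
    then have "f -` S \<inter> {0<..<X} \<in> sets borel" by auto
    moreover have "f -` S \<inter> {0<..<X} = {s \<in> {0<..<X}. f s \<in> S}" by auto
    ultimately show ?thesis by simp
  qed
  have additive: "(\<Sum>i. emeasure lborel {s \<in> {0<..<X}. f s \<in> F i}) =
      emeasure lborel {s \<in> {0<..<X}. f s \<in> (\<Union>i. F i)}"
    if F: "range F \<subseteq> sets borel" "disjoint_family F" and f: "f \<in> borel_measurable borel"
    for X :: real and f :: "real \<Rightarrow> real \<times> real" and F :: "nat \<Rightarrow> (real \<times> real) set"
  proof -
    have "(\<Sum>i. emeasure lborel {s \<in> {0<..<X}. f s \<in> F i}) =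
        emeasure lborel (\<Union>i. {s \<in> {0<..<X}. f s \<in> F i})"
      using F piece[OF _ f] by (intro suminf_emeasure) (auto simp: disjoint_family_on_def)
    also have "(\<Union>i. {s \<in> {0<..<X}. f s \<in> F i}) = {s \<in> {0<..<X}. f s \<in> (\<Union>i. F i)}" by auto
    finally show ?thesis .
  qed
  have m: "(\<lambda>s::real. (a, s)) \<in> borel_measurable borel" "(\<lambda>s::real. (s, a)) \<in> borel_measurable borel"
    for a :: real
    by (intro borel_measurable_continuous_onI continuous_intros)+
  show ?thesis
  proof (rule emeasure_measure_of[OF rect_surface_def])
    show "sets borel \<subseteq> Pow (UNIV :: (real \<times> real) set)" by simp
    show "S \<in> sets (rect_surface X1 X2)" using S by simp
    show "positive (sets (rect_surface X1 X2)) (\<lambda>S.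
       emeasure lborel {s \<in> {0<..<X2}. (0, s) \<in> S} + emeasure lborel {s \<in> {0<..<X2}. (X1, s) \<in> S} +
       emeasure lborel {s \<in> {0<..<X1}. (s, 0) \<in> S} + emeasure lborel {s \<in> {0<..<X1}. (s, X2) \<in> S})"
      by (simp add: positive_def)
    show "countably_additive (sets (rect_surface X1 X2)) (\<lambda>S.
       emeasure lborel {s \<in> {0<..<X2}. (0, s) \<in> S} + emeasure lborel {s \<in> {0<..<X2}. (X1, s) \<in> S} +
       emeasure lborel {s \<in> {0<..<X1}. (s, 0) \<in> S} + emeasure lborel {s \<in> {0<..<X1}. (s, X2) \<in> S})"
    proof (rule countably_additiveI)
      fix F :: "nat \<Rightarrow> (real \<times> real) set"
      assume "range F \<subseteq> sets (rect_surface X1 X2)" and d: "disjoint_family F"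
      then have F: "range F \<subseteq> sets borel" by simp
      note a = additive[OF F d m(1)] additive[OF F d m(2)]
      show "(\<Sum>i. emeasure lborel {s \<in> {0<..<X2}. (0, s) \<in> F i} +
             emeasure lborel {s \<in> {0<..<X2}. (X1, s) \<in> F i} +
             emeasure lborel {s \<in> {0<..<X1}. (s, 0) \<in> F i} +
             emeasure lborel {s \<in> {0<..<X1}. (s, X2) \<in> F i}) =
           emeasure lborel {s \<in> {0<..<X2}. (0, s) \<in> (\<Union>i. F i)} +
           emeasure lborel {s \<in> {0<..<X2}. (X1, s) \<in> (\<Union>i. F i)} +
           emeasure lborel {s \<in> {0<..<X1}. (s, 0) \<in> (\<Union>i. F i)} +
           emeasure lborel {s \<in> {0<..<X1}. (s, X2) \<in> (\<Union>i. F i)}"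
        by (simp only: a[symmetric] suminf_add[symmetric] summableI)
    qed
  qed
qed

end

theory Submission
  imports Defs "HOL-Complex_Analysis.Complex_Analysis" "HOL-Real_Asymp.Real_Asymp"
begin

text \<open>
  In the sine basis of the rectangle the adjoint flow acts on the coefficient of index \<open>(k,l)\<close> by
  \<open>exp (- \<lambda>\<^sub>k\<^sub>l s) e\<^sup>s\<^sup>A\<^sup>*\<close>, and the reachable set is dense in \<open>H\<^sup>-\<^sup>1\<close> unless some nonzero coefficient
  family \<open>\<zeta>\<close> has vanishing boundary observation.  Controls proportional to a single sine on the left
  edge isolate, for each \<open>l\<close>, the series \<open>\<Sum>k. \<omega>\<^sub>k exp (- \<lambda>\<^sub>k\<^sub>l s) B\<^sup>* e\<^sup>s\<^sup>A\<^sup>* \<zeta>\<^sub>k\<^sub>l\<close>; it is holomorphic for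
  \<open>Re s > 0\<close>, so it vanishes for all \<open>s > 0\<close> as soon as it does on \<open>(0,T)\<close>.  The top edge gives the same
  for each \<open>k\<close>.  Terms with distinct exponents vanish separately.  For a double eigenvalue of \<open>A\<^sup>*\<close> all
  exponents in one series are distinct.  For two eigenvalues the only obstruction is a cancellation
  between their spectral components, and following it alternately along the two edges is an infinite
  descent in one of the indices.  Hence \<open>B\<^sup>*\<close> annihilates both spectral components of every \<open>\<zeta>\<^sub>k\<^sub>l\<close>, and
  the kernel hypothesis gives \<open>\<zeta> = 0\<close>.
\<close>

section \<open>Square-integrable functions\<close>

text \<open>The transposition identity quantifies over every adjoint solution whose normal
  derivative exists only as an L2 trace, so no sine series may be differentiated term by term. Two
  devices avoid this. Each sine coefficient of the adjoint state solves a linear ODE, hence is known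
  whatever solution is given; and boundary integrals are computed by Green's formula against lifts
  that are affine in one variable and a sine in the other, whose sine coefficients are explicit. The
  controlled state is not obtained from a well-posedness theorem but written down by Duhamel in each
  mode, \<open>H^-1\<close> being a weighted l2 space. Distinct modes of a rectangle may share one
  Laplace eigenvalue, so exponents do not separate all modes together; along one row or column they
  increase strictly. Having only two eigenvalues of the adjoint matrix matters: every coincidence
  has the same gap, so both edges compare against one number. Equal and distinct roots share one
  formula for the flow, through a divided difference.\<close>

lemma L2_spaceI:
  "u \<in> borel_measurable M \<Longrightarrow> integrable M (\<lambda>x. (norm (u x))\<^sup>2) \<Longrightarrow> u \<in> L2_space M"
  by (simp add: L2_space_def)

lemma L2_space_measurable [dest]: "u \<in> L2_space M \<Longrightarrow> u \<in> borel_measurable M"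
  by (simp add: L2_space_def)

lemma L2_space_integrable_sq: "u \<in> L2_space M \<Longrightarrow> integrable M (\<lambda>x. (norm (u x))\<^sup>2)"
  by (simp add: L2_space_def)

lemma L2_norm_nonneg [simp]: "0 \<le> L2_norm M u"
  by (simp add: L2_norm_def)

lemma L2_norm_sq: "(L2_norm M u)\<^sup>2 = (\<integral>x. (norm (u x))\<^sup>2 \<partial>M)"
  by (simp add: L2_norm_def)

lemma L2_space_bound:
  fixes u :: "'a \<Rightarrow> 'b::euclidean_space" and v :: "'a \<Rightarrow> 'c::euclidean_space"
  assumes u: "u \<in> L2_space M" and v: "v \<in> borel_measurable M"
    and le: "\<And>x. norm (v x) \<le> K * norm (u x)"
  shows "v \<in> L2_space M"
proof (rule L2_spaceI[OF v])
  show "integrable M (\<lambda>x. (norm (v x))\<^sup>2)"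
  proof (rule Bochner_Integration.integrable_bound)
    show "integrable M (\<lambda>x. K\<^sup>2 * (norm (u x))\<^sup>2)"
      using L2_space_integrable_sq[OF u] by simp
    show "(\<lambda>x. (norm (v x))\<^sup>2) \<in> borel_measurable M"
      using v by measurable
    show "AE x in M. norm ((norm (v x))\<^sup>2) \<le> norm (K\<^sup>2 * (norm (u x))\<^sup>2)"
    proof (rule AE_I2)
      fix x
      have "(norm (v x))\<^sup>2 \<le> (K * norm (u x))\<^sup>2"
        using le[of x] by (intro power_mono) auto
      then show "norm ((norm (v x))\<^sup>2) \<le> norm (K\<^sup>2 * (norm (u x))\<^sup>2)"
        by (simp add: power_mult_distrib)
    qed
  qed
qed

lemma L2_space_linear:
  fixes u :: "'a \<Rightarrow> 'b::euclidean_space" and T :: "'b \<Rightarrow> 'c::euclidean_space"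
  assumes "u \<in> L2_space M" and "bounded_linear T"
  shows "(\<lambda>x. T (u x)) \<in> L2_space M"
proof -
  obtain K where K: "\<And>x. norm (T x) \<le> norm x * K"
    using bounded_linear.bounded[OF assms(2)] by blast
  have "T \<in> borel_measurable borel"
    by (intro borel_measurable_continuous_onI linear_continuous_on assms)
  then have "(\<lambda>x. T (u x)) \<in> borel_measurable M"
    using assms(1) by (auto simp: L2_space_def)
  then show ?thesis
    by (rule L2_space_bound[OF assms(1)]) (use K in \<open>auto simp: mult.commute\<close>)
qed

lemma L2_space_zero [simp]: "(\<lambda>x. 0) \<in> L2_space M"
  by (simp add: L2_space_def)

lemma L2_space_scaleR: "u \<in> L2_space M \<Longrightarrow> (\<lambda>x. c *\<^sub>R u x) \<in> L2_space M"
  by (rule L2_space_linear) (auto intro: bounded_linear_intros)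

lemma L2_space_uminus: "u \<in> L2_space M \<Longrightarrow> (\<lambda>x. - u x) \<in> L2_space M"
  using L2_space_scaleR[of u M "-1"] by simp

lemma L2_space_norm: "u \<in> L2_space M \<Longrightarrow> (\<lambda>x. norm (u x)) \<in> L2_space M"
  by (auto simp: L2_space_def)

lemma L2_space_add:
  assumes "u \<in> L2_space M" "v \<in> L2_space M"
  shows "(\<lambda>x. u x + v x) \<in> L2_space M"
proof (rule L2_spaceI)
  show m: "(\<lambda>x. u x + v x) \<in> borel_measurable M" using assms by (auto simp: L2_space_def)
  show "integrable M (\<lambda>x. (norm (u x + v x))\<^sup>2)"
  proof (rule Bochner_Integration.integrable_bound)
    show "integrable M (\<lambda>x. 2 * (norm (u x))\<^sup>2 + 2 * (norm (v x))\<^sup>2)"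
      using assms by (intro Bochner_Integration.integrable_add integrable_mult_right L2_space_integrable_sq)
    show "(\<lambda>x. (norm (u x + v x))\<^sup>2) \<in> borel_measurable M" using m by measurable
    show "AE x in M. norm ((norm (u x + v x))\<^sup>2) \<le> norm (2 * (norm (u x))\<^sup>2 + 2 * (norm (v x))\<^sup>2)"
    proof (rule AE_I2)
      fix x
      have "(norm (u x + v x))\<^sup>2 \<le> (norm (u x) + norm (v x))\<^sup>2"
        by (intro power_mono norm_triangle_ineq) auto
      also have "\<dots> \<le> 2 * (norm (u x))\<^sup>2 + 2 * (norm (v x))\<^sup>2"
        using sum_squares_bound[of "norm (u x)" "norm (v x)"] by (simp add: power2_sum)
      finally show "norm ((norm (u x + v x))\<^sup>2) \<le> norm (2 * (norm (u x))\<^sup>2 + 2 * (norm (v x))\<^sup>2)"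
        by simp
    qed
  qed
qed

lemma L2_space_diff:
  "u \<in> L2_space M \<Longrightarrow> v \<in> L2_space M \<Longrightarrow> (\<lambda>x. u x - v x) \<in> L2_space M"
  using L2_space_add[of u M "\<lambda>x. - v x"] L2_space_uminus[of v M] by simp

lemma L2_space_sum:
  "(\<And>i. i \<in> I \<Longrightarrow> u i \<in> L2_space M) \<Longrightarrow> (\<lambda>x. \<Sum>i\<in>I. u i x) \<in> L2_space M"
  by (induction I rule: infinite_finite_induct) (auto intro: L2_space_add)

lemma L2_integrable_norm_mult:
  fixes u :: "'a \<Rightarrow> 'b::euclidean_space" and v :: "'a \<Rightarrow> 'c::euclidean_space"
  assumes "u \<in> L2_space M" "v \<in> L2_space M"
  shows "integrable M (\<lambda>x. norm (u x) * norm (v x))"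
proof (rule Bochner_Integration.integrable_bound)
  show "integrable M (\<lambda>x. (norm (u x))\<^sup>2 + (norm (v x))\<^sup>2)"
    using assms by (intro Bochner_Integration.integrable_add L2_space_integrable_sq)
  show "(\<lambda>x. norm (u x) * norm (v x)) \<in> borel_measurable M"
    using assms by (auto simp: L2_space_def)
  show "AE x in M. norm (norm (u x) * norm (v x)) \<le> norm ((norm (u x))\<^sup>2 + (norm (v x))\<^sup>2)"
  proof (rule AE_I2)
    fix x
    have "2 * (norm (u x) * norm (v x)) \<le> (norm (u x))\<^sup>2 + (norm (v x))\<^sup>2"
      using sum_squares_bound[of "norm (u x)" "norm (v x)"] by (simp add: algebra_simps)
    moreover have "0 \<le> norm (u x) * norm (v x)" by simp
    ultimately show "norm (norm (u x) * norm (v x)) \<le> norm ((norm (u x))\<^sup>2 + (norm (v x))\<^sup>2)"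
      by (simp del: mult_nonneg_nonneg zero_le_mult_iff)
  qed
qed

lemma L2_norm_AE_zero:
  assumes "u \<in> L2_space M"
  shows "L2_norm M u = 0 \<longleftrightarrow> (AE x in M. u x = 0)"
proof -
  have "L2_norm M u = 0 \<longleftrightarrow> (\<integral>x. (norm (u x))\<^sup>2 \<partial>M) = 0"
    by (simp add: L2_norm_def)
  also have "\<dots> \<longleftrightarrow> (AE x in M. (norm (u x))\<^sup>2 = 0)"
    by (intro integral_nonneg_eq_0_iff_AE L2_space_integrable_sq assms) simp
  finally show ?thesis by simp
qed

lemma L2_Cauchy_Schwarz_norm:
  fixes u :: "'a \<Rightarrow> 'b::euclidean_space" and v :: "'a \<Rightarrow> 'c::euclidean_space"
  assumes u: "u \<in> L2_space M" and v: "v \<in> L2_space M"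
  shows "(\<integral>x. norm (u x) * norm (v x) \<partial>M) \<le> L2_norm M u * L2_norm M v"
proof -
  define a where "a = L2_norm M u"
  define b where "b = L2_norm M v"
  have a2: "(\<integral>x. (norm (u x))\<^sup>2 \<partial>M) = a\<^sup>2" and b2: "(\<integral>x. (norm (v x))\<^sup>2 \<partial>M) = b\<^sup>2"
    by (simp_all add: a_def b_def L2_norm_sq)
  have ab: "a \<ge> 0" "b \<ge> 0" by (simp_all add: a_def b_def)
  show ?thesis
  proof (cases "a = 0 \<or> b = 0")
    case True
    then have "(AE x in M. u x = 0) \<or> (AE x in M. v x = 0)"
      using L2_norm_AE_zero[OF u] L2_norm_AE_zero[OF v] by (simp add: a_def b_def)
    then have "AE x in M. norm (u x) * norm (v x) = 0" by auto
    then have "(\<integral>x. norm (u x) * norm (v x) \<partial>M) = 0"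
      by (rule integral_eq_zero_AE)
    then show ?thesis by simp
  next
    case False
    then have pos: "0 < 2 * a * b" using ab by simp
    have i: "integrable M (\<lambda>x. norm (u x) * norm (v x))" "integrable M (\<lambda>x. (norm (u x))\<^sup>2)"
      "integrable M (\<lambda>x. (norm (v x))\<^sup>2)"
      using assms by (auto intro: L2_integrable_norm_mult L2_space_integrable_sq)
    \<comment> \<open>With \<open>a\<close> and \<open>b\<close> the two norms, expanding this
      square gives \<open>2 * a * b\<close> times the desired inequality; the degenerate case was
      split off so that the factor can be cancelled.\<close>
    have "0 \<le> (\<integral>x. (b * norm (u x) - a * norm (v x))\<^sup>2 \<partial>M)" by simp
    also have "\<dots> = (\<integral>x. b\<^sup>2 * (norm (u x))\<^sup>2 + a\<^sup>2 * (norm (v x))\<^sup>2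
        - 2 * a * b * (norm (u x) * norm (v x)) \<partial>M)"
      by (intro Bochner_Integration.integral_cong refl) (simp add: power2_eq_square algebra_simps)
    also have "\<dots> = b\<^sup>2 * a\<^sup>2 + a\<^sup>2 * b\<^sup>2 - 2 * a * b * (\<integral>x. norm (u x) * norm (v x) \<partial>M)"
      using i by (simp add: a2 b2)
    also have "\<dots> = 2 * a * b * (a * b - (\<integral>x. norm (u x) * norm (v x) \<partial>M))"
      by (simp add: power2_eq_square algebra_simps)
    finally have "0 \<le> a * b - (\<integral>x. norm (u x) * norm (v x) \<partial>M)"
      using pos by (simp add: zero_le_mult_iff)
    then show ?thesis by (simp add: a_def b_def)
  qed
qed

text \<open>Cauchy--Schwarz for any product bounded by the product of norms. One statement serves
  the real inner product, scalar multiples and the complex pairing \<open>cdot\<close>.\<close>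

lemma L2_bilinear:
  fixes u :: "'a \<Rightarrow> 'b::euclidean_space" and v :: "'a \<Rightarrow> 'c::euclidean_space"
    and p :: "'a \<Rightarrow> 'd::euclidean_space"
  assumes u: "u \<in> L2_space M" and v: "v \<in> L2_space M" and p: "p \<in> borel_measurable M"
    and le: "\<And>x. norm (p x) \<le> K * (norm (u x) * norm (v x))" and K: "K \<ge> 0"
  shows "integrable M p" and "norm (\<integral>x. p x \<partial>M) \<le> K * (L2_norm M u * L2_norm M v)"
proof -
  have i: "integrable M (\<lambda>x. K * (norm (u x) * norm (v x)))"
    by (intro integrable_mult_right L2_integrable_norm_mult u v)
  show int: "integrable M p"
    by (rule Bochner_Integration.integrable_bound[OF i p])
      (use le K in \<open>auto intro!: AE_I2 simp: abs_mult\<close>)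
  have "norm (\<integral>x. p x \<partial>M) \<le> (\<integral>x. norm (p x) \<partial>M)" by simp
  also have "\<dots> \<le> (\<integral>x. K * (norm (u x) * norm (v x)) \<partial>M)"
    by (intro integral_mono integrable_norm int i le)
  also have "\<dots> \<le> K * (L2_norm M u * L2_norm M v)"
    using L2_Cauchy_Schwarz_norm[OF u v] K by (simp add: mult_left_mono)
  finally show "norm (\<integral>x. p x \<partial>M) \<le> K * (L2_norm M u * L2_norm M v)" .
qed

lemma L2_integrable_inner:
  assumes "u \<in> L2_space M" "v \<in> L2_space M"
  shows "integrable M (\<lambda>x. u x \<bullet> v x)"
    and "\<bar>\<integral>x. u x \<bullet> v x \<partial>M\<bar> \<le> L2_norm M u * L2_norm M v"
proof -
  have "(\<lambda>x. u x \<bullet> v x) \<in> borel_measurable M"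
    by (intro borel_measurable_inner L2_space_measurable assms)
  note * = L2_bilinear[OF assms this, of 1]
  show "integrable M (\<lambda>x. u x \<bullet> v x)" by (rule *(1)) (simp_all add: Cauchy_Schwarz_ineq2)
  show "\<bar>\<integral>x. u x \<bullet> v x \<partial>M\<bar> \<le> L2_norm M u * L2_norm M v"
    using *(2) by (simp add: Cauchy_Schwarz_ineq2)
qed

lemma L2_integrable_scaleR:
  fixes u :: "'a \<Rightarrow> real"
  assumes "u \<in> L2_space M" "v \<in> L2_space M"
  shows "integrable M (\<lambda>x. u x *\<^sub>R v x)"
    and "norm (\<integral>x. u x *\<^sub>R v x \<partial>M) \<le> L2_norm M u * L2_norm M v"
proof -
  have "(\<lambda>x. u x *\<^sub>R v x) \<in> borel_measurable M"
    by (intro borel_measurable_scaleR L2_space_measurable assms)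
  note * = L2_bilinear[OF assms this, of 1]
  show "integrable M (\<lambda>x. u x *\<^sub>R v x)" by (rule *(1)) simp_all
  show "norm (\<integral>x. u x *\<^sub>R v x \<partial>M) \<le> L2_norm M u * L2_norm M v"
    using *(2) by simp
qed

lemma L2_norm_scaleR [simp]: "L2_norm M (\<lambda>x. c *\<^sub>R u x) = \<bar>c\<bar> * L2_norm M u"
  by (simp add: L2_norm_def power_mult_distrib real_sqrt_mult)

lemma L2_norm_uminus [simp]: "L2_norm M (\<lambda>x. - u x) = L2_norm M u"
  by (simp add: L2_norm_def)

lemma L2_norm_minus_commute: "L2_norm M (\<lambda>x. u x - v x) = L2_norm M (\<lambda>x. v x - u x)"
  by (simp add: L2_norm_def norm_minus_commute)

lemma L2_norm_zero [simp]: "L2_norm M (\<lambda>x. 0) = 0"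
  by (simp add: L2_norm_def)

lemma L2_norm_norm [simp]: "L2_norm M (\<lambda>x. norm (u x)) = L2_norm M u"
  by (simp add: L2_norm_def)

lemma L2_norm_add_sq:
  assumes "u \<in> L2_space M" "v \<in> L2_space M"
  shows "(L2_norm M (\<lambda>x. u x + v x))\<^sup>2 =
    (L2_norm M u)\<^sup>2 + 2 * (\<integral>x. u x \<bullet> v x \<partial>M) + (L2_norm M v)\<^sup>2"
proof -
  have "(L2_norm M (\<lambda>x. u x + v x))\<^sup>2 =
      (\<integral>x. (norm (u x))\<^sup>2 + 2 * (u x \<bullet> v x) + (norm (v x))\<^sup>2 \<partial>M)"
    unfolding L2_norm_sq
    by (intro Bochner_Integration.integral_cong refl)
      (simp add: power2_norm_eq_inner inner_simps inner_commute)
  also have "\<dots> = (L2_norm M u)\<^sup>2 + 2 * (\<integral>x. u x \<bullet> v x \<partial>M) + (L2_norm M v)\<^sup>2"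
    using assms by (simp add: L2_space_integrable_sq L2_integrable_inner L2_norm_sq)
  finally show ?thesis .
qed

lemma L2_norm_diff_sq:
  assumes "u \<in> L2_space M" "v \<in> L2_space M"
  shows "(L2_norm M (\<lambda>x. u x - v x))\<^sup>2 =
    (L2_norm M u)\<^sup>2 - 2 * (\<integral>x. u x \<bullet> v x \<partial>M) + (L2_norm M v)\<^sup>2"
  using L2_norm_add_sq[OF assms(1) L2_space_uminus[OF assms(2)]] by simp

lemma L2_norm_triangle:
  assumes "u \<in> L2_space M" "v \<in> L2_space M"
  shows "L2_norm M (\<lambda>x. u x + v x) \<le> L2_norm M u + L2_norm M v"
proof (rule power2_le_imp_le)
  show "(L2_norm M (\<lambda>x. u x + v x))\<^sup>2 \<le> (L2_norm M u + L2_norm M v)\<^sup>2"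
    unfolding L2_norm_add_sq[OF assms] power2_sum using L2_integrable_inner(2)[OF assms] by simp
qed simp

lemma L2_norm_triangle_diff:
  assumes "u \<in> L2_space M" "v \<in> L2_space M"
  shows "L2_norm M (\<lambda>x. u x - v x) \<le> L2_norm M u + L2_norm M v"
  using L2_norm_triangle[OF assms(1) L2_space_uminus[OF assms(2)]] by simp

lemma L2_norm_triangle3:
  assumes "u \<in> L2_space M" "v \<in> L2_space M" "w \<in> L2_space M"
  shows "L2_norm M (\<lambda>x. u x - w x) \<le> L2_norm M (\<lambda>x. u x - v x) + L2_norm M (\<lambda>x. v x - w x)"
  using L2_norm_triangle[OF L2_space_diff[OF assms(1,2)] L2_space_diff[OF assms(2,3)]] by simp

lemma L2_norm_cong_AE:
  assumes "u \<in> borel_measurable M" "v \<in> borel_measurable M" "AE x in M. u x = v x"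
  shows "L2_norm M u = L2_norm M v"
  unfolding L2_norm_def
  by (rule arg_cong[of _ _ sqrt], rule integral_cong_AE) (use assms in \<open>auto\<close>)

lemma L2_norm_mono:
  fixes u :: "'a \<Rightarrow> 'b::euclidean_space" and v :: "'a \<Rightarrow> 'c::euclidean_space"
  assumes "u \<in> L2_space M" "v \<in> borel_measurable M" and le: "\<And>x. norm (v x) \<le> norm (u x)"
  shows "L2_norm M v \<le> L2_norm M u"
proof -
  have "v \<in> L2_space M" using L2_space_bound[OF assms(1,2), of 1] le by simp
  then show ?thesis
    unfolding L2_norm_def
    by (intro real_sqrt_le_mono integral_mono L2_space_integrable_sq assms(1) power_mono le) auto
qed

text \<open>Fatou and monotone convergence yield bounds on nonnegative integrals with no
  integrability known beforehand; such a bound is turned into membership and a norm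
  estimate.\<close>

lemma L2_from_nn_bound:
  assumes m: "u \<in> borel_measurable M" and e: "e \<ge> 0"
    and le: "(\<integral>\<^sup>+x. ennreal ((norm (u x))\<^sup>2) \<partial>M) \<le> ennreal (e\<^sup>2)"
  shows "u \<in> L2_space M" and "L2_norm M u \<le> e"
proof -
  have i: "integrable M (\<lambda>x. (norm (u x))\<^sup>2)"
    proof (rule integrableI_bounded)
    show "(\<lambda>x. (norm (u x))\<^sup>2) \<in> borel_measurable M" using m by measurable
    have "(\<integral>\<^sup>+x. ennreal (norm ((norm (u x))\<^sup>2)) \<partial>M) \<le> ennreal (e\<^sup>2)" using le by simp
    then show "(\<integral>\<^sup>+x. ennreal (norm ((norm (u x))\<^sup>2)) \<partial>M) < \<infinity>"
      by (rule le_less_trans) simp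
  qed
  then show "u \<in> L2_space M" using m by (rule L2_spaceI[rotated])
  have "(\<integral>x. (norm (u x))\<^sup>2 \<partial>M) \<le> e\<^sup>2"
    using le i by (simp add: nn_integral_eq_integral)
  then show "L2_norm M u \<le> e"
    unfolding L2_norm_def using e by (simp add: real_le_lsqrt)
qed

lemma L2_nn_norm:
  assumes "u \<in> L2_space M"
  shows "(\<integral>\<^sup>+x. ennreal ((norm (u x))\<^sup>2) \<partial>M) = ennreal ((L2_norm M u)\<^sup>2)"
  using nn_integral_eq_integral[OF L2_space_integrable_sq[OF assms]] by (simp add: L2_norm_sq)

lemma L2_norm_sum_le:
  assumes "\<And>i. i \<in> I \<Longrightarrow> u i \<in> L2_space M"
  shows "L2_norm M (\<lambda>x. \<Sum>i\<in>I. u i x) \<le> (\<Sum>i\<in>I. L2_norm M (u i))"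
  using assms
proof (induction I rule: infinite_finite_induct)
  case (insert i I)
  have "L2_norm M (\<lambda>x. u i x + (\<Sum>i\<in>I. u i x)) \<le> L2_norm M (u i) + L2_norm M (\<lambda>x. \<Sum>i\<in>I. u i x)"
    using insert.prems by (intro L2_norm_triangle L2_space_sum) auto
  also have "\<dots> \<le> L2_norm M (u i) + (\<Sum>i\<in>I. L2_norm M (u i))"
    using insert by auto
  finally show ?case using insert by simp
qed auto

text \<open>By Minkowski the partial sums of \<open>norm (d j x)\<close> have L2 norm at most
  \<open>S\<close>, and monotone convergence carries this to the supremum of their squares, which is
  therefore finite almost everywhere.\<close>

lemma L2_series_AE_summable:
  fixes d :: "nat \<Rightarrow> 'a \<Rightarrow> 'b::euclidean_space"
  assumes d: "\<And>j. d j \<in> L2_space M" and s: "summable (\<lambda>j. L2_norm M (d j))"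
  shows "AE x in M. summable (\<lambda>j. norm (d j x))"
proof -
  define S where "S = (\<Sum>j. L2_norm M (d j))"
  have S0: "S \<ge> 0" using s by (simp add: S_def suminf_nonneg)
  define g where "g n x = ennreal ((\<Sum>j<n. norm (d j x))\<^sup>2)" for n x
  have [measurable]: "d j \<in> borel_measurable M" for j using d by auto
  have L: "(\<lambda>x. \<Sum>j<n. norm (d j x)) \<in> L2_space M" for n
    by (intro L2_space_sum L2_space_norm d)
  have gle: "(\<integral>\<^sup>+x. g n x \<partial>M) \<le> ennreal (S\<^sup>2)" for n
  proof -
    have *: "(\<integral>\<^sup>+x. g n x \<partial>M) = ennreal ((L2_norm M (\<lambda>x. \<Sum>j<n. norm (d j x)))\<^sup>2)"
      using L2_nn_norm[OF L[of n]] by (simp add: g_def)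
    have "L2_norm M (\<lambda>x. \<Sum>j<n. norm (d j x)) \<le> (\<Sum>j<n. L2_norm M (\<lambda>x. norm (d j x)))"
      by (intro L2_norm_sum_le L2_space_norm d)
    also have "\<dots> \<le> S" unfolding S_def L2_norm_norm
      by (intro sum_le_suminf s) auto
    finally have "(L2_norm M (\<lambda>x. \<Sum>j<n. norm (d j x)))\<^sup>2 \<le> S\<^sup>2" by (intro power_mono) auto
    then show ?thesis unfolding * by (rule ennreal_leI)
  qed
  have inc: "incseq g"
    by (auto simp: g_def incseq_def le_fun_def intro!: ennreal_leI power_mono sum_mono2 sum_nonneg)
  have "(\<integral>\<^sup>+x. (SUP n. g n x) \<partial>M) = (SUP n. \<integral>\<^sup>+x. g n x \<partial>M)"
    by (rule nn_integral_monotone_convergence_SUP[OF inc]) (unfold g_def, measurable)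
  also have "\<dots> \<le> ennreal (S\<^sup>2)" using gle by (simp add: SUP_least)
  finally have "(\<integral>\<^sup>+x. (SUP n. g n x) \<partial>M) \<noteq> \<infinity>"
    using ennreal_less_top le_less_trans by (metis infinity_ennreal_def less_irrefl)
  then have "AE x in M. (SUP n. g n x) \<noteq> \<infinity>"
    by (intro nn_integral_PInf_AE) (auto simp: g_def)
  then show ?thesis
  proof eventually_elim
    fix x assume fin: "(SUP n. g n x) \<noteq> \<infinity>"
    then obtain C where C: "(SUP n. g n x) = ennreal C" "C \<ge> 0"
      by (cases "SUP n. g n x") auto
    have "(\<Sum>j<n. norm (d j x)) \<le> sqrt C" for n
    proof -
      have "g n x \<le> ennreal C" unfolding C(1)[symmetric] by (rule SUP_upper) simp
      then have "(\<Sum>j<n. norm (d j x))\<^sup>2 \<le> C" using C(2) by (simp add: g_def)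
      then show ?thesis by (rule real_le_rsqrt)
    qed
    then show "summable (\<lambda>j. norm (d j x))"
      by (intro bounded_imp_summable[of _ "sqrt C"]) (auto simp only: lessThan_Suc_atMost[symmetric] norm_ge_zero)
  qed
qed

text \<open>Riesz--Fischer: a rapidly convergent subsequence converges almost everywhere by its
  telescoping series, and Fatou upgrades this to convergence in norm of the full sequence.\<close>

theorem L2_complete:
  fixes u :: "nat \<Rightarrow> 'a \<Rightarrow> 'b::euclidean_space"
  assumes u: "\<And>n. u n \<in> L2_space M"
    and C: "\<And>e. e > 0 \<Longrightarrow> \<exists>N. \<forall>m\<ge>N. \<forall>n\<ge>N. L2_norm M (\<lambda>x. u m x - u n x) < e"
  shows "\<exists>v\<in>L2_space M. (\<lambda>n. L2_norm M (\<lambda>x. u n x - v x)) \<longlonglongrightarrow> 0"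
proof -
  have "\<exists>N. \<forall>m\<ge>N. \<forall>n\<ge>N. L2_norm M (\<lambda>x. u m x - u n x) < (1/2)^j" for j :: nat
    by (rule C) simp
  then obtain N where N: "\<And>j m n. m \<ge> N j \<Longrightarrow> n \<ge> N j \<Longrightarrow> L2_norm M (\<lambda>x. u m x - u n x) < (1/2)^j"
    by metis
  \<comment> \<open>Summing the thresholds makes \<open>r k\<close> at least \<open>N j\<close> for
    all \<open>j \<le> k\<close> without choosing the \<open>N j\<close> monotone.\<close>
  define r where "r j = (\<Sum>i\<le>j. N i)" for j
  have rN: "r k \<ge> N j" if "k \<ge> j" for j k
    unfolding r_def using that by (intro member_le_sum) auto
  define d where "d j x = u (r (Suc j)) x - u (r j) x" for j x
  have dL: "d j \<in> L2_space M" for j unfolding d_def by (intro L2_space_diff u)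
  have dle: "L2_norm M (d j) \<le> (1/2)^j" for j
    unfolding d_def by (intro less_imp_le[OF N] rN) auto
  have "summable (\<lambda>j. L2_norm M (d j))"
    by (rule summable_comparison_test'[of "\<lambda>j. (1/2)^j" 0]) (use dle in auto)
  from L2_series_AE_summable[OF dL this]
  have conv: "AE x in M. convergent (\<lambda>j. u (r j) x)"
  proof eventually_elim
    fix x assume "summable (\<lambda>j. norm (d j x))"
    then have "summable (\<lambda>j. d j x)" by (rule summable_norm_cancel)
    then have c: "convergent (\<lambda>n. \<Sum>j<n. d j x)" by (simp add: summable_iff_convergent)
    have "(\<Sum>j<n. d j x) = u (r n) x - u (r 0) x" for n
      unfolding d_def by (rule sum_lessThan_telescope)
    then have "convergent (\<lambda>n. u (r n) x - u (r 0) x)" using c by simp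
    then have "convergent (\<lambda>n. (u (r n) x - u (r 0) x) + u (r 0) x)"
      by (intro convergent_add convergent_const)
    then show "convergent (\<lambda>j. u (r j) x)" by simp
  qed
  have [measurable]: "u n \<in> borel_measurable M" for n using u by auto
  \<comment> \<open>\<open>lim\<close> is total, so \<open>v\<close> is defined and measurable
    everywhere; it is the pointwise limit only off a null set.\<close>
  define v where "v x = lim (\<lambda>j. u (r j) x)" for x
  have vm [measurable]: "v \<in> borel_measurable M"
    unfolding v_def by measurable
  have close: "(\<lambda>x. u n x - v x) \<in> L2_space M \<and> L2_norm M (\<lambda>x. u n x - v x) \<le> (1/2)^j"
    if n: "n \<ge> N j" for n j
  proof -
    have "(\<integral>\<^sup>+x. ennreal ((norm (u n x - v x))\<^sup>2) \<partial>M) =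
        (\<integral>\<^sup>+x. liminf (\<lambda>k. ennreal ((norm (u n x - u (r k) x))\<^sup>2)) \<partial>M)"
    proof (rule nn_integral_cong_AE)
      show "AE x in M. ennreal ((norm (u n x - v x))\<^sup>2) =
          liminf (\<lambda>k. ennreal ((norm (u n x - u (r k) x))\<^sup>2))"
        using conv
      proof eventually_elim
        fix x assume "convergent (\<lambda>j. u (r j) x)"
        then have "(\<lambda>j. u (r j) x) \<longlonglongrightarrow> v x" by (simp add: v_def convergent_LIMSEQ_iff)
        then have "(\<lambda>k. ennreal ((norm (u n x - u (r k) x))\<^sup>2)) \<longlonglongrightarrow> ennreal ((norm (u n x - v x))\<^sup>2)"
          by (intro tendsto_ennrealI tendsto_intros)
        then show "ennreal ((norm (u n x - v x))\<^sup>2) =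
            liminf (\<lambda>k. ennreal ((norm (u n x - u (r k) x))\<^sup>2))"
          using lim_imp_Liminf[OF trivial_limit_sequentially] by metis
      qed
    qed
    \<comment> \<open>Fatou's lemma along the subsequence, with \<open>n\<close> fixed.\<close>
    also have "\<dots> \<le> liminf (\<lambda>k. \<integral>\<^sup>+x. ennreal ((norm (u n x - u (r k) x))\<^sup>2) \<partial>M)"
      by (rule nn_integral_liminf) measurable
    also have "\<dots> \<le> limsup (\<lambda>k. \<integral>\<^sup>+x. ennreal ((norm (u n x - u (r k) x))\<^sup>2) \<partial>M)"
      by (rule Liminf_le_Limsup) simp
    also have "\<dots> \<le> ennreal (((1/2)^j)\<^sup>2)"
    proof (rule Limsup_bounded, rule eventually_sequentiallyI[of j])
      fix k assume k: "j \<le> k"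
      have "(\<integral>\<^sup>+x. ennreal ((norm (u n x - u (r k) x))\<^sup>2) \<partial>M)
          = ennreal ((L2_norm M (\<lambda>x. u n x - u (r k) x))\<^sup>2)"
        by (rule L2_nn_norm[OF L2_space_diff[OF u u]])
      also have "\<dots> \<le> ennreal (((1/2)^j)\<^sup>2)"
        by (intro ennreal_leI power_mono less_imp_le[OF N] n rN k) simp
      finally show "(\<integral>\<^sup>+x. ennreal ((norm (u n x - u (r k) x))\<^sup>2) \<partial>M) \<le> ennreal (((1/2)^j)\<^sup>2)" .
    qed
    finally show ?thesis
      using L2_from_nn_bound[of "\<lambda>x. u n x - v x" M "(1/2)^j"] by auto
  qed
  have "v \<in> L2_space M"
    using L2_space_diff[OF u[of "N 0"] conjunct1[OF close[of 0 "N 0"]]] by simp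
  moreover have "(\<lambda>n. L2_norm M (\<lambda>x. u n x - v x)) \<longlonglongrightarrow> 0"
  proof (rule LIMSEQ_I)
    fix e :: real assume "e > 0"
    then obtain j where "(1/2::real)^j < e" using real_arch_pow_inv[of e "1/2"] by auto
    then show "\<exists>no. \<forall>n\<ge>no. norm (L2_norm M (\<lambda>x. u n x - v x) - 0) < e"
      using close[of j] by (intro exI[of _ "N j"]) (auto intro: le_less_trans)
  qed
  ultimately show ?thesis by blast
qed

text \<open>The projection theorem for a subspace that need not be closed: a minimising sequence in
  \<open>R\<close> is Cauchy, its limit leaves a residual orthogonal to \<open>R\<close>, and the
  hypothesis makes that residual null. All scalars are real.\<close>

lemma L2_dense_if_orthogonal_trivial:
  fixes R :: "('a \<Rightarrow> 'b::euclidean_space) set"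
  assumes R: "R \<subseteq> L2_space M" "R \<noteq> {}"
    and add: "\<And>u v. u \<in> R \<Longrightarrow> v \<in> R \<Longrightarrow> (\<lambda>x. u x + v x) \<in> R"
    and scale: "\<And>c u. u \<in> R \<Longrightarrow> (\<lambda>x. c *\<^sub>R u x) \<in> R"
    and orth: "\<And>d. d \<in> L2_space M \<Longrightarrow> (\<And>u. u \<in> R \<Longrightarrow> (\<integral>x. u x \<bullet> d x \<partial>M) = 0) \<Longrightarrow> L2_norm M d = 0"
    and b: "b \<in> L2_space M" and e: "e > 0"
  shows "\<exists>u\<in>R. L2_norm M (\<lambda>x. b x - u x) < e"
proof -
  define I where "I = (INF u\<in>R. (L2_norm M (\<lambda>x. b x - u x))\<^sup>2)"
  have bdd: "bdd_below ((\<lambda>u. (L2_norm M (\<lambda>x. b x - u x))\<^sup>2) ` R)"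
    by (rule bdd_belowI[of _ 0]) auto
  have Ile: "I \<le> (L2_norm M (\<lambda>x. b x - u x))\<^sup>2" if "u \<in> R" for u
    unfolding I_def using bdd that by (rule cINF_lower)
  have "\<exists>u\<in>R. (L2_norm M (\<lambda>x. b x - u x))\<^sup>2 < I + 1 / Suc n" for n
  proof -
    have "I < I + 1 / Suc n" by simp
    then show ?thesis unfolding I_def cINF_less_iff[OF R(2) bdd] .
  qed
  then obtain r where r: "\<And>n. r n \<in> R" "\<And>n. (L2_norm M (\<lambda>x. b x - r n x))\<^sup>2 < I + 1 / Suc n"
    by metis
  have rL: "r n \<in> L2_space M" for n using r R by auto
  have lin: "(\<lambda>x. a *\<^sub>R u x + c *\<^sub>R v x) \<in> R" if "u \<in> R" "v \<in> R" for a c u v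
    using add[OF scale[OF that(1)] scale[OF that(2)]] .
  \<comment> \<open>Parallelogram law; the midpoint of \<open>r m\<close> and \<open>r n\<close>
    lies in \<open>R\<close>, so its squared distance to \<open>b\<close> is at least
    \<open>I\<close>.\<close>
  have par: "(L2_norm M (\<lambda>x. r m x - r n x))\<^sup>2 \<le> 2 / Suc m + 2 / Suc n" for m n
  proof -
    let ?f = "\<lambda>x. b x - r m x" and ?g = "\<lambda>x. b x - r n x"
    have L: "?f \<in> L2_space M" "?g \<in> L2_space M" using b rL by (auto intro: L2_space_diff)
    have "(\<lambda>x. (1/2) *\<^sub>R r m x + (1/2) *\<^sub>R r n x) \<in> R" by (intro lin r)
    from Ile[OF this]
    have 1: "4 * I \<le> 4 * (L2_norm M (\<lambda>x. b x - ((1/2) *\<^sub>R r m x + (1/2) *\<^sub>R r n x)))\<^sup>2" by simp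
    have "L2_norm M (\<lambda>x. ?f x + ?g x) = L2_norm M (\<lambda>x. 2 *\<^sub>R (b x - ((1/2) *\<^sub>R r m x + (1/2) *\<^sub>R r n x)))"
      by (rule arg_cong[of _ _ "L2_norm M"]) (auto simp: algebra_simps scaleR_2)
    also have "\<dots> = 2 * L2_norm M (\<lambda>x. b x - ((1/2) *\<^sub>R r m x + (1/2) *\<^sub>R r n x))"
      by (subst L2_norm_scaleR) simp
    finally have 2: "4 * I \<le> (L2_norm M (\<lambda>x. ?f x + ?g x))\<^sup>2" using 1 by (simp add: power_mult_distrib)
    have "(L2_norm M (\<lambda>x. ?f x + ?g x))\<^sup>2 + (L2_norm M (\<lambda>x. ?f x - ?g x))\<^sup>2
        = 2 * (L2_norm M ?f)\<^sup>2 + 2 * (L2_norm M ?g)\<^sup>2"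
      unfolding L2_norm_add_sq[OF L] L2_norm_diff_sq[OF L] by simp
    moreover have "L2_norm M (\<lambda>x. ?f x - ?g x) = L2_norm M (\<lambda>x. r m x - r n x)"
      using L2_norm_minus_commute[of M "r n" "r m"] by simp
    ultimately show ?thesis using 2 less_imp_le[OF r(2)[of m]] less_imp_le[OF r(2)[of n]] by (simp only:)
  qed
  have "\<exists>v\<in>L2_space M. (\<lambda>n. L2_norm M (\<lambda>x. r n x - v x)) \<longlonglongrightarrow> 0"
  proof (rule L2_complete[OF rL])
    fix e :: real assume e: "e > 0"
    then obtain N where N: "1 / real (Suc N) < e\<^sup>2 / 4"
      using nat_approx_posE[of "e\<^sup>2/4"] by auto
    have "L2_norm M (\<lambda>x. r m x - r n x) < e" if "m \<ge> N" "n \<ge> N" for m n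
    proof (rule power2_less_imp_less)
      have "1 / real (Suc m) \<le> 1 / real (Suc N)" "1 / real (Suc n) \<le> 1 / real (Suc N)"
        using that by (auto intro!: frac_le)
      then show "(L2_norm M (\<lambda>x. r m x - r n x))\<^sup>2 < e\<^sup>2" using par[of m n] N by simp
    qed (use e in simp)
    then show "\<exists>N. \<forall>m\<ge>N. \<forall>n\<ge>N. L2_norm M (\<lambda>x. r m x - r n x) < e" by blast
  qed
  then obtain v where v: "v \<in> L2_space M" and lim: "(\<lambda>n. L2_norm M (\<lambda>x. r n x - v x)) \<longlonglongrightarrow> 0" by auto
  define d where "d x = b x - v x" for x
  have d: "d \<in> L2_space M" unfolding d_def by (intro L2_space_diff b v)
  have le: "L2_norm M d \<le> L2_norm M (\<lambda>x. b x - u x)" if u: "u \<in> R" for u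
  proof -
    have "(L2_norm M d)\<^sup>2 \<le> I"
    proof (rule LIMSEQ_le_const)
      have lim2: "(\<lambda>n. L2_norm M (\<lambda>x. b x - r n x)) \<longlonglongrightarrow> L2_norm M d"
      proof (rule LIMSEQ_I)
        fix e :: real assume "e > 0"
        then obtain N where N: "\<forall>n\<ge>N. norm (L2_norm M (\<lambda>x. r n x - v x) - 0) < e" using LIMSEQ_D[OF lim] by blast
        have bd: "\<bar>L2_norm M (\<lambda>x. b x - r n x) - L2_norm M d\<bar> \<le> L2_norm M (\<lambda>x. r n x - v x)" for n
        proof -
          have "L2_norm M d \<le> L2_norm M (\<lambda>x. b x - r n x) + L2_norm M (\<lambda>x. r n x - v x)"
            unfolding d_def by (rule L2_norm_triangle3[OF b rL v])
          moreover have "L2_norm M (\<lambda>x. b x - r n x) \<le> L2_norm M d + L2_norm M (\<lambda>x. v x - r n x)"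
            unfolding d_def by (rule L2_norm_triangle3[OF b v rL])
          ultimately show ?thesis using L2_norm_minus_commute[of M v "r n"] by simp
        qed
        show "\<exists>no. \<forall>n\<ge>no. norm (L2_norm M (\<lambda>x. b x - r n x) - L2_norm M d) < e"
        proof (intro exI[of _ N] allI impI)
          fix n assume "N \<le> n"
          then have "L2_norm M (\<lambda>x. r n x - v x) < e" using N by auto
          then show "norm (L2_norm M (\<lambda>x. b x - r n x) - L2_norm M d) < e"
            unfolding real_norm_def by (rule le_less_trans[OF bd])
        qed
      qed
      have *: "(\<lambda>n. I + 1 / Suc n - (L2_norm M (\<lambda>x. b x - r n x))\<^sup>2) \<longlonglongrightarrow> I + 0 - (L2_norm M d)\<^sup>2"
        by (intro tendsto_intros lim2 LIMSEQ_Suc[OF lim_1_over_n])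
      show "(\<lambda>n. (L2_norm M d)\<^sup>2 + (I + 1 / Suc n - (L2_norm M (\<lambda>x. b x - r n x))\<^sup>2)) \<longlonglongrightarrow> I"
        using tendsto_add[OF tendsto_const[of "(L2_norm M d)\<^sup>2"] *] by simp
      show "\<exists>N. \<forall>n\<ge>N. (L2_norm M d)\<^sup>2 \<le> (L2_norm M d)\<^sup>2 + (I + 1 / Suc n - (L2_norm M (\<lambda>x. b x - r n x))\<^sup>2)"
        using r(2) by (auto intro: less_imp_le)
    qed
    also have "I \<le> (L2_norm M (\<lambda>x. b x - u x))\<^sup>2" by (rule Ile[OF u])
    finally show ?thesis by (rule power2_le_imp_le) simp
  qed
  have "L2_norm M d = 0"
  proof (rule orth[OF d])
    fix p assume p: "p \<in> R"
    then have pL: "p \<in> L2_space M" using R by auto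
    define c where "c = (\<integral>x. p x \<bullet> d x \<partial>M)"
    \<comment> \<open>Moving from the minimiser in the direction of \<open>p\<close> cannot shorten
      the residual. Since \<open>v\<close> itself need not lie in \<open>R\<close>, the comparison
      is made at \<open>r n\<close> and passed to the limit.\<close>
    have ineq: "2 * t * c \<le> t\<^sup>2 * (L2_norm M p)\<^sup>2" for t :: real
    proof -
      let ?q = "\<lambda>x. d x - t *\<^sub>R p x"
      have tp: "(\<lambda>x. t *\<^sub>R p x) \<in> L2_space M" by (rule L2_space_scaleR[OF pL])
      have ge: "(L2_norm M d)\<^sup>2 \<le> (L2_norm M ?q)\<^sup>2"
      proof (rule power_mono)
        show "L2_norm M d \<le> L2_norm M ?q"
        proof (rule LIMSEQ_le_const)
          have "(\<lambda>n. L2_norm M ?q + L2_norm M (\<lambda>x. r n x - v x)) \<longlonglongrightarrow> L2_norm M ?q + 0"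
            by (intro tendsto_intros lim)
          then show "(\<lambda>n. L2_norm M ?q + L2_norm M (\<lambda>x. r n x - v x)) \<longlonglongrightarrow> L2_norm M ?q" by simp
          have "L2_norm M d \<le> L2_norm M ?q + L2_norm M (\<lambda>x. r n x - v x)" for n
          proof -
            have "(\<lambda>x. r n x + t *\<^sub>R p x) \<in> R" using lin[OF r(1) p, of 1 n t] by simp
            from le[OF this] have "L2_norm M d \<le> L2_norm M (\<lambda>x. ?q x - (r n x - v x))"
              by (simp add: d_def algebra_simps)
            also have "\<dots> \<le> L2_norm M ?q + L2_norm M (\<lambda>x. r n x - v x)"
              by (intro L2_norm_triangle_diff L2_space_diff d tp rL v)
            finally show ?thesis .
          qed
          then show "\<exists>N. \<forall>n\<ge>N. L2_norm M d \<le> L2_norm M ?q + L2_norm M (\<lambda>x. r n x - v x)" by blast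
        qed
      qed simp
      have "(L2_norm M ?q)\<^sup>2 = (L2_norm M d)\<^sup>2 - 2 * t * c + t\<^sup>2 * (L2_norm M p)\<^sup>2"
        unfolding L2_norm_diff_sq[OF d tp] c_def by (simp add: power_mult_distrib inner_commute)
      then show ?thesis using ge by simp
    qed
    show "(\<integral>x. p x \<bullet> d x \<partial>M) = 0"
    proof (rule ccontr)
      assume "\<not> ?thesis"
      then have c0: "c \<noteq> 0" by (simp add: c_def)
      \<comment> \<open>Adding 1 allows division even when \<open>p\<close> is null; at
        \<open>t = c / P\<close> the linear term beats the quadratic one.\<close>
      define P where "P = (L2_norm M p)\<^sup>2 + 1"
      have P: "P > 0" by (simp add: P_def add_nonneg_pos)
      have "2 * (c / P) * c \<le> (c / P)\<^sup>2 * (L2_norm M p)\<^sup>2" by (rule ineq)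
      also have "\<dots> \<le> (c / P)\<^sup>2 * P" by (intro mult_left_mono) (auto simp: P_def)
      also have "\<dots> = (c / P) * c" using P by (simp add: power2_eq_square)
      finally have "c * c / P \<le> 0" by simp
      then show False using c0 P by (auto simp: divide_le_0_iff mult_le_0_iff)
    qed
  qed
  then have "L2_norm M (\<lambda>x. b x - v x) = 0" by (simp add: d_def[abs_def])
  obtain N where "\<forall>n\<ge>N. norm (L2_norm M (\<lambda>x. r n x - v x) - 0) < e" using LIMSEQ_D[OF lim e] by blast
  then have "L2_norm M (\<lambda>x. v x - r N x) < e" using L2_norm_minus_commute[of M v "r N"] by simp
  then have "L2_norm M (\<lambda>x. b x - r N x) < e"
    using L2_norm_triangle3[OF b v rL[of N]] \<open>L2_norm M (\<lambda>x. b x - v x) = 0\<close> by simp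
  then show ?thesis using r(1) by blast
qed

section \<open>Continuity of integral pairings under L2 convergence\<close>

lemma L2_tendsto_inner:
  assumes "\<And>n. u n \<in> L2_space M" "v \<in> L2_space M" "w \<in> L2_space M"
    and "(\<lambda>n. L2_norm M (\<lambda>x. u n x - v x)) \<longlonglongrightarrow> 0"
  shows "(\<lambda>n. \<integral>x. u n x \<bullet> w x \<partial>M) \<longlonglongrightarrow> (\<integral>x. v x \<bullet> w x \<partial>M)"
proof (rule Lim_null[THEN iffD2], rule Lim_null_comparison)
  have "(\<integral>x. u n x \<bullet> w x \<partial>M) - (\<integral>x. v x \<bullet> w x \<partial>M) = (\<integral>x. (u n x - v x) \<bullet> w x \<partial>M)" for n
    unfolding inner_diff_left
    by (rule Bochner_Integration.integral_diff[symmetric]) (use assms in \<open>auto intro: L2_integrable_inner\<close>)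
  then show "\<forall>\<^sub>F n in sequentially. norm ((\<integral>x. u n x \<bullet> w x \<partial>M) - (\<integral>x. v x \<bullet> w x \<partial>M))
      \<le> L2_norm M (\<lambda>x. u n x - v x) * L2_norm M w"
    using L2_integrable_inner(2)[OF L2_space_diff[OF assms(1,2)] assms(3)] by simp
  show "(\<lambda>n. L2_norm M (\<lambda>x. u n x - v x) * L2_norm M w) \<longlonglongrightarrow> 0"
    using tendsto_mult_right[OF assms(4), of "L2_norm M w"] by simp
qed

lemma L2_tendsto_scaleR:
  fixes u :: "nat \<Rightarrow> 'a \<Rightarrow> real"
  assumes "\<And>n. u n \<in> L2_space M" "v \<in> L2_space M" "w \<in> L2_space M"
    and "(\<lambda>n. L2_norm M (\<lambda>x. u n x - v x)) \<longlonglongrightarrow> 0"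
  shows "(\<lambda>n. \<integral>x. u n x *\<^sub>R w x \<partial>M) \<longlonglongrightarrow> (\<integral>x. v x *\<^sub>R w x \<partial>M)"
proof (rule Lim_null[THEN iffD2], rule Lim_null_comparison)
  have "(\<integral>x. u n x *\<^sub>R w x \<partial>M) - (\<integral>x. v x *\<^sub>R w x \<partial>M) = (\<integral>x. (u n x - v x) *\<^sub>R w x \<partial>M)" for n
    unfolding scaleR_diff_left
    by (rule Bochner_Integration.integral_diff[symmetric]) (use assms in \<open>auto intro: L2_integrable_scaleR\<close>)
  then show "\<forall>\<^sub>F n in sequentially. norm ((\<integral>x. u n x *\<^sub>R w x \<partial>M) - (\<integral>x. v x *\<^sub>R w x \<partial>M))
      \<le> L2_norm M (\<lambda>x. u n x - v x) * L2_norm M w"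
    using L2_integrable_scaleR(2)[OF L2_space_diff[OF assms(1,2)] assms(3)] by simp
  show "(\<lambda>n. L2_norm M (\<lambda>x. u n x - v x) * L2_norm M w) \<longlonglongrightarrow> 0"
    using tendsto_mult_right[OF assms(4), of "L2_norm M w"] by simp
qed

lemma L2_tendsto_scaleR_right:
  fixes w :: "'a \<Rightarrow> real"
  assumes "\<And>n. u n \<in> L2_space M" "v \<in> L2_space M" "w \<in> L2_space M"
    and "(\<lambda>n. L2_norm M (\<lambda>x. u n x - v x)) \<longlonglongrightarrow> 0"
  shows "(\<lambda>n. \<integral>x. w x *\<^sub>R u n x \<partial>M) \<longlonglongrightarrow> (\<integral>x. w x *\<^sub>R v x \<partial>M)"
proof (rule Lim_null[THEN iffD2], rule Lim_null_comparison)
  have "(\<integral>x. w x *\<^sub>R u n x \<partial>M) - (\<integral>x. w x *\<^sub>R v x \<partial>M) = (\<integral>x. w x *\<^sub>R (u n x - v x) \<partial>M)" for n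
    unfolding scaleR_diff_right
    by (rule Bochner_Integration.integral_diff[symmetric]) (use assms in \<open>auto intro: L2_integrable_scaleR\<close>)
  then show "\<forall>\<^sub>F n in sequentially. norm ((\<integral>x. w x *\<^sub>R u n x \<partial>M) - (\<integral>x. w x *\<^sub>R v x \<partial>M))
      \<le> L2_norm M w * L2_norm M (\<lambda>x. u n x - v x)"
    using L2_integrable_scaleR(2)[OF assms(3) L2_space_diff[OF assms(1,2)]] by simp
  show "(\<lambda>n. L2_norm M w * L2_norm M (\<lambda>x. u n x - v x)) \<longlonglongrightarrow> 0"
    using tendsto_mult_left[OF assms(4), of "L2_norm M w"] by simp
qed

section \<open>Smooth functions of tensor form\<close>

type_synonym plane = "real \<times> real"

abbreviation "pder b f x \<equiv> frechet_derivative f (at x) b"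

text \<open>One-variable smoothness with the derivative quantified existentially, so that closure
  under products and affine substitution are plain inductions; \<open>C_k_tensor\<close> transfers
  it to the recursion of \<open>C_k\<close> with Frechet derivatives.\<close>

primrec smooth_upto :: "nat \<Rightarrow> (real \<Rightarrow> real) \<Rightarrow> bool" where
  "smooth_upto 0 f \<longleftrightarrow> continuous_on UNIV f"
| "smooth_upto (Suc k) f \<longleftrightarrow> (\<exists>f'. (\<forall>x. (f has_real_derivative f' x) (at x)) \<and> smooth_upto k f')"

lemma smooth_upto_SucI:
  "(\<And>x. (f has_real_derivative f' x) (at x)) \<Longrightarrow> smooth_upto k f' \<Longrightarrow> smooth_upto (Suc k) f"
  by auto

lemma smooth_upto_continuous: "smooth_upto k f \<Longrightarrow> continuous_on UNIV f"
  by (cases k) (auto intro!: continuous_at_imp_continuous_on intro: DERIV_isCont)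

lemma smooth_upto_Suc: "smooth_upto (Suc k) f \<Longrightarrow> smooth_upto k f"
proof (induction k arbitrary: f)
  case 0 then show ?case using smooth_upto_continuous[of "Suc 0" f] by simp
next
  case (Suc k)
  from Suc.prems obtain f' where "\<forall>x. (f has_real_derivative f' x) (at x)" "smooth_upto (Suc k) f'" by auto
  then show ?case using Suc.IH[of f'] by auto
qed

lemma smooth_upto_const [simp]: "smooth_upto k (\<lambda>x. c)"
proof (induction k arbitrary: c)
  case (Suc k)
  show ?case by (auto intro!: exI[of _ "\<lambda>x. 0"] Suc derivative_eq_intros)
qed simp

lemma smooth_upto_add: "smooth_upto k f \<Longrightarrow> smooth_upto k g \<Longrightarrow> smooth_upto k (\<lambda>x. f x + g x)"
proof (induction k arbitrary: f g)
  case (Suc k)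
  then obtain f' g' where "\<forall>x. (f has_real_derivative f' x) (at x)" "smooth_upto k f'"
    "\<forall>x. (g has_real_derivative g' x) (at x)" "smooth_upto k g'" by auto
  then show ?case
    by (auto intro!: exI[of _ "\<lambda>x. f' x + g' x"] Suc.IH derivative_intros)
qed (auto intro: continuous_intros)

lemma smooth_upto_mult: "smooth_upto k f \<Longrightarrow> smooth_upto k g \<Longrightarrow> smooth_upto k (\<lambda>x. f x * g x)"
proof (induction k arbitrary: f g)
  case (Suc k)
  then obtain f' g' where *: "\<forall>x. (f has_real_derivative f' x) (at x)" "smooth_upto k f'"
    "\<forall>x. (g has_real_derivative g' x) (at x)" "smooth_upto k g'" by auto
  have "smooth_upto k (\<lambda>x. f' x * g x + f x * g' x)"
    using * Suc.prems by (intro smooth_upto_add Suc.IH) (auto dest: smooth_upto_Suc simp del: smooth_upto.simps)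
  with * show ?case
    by (auto intro!: exI[of _ "\<lambda>x. f' x * g x + f x * g' x"] derivative_eq_intros)
qed (auto intro: continuous_intros)

lemma smooth_upto_affine: "smooth_upto k f \<Longrightarrow> smooth_upto k (\<lambda>x. f (a * x + b))"
proof (induction k arbitrary: f)
  case 0
  then have "continuous_on UNIV f" by simp
  then have "continuous_on UNIV (\<lambda>x. f (a * x + b))"
    by (rule continuous_on_compose2[of UNIV f UNIV]) (intro continuous_intros subset_UNIV)+
  then show ?case by simp
next
  case (Suc k)
  then obtain f' where *: "\<forall>x. (f has_real_derivative f' x) (at x)" "smooth_upto k f'" by auto
  have "((\<lambda>x. f (a * x + b)) has_real_derivative f' (a * x + b) * a) (at x)" for x
    by (rule DERIV_chain2[of f]) (use * in \<open>auto intro!: derivative_eq_intros\<close>)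
  moreover have "smooth_upto k (\<lambda>x. f' (a * x + b) * a)"
    by (rule smooth_upto_mult[OF Suc.IH[OF *(2)] smooth_upto_const])
  ultimately show ?case by (rule smooth_upto_SucI)
qed

lemma smooth_upto_linear: "smooth_upto k (\<lambda>x. a * x + b)"
  by (cases k) (auto intro!: continuous_intros exI[of _ "\<lambda>x. a"] derivative_eq_intros)

lemma smooth_upto_sin_cos: "smooth_upto k (\<lambda>x. c * sin (a * x))" "smooth_upto k (\<lambda>x. c * cos (a * x))"
proof (induction k arbitrary: c)
  case 0
  { case 1 show ?case by (auto intro!: continuous_intros) }
  { case 2 show ?case by (auto intro!: continuous_intros) }
next
  case (Suc k)
  { case 1
    have "((\<lambda>x. c * sin (a * x)) has_real_derivative (c * a) * cos (a * x)) (at x)" for x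
      by (auto intro!: derivative_eq_intros)
    then show ?case by (rule smooth_upto_SucI) (rule Suc(2)) }
  { case 2
    have "((\<lambda>x. c * cos (a * x)) has_real_derivative (- c * a) * sin (a * x)) (at x)" for x
      by (auto intro!: derivative_eq_intros)
    then show ?case by (rule smooth_upto_SucI) (rule Suc(1)) }
qed

lemma smooth_upto_sin: "smooth_upto k (\<lambda>x. sin (a * x))"
  using smooth_upto_sin_cos(1)[of k 1 a] by simp

text \<open>The flat function \<open>exp (- 1 / x)\<close> together with its quotients by powers:
  their span is closed under differentiation, so smoothness at 0 is proved for all members by one
  induction.\<close>

definition flat_exp :: "nat \<Rightarrow> real \<Rightarrow> real" where
  "flat_exp n x = (if x > 0 then exp (- 1 / x) / x ^ n else 0)"

lemma power_div_fact_le_exp: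
  fixes t :: real assumes "t \<ge> 0" shows "t ^ n / fact n \<le> exp t"
proof -
  have "(\<Sum>i\<in>{n}. t ^ i /\<^sub>R fact i) \<le> (\<Sum>i. t ^ i /\<^sub>R fact i)"
    using assms by (intro sum_le_suminf summable_exp_generic) auto
  then show ?thesis by (simp add: exp_def divide_inverse mult.commute)
qed

lemma flat_exp_nonneg: "0 \<le> flat_exp n x"
  by (simp add: flat_exp_def)

text \<open>With \<open>t = 1 / x\<close>, the single term of order \<open>n + 1\<close> in the
  exponential series bounds \<open>t ^ Suc n\<close>; this absorbs the pole of order
  \<open>n\<close> and leaves one factor \<open>x\<close> over.\<close>

lemma flat_exp_le: "flat_exp n x \<le> fact (Suc n) * \<bar>x\<bar>"
proof (cases "x > 0")
  case True
  define t where "t = 1 / x"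
  define F where "F = (fact (Suc n) :: real)"
  have F: "F > 0" unfolding F_def by simp
  have t: "t \<ge> 0" "t * x = 1" using True by (auto simp: t_def)
  have "t ^ Suc n / F \<le> exp t" unfolding F_def by (rule power_div_fact_le_exp[OF t(1)])
  then have "t ^ Suc n \<le> F * exp t" using F by (simp add: pos_divide_le_eq mult.commute)
  then have "t ^ Suc n * (x * exp (- t)) \<le> F * exp t * (x * exp (- t))"
    using True by (intro mult_right_mono) auto
  also have "t ^ Suc n * (x * exp (- t)) = t ^ n * (t * x) * exp (- t)" by (simp only: power_Suc ac_simps)
  also have "F * exp t * (x * exp (- t)) = F * x" by (simp add: exp_minus)
  finally have "t ^ n * exp (- t) \<le> F * x" by (simp only: t mult_1_right)
  moreover have "flat_exp n x = t ^ n * exp (- t)"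
    using True by (simp add: flat_exp_def t_def field_simps)
  ultimately show ?thesis using True unfolding F_def by simp
qed (simp add: flat_exp_def mult_nonneg_nonpos del: fact_Suc)

lemma flat_exp_Suc: "flat_exp n x = x * flat_exp (Suc n) x"
  by (simp add: flat_exp_def)

lemma flat_exp_deriv:
  "(flat_exp n has_real_derivative flat_exp (n + 2) x - real n * flat_exp (n + 1) x) (at x)"
proof -
  consider "x > 0" | "x < 0" | "x = 0" by linarith
  then show ?thesis
  proof cases
    case 1
    have "((\<lambda>x. exp (- 1 / x) / x ^ n) has_real_derivative
        (exp (- 1 / x) * (1 / x\<^sup>2) * x ^ n - exp (- 1 / x) * (real n * x ^ (n - 1))) / (x ^ n * x ^ n)) (at x)"
      using 1 by (auto intro!: derivative_eq_intros simp: power2_eq_square)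
    moreover have "(exp (- 1 / x) * (1 / x\<^sup>2) * x ^ n - exp (- 1 / x) * (real n * x ^ (n - 1))) / (x ^ n * x ^ n)
        = flat_exp (n + 2) x - real n * flat_exp (n + 1) x"
    proof (cases n)
      case 0 then show ?thesis using 1 by (simp add: flat_exp_def power2_eq_square)
    next
      case (Suc m) then show ?thesis using 1
        by (simp add: flat_exp_def field_simps power2_eq_square)
    qed
    ultimately have "((\<lambda>x. exp (- 1 / x) / x ^ n) has_real_derivative
        flat_exp (n + 2) x - real n * flat_exp (n + 1) x) (at x)" by simp
    then show ?thesis
      by (rule has_field_derivative_transform_within_open[of _ _ _ "{0<..}"]) (use 1 in \<open>auto simp: flat_exp_def\<close>)
  next
    case 2
    have "((\<lambda>x. 0) has_real_derivative flat_exp (n + 2) x - real n * flat_exp (n + 1) x) (at x)"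
      using 2 by (simp add: flat_exp_def)
    then show ?thesis
      by (rule has_field_derivative_transform_within_open[of _ _ _ "{..<0}"]) (use 2 in \<open>auto simp: flat_exp_def\<close>)
  next
    case 3
    \<comment> \<open>The difference quotient at 0 is the next member of the family, which is
      bounded by a multiple of \<open>\<bar>h\<bar>\<close>.\<close>
    have "((\<lambda>h. flat_exp n h / h) \<longlongrightarrow> 0) (at 0)"
    proof (rule Lim_null_comparison)
      show "\<forall>\<^sub>F h in at 0. norm (flat_exp n h / h) \<le> fact (n + 2) * \<bar>h\<bar>"
        unfolding eventually_at_filter
      proof (intro always_eventually allI impI)
        fix h :: real assume "h \<noteq> 0"
        then have "flat_exp n h / h = flat_exp (Suc n) h" using flat_exp_Suc[of n h] by simp
        then show "norm (flat_exp n h / h) \<le> fact (n + 2) * \<bar>h\<bar>"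
          using flat_exp_le[of "Suc n" h] flat_exp_nonneg[of "Suc n" h] by simp
      qed
      show "((\<lambda>h. fact (n + 2) * \<bar>h\<bar>) \<longlongrightarrow> 0) (at (0::real))" by (auto intro!: tendsto_eq_intros)
    qed
    then show ?thesis using 3 by (simp add: DERIV_def flat_exp_def)
  qed
qed

lemma smooth_upto_flat_exp: "smooth_upto k (flat_exp n)"
proof (induction k arbitrary: n)
  case 0
  show ?case using flat_exp_deriv by (auto intro!: continuous_at_imp_continuous_on DERIV_isCont)
next
  case (Suc k)
  have "smooth_upto k (\<lambda>x. flat_exp (n + 2) x + (- real n) * flat_exp (n + 1) x)"
    by (intro smooth_upto_add smooth_upto_mult smooth_upto_const Suc)
  then show ?case by (intro smooth_upto_SucI[of _ "\<lambda>x. flat_exp (n + 2) x - real n * flat_exp (n + 1) x"] flat_exp_deriv) simp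
qed

lemma flat_exp_0_le_1: "flat_exp 0 x \<le> 1"
  by (simp add: flat_exp_def)

text \<open>The bounds that control \<open>sin x\<close> times the derivative of the cut-off \<open>flat_exp 0 (n x - 1)\<close>.\<close>

lemma flat_exp_deriv_bound: "\<bar>(u + 1) * flat_exp 2 u\<bar> \<le> 8"
proof (cases "u > 0")
  case True
  define t where "t = 1 / u"
  have t: "t > 0" using True by (simp add: t_def)
  have "flat_exp 2 u = exp (- t) * t ^ 2" using True by (simp add: flat_exp_def t_def field_simps)
  then have "(u + 1) * flat_exp 2 u = exp (- t) * (t + t ^ 2)"
    using True by (simp add: t_def field_simps power2_eq_square)
  \<comment> \<open>The linear and quadratic terms of the series already give
    \<open>3 * exp t\<close>; 8 is a rounded-up constant.\<close>
  also have "t + t\<^sup>2 \<le> 8 * exp t"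
    using power_div_fact_le_exp[of t 1] power_div_fact_le_exp[of t 2] t exp_gt_zero[of t]
    by (simp add: fact_2)
  finally have "(u + 1) * flat_exp 2 u \<le> exp (- t) * (8 * exp t)" by simp
  also have "exp (- t) * (8 * exp t) = 8" by (simp add: exp_minus)
  finally show ?thesis using True by (simp add: flat_exp_nonneg)
qed (simp add: flat_exp_def)

text \<open>Supported at distance \<open>1 / Suc n\<close> from both ends of the interval and
  tending to 1 inside it. The arguments are spelled as affine expressions \<open>a * x + b\<close>
  so that \<open>smooth_upto_affine\<close> applies directly.\<close>

definition cutoff :: "real \<Rightarrow> nat \<Rightarrow> real \<Rightarrow> real" where
  "cutoff X n x = flat_exp 0 (real (Suc n) * x + (-1)) * flat_exp 0 ((- real (Suc n)) * x + (real (Suc n) * X - 1))"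

lemma smooth_upto_cutoff: "smooth_upto k (cutoff X n)"
  unfolding cutoff_def[abs_def]
  by (rule smooth_upto_mult[OF smooth_upto_affine[OF smooth_upto_flat_exp] smooth_upto_affine[OF smooth_upto_flat_exp]])

definition bump :: "real \<Rightarrow> real \<Rightarrow> nat \<Rightarrow> real \<Rightarrow> real" where
  "bump c d n x = cutoff (d - c) n (1 * x + (- c))"

lemma smooth_upto_bump: "smooth_upto k (bump c d n)"
  unfolding bump_def[abs_def] by (rule smooth_upto_affine[OF smooth_upto_cutoff])

lemma cutoff_bounds: "0 \<le> cutoff X n x" "cutoff X n x \<le> 1"
  unfolding cutoff_def by (auto intro!: mult_nonneg_nonneg mult_le_one flat_exp_nonneg flat_exp_0_le_1)

lemma bump_bounds: "0 \<le> bump c d n x" "bump c d n x \<le> 1"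
  unfolding bump_def by (rule cutoff_bounds)+

lemma cutoff_support: "cutoff X n x \<noteq> 0 \<Longrightarrow> x \<in> {1 / Suc n .. X - 1 / Suc n}"
proof -
  assume "cutoff X n x \<noteq> 0"
  then have "real (Suc n) * x - 1 > 0" "real (Suc n) * (X - x) - 1 > 0"
    unfolding cutoff_def flat_exp_def by (auto simp: algebra_simps split: if_splits)
  then show ?thesis by (simp add: field_simps)
qed

lemma flat_exp_tendsto_1:
  assumes "a > 0" shows "(\<lambda>n. flat_exp 0 (real (Suc n) * a - 1)) \<longlonglongrightarrow> 1"
proof -
  have lim: "filterlim (\<lambda>n. real (Suc n) * a - 1) at_top sequentially"
    using assms by real_asymp
  have "((\<lambda>y::real. exp (- 1 / y)) \<longlongrightarrow> 1) at_top" by real_asymp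
  from filterlim_compose[OF this lim]
  have "(\<lambda>n. exp (- 1 / (real (Suc n) * a - 1))) \<longlonglongrightarrow> 1" .
  then show ?thesis
  proof (rule Lim_transform_eventually)
    show "\<forall>\<^sub>F n in sequentially. exp (- 1 / (real (Suc n) * a - 1)) = flat_exp 0 (real (Suc n) * a - 1)"
      using filterlim_at_top_dense[THEN iffD1, OF lim, rule_format, of 0]
      by eventually_elim (simp add: flat_exp_def)
  qed
qed

lemma cutoff_tendsto: "(\<lambda>n. cutoff X n x) \<longlonglongrightarrow> indicator {0<..<X} x"
proof (cases "x \<in> {0<..<X}")
  case True
  have "(\<lambda>n. flat_exp 0 (real (Suc n) * x - 1) * flat_exp 0 (real (Suc n) * (X - x) - 1)) \<longlonglongrightarrow> 1 * 1"
    by (intro tendsto_mult flat_exp_tendsto_1) (use True in auto)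
  moreover have "cutoff X n x = flat_exp 0 (real (Suc n) * x - 1) * flat_exp 0 (real (Suc n) * (X - x) - 1)" for n
    by (simp add: cutoff_def algebra_simps)
  ultimately show ?thesis using True by simp
next
  case False
  have "cutoff X n x = 0" for n
  proof (rule ccontr)
    assume "cutoff X n x \<noteq> 0"
    from cutoff_support[OF this] have "1 / real (Suc n) \<le> x" "x \<le> X - 1 / real (Suc n)" by auto
    moreover have "1 / real (Suc n) > 0" by simp
    ultimately have "0 < x" "x < X" by linarith+
    then show False using False by simp
  qed
  then show ?thesis using False by simp
qed

lemma bump_tendsto: "(\<lambda>n. bump c d n x) \<longlonglongrightarrow> indicator {c<..<d} x"
proof -
  have "indicator {0<..<d - c} (1 * x + (- c)) = (indicator {c<..<d} x :: real)"
    by (auto simp: indicator_def)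
  then show ?thesis unfolding bump_def using cutoff_tendsto[of "d - c" "1 * x + (- c)"] by simp
qed

text \<open>Each partial derivative of a separable function is again separable, so
  differentiability, integrals and cut-offs on the plane reduce to one variable. The vector
  \<open>c\<close> lets the same calculus serve scalar and vector-valued sines.\<close>

definition tensor :: "(real \<Rightarrow> real) \<Rightarrow> (real \<Rightarrow> real) \<Rightarrow> 'b::real_vector \<Rightarrow> plane \<Rightarrow> 'b" where
  "tensor a b c x = (a (fst x) * b (snd x)) *\<^sub>R c"

lemma Basis_real_prod: "(Basis :: plane set) = {(1, 0), (0, 1)}"
  by (auto simp: Basis_prod_def)

lemma frechet_derivative_eqI:
  "(f has_derivative f') (at x) \<Longrightarrow> frechet_derivative f (at x) = f'"
  using frechet_derivative_at by metis

lemma frechet_derivative_worksI: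
  "f differentiable (at x) \<Longrightarrow> (f has_derivative frechet_derivative f (at x)) (at x)"
  using frechet_derivative_works by blast

lemma tensor_has_derivative:
  fixes c :: "'b::real_normed_vector"
  assumes a: "(a has_real_derivative a') (at (fst x))" and b: "(b has_real_derivative b') (at (snd x))"
  shows "(tensor a b c has_derivative (\<lambda>h. (a' * fst h * b (snd x) + a (fst x) * (b' * snd h)) *\<^sub>R c)) (at x)"
proof -
  have 1: "((\<lambda>x. a (fst x)) has_derivative (\<lambda>h. a' * fst h)) (at x)"
    by (rule has_derivative_compose[OF has_derivative_fst[OF has_derivative_ident]])
      (use a in \<open>simp add: has_field_derivative_def\<close>)
  have 2: "((\<lambda>x. b (snd x)) has_derivative (\<lambda>h. b' * snd h)) (at x)"
    by (rule has_derivative_compose[OF has_derivative_snd[OF has_derivative_ident]])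
      (use b in \<open>simp add: has_field_derivative_def\<close>)
  show ?thesis
    unfolding tensor_def[abs_def]
    by (rule has_derivative_eq_rhs[OF has_derivative_scaleR_left[OF has_derivative_mult[OF 1 2]]])
      (auto simp: algebra_simps fun_eq_iff)
qed

lemma frechet_tensor:
  fixes c :: "'b::real_normed_vector"
  assumes "\<And>x. (a has_real_derivative a' x) (at x)" "\<And>x. (b has_real_derivative b' x) (at x)"
  shows "(\<lambda>x. pder (1, 0) (tensor a b c) x) = tensor a' b c"
    and "(\<lambda>x. pder (0, 1) (tensor a b c) x) = tensor a b' c"
  unfolding frechet_derivative_eqI[OF tensor_has_derivative[OF assms]]
  by (auto simp: tensor_def fun_eq_iff)

lemma C_k_tensor:
  fixes c :: "'b::euclidean_space"
  shows "smooth_upto k a \<Longrightarrow> smooth_upto k b \<Longrightarrow> C_k k (tensor a b c)"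
proof (induction k arbitrary: a b)
  case 0
  then have ab: "continuous_on UNIV a" "continuous_on UNIV b" by simp_all
  have "continuous_on UNIV (\<lambda>x::plane. a (fst x))" "continuous_on UNIV (\<lambda>x::plane. b (snd x))"
    by (rule continuous_on_compose2[of UNIV a UNIV], rule ab(1), intro continuous_intros, simp)
      (rule continuous_on_compose2[of UNIV b UNIV], rule ab(2), intro continuous_intros, simp)
  then show ?case by (auto simp: tensor_def[abs_def] intro!: continuous_intros)
next
  case (Suc k)
  obtain a' b' where *: "\<And>x. (a has_real_derivative a' x) (at x)" "smooth_upto k a'"
    "\<And>x. (b has_real_derivative b' x) (at x)" "smooth_upto k b'" using Suc.prems by auto
  have "tensor a b c differentiable_on UNIV"
    using tensor_has_derivative[OF *(1,3)] by (auto simp: differentiable_on_def differentiable_def)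
  moreover have "C_k k (tensor a' b c)" "C_k k (tensor a b' c)"
    using Suc.prems * by (auto intro!: Suc.IH dest: smooth_upto_Suc simp del: smooth_upto.simps)
  ultimately show ?case
    unfolding C_k.simps Basis_real_prod using frechet_tensor[OF *(1,3), of c] by simp
qed

lemma C_inf_tensor:
  fixes c :: "'b::euclidean_space"
  assumes "\<And>k. smooth_upto k a" "\<And>k. smooth_upto k b"
  shows "C_inf (tensor a b c)"
  unfolding C_inf_def using C_k_tensor assms by blast

section \<open>Closure properties of smooth functions and test functions\<close>

lemma C_k_continuous: "C_k k f \<Longrightarrow> continuous_on UNIV f"
  by (cases k) (auto intro: differentiable_imp_continuous_on)

lemma C_k_add:
  fixes f g :: "'a::euclidean_space \<Rightarrow> 'b::euclidean_space"
  shows "C_k k f \<Longrightarrow> C_k k g \<Longrightarrow> C_k k (\<lambda>x. f x + g x)"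
proof (induction k arbitrary: f g)
  case (Suc k)
  have d: "f differentiable (at x)" "g differentiable (at x)" for x
    using Suc.prems by (auto simp: differentiable_on_def)
  have eq: "frechet_derivative (\<lambda>x. f x + g x) (at x) = (\<lambda>i. pder i f x + pder i g x)" for x
    by (rule frechet_derivative_eqI) (intro has_derivative_add frechet_derivative_worksI d)
  show ?case
    unfolding C_k.simps eq using Suc.prems d
    by (auto intro!: Suc.IH simp: differentiable_on_def)
qed (auto intro: continuous_intros)

lemma C_k_bounded_linear:
  fixes f :: "'a::euclidean_space \<Rightarrow> 'b::euclidean_space" and T :: "'b \<Rightarrow> 'c::euclidean_space"
  assumes T: "bounded_linear T"
  shows "C_k k f \<Longrightarrow> C_k k (\<lambda>x. T (f x))"
proof (induction k arbitrary: f)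
  case 0 then show ?case using bounded_linear.continuous_on[OF T] by auto
next
  case (Suc k)
  have d: "f differentiable (at x)" for x
    using Suc.prems by (auto simp: differentiable_on_def)
  have hd: "((\<lambda>x. T (f x)) has_derivative (\<lambda>i. T (pder i f x))) (at x)" for x
    by (intro bounded_linear.has_derivative[OF T] frechet_derivative_worksI d)
  show ?case
    unfolding C_k.simps frechet_derivative_eqI[OF hd] using Suc.prems hd
    by (auto intro!: Suc.IH simp: differentiable_on_def differentiable_def)
qed

lemma C_inf_add: "C_inf f \<Longrightarrow> C_inf g \<Longrightarrow> C_inf (\<lambda>x. f x + g x)"
  by (simp add: C_inf_def C_k_add)

lemma C_inf_bounded_linear: "bounded_linear T \<Longrightarrow> C_inf f \<Longrightarrow> C_inf (\<lambda>x. T (f x))"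
  by (simp add: C_inf_def C_k_bounded_linear)

lemma C_inf_sum: "finite I \<Longrightarrow> (\<And>i. i \<in> I \<Longrightarrow> C_inf (f i)) \<Longrightarrow> C_inf (\<lambda>x. \<Sum>i\<in>I. f i x)"
proof (induction I rule: finite_induct)
  case empty
  have "C_k k (\<lambda>x. 0)" for k
    by (induction k) (auto intro: continuous_intros simp: frechet_derivative_const)
  then show ?case by (auto simp: C_inf_def)
qed (auto intro: C_inf_add)

lemma C_inf_partial: "C_inf f \<Longrightarrow> i \<in> Basis \<Longrightarrow> C_inf (\<lambda>x. pder i f x)"
  unfolding C_inf_def by (metis C_k.simps(2))

lemma C_inf_imp_C_k: "C_inf f \<Longrightarrow> C_k k f"
  by (simp add: C_inf_def)

lemma C_1_differentiable: "C_k (Suc 0) f \<Longrightarrow> f differentiable (at x)"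
  by (auto simp: differentiable_on_def)

lemma C_1_continuous_partial:
  "C_k (Suc 0) f \<Longrightarrow> i \<in> Basis \<Longrightarrow> continuous_on UNIV (\<lambda>x. pder i f x)"
  by simp

lemma frechet_derivative_scaleR_fun:
  fixes \<phi> :: "'a::euclidean_space \<Rightarrow> real" and u :: "'a \<Rightarrow> 'b::euclidean_space"
  assumes "\<phi> differentiable (at x)" "u differentiable (at x)"
  shows "((\<lambda>x. \<phi> x *\<^sub>R u x) has_derivative
    (\<lambda>h. \<phi> x *\<^sub>R pder h u x + pder h \<phi> x *\<^sub>R u x)) (at x)"
  by (intro has_derivative_scaleR frechet_derivative_worksI assms)

lemma C_1_scaleR_fun:
  fixes \<phi> :: "'a::euclidean_space \<Rightarrow> real" and u :: "'a \<Rightarrow> 'b::euclidean_space"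
  assumes "C_k (Suc 0) \<phi>" "C_k (Suc 0) u"
  shows "C_k (Suc 0) (\<lambda>x. \<phi> x *\<^sub>R u x)"
proof -
  note hd = frechet_derivative_scaleR_fun[OF C_1_differentiable[OF assms(1)] C_1_differentiable[OF assms(2)]]
  show ?thesis
    unfolding C_k.simps frechet_derivative_eqI[OF hd]
  proof (intro conjI ballI)
    show "(\<lambda>x. \<phi> x *\<^sub>R u x) differentiable_on UNIV"
      using hd unfolding differentiable_on_def differentiable_def by blast
    show "continuous_on UNIV (\<lambda>x. \<phi> x *\<^sub>R pder i u x + pder i \<phi> x *\<^sub>R u x)"
      if "i \<in> Basis" for i
      by (intro continuous_on_add continuous_on_scaleR C_1_continuous_partial that assms
          C_k_continuous[OF assms(1)] C_k_continuous[OF assms(2)])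
  qed
qed

lemma test_functionsI:
  assumes "C_inf \<phi>" "compact K" "K \<subseteq> \<Omega>" "\<And>x. \<phi> x \<noteq> 0 \<Longrightarrow> x \<in> K"
  shows "\<phi> \<in> test_functions \<Omega>"
proof -
  have sub: "closure {x. \<phi> x \<noteq> 0} \<subseteq> K"
    by (rule closure_minimal) (use assms in \<open>auto intro: compact_imp_closed\<close>)
  moreover have "compact (closure {x. \<phi> x \<noteq> 0})"
    using compact_Int_closed[OF assms(2) closed_closure[of "{x. \<phi> x \<noteq> 0}"]] sub
    by (simp add: Int_absorb1)
  ultimately show ?thesis using assms by (auto simp: test_functions_def)
qed

lemma test_functions_add:
  assumes "\<phi> \<in> test_functions \<Omega>" "\<psi> \<in> test_functions \<Omega>"
  shows "(\<lambda>x. \<phi> x + \<psi> x) \<in> test_functions \<Omega>"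
proof (rule test_functionsI)
  show "C_inf (\<lambda>x. \<phi> x + \<psi> x)" using assms by (intro C_inf_add) (auto simp: test_functions_def)
  show "compact (closure {x. \<phi> x \<noteq> 0} \<union> closure {x. \<psi> x \<noteq> 0})"
    using assms by (auto simp: test_functions_def)
  show "closure {x. \<phi> x \<noteq> 0} \<union> closure {x. \<psi> x \<noteq> 0} \<subseteq> \<Omega>"
    using assms by (auto simp: test_functions_def)
  show "x \<in> closure {x. \<phi> x \<noteq> 0} \<union> closure {x. \<psi> x \<noteq> 0}" if "\<phi> x + \<psi> x \<noteq> 0" for x
    using that closure_subset[of "{x. \<phi> x \<noteq> 0}"] closure_subset[of "{x. \<psi> x \<noteq> 0}"]
    by (cases "\<phi> x = 0") auto
qed

lemma test_functions_bounded_linear: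
  fixes T :: "'b::euclidean_space \<Rightarrow> 'c::euclidean_space"
  assumes "\<phi> \<in> test_functions \<Omega>" "bounded_linear T"
  shows "(\<lambda>x. T (\<phi> x)) \<in> test_functions \<Omega>"
proof (rule test_functionsI)
  show "C_inf (\<lambda>x. T (\<phi> x))" using assms C_inf_bounded_linear[OF assms(2), of \<phi>] by (simp add: test_functions_def)
  show "compact (closure {x. \<phi> x \<noteq> 0})" "closure {x. \<phi> x \<noteq> 0} \<subseteq> \<Omega>"
    using assms by (auto simp: test_functions_def)
  show "x \<in> closure {x. \<phi> x \<noteq> 0}" if "T (\<phi> x) \<noteq> 0" for x
    using that closure_subset[of "{x. \<phi> x \<noteq> 0}"] bounded_linear.linear[OF assms(2), THEN linear_0] by auto
qed

section \<open>Weak derivatives on the rectangle\<close>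

lemma integral_lborel_on_interval_FTC:
  fixes F :: "real \<Rightarrow> 'b::euclidean_space"
  assumes X: "X \<ge> 0" and F: "\<And>s. (F has_vector_derivative f s) (at s)" and f: "continuous_on UNIV f"
  shows "(\<integral>s. f s \<partial>lborel_on {0<..<X}) = F X - F 0"
proof -
  have "(\<integral>s. f s \<partial>lborel_on {0<..<X}) = (\<integral>s. indicator {0<..<X} s *\<^sub>R f s \<partial>lborel)"
    by (rule integral_restrict_space) simp
  also have "\<dots> = (\<integral>s. indicator {0..X} s *\<^sub>R f s \<partial>lborel)"
  proof (rule integral_cong_AE)
    have [measurable]: "f \<in> borel_measurable borel" by (rule borel_measurable_continuous_onI[OF f])
    show "(\<lambda>s. indicator {0<..<X} s *\<^sub>R f s) \<in> borel_measurable lborel"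
      "(\<lambda>s. indicator {0..X} s *\<^sub>R f s) \<in> borel_measurable lborel" by measurable
    show "AE s in lborel. indicator {0<..<X} s *\<^sub>R f s = indicator {0..X} s *\<^sub>R f s"
      using AE_lborel_singleton[of 0] AE_lborel_singleton[of X]
      by eventually_elim (auto simp: indicator_def)
  qed
  also have "\<dots> = F X - F 0"
    by (rule integral_FTC_Icc[OF X])
      (use F f in \<open>auto intro: has_vector_derivative_at_within continuous_on_subset\<close>)
  finally show ?thesis .
qed

text \<open>Lebesgue measure on the plane is a product measure; for its restriction to a rectangle
  the indicator is carried through Fubini and split into its two factors.\<close>

lemma integral_lborel_on_prod:
  fixes f :: "plane \<Rightarrow> 'b::{banach, second_countable_topology}"
  assumes [measurable]: "S \<in> sets borel" "T \<in> sets borel"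
    and f: "integrable (lborel_on (S \<times> T)) f"
  shows "(\<integral>x. f x \<partial>lborel_on (S \<times> T)) = (\<integral>s. (\<integral>t. f (s, t) \<partial>lborel_on T) \<partial>lborel_on S)"
    and "(\<integral>x. f x \<partial>lborel_on (S \<times> T)) = (\<integral>t. (\<integral>s. f (s, t) \<partial>lborel_on S) \<partial>lborel_on T)"
proof -
  have ST: "S \<times> T \<in> sets (lborel :: plane measure)" by (simp add: borel_Times)
  let ?g = "\<lambda>x. indicator (S \<times> T) x *\<^sub>R f x"
  have "integrable lborel ?g" using f ST by (simp add: integrable_restrict_space)
  then have g: "integrable (lborel \<Otimes>\<^sub>M lborel) ?g" by (simp add: lborel_prod)
  have cp: "case_prod (\<lambda>s t. ?g (s, t)) = ?g" by (rule ext) (simp only: case_prod_beta prod.collapse)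
  from cp g have g': "integrable (lborel \<Otimes>\<^sub>M lborel) (case_prod (\<lambda>s t. ?g (s, t)))" by (simp only:)
  have eq: "(\<integral>x. f x \<partial>lborel_on (S \<times> T)) = integral\<^sup>L (lborel \<Otimes>\<^sub>M lborel) ?g"
    using ST by (simp add: integral_restrict_space lborel_prod)
  have i: "?g (s, t) = indicator S s *\<^sub>R (indicator T t *\<^sub>R f (s, t))" for s t
    by (simp add: indicator_def)
  have [simp]: "S \<in> sets lborel" "T \<in> sets lborel" by auto
  show "(\<integral>x. f x \<partial>lborel_on (S \<times> T)) = (\<integral>s. (\<integral>t. f (s, t) \<partial>lborel_on T) \<partial>lborel_on S)"
    unfolding eq lborel_pair.integral_fst'[OF g, symmetric] unfolding i by (simp add: integral_restrict_space del: scaleR_scaleR)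
  have i: "?g (s, t) = indicator T t *\<^sub>R (indicator S s *\<^sub>R f (s, t))" for s t
    by (auto simp: indicator_def)
  have step: "integral\<^sup>L (lborel \<Otimes>\<^sub>M lborel) ?g = (\<integral>t. (\<integral>s. ?g (s, t) \<partial>lborel) \<partial>lborel)"
    by (simp only: lborel_pair.integral_snd[OF g'] cp)
  show "(\<integral>x. f x \<partial>lborel_on (S \<times> T)) = (\<integral>t. (\<integral>s. f (s, t) \<partial>lborel_on S) \<partial>lborel_on T)"
    unfolding eq step unfolding i by (simp add: integral_restrict_space del: scaleR_scaleR)
qed

locale rectangle =
  fixes X1 X2 :: real
  assumes X1: "X1 > 0" and X2: "X2 > 0"
begin

abbreviation "Om \<equiv> rect X1 X2"
abbreviation "Lb \<equiv> lborel_on Om"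
abbreviation "active_edges \<equiv> rect_left X1 X2 \<union> rect_top X1 X2"
abbreviation "H1 \<equiv> Sobolev_H1 Om"
abbreviation "H10 \<equiv> Sobolev_H10 Om"
abbreviation "wpart \<equiv> weak_partial Om"
abbreviation "I1 \<equiv> lborel_on {0<..<X1}"
abbreviation "I2 \<equiv> lborel_on {0<..<X2}"

lemma Om_borel [measurable, simp]: "Om \<in> sets borel"
  unfolding rect_def by (simp add: borel_Times)

lemma space_Lb [simp]: "space Lb = Om"
  by (simp add: space_restrict_space)

lemma Om_subset: "Om \<subseteq> {0..X1} \<times> {0..X2}"
  by (auto simp: rect_def)

lemma finite_Lb: "finite_measure Lb"
proof
  have "emeasure Lb (space Lb) = emeasure lborel Om" by (simp add: emeasure_restrict_space)
  also have "\<dots> \<le> emeasure lborel (cbox (0,0) (X1,X2))"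
    by (rule emeasure_mono) (auto simp: rect_def mem_box Basis_real_prod)
  also have "\<dots> < \<infinity>" by (rule emeasure_lborel_cbox_finite)
  finally show "emeasure Lb (space Lb) \<noteq> \<infinity>" by simp
qed

lemma borel_imp_Lb: "f \<in> borel_measurable borel \<Longrightarrow> f \<in> borel_measurable Lb"
  by (simp add: measurable_restrict_space1)

lemma bounded_imp_L2:
  fixes f :: "plane \<Rightarrow> 'b::euclidean_space"
  assumes "f \<in> borel_measurable Lb" "\<And>x. x \<in> Om \<Longrightarrow> norm (f x) \<le> C"
  shows "f \<in> L2_space Lb"
proof (rule L2_spaceI[OF assms(1)])
  interpret finite_measure Lb by (rule finite_Lb)
  show "integrable Lb (\<lambda>x. (norm (f x))\<^sup>2)"
    by (rule integrable_const_bound[of _ "C\<^sup>2"])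
      (use assms in \<open>auto intro!: AE_I2 power_mono\<close>)
qed

lemma continuous_imp_L2:
  fixes f :: "plane \<Rightarrow> 'b::euclidean_space"
  assumes "continuous_on UNIV f"
  shows "f \<in> L2_space Lb"
proof -
  have "compact (f ` ({0..X1} \<times> {0..X2}))"
    by (intro compact_continuous_image continuous_on_subset[OF assms] compact_Times) auto
  then have "bounded (f ` ({0..X1} \<times> {0..X2}))" by (rule compact_imp_bounded)
  then obtain C where C: "\<And>x. x \<in> {0..X1} \<times> {0..X2} \<Longrightarrow> norm (f x) \<le> C"
    unfolding bounded_iff by auto
  have "norm (f x) \<le> C" if "x \<in> Om" for x by (rule C) (use that Om_subset in auto)
  then show ?thesis
    by (rule bounded_imp_L2[OF borel_imp_Lb[OF borel_measurable_continuous_onI[OF assms]]])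
qed

lemma L2_imp_integrable:
  fixes u :: "plane \<Rightarrow> 'b::euclidean_space"
  shows "u \<in> L2_space Lb \<Longrightarrow> integrable Lb u"
  using L2_integrable_scaleR(1)[of "\<lambda>x. 1" Lb u] continuous_imp_L2[of "\<lambda>x. 1::real"] by simp

lemma continuous_imp_integrable:
  fixes f :: "plane \<Rightarrow> 'b::euclidean_space"
  shows "continuous_on UNIV f \<Longrightarrow> integrable Lb f"
  by (rule L2_imp_integrable[OF continuous_imp_L2])

lemma fubini_Lb:
  fixes f :: "plane \<Rightarrow> 'b::{banach, second_countable_topology}"
  assumes "integrable Lb f"
  shows "(\<integral>x. f x \<partial>Lb) = (\<integral>s. (\<integral>t. f (s, t) \<partial>I2) \<partial>I1)"
    and "(\<integral>x. f x \<partial>Lb) = (\<integral>t. (\<integral>s. f (s, t) \<partial>I1) \<partial>I2)"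
  using integral_lborel_on_prod[of "{0<..<X1}" "{0<..<X2}" f] assms unfolding rect_def by auto

lemma integral_tensor:
  fixes c :: "'b::euclidean_space"
  assumes "continuous_on UNIV a" "continuous_on UNIV b"
  shows "(\<integral>x. tensor a b c x \<partial>Lb) = ((\<integral>s. a s \<partial>I1) * (\<integral>t. b t \<partial>I2)) *\<^sub>R c"
proof -
  have "C_k 0 (tensor a b c)" using assms by (intro C_k_tensor) auto
  then have i: "integrable Lb (tensor a b c)" by (intro continuous_imp_integrable) simp
  have i': "integrable Lb (tensor a b 1 :: _ \<Rightarrow> real)"
    using C_k_tensor[of 0 a b "1::real"] assms by (intro continuous_imp_integrable) simp
  have "(\<integral>x. tensor a b c x \<partial>Lb) = (\<integral>x. tensor a b (1::real) x *\<^sub>R c \<partial>Lb)"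
    by (simp add: tensor_def)
  also have "\<dots> = (\<integral>x. tensor a b (1::real) x \<partial>Lb) *\<^sub>R c"
    using i' by simp
  also have "(\<integral>x. tensor a b (1::real) x \<partial>Lb) = (\<integral>s. a s \<partial>I1) * (\<integral>t. b t \<partial>I2)"
    unfolding fubini_Lb(1)[OF i'] by (simp add: tensor_def)
  finally show ?thesis .
qed

lemma partial_1_has_vector_derivative:
  fixes F :: "plane \<Rightarrow> 'b::euclidean_space"
  assumes "C_k (Suc 0) F"
  shows "((\<lambda>s. F (s, t)) has_vector_derivative pder (1, 0) F ((s, t))) (at s)"
    and "((\<lambda>t. F (s, t)) has_vector_derivative pder (0, 1) F ((s, t))) (at t)"
proof -
  note d = frechet_derivative_worksI[OF C_1_differentiable[OF assms, of "(s, t)"]]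
  interpret L: bounded_linear "frechet_derivative F (at (s, t))" using d by (rule has_derivative_bounded_linear)
  have "((\<lambda>s. (s, t)) has_derivative (\<lambda>h. (h, 0))) (at s)"
    by (auto intro!: derivative_eq_intros)
  from has_derivative_compose[OF this, of F] d
  show "((\<lambda>s. F (s, t)) has_vector_derivative pder (1, 0) F ((s, t))) (at s)"
    unfolding has_vector_derivative_def L.scaleR[symmetric] by simp
  have "((\<lambda>t. (s, t)) has_derivative (\<lambda>h. (0, h))) (at t)"
    by (auto intro!: derivative_eq_intros)
  from has_derivative_compose[OF this, of F] d
  show "((\<lambda>t. F (s, t)) has_vector_derivative pder (0, 1) F ((s, t))) (at t)"
    unfolding has_vector_derivative_def L.scaleR[symmetric] by simp
qed

text \<open>Fubini with the differentiated variable innermost, then the fundamental theorem of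
  calculus on each line.\<close>

lemma divergence_rect:
  fixes F :: "plane \<Rightarrow> 'b::euclidean_space"
  assumes "C_k (Suc 0) F"
  shows "(\<integral>x. pder (1, 0) F x \<partial>Lb) = (\<integral>t. F (X1, t) - F (0, t) \<partial>I2)"
    and "(\<integral>x. pder (0, 1) F x \<partial>Lb) = (\<integral>s. F (s, X2) - F (s, 0) \<partial>I1)"
proof -
  have c: "continuous_on UNIV (\<lambda>x. pder (1, 0) F x)"
    "continuous_on UNIV (\<lambda>x. pder (0, 1) F x)"
    using assms by (auto simp: Basis_real_prod)
  have c1: "continuous_on UNIV (\<lambda>s. pder (1, 0) F ((s, t)))" for t
    by (rule continuous_on_compose2[OF c(1), of _ "\<lambda>s. (s, t)"]) (auto intro!: continuous_intros)
  have c2: "continuous_on UNIV (\<lambda>t. pder (0, 1) F ((s, t)))" for s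
    by (rule continuous_on_compose2[OF c(2), of _ "\<lambda>t. (s, t)"]) (auto intro!: continuous_intros)
  show "(\<integral>x. pder (1, 0) F x \<partial>Lb) = (\<integral>t. F (X1, t) - F (0, t) \<partial>I2)"
    unfolding fubini_Lb(2)[OF continuous_imp_integrable[OF c(1)]]
    using integral_lborel_on_interval_FTC[OF less_imp_le[OF X1] partial_1_has_vector_derivative(1)[OF assms] c1]
    by simp
  show "(\<integral>x. pder (0, 1) F x \<partial>Lb) = (\<integral>s. F (s, X2) - F (s, 0) \<partial>I1)"
    unfolding fubini_Lb(1)[OF continuous_imp_integrable[OF c(2)]]
    using integral_lborel_on_interval_FTC[OF less_imp_le[OF X2] partial_1_has_vector_derivative(2)[OF assms] c2]
    by simp
qed

lemma integral_partial_scaleR: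
  fixes \<psi> :: "plane \<Rightarrow> real" and u :: "plane \<Rightarrow> 'b::euclidean_space"
  assumes \<psi>: "C_k (Suc 0) \<psi>" and u: "C_k (Suc 0) u" and i: "i \<in> Basis"
  shows "(\<integral>x. pder i (\<lambda>x. \<psi> x *\<^sub>R u x) x \<partial>Lb) =
    (\<integral>x. \<psi> x *\<^sub>R pder i u x \<partial>Lb) + (\<integral>x. pder i \<psi> x *\<^sub>R u x \<partial>Lb)"
proof -
  note hd = frechet_derivative_scaleR_fun[OF C_1_differentiable[OF \<psi>] C_1_differentiable[OF u]]
  note L = L2_integrable_scaleR(1)[OF continuous_imp_L2 continuous_imp_L2]
  show ?thesis
    unfolding frechet_derivative_eqI[OF hd]
    by (intro Bochner_Integration.integral_add L C_k_continuous[OF \<psi>] C_k_continuous[OF u]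
      C_1_continuous_partial[OF \<psi> i] C_1_continuous_partial[OF u i])
qed

lemma test_function_C_1: "\<phi> \<in> test_functions \<Omega> \<Longrightarrow> C_k (Suc 0) \<phi>"
  by (simp add: test_functions_def C_inf_def del: C_k.simps)

lemma test_function_L2:
  fixes \<phi> :: "plane \<Rightarrow> 'b::euclidean_space"
  assumes "\<phi> \<in> test_functions \<Omega>"
  shows "\<phi> \<in> L2_space Lb" and "i \<in> Basis \<Longrightarrow> (\<lambda>x. pder i \<phi> x) \<in> L2_space Lb"
  by (intro continuous_imp_L2 C_k_continuous[OF test_function_C_1[OF assms]])
    (intro continuous_imp_L2 C_1_continuous_partial[OF test_function_C_1[OF assms]])

lemma test_function_zero: "\<phi> \<in> test_functions \<Omega> \<Longrightarrow> x \<notin> \<Omega> \<Longrightarrow> \<phi> x = 0"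
  using closure_subset[of "{x. \<phi> x \<noteq> 0}"] by (auto simp: test_functions_def)

text \<open>Vanishing off the open rectangle is asked of the product only, so the test function may
  be either factor: the scalar one for weak derivatives, the vector one for the approximants that
  define \<open>H10\<close>.\<close>

lemma integration_by_parts:
  fixes \<psi> :: "plane \<Rightarrow> real" and u :: "plane \<Rightarrow> 'b::euclidean_space"
  assumes \<psi>: "C_k (Suc 0) \<psi>" and u: "C_k (Suc 0) u" and i: "i \<in> Basis"
    and zero: "\<And>x. x \<notin> Om \<Longrightarrow> \<psi> x *\<^sub>R u x = 0"
  shows "(\<integral>x. pder i \<psi> x *\<^sub>R u x \<partial>Lb) = - (\<integral>x. \<psi> x *\<^sub>R pder i u x \<partial>Lb)"
proof -
  have z: "\<psi> (0, t) *\<^sub>R u (0, t) = 0" "\<psi> (X1, t) *\<^sub>R u (X1, t) = 0" "\<psi> (s, 0) *\<^sub>R u (s, 0) = 0" "\<psi> (s, X2) *\<^sub>R u (s, X2) = 0" for s t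
    by (rule zero; simp add: rect_def)+
  have "(\<integral>x. pder i (\<lambda>x. \<psi> x *\<^sub>R u x) x \<partial>Lb) = 0"
    using divergence_rect[OF C_1_scaleR_fun[OF \<psi> u]] i by (auto simp: Basis_real_prod z)
  then show ?thesis unfolding integral_partial_scaleR[OF assms(1-3)] by (simp add: add_eq_0_iff)
qed

lemma C_1_has_weak_partial:
  fixes u :: "plane \<Rightarrow> 'b::euclidean_space"
  assumes "C_k (Suc 0) u" "i \<in> Basis"
  shows "has_weak_partial Om i u (\<lambda>x. pder i u x)"
  unfolding has_weak_partial_def
  using assms by (auto intro!: integration_by_parts test_function_C_1 simp: test_function_zero simp del: C_k.simps)

text \<open>Products of one-dimensional bumps are test functions below 1 converging pointwise to the
  indicator of the box; dominated convergence transfers the orthogonality.\<close>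

lemma integral_box_zero:
  fixes v :: "plane \<Rightarrow> 'b::euclidean_space"
  assumes v: "v \<in> L2_space Lb"
    and z: "\<And>\<phi>::plane \<Rightarrow> real. \<phi> \<in> test_functions Om \<Longrightarrow> (\<integral>x. \<phi> x *\<^sub>R v x \<partial>Lb) = 0"
    and c: "0 \<le> c1" "d1 \<le> X1" "0 \<le> c2" "d2 \<le> X2"
  shows "(\<integral>x. indicator ({c1<..<d1} \<times> {c2<..<d2}) x *\<^sub>R v x \<partial>Lb) = 0"
proof -
  define \<phi> where "\<phi> n = tensor (bump c1 d1 n) (bump c2 d2 n) (1::real)" for n
  have t: "\<phi> n \<in> test_functions Om" for n
  proof (rule test_functionsI)
    let ?K = "{c1 + 1 / Suc n .. d1 - 1 / Suc n} \<times> {c2 + 1 / Suc n .. d2 - 1 / Suc n}"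
    show "C_inf (\<phi> n)" unfolding \<phi>_def by (intro C_inf_tensor smooth_upto_bump)
    show "compact ?K" by (intro compact_Times) auto
    define r where "r = 1 / real (Suc n)"
    have "r > 0" by (simp add: r_def)
    then have "{c1 + 1 / Suc n .. d1 - 1 / Suc n} \<subseteq> {0<..<X1}" "{c2 + 1 / Suc n .. d2 - 1 / Suc n} \<subseteq> {0<..<X2}"
      using c unfolding r_def[symmetric] by auto
    then show "?K \<subseteq> Om" unfolding rect_def by (rule Sigma_mono)
    show "x \<in> ?K" if "\<phi> n x \<noteq> 0" for x
    proof -
      have "bump c1 d1 n (fst x) \<noteq> 0" "bump c2 d2 n (snd x) \<noteq> 0" using that by (auto simp: \<phi>_def tensor_def)
      then show ?thesis unfolding bump_def by (cases x) (auto dest!: cutoff_support simp del: of_nat_Suc)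
    qed
  qed
  have "(\<lambda>n. \<integral>x. \<phi> n x *\<^sub>R v x \<partial>Lb) \<longlonglongrightarrow> (\<integral>x. indicator ({c1<..<d1} \<times> {c2<..<d2}) x *\<^sub>R v x \<partial>Lb)"
  proof (rule integral_dominated_convergence)
    have [measurable]: "v \<in> borel_measurable Lb" using v by auto
    have [measurable]: "\<phi> n \<in> borel_measurable Lb" for n using test_function_L2(1)[OF t] by auto
    have [measurable]: "{c1<..<d1} \<times> {c2<..<d2} \<in> sets (borel :: plane measure)" by (simp add: borel_Times)
    show "(\<lambda>x. indicator ({c1<..<d1} \<times> {c2<..<d2}) x *\<^sub>R v x) \<in> borel_measurable Lb"
      by (rule borel_measurable_scaleR[OF borel_imp_Lb[OF borel_measurable_indicator]]) (use v in auto)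
    show "(\<lambda>x. \<phi> n x *\<^sub>R v x) \<in> borel_measurable Lb" for n by measurable
    show "integrable Lb (\<lambda>x. norm (v x))" using L2_imp_integrable[OF v] by simp
    show "AE x in Lb. (\<lambda>n. \<phi> n x *\<^sub>R v x) \<longlonglongrightarrow> indicator ({c1<..<d1} \<times> {c2<..<d2}) x *\<^sub>R v x"
    proof (rule AE_I2)
      fix x
      have "(\<lambda>n. bump c1 d1 n (fst x) * bump c2 d2 n (snd x)) \<longlonglongrightarrow> indicator {c1<..<d1} (fst x) * indicator {c2<..<d2} (snd x)"
        by (intro tendsto_mult bump_tendsto)
      then have "\<phi> \<longlonglongrightarrow> (\<lambda>n. 0) \<or> (\<lambda>n. \<phi> n x) \<longlonglongrightarrow> indicator ({c1<..<d1} \<times> {c2<..<d2}) x"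
        by (cases x) (simp add: \<phi>_def tensor_def indicator_times)
      then show "(\<lambda>n. \<phi> n x *\<^sub>R v x) \<longlonglongrightarrow> indicator ({c1<..<d1} \<times> {c2<..<d2}) x *\<^sub>R v x"
        using \<open>(\<lambda>n. bump c1 d1 n (fst x) * bump c2 d2 n (snd x)) \<longlonglongrightarrow> _\<close>
        by (intro tendsto_scaleR tendsto_const) (cases x, simp add: \<phi>_def tensor_def indicator_times)
    qed
    show "AE x in Lb. norm (\<phi> n x *\<^sub>R v x) \<le> norm (v x)" for n
    proof (rule AE_I2)
      fix x
      have "\<bar>\<phi> n x\<bar> \<le> 1"
        using bump_bounds[of c1 d1 n "fst x"] bump_bounds[of c2 d2 n "snd x"]
        by (simp add: \<phi>_def tensor_def abs_mult mult_le_one)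
      then show "norm (\<phi> n x *\<^sub>R v x) \<le> norm (v x)" by (simp add: mult_left_le_one_le)
    qed
  qed
  moreover have "(\<integral>x. \<phi> n x *\<^sub>R v x \<partial>Lb) = 0" for n by (rule z[OF t])
  ultimately show ?thesis by (simp add: LIMSEQ_const_iff)
qed

text \<open>The fundamental lemma of the calculus of variations. Boxes form an intersection-stable
  generator of the Borel sets, so the integrals of \<open>v\<close>, extended by zero, vanish over
  all Borel sets.\<close>

lemma test_functions_separate:
  fixes v :: "plane \<Rightarrow> 'b::euclidean_space"
  assumes v: "v \<in> L2_space Lb"
    and z: "\<And>\<phi>::plane \<Rightarrow> real. \<phi> \<in> test_functions Om \<Longrightarrow> (\<integral>x. \<phi> x *\<^sub>R v x \<partial>Lb) = 0"
  shows "AE x in Lb. v x = 0"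
proof -
  define g where "g x = indicator Om x *\<^sub>R v x" for x
  have g: "integrable lborel g"
    using L2_imp_integrable[OF v] by (simp add: g_def[abs_def] integrable_restrict_space)
  have gm [measurable]: "g \<in> borel_measurable borel" using g by auto
  let ?E = "range (\<lambda>(a, b). box a b :: plane set)"
  have si: "set_integrable lborel A g" if "A \<in> sets borel" for A
    unfolding set_integrable_def using g that by (intro integrable_mult_indicator) auto
  have Z: "(LINT x:A|lborel. g x) = 0" if A: "A \<in> sets borel" for A
  proof -
    have "A \<in> sigma_sets UNIV ?E" using A by (simp add: borel_eq_box)
    moreover have "Int_stable ?E" by (auto simp: Int_stable_def box_Int_box)
    moreover have sb: "S \<in> sets borel" if "S \<in> sigma_sets UNIV ?E" for S
      using that by (simp add: borel_eq_box)
    have UV: "(LINT x:UNIV|lborel. g x) = 0"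
    proof -
      have "(LINT x:UNIV|lborel. g x) = (\<integral>x. indicator ({0<..<X1} \<times> {0<..<X2}) x *\<^sub>R v x \<partial>Lb)"
        unfolding set_lebesgue_integral_def
        by (subst integral_restrict_space) (auto simp: g_def rect_def indicator_def borel_Times intro!: Bochner_Integration.integral_cong)
      then show ?thesis using integral_box_zero[OF v z, of 0 X1 0 X2] by simp
    qed
    show ?thesis
      using \<open>Int_stable ?E\<close> subset_UNIV[of "?E", simplified Pow_UNIV[symmetric]] \<open>A \<in> sigma_sets UNIV ?E\<close>
    proof (induction rule: sigma_sets_induct_disjoint)
      case (basic S)
      then obtain a b where S: "S = box a b" by auto
      obtain a1 a2 b1 b2 where ab: "a = (a1, a2)" "b = (b1, b2)" by (cases a, cases b)
      \<comment> \<open>An arbitrary box is clipped to the rectangle, outside of which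
        \<open>g\<close> is zero.\<close>
      let ?R = "{max a1 0<..<min b1 X1} \<times> {max a2 0<..<min b2 X2}"
      have "(LINT x:S|lborel. g x) = (\<integral>x. indicator ?R x *\<^sub>R v x \<partial>Lb)"
        unfolding set_lebesgue_integral_def
        by (subst integral_restrict_space) (auto simp: S ab g_def rect_def indicator_def borel_Times mem_box Basis_real_prod
            intro!: Bochner_Integration.integral_cong)
      then show ?case using integral_box_zero[OF v z, of "max a1 0" "min b1 X1" "max a2 0" "min b2 X2"] by simp
    next
      case empty
      show ?case by (simp add: set_lebesgue_integral_def)
    next
      case (compl S)
      have "(LINT x:S \<union> (UNIV - S)|lborel. g x) = (LINT x:S|lborel. g x) + (LINT x:UNIV - S|lborel. g x)"
        using sb[OF compl(1)] by (intro set_integral_Un si) auto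
      then show ?case using compl UV by simp
    next
      case (union S)
      have "S i \<in> sets borel" for i using union(2) sb by auto
      then have "(LINT x:(\<Union>i. S i)|lborel. g x) = (\<Sum>i. (LINT x:(S i)|lborel. g x))"
        using union(1) by (intro lebesgue_integral_countable_add si) (auto simp: disjoint_family_on_def)
      then show ?case using union(3) by simp
    qed
  qed
  have "AE x in lborel. g x = 0" by (rule sigma_finite_measure.density_zero[OF sigma_finite_lborel g]) (simp add: Z)
  then show ?thesis by (simp add: AE_restrict_space_iff g_def indicator_def)
qed

text \<open>\<open>weak_partial\<close> is a choice among weak derivatives. Uniqueness up to null
  sets makes the chosen one interchangeable, under norms and integrals, with any square-integrable
  weak derivative already at hand.\<close>

lemma weak_partial_props:
  fixes u :: "plane \<Rightarrow> 'b::euclidean_space"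
  assumes v: "v \<in> L2_space Lb" and h: "has_weak_partial Om i u v"
  shows "wpart i u \<in> L2_space Lb" and "has_weak_partial Om i u (wpart i u)"
    and "AE x in Lb. wpart i u x = v x"
    and "L2_norm Lb (wpart i u) = L2_norm Lb v"
proof -
  have "\<exists>w. w \<in> L2_space Lb \<and> has_weak_partial Om i u w" using v h by blast
  from someI_ex[OF this]
  show w: "wpart i u \<in> L2_space Lb" "has_weak_partial Om i u (wpart i u)"
    by (simp_all add: weak_partial_def)
  have "AE x in Lb. wpart i u x - v x = 0"
  proof (rule test_functions_separate)
    show "(\<lambda>x. wpart i u x - v x) \<in> L2_space Lb" using w v by (intro L2_space_diff)
    fix \<phi> :: "plane \<Rightarrow> real" assume \<phi>: "\<phi> \<in> test_functions Om"
    have "(\<integral>x. \<phi> x *\<^sub>R (wpart i u x - v x) \<partial>Lb) =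
        (\<integral>x. \<phi> x *\<^sub>R wpart i u x \<partial>Lb) - (\<integral>x. \<phi> x *\<^sub>R v x \<partial>Lb)"
      unfolding scaleR_diff_right
      by (intro Bochner_Integration.integral_diff L2_integrable_scaleR test_function_L2[OF \<phi>] w v)
    also have "\<dots> = 0"
      using w(2) h \<phi> unfolding has_weak_partial_def by (metis (no_types, lifting) minus_equation_iff right_minus_eq)
    finally show "(\<integral>x. \<phi> x *\<^sub>R (wpart i u x - v x) \<partial>Lb) = 0" .
  qed
  then show ae: "AE x in Lb. wpart i u x = v x" by simp
  show "L2_norm Lb (wpart i u) = L2_norm Lb v"
    using w v ae by (intro L2_norm_cong_AE) auto
qed

section \<open>Linear structure and approximation in H1 and H10\<close>

lemma Sobolev_H1_L2: "u \<in> H1 \<Longrightarrow> u \<in> L2_space Lb"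
  by (simp add: Sobolev_H1_def)

lemma Sobolev_H1_weak_partial:
  assumes "u \<in> H1" "i \<in> Basis"
  shows "wpart i u \<in> L2_space Lb" and "has_weak_partial Om i u (wpart i u)"
  using assms weak_partial_props unfolding Sobolev_H1_def by blast+

text \<open>Two linear maps at once: identities give sums, a negated identity gives differences, and
  a zero map gives the image under a single linear map.\<close>

lemma has_weak_partial_lin:
  fixes u v :: "plane \<Rightarrow> 'b::euclidean_space" and S T :: "'b \<Rightarrow> 'b"
  assumes S: "bounded_linear S" and T: "bounded_linear T" and i: "i \<in> Basis"
    and u: "u \<in> L2_space Lb" "u' \<in> L2_space Lb" "has_weak_partial Om i u u'"
    and v: "v \<in> L2_space Lb" "v' \<in> L2_space Lb" "has_weak_partial Om i v v'"
  shows "has_weak_partial Om i (\<lambda>x. S (u x) + T (v x)) (\<lambda>x. S (u' x) + T (v' x))"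
  unfolding has_weak_partial_def
proof (intro allI impI)
  fix \<phi> :: "plane \<Rightarrow> real" assume \<phi>: "\<phi> \<in> test_functions Om"
  have lin: "(\<integral>x. f x *\<^sub>R (S (p x) + T (q x)) \<partial>Lb) = S (\<integral>x. f x *\<^sub>R p x \<partial>Lb) + T (\<integral>x. f x *\<^sub>R q x \<partial>Lb)"
    if f: "f \<in> L2_space Lb" and p: "p \<in> L2_space Lb" and q: "q \<in> L2_space Lb" for f :: "plane \<Rightarrow> real" and p q
  proof -
    have "(\<integral>x. f x *\<^sub>R (S (p x) + T (q x)) \<partial>Lb) = (\<integral>x. S (f x *\<^sub>R p x) + T (f x *\<^sub>R q x) \<partial>Lb)"
      by (simp add: scaleR_add_right linear_scale[OF bounded_linear.linear[OF S]] linear_scale[OF bounded_linear.linear[OF T]])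
    also have "\<dots> = (\<integral>x. S (f x *\<^sub>R p x) \<partial>Lb) + (\<integral>x. T (f x *\<^sub>R q x) \<partial>Lb)"
      by (intro Bochner_Integration.integral_add integrable_bounded_linear[OF S] integrable_bounded_linear[OF T]
          L2_integrable_scaleR f p q)
    also have "\<dots> = S (\<integral>x. f x *\<^sub>R p x \<partial>Lb) + T (\<integral>x. f x *\<^sub>R q x \<partial>Lb)"
      using L2_integrable_scaleR(1)[OF f p] L2_integrable_scaleR(1)[OF f q]
      by (simp add: integral_bounded_linear[OF S] integral_bounded_linear[OF T])
    finally show ?thesis .
  qed
  show "(\<integral>x. pder i \<phi> x *\<^sub>R (S (u x) + T (v x)) \<partial>Lb) =
      - (\<integral>x. \<phi> x *\<^sub>R (S (u' x) + T (v' x)) \<partial>Lb)"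
    unfolding lin[OF test_function_L2(2)[OF \<phi> i] u(1) v(1)] lin[OF test_function_L2(1)[OF \<phi>] u(2) v(2)]
    using u(3) v(3) \<phi>
    by (simp add: has_weak_partial_def linear_neg[OF bounded_linear.linear[OF S]] linear_neg[OF bounded_linear.linear[OF T]])
qed

lemma Sobolev_H1_lin:
  fixes u v :: "plane \<Rightarrow> 'b::euclidean_space" and S T :: "'b \<Rightarrow> 'b"
  assumes S: "bounded_linear S" and T: "bounded_linear T"
    and u: "u \<in> H1" and v: "v \<in> H1"
  shows "(\<lambda>x. S (u x) + T (v x)) \<in> H1"
    and "i \<in> Basis \<Longrightarrow> AE x in Lb. wpart i (\<lambda>x. S (u x) + T (v x)) x =
      S (wpart i u x) + T (wpart i v x)"
proof -
  have L: "(\<lambda>x. S (p x) + T (q x)) \<in> L2_space Lb" if "p \<in> L2_space Lb" "q \<in> L2_space Lb" for p q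
    by (intro L2_space_add L2_space_linear[OF _ S] L2_space_linear[OF _ T] that)
  have h: "has_weak_partial Om i (\<lambda>x. S (u x) + T (v x)) (\<lambda>x. S (wpart i u x) + T (wpart i v x))"
    if i: "i \<in> Basis" for i
    by (intro has_weak_partial_lin S T i Sobolev_H1_L2 Sobolev_H1_weak_partial u v)
  show "(\<lambda>x. S (u x) + T (v x)) \<in> H1"
    unfolding Sobolev_H1_def using h L[OF Sobolev_H1_L2[OF u] Sobolev_H1_L2[OF v]]
      L[OF Sobolev_H1_weak_partial(1)[OF u] Sobolev_H1_weak_partial(1)[OF v]] by blast
  show "AE x in Lb. wpart i (\<lambda>x. S (u x) + T (v x)) x =
      S (wpart i u x) + T (wpart i v x)" if "i \<in> Basis"
    by (rule weak_partial_props(3)[OF L h[OF that]]) (intro Sobolev_H1_weak_partial u v that)+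
qed

lemma C_1_Sobolev_H1:
  fixes u :: "plane \<Rightarrow> 'b::euclidean_space"
  assumes "C_k (Suc 0) u"
  shows "u \<in> H1"
    and "i \<in> Basis \<Longrightarrow> AE x in Lb. wpart i u x = pder i u x"
proof -
  have L: "(\<lambda>x. pder i u x) \<in> L2_space Lb" if "i \<in> Basis" for i
    by (intro continuous_imp_L2 C_1_continuous_partial assms that)
  show "u \<in> H1"
    unfolding Sobolev_H1_def
    using C_1_has_weak_partial[OF assms] L continuous_imp_L2[OF C_k_continuous[OF assms]] by blast
  show "AE x in Lb. wpart i u x = pder i u x" if "i \<in> Basis"
    by (rule weak_partial_props(3)[OF L C_1_has_weak_partial[OF assms]]) (rule that)+
qed

lemma H1_norm_nonneg [simp]: "0 \<le> H1_norm Om u"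
  by (simp add: H1_norm_def sum_nonneg)

lemma H1_norm_sq:
  "(H1_norm Om u)\<^sup>2 = (L2_norm Lb u)\<^sup>2 + (L2_norm Lb (wpart (1,0) u))\<^sup>2 + (L2_norm Lb (wpart (0,1) u))\<^sup>2"
  by (simp add: H1_norm_def Basis_real_prod)

lemma L2_le_H1_norm: "L2_norm Lb u \<le> H1_norm Om u"
  by (rule power2_le_imp_le) (auto simp: H1_norm_sq)

lemma weak_partial_le_H1_norm: "i \<in> Basis \<Longrightarrow> L2_norm Lb (wpart i u) \<le> H1_norm Om u"
  by (rule power2_le_imp_le) (auto simp: H1_norm_sq Basis_real_prod)

lemma H1_norm_le_sum:
  "H1_norm Om u \<le> L2_norm Lb u + L2_norm Lb (wpart (1,0) u) + L2_norm Lb (wpart (0,1) u)"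
proof (rule power2_le_imp_le)
  have "a\<^sup>2 + b\<^sup>2 + c\<^sup>2 \<le> (a + b + c)\<^sup>2" if "a \<ge> 0" "b \<ge> 0" "c \<ge> 0" for a b c :: real
    using that by (simp add: power2_eq_square algebra_simps)
  then show "(H1_norm Om u)\<^sup>2 \<le> (L2_norm Lb u + L2_norm Lb (wpart (1,0) u) + L2_norm Lb (wpart (0,1) u))\<^sup>2"
    unfolding H1_norm_sq by simp
qed simp

lemma weak_partial_L2_norm_diff:
  fixes u v :: "plane \<Rightarrow> 'b::euclidean_space"
  assumes "u \<in> H1" "v \<in> H1" "i \<in> Basis"
  shows "(\<lambda>x. u x - v x) \<in> H1"
    and "L2_norm Lb (wpart i (\<lambda>x. u x - v x)) =
      L2_norm Lb (\<lambda>x. wpart i u x - wpart i v x)"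
proof -
  have bl: "bounded_linear (\<lambda>x::'b. x)" "bounded_linear (\<lambda>x::'b. - x)"
    by (auto intro: bounded_linear_ident bounded_linear_minus)
  note * = Sobolev_H1_lin[OF bl assms(1,2)]
  show H: "(\<lambda>x. u x - v x) \<in> H1" using *(1) by simp
  show "L2_norm Lb (wpart i (\<lambda>x. u x - v x)) =
      L2_norm Lb (\<lambda>x. wpart i u x - wpart i v x)"
  proof (rule L2_norm_cong_AE)
    show "wpart i (\<lambda>x. u x - v x) \<in> borel_measurable Lb"
      using Sobolev_H1_weak_partial(1)[OF H assms(3)] by auto
    show "(\<lambda>x. wpart i u x - wpart i v x) \<in> borel_measurable Lb"
      by (intro borel_measurable_diff L2_space_measurable Sobolev_H1_weak_partial(1) assms)
    show "AE x in Lb. wpart i (\<lambda>x. u x - v x) x = wpart i u x - wpart i v x"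
      using *(2)[OF assms(3)] by simp
  qed
qed

text \<open>\<open>H1_norm\<close> contains the chosen derivative of a difference, which agrees only
  almost everywhere with the difference of the chosen derivatives; L2 norms do not see this.\<close>

lemma H1_tendsto_imp:
  fixes u :: "plane \<Rightarrow> 'b::euclidean_space"
  assumes lim: "((\<lambda>k. H1_norm Om (\<lambda>x. \<phi> k x - u x)) \<longlongrightarrow> 0) F"
    and \<phi>: "\<And>k. \<phi> k \<in> H1" and u: "u \<in> H1"
  shows "((\<lambda>k. L2_norm Lb (\<lambda>x. \<phi> k x - u x)) \<longlongrightarrow> 0) F"
    and "i \<in> Basis \<Longrightarrow> ((\<lambda>k. L2_norm Lb (\<lambda>x. wpart i (\<phi> k) x - wpart i u x)) \<longlongrightarrow> 0) F"
proof -
  show "((\<lambda>k. L2_norm Lb (\<lambda>x. \<phi> k x - u x)) \<longlongrightarrow> 0) F"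
    by (rule Lim_null_comparison[OF _ lim]) (auto intro!: always_eventually L2_le_H1_norm)
  show "((\<lambda>k. L2_norm Lb (\<lambda>x. wpart i (\<phi> k) x - wpart i u x)) \<longlongrightarrow> 0) F" if i: "i \<in> Basis"
  proof (rule Lim_null_comparison[OF _ lim], intro always_eventually allI)
    fix k
    show "norm (L2_norm Lb (\<lambda>x. wpart i (\<phi> k) x - wpart i u x)) \<le> H1_norm Om (\<lambda>x. \<phi> k x - u x)"
      using weak_partial_L2_norm_diff(2)[OF \<phi>[of k] u i] weak_partial_le_H1_norm[OF i] by (metis L2_norm_nonneg abs_of_nonneg real_norm_def)
  qed
qed

lemma H1_tendstoI:
  fixes u :: "plane \<Rightarrow> 'b::euclidean_space"
  assumes "\<And>k. \<phi> k \<in> H1" "u \<in> H1"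
    and "((\<lambda>k. L2_norm Lb (\<lambda>x. \<phi> k x - u x)) \<longlongrightarrow> 0) F"
    and "\<And>i. i \<in> Basis \<Longrightarrow> ((\<lambda>k. L2_norm Lb (\<lambda>x. wpart i (\<phi> k) x - wpart i u x)) \<longlongrightarrow> 0) F"
  shows "((\<lambda>k. H1_norm Om (\<lambda>x. \<phi> k x - u x)) \<longlongrightarrow> 0) F"
proof (rule Lim_null_comparison)
  show "\<forall>\<^sub>F k in F. norm (H1_norm Om (\<lambda>x. \<phi> k x - u x)) \<le> L2_norm Lb (\<lambda>x. \<phi> k x - u x)
      + L2_norm Lb (\<lambda>x. wpart (1,0) (\<phi> k) x - wpart (1,0) u x)
      + L2_norm Lb (\<lambda>x. wpart (0,1) (\<phi> k) x - wpart (0,1) u x)"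
  proof (intro always_eventually allI)
    fix k
    have "H1_norm Om (\<lambda>x. \<phi> k x - u x) \<le> L2_norm Lb (\<lambda>x. \<phi> k x - u x)
      + L2_norm Lb (wpart (1,0) (\<lambda>x. \<phi> k x - u x)) + L2_norm Lb (wpart (0,1) (\<lambda>x. \<phi> k x - u x))"
      by (rule H1_norm_le_sum)
    then show "norm (H1_norm Om (\<lambda>x. \<phi> k x - u x)) \<le> L2_norm Lb (\<lambda>x. \<phi> k x - u x)
      + L2_norm Lb (\<lambda>x. wpart (1,0) (\<phi> k) x - wpart (1,0) u x)
      + L2_norm Lb (\<lambda>x. wpart (0,1) (\<phi> k) x - wpart (0,1) u x)"
      using weak_partial_L2_norm_diff(2)[OF assms(1,2), of "(1,0)"]
        weak_partial_L2_norm_diff(2)[OF assms(1,2), of "(0,1)"] by (simp add: Basis_real_prod)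
  qed
  show "((\<lambda>k. L2_norm Lb (\<lambda>x. \<phi> k x - u x)
      + L2_norm Lb (\<lambda>x. wpart (1,0) (\<phi> k) x - wpart (1,0) u x)
      + L2_norm Lb (\<lambda>x. wpart (0,1) (\<phi> k) x - wpart (0,1) u x)) \<longlongrightarrow> 0) F"
    using assms(3) assms(4)[of "(1,0)"] assms(4)[of "(0,1)"]
    by (auto intro!: tendsto_add_zero simp: Basis_real_prod)
qed

lemma Sobolev_H10_H1: "u \<in> H10 \<Longrightarrow> u \<in> H1"
  by (simp add: Sobolev_H10_def)

lemma Sobolev_H10_approx:
  fixes u :: "plane \<Rightarrow> 'b::euclidean_space"
  assumes "u \<in> H10"
  obtains \<phi> where "\<And>k. \<phi> k \<in> test_functions Om" "\<And>k. \<phi> k \<in> H1"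
    "(\<lambda>k. L2_norm Lb (\<lambda>x. \<phi> k x - u x)) \<longlonglongrightarrow> 0"
    "\<And>i. i \<in> Basis \<Longrightarrow> (\<lambda>k. L2_norm Lb (\<lambda>x. wpart i (\<phi> k) x - wpart i u x)) \<longlonglongrightarrow> 0"
proof -
  obtain \<phi> where \<phi>: "\<And>k. \<phi> k \<in> test_functions Om" "(\<lambda>k. H1_norm Om (\<lambda>x. \<phi> k x - u x)) \<longlonglongrightarrow> 0"
    using assms by (auto simp: Sobolev_H10_def)
  have "\<phi> k \<in> H1" for k by (rule C_1_Sobolev_H1(1)[OF test_function_C_1[OF \<phi>(1)]])
  note H = this
  show ?thesis
    by (rule that[of \<phi>]) (intro \<phi> H H1_tendsto_imp[OF \<phi>(2) H Sobolev_H10_H1[OF assms]] | assumption)+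
qed

text \<open>The same maps send approximating test functions to approximating test functions;
  boundedness of \<open>S\<close> and \<open>T\<close> controls the error in the function and in
  each derivative.\<close>

lemma Sobolev_H10_lin:
  fixes u v :: "plane \<Rightarrow> 'b::euclidean_space" and S T :: "'b \<Rightarrow> 'b"
  assumes S: "bounded_linear S" and T: "bounded_linear T"
    and u: "u \<in> H10" and v: "v \<in> H10"
  shows "(\<lambda>x. S (u x) + T (v x)) \<in> H10"
proof -
  obtain \<phi> where \<phi>: "\<And>k. \<phi> k \<in> test_functions Om" "\<And>k. \<phi> k \<in> H1"
    "(\<lambda>k. L2_norm Lb (\<lambda>x. \<phi> k x - u x)) \<longlonglongrightarrow> 0"
    "\<And>i. i \<in> Basis \<Longrightarrow> (\<lambda>k. L2_norm Lb (\<lambda>x. wpart i (\<phi> k) x - wpart i u x)) \<longlonglongrightarrow> 0"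
    by (rule Sobolev_H10_approx[OF u]) blast
  obtain \<psi> where \<psi>: "\<And>k. \<psi> k \<in> test_functions Om" "\<And>k. \<psi> k \<in> H1"
    "(\<lambda>k. L2_norm Lb (\<lambda>x. \<psi> k x - v x)) \<longlonglongrightarrow> 0"
    "\<And>i. i \<in> Basis \<Longrightarrow> (\<lambda>k. L2_norm Lb (\<lambda>x. wpart i (\<psi> k) x - wpart i v x)) \<longlonglongrightarrow> 0"
    by (rule Sobolev_H10_approx[OF v]) blast
  note uv = Sobolev_H10_H1[OF u] Sobolev_H10_H1[OF v]
  obtain K where K: "\<And>x. norm (S x) \<le> norm x * K" using bounded_linear.bounded[OF S] by blast
  obtain J where J: "\<And>x. norm (T x) \<le> norm x * J" using bounded_linear.bounded[OF T] by blast
  have key: "(\<lambda>k. L2_norm Lb (\<lambda>x. (S (p k x) + T (q k x)) - (S (a x) + T (b x)))) \<longlonglongrightarrow> 0"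
    if p: "\<And>k. p k \<in> L2_space Lb" "\<And>k. q k \<in> L2_space Lb" "a \<in> L2_space Lb" "b \<in> L2_space Lb"
      and l: "(\<lambda>k. L2_norm Lb (\<lambda>x. p k x - a x)) \<longlonglongrightarrow> 0" "(\<lambda>k. L2_norm Lb (\<lambda>x. q k x - b x)) \<longlonglongrightarrow> 0" for p q a b
  proof (rule Lim_null_comparison)
    have bd: "L2_norm Lb (\<lambda>x. R (w x)) \<le> \<bar>L\<bar> * L2_norm Lb w" if w: "w \<in> L2_space Lb" and R: "bounded_linear R"
      and L: "\<And>x. norm (R x) \<le> norm x * L" for w R and L :: real
    proof -
      have "L2_norm Lb (\<lambda>x. R (w x)) \<le> L2_norm Lb (\<lambda>x. L *\<^sub>R w x)"
      proof (rule L2_norm_mono[OF L2_space_scaleR[OF w]])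
        show "(\<lambda>x. R (w x)) \<in> borel_measurable Lb" using L2_space_linear[OF w R] by auto
        show "norm (R (w x)) \<le> norm (L *\<^sub>R w x)" for x
        proof -
          have "norm (w x) * L \<le> norm (w x) * \<bar>L\<bar>" by (intro mult_left_mono) auto
          then show ?thesis using L[of "w x"] by (simp add: mult.commute)
        qed
      qed
      then show ?thesis by simp
    qed
    have "L2_norm Lb (\<lambda>x. (S (p k x) + T (q k x)) - (S (a x) + T (b x))) \<le>
        \<bar>K\<bar> * L2_norm Lb (\<lambda>x. p k x - a x) + \<bar>J\<bar> * L2_norm Lb (\<lambda>x. q k x - b x)" for k
    proof -
      have "(\<lambda>x. (S (p k x) + T (q k x)) - (S (a x) + T (b x))) = (\<lambda>x. S (p k x - a x) + T (q k x - b x))"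
        by (simp add: linear_diff[OF bounded_linear.linear[OF S]] linear_diff[OF bounded_linear.linear[OF T]] fun_eq_iff)
      moreover have "L2_norm Lb (\<lambda>x. S (p k x - a x) + T (q k x - b x)) \<le>
          L2_norm Lb (\<lambda>x. S (p k x - a x)) + L2_norm Lb (\<lambda>x. T (q k x - b x))"
        by (intro L2_norm_triangle L2_space_linear[OF _ S] L2_space_linear[OF _ T] L2_space_diff p)
      moreover note bd[OF L2_space_diff[OF p(1)[of k] p(3)] S K] bd[OF L2_space_diff[OF p(2)[of k] p(4)] T J]
      ultimately show ?thesis by simp
    qed
    then show "\<forall>\<^sub>F k in sequentially. norm (L2_norm Lb (\<lambda>x. (S (p k x) + T (q k x)) - (S (a x) + T (b x)))) \<le>
        \<bar>K\<bar> * L2_norm Lb (\<lambda>x. p k x - a x) + \<bar>J\<bar> * L2_norm Lb (\<lambda>x. q k x - b x)"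
      by (intro always_eventually) simp
    show "(\<lambda>k. \<bar>K\<bar> * L2_norm Lb (\<lambda>x. p k x - a x) + \<bar>J\<bar> * L2_norm Lb (\<lambda>x. q k x - b x)) \<longlonglongrightarrow> 0"
      using tendsto_add[OF tendsto_mult_left[OF l(1), of "\<bar>K\<bar>"] tendsto_mult_left[OF l(2), of "\<bar>J\<bar>"]] by simp
  qed
  have H: "(\<lambda>x. S (\<phi> k x) + T (\<psi> k x)) \<in> H1" for k
    by (rule Sobolev_H1_lin(1)[OF S T \<phi>(2) \<psi>(2)])
  note Huv = Sobolev_H1_lin(1)[OF S T uv]
  have lim: "(\<lambda>k. H1_norm Om (\<lambda>x. (S (\<phi> k x) + T (\<psi> k x)) - (S (u x) + T (v x)))) \<longlonglongrightarrow> 0"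
  proof (rule H1_tendstoI[OF H Huv])
    show "(\<lambda>k. L2_norm Lb (\<lambda>x. (S (\<phi> k x) + T (\<psi> k x)) - (S (u x) + T (v x)))) \<longlonglongrightarrow> 0"
      by (intro key Sobolev_H1_L2 \<phi> \<psi> uv)
    fix i :: "plane" assume i: "i \<in> Basis"
    have eq: "L2_norm Lb (\<lambda>x. wpart i (\<lambda>x. S (\<phi> k x) + T (\<psi> k x)) x - wpart i (\<lambda>x. S (u x) + T (v x)) x)
      = L2_norm Lb (\<lambda>x. (S (wpart i (\<phi> k) x) + T (wpart i (\<psi> k) x)) -
          (S (wpart i u x) + T (wpart i v x)))" for k
    proof (rule L2_norm_cong_AE)
      have L: "(\<lambda>x. S (p x) + T (q x)) \<in> borel_measurable Lb" if "p \<in> L2_space Lb" "q \<in> L2_space Lb" for p q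
        by (intro L2_space_measurable L2_space_add L2_space_linear[OF _ S] L2_space_linear[OF _ T] that)
      show "(\<lambda>x. wpart i (\<lambda>x. S (\<phi> k x) + T (\<psi> k x)) x - wpart i (\<lambda>x. S (u x) + T (v x)) x) \<in> borel_measurable Lb"
        by (intro borel_measurable_diff L2_space_measurable Sobolev_H1_weak_partial(1) H Huv i)
      show "(\<lambda>x. (S (wpart i (\<phi> k) x) + T (wpart i (\<psi> k) x)) -
          (S (wpart i u x) + T (wpart i v x))) \<in> borel_measurable Lb"
        by (intro borel_measurable_diff L Sobolev_H1_weak_partial(1) \<phi> \<psi> uv i)
      show "AE x in Lb. wpart i (\<lambda>x. S (\<phi> k x) + T (\<psi> k x)) x - wpart i (\<lambda>x. S (u x) + T (v x)) x =
          (S (wpart i (\<phi> k) x) + T (wpart i (\<psi> k) x)) -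
          (S (wpart i u x) + T (wpart i v x))"
        using Sobolev_H1_lin(2)[OF S T \<phi>(2) \<psi>(2) i] Sobolev_H1_lin(2)[OF S T uv i] by eventually_elim simp
    qed
    show "(\<lambda>k. L2_norm Lb (\<lambda>x. wpart i (\<lambda>x. S (\<phi> k x) + T (\<psi> k x)) x -
        wpart i (\<lambda>x. S (u x) + T (v x)) x)) \<longlonglongrightarrow> 0"
      unfolding eq by (intro key Sobolev_H1_weak_partial(1) \<phi> \<psi> uv i)
  qed
  have "(\<lambda>x. S (\<phi> k x) + T (\<psi> k x)) \<in> test_functions Om" for k
    by (rule test_functions_add[OF test_functions_bounded_linear[OF \<phi>(1) S] test_functions_bounded_linear[OF \<psi>(1) T]])
  then show ?thesis
    unfolding Sobolev_H10_def using lim Huv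
    by (auto intro!: exI[of _ "\<lambda>k x. S (\<phi> k x) + T (\<psi> k x)"])
qed

end

section \<open>Sine series on the rectangle\<close>

text \<open>Indices start at 0, so index \<open>k\<close> is the Dirichlet mode number
  \<open>k + 1\<close>. This shifts signs: the cosine at the right end is
  \<open>- ((-1) ^ k)\<close>.\<close>

definition freq :: "real \<Rightarrow> nat \<Rightarrow> real" where
  "freq X k = real (Suc k) * pi / X"

lemma freq_pos: "X > 0 \<Longrightarrow> freq X k > 0"
  by (simp add: freq_def)

lemma freq_eq_iff: "X > 0 \<Longrightarrow> freq X j = freq X k \<longleftrightarrow> j = k"
  by (simp add: freq_def)

lemma sin_freq_end: "X > 0 \<Longrightarrow> sin (freq X k * X) = 0"
  using sin_npi[of "Suc k"] by (simp add: freq_def)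

lemma cos_freq_end: "X > 0 \<Longrightarrow> cos (freq X k * X) = - ((-1) ^ k)"
  using cos_npi[of "Suc k"] by (simp add: freq_def)

lemma integral_sin_sin:
  assumes X: "X > 0"
  shows "(\<integral>x. sin (freq X j * x) * sin (freq X k * x) \<partial>lborel_on {0<..<X}) = (if j = k then X / 2 else 0)"
proof -
  define a b where ab: "a = freq X j" "b = freq X k"
  have pos: "a > 0" "b > 0" using X by (auto simp: ab freq_pos)
  have s: "sin (a * X) = 0" "sin (b * X) = 0" using X by (auto simp: ab sin_freq_end)
  have pr: "sin (c * x) * sin (d * x) = (cos ((c - d) * x) - cos ((c + d) * x)) / 2" for c d x :: real
    by (simp add: cos_diff cos_add algebra_simps)
  have d: "((\<lambda>x. sin (c * x) / (2 * c)) has_real_derivative cos (c * x) / 2) (at x)" if "c \<noteq> 0" for c x :: real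
    using that by (auto intro!: derivative_eq_intros)
  have l: "((\<lambda>x. x / 2) has_real_derivative 1 / 2) (at x)" for x :: real
    by (auto intro!: derivative_eq_intros)
  show ?thesis
  proof (cases "j = k")
    case True
    then have "a = b" by (simp add: ab)
    have ne: "a + a \<noteq> 0" using pos by simp
    have "(\<integral>x. sin (a * x) * sin (b * x) \<partial>lborel_on {0<..<X}) =
        (\<lambda>x. x / 2 - sin ((a + a) * x) / (2 * (a + a))) X - (\<lambda>x. x / 2 - sin ((a + a) * x) / (2 * (a + a))) 0"
    proof (rule integral_lborel_on_interval_FTC)
      show "((\<lambda>x. x / 2 - sin ((a + a) * x) / (2 * (a + a))) has_vector_derivative sin (a * x) * sin (b * x)) (at x)" for x
      proof -
        have "((\<lambda>x. x / 2 - sin ((a + a) * x) / (2 * (a + a))) has_real_derivative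
          1 / 2 - cos ((a + a) * x) / 2) (at x)"
          by (rule DERIV_diff[OF l d[OF ne]])
        then show ?thesis
          unfolding has_real_derivative_iff_has_vector_derivative[symmetric] pr \<open>a = b\<close>[symmetric]
          by (simp add: diff_divide_distrib)
      qed
    qed (use X in \<open>auto intro!: continuous_intros\<close>)
    also have "\<dots> = X / 2"
      using s sin_double[of "a * X"] by (simp add: mult.assoc)
    finally show ?thesis using True by (simp add: ab)
  next
    case False
    then have ne: "a - b \<noteq> 0" "a + b \<noteq> 0" using X pos by (auto simp: ab freq_eq_iff)
    have "(\<integral>x. sin (a * x) * sin (b * x) \<partial>lborel_on {0<..<X}) =
        (\<lambda>x. sin ((a - b) * x) / (2 * (a - b)) - sin ((a + b) * x) / (2 * (a + b))) X
        - (\<lambda>x. sin ((a - b) * x) / (2 * (a - b)) - sin ((a + b) * x) / (2 * (a + b))) 0"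
    proof (rule integral_lborel_on_interval_FTC)
      show "((\<lambda>x. sin ((a - b) * x) / (2 * (a - b)) - sin ((a + b) * x) / (2 * (a + b)))
          has_vector_derivative sin (a * x) * sin (b * x)) (at x)" for x
      proof -
        have "((\<lambda>x. sin ((a - b) * x) / (2 * (a - b)) - sin ((a + b) * x) / (2 * (a + b)))
          has_real_derivative cos ((a - b) * x) / 2 - cos ((a + b) * x) / 2) (at x)"
          by (rule DERIV_diff[OF d[OF ne(1)] d[OF ne(2)]])
        then show ?thesis
          unfolding has_real_derivative_iff_has_vector_derivative[symmetric] pr
          by (simp add: diff_divide_distrib)
      qed
    qed (use X in \<open>auto intro!: continuous_intros\<close>)
    also have "\<dots> = 0"
    proof -
      have "sin ((a - b) * X) = 0" "sin ((a + b) * X) = 0"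
        using s by (simp_all add: left_diff_distrib distrib_right sin_diff sin_add)
      then show ?thesis by simp
    qed
    finally show ?thesis using False by (simp add: ab)
  qed
qed

lemma cutoff_has_derivative:
  "(cutoff X n has_real_derivative
     (let m = real (Suc n) in m * flat_exp 2 (m * x + (-1)) * flat_exp 0 ((- m) * x + (m * X - 1))
       - m * flat_exp 0 (m * x + (-1)) * flat_exp 2 ((- m) * x + (m * X - 1)))) (at x)"
proof -
  define m where "m = real (Suc n)"
  have f0: "(flat_exp 0 has_real_derivative flat_exp 2 y) (at y)" for y
    using flat_exp_deriv[of 0 y] by (simp add: numeral_2_eq_2)
  have 1: "((\<lambda>x. flat_exp 0 (m * x + (-1))) has_real_derivative flat_exp 2 (m * x + (-1)) * m) (at x)"
    by (rule DERIV_chain2[of "flat_exp 0"]) (rule f0, auto intro!: derivative_eq_intros)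
  have 2: "((\<lambda>x. flat_exp 0 ((- m) * x + (m * X - 1))) has_real_derivative
      flat_exp 2 ((- m) * x + (m * X - 1)) * (- m)) (at x)"
    by (rule DERIV_chain2[of "flat_exp 0"]) (rule f0, auto intro!: derivative_eq_intros)
  show ?thesis
    unfolding cutoff_def[abs_def] m_def[symmetric] Let_def
    by (rule DERIV_cong[OF DERIV_mult[OF 1 2]]) (simp add: algebra_simps)
qed

text \<open>The derivative of the cut-off grows like \<open>n\<close> near the ends, but the sine
  vanishes there to first order. The product stays bounded uniformly in \<open>n\<close>, and this
  is what puts the sines into \<open>H10\<close>.\<close>

lemma sin_times_cutoff_derivative:
  assumes X: "X > 0"
  obtains D where
    "\<And>n x. ((\<lambda>x. sin (freq X k * x) * cutoff X n x) has_real_derivative D n x) (at x)"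
    "\<And>n x. \<bar>D n x\<bar> \<le> 17 * freq X k"
    "\<And>x. x \<in> {0<..<X} \<Longrightarrow> (\<lambda>n. D n x) \<longlonglongrightarrow> freq X k * cos (freq X k * x)"
    "\<And>n. continuous_on UNIV (D n)"
proof -
  define w where "w = freq X k"
  have w: "w > 0" using X by (simp add: w_def freq_pos)
  have sw: "sin (w * X) = 0" using X by (simp add: w_def sin_freq_end)
  define f1 where "f1 n x = flat_exp 0 (real (Suc n) * x + (-1))" for n x
  define f2 where "f2 n x = flat_exp 0 ((- real (Suc n)) * x + (real (Suc n) * X - 1))" for n x
  define g1 where "g1 n x = real (Suc n) * flat_exp 2 (real (Suc n) * x + (-1))" for n x
  define g2 where "g2 n x = real (Suc n) * flat_exp 2 ((- real (Suc n)) * x + (real (Suc n) * X - 1))" for n x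
  define D where "D n x = w * cos (w * x) * cutoff X n x + (sin (w * x) * g1 n x * f2 n x - sin (w * x) * g2 n x * f1 n x)" for n x
  have f: "\<bar>f1 n x\<bar> \<le> 1" "\<bar>f2 n x\<bar> \<le> 1" for n x
    unfolding f1_def f2_def using flat_exp_0_le_1 flat_exp_nonneg by (simp_all add: abs_of_nonneg del: of_nat_Suc)
  \<comment> \<open>With \<open>u = real (Suc n) * x - 1\<close> the factor
    \<open>real (Suc n) * x\<close> is \<open>u + 1\<close>, so \<open>flat_exp_deriv_bound\<close>
    supplies the 8.\<close>
  have b1: "\<bar>sin (w * x) * g1 n x\<bar> \<le> 8 * w" for n x
  proof -
    have "\<bar>sin (w * x) * g1 n x\<bar> \<le> \<bar>w * x\<bar> * \<bar>g1 n x\<bar>"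
      unfolding abs_mult[of "sin (w * x)"] by (intro mult_right_mono abs_sin_x_le_abs_x abs_ge_zero)
    also have "\<dots> = w * \<bar>(real (Suc n) * x + (-1) + 1) * flat_exp 2 (real (Suc n) * x + (-1))\<bar>"
      using w by (simp add: g1_def abs_mult del: of_nat_Suc)
    also have "\<dots> \<le> w * 8" using w by (intro mult_left_mono flat_exp_deriv_bound) auto
    finally show ?thesis by simp
  qed
  \<comment> \<open>At the right end the zero of the sine is used through
    \<open>sin (w * X) = 0\<close>, which rewrites \<open>sin (w * x)\<close> as a multiple of the
    sine of \<open>w * (X - x)\<close>.\<close>
  have b2: "\<bar>sin (w * x) * g2 n x\<bar> \<le> 8 * w" for n x
  proof -
    have "sin (w * x) = sin (w * X - w * (X - x))" by (simp add: algebra_simps)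
    also have "\<dots> = - cos (w * X) * sin (w * (X - x))" by (simp add: sin_diff sw)
    finally have "\<bar>sin (w * x)\<bar> = \<bar>cos (w * X)\<bar> * \<bar>sin (w * (X - x))\<bar>" by (simp add: abs_mult)
    also have "\<dots> \<le> 1 * \<bar>w * (X - x)\<bar>" by (intro mult_mono abs_sin_x_le_abs_x abs_cos_le_one) auto
    finally have "\<bar>sin (w * x) * g2 n x\<bar> \<le> \<bar>w * (X - x)\<bar> * \<bar>g2 n x\<bar>"
      unfolding abs_mult[of "sin (w * x)"] by (intro mult_right_mono) auto
    also have "\<dots> = w * \<bar>((- real (Suc n)) * x + (real (Suc n) * X - 1) + 1) * flat_exp 2 ((- real (Suc n)) * x + (real (Suc n) * X - 1))\<bar>"
    proof -
      have "(- real (Suc n)) * x + (real (Suc n) * X - 1) + 1 = real (Suc n) * (X - x)" by (simp add: algebra_simps)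
      then show ?thesis using w by (simp add: g2_def abs_mult del: of_nat_Suc)
    qed
    also have "\<dots> \<le> w * 8" using w by (intro mult_left_mono flat_exp_deriv_bound) auto
    finally show ?thesis by simp
  qed
  show ?thesis
  proof
    show "((\<lambda>x. sin (freq X k * x) * cutoff X n x) has_real_derivative D n x) (at x)" for n x
    proof -
      have "((\<lambda>x. sin (w * x)) has_real_derivative cos (w * x) * w) (at x)"
        by (auto intro!: derivative_eq_intros)
      from DERIV_mult[OF this cutoff_has_derivative[of X n x]] show ?thesis
        unfolding w_def[symmetric] by (rule DERIV_cong) (simp add: D_def Let_def g1_def g2_def f1_def f2_def algebra_simps del: of_nat_Suc)
    qed
    \<comment> \<open>17 = 1 + 8 + 8: the derivative of the sine and the two factors of the
      cut-off.\<close>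
    show "\<bar>D n x\<bar> \<le> 17 * freq X k" for n x
    proof -
      have "\<bar>w * cos (w * x) * cutoff X n x\<bar> \<le> w * 1 * 1"
        unfolding abs_mult using w cutoff_bounds[of X n x] abs_cos_le_one[of "w * x"]
        by (intro mult_mono) auto
      moreover have "\<bar>sin (w * x) * g1 n x * f2 n x\<bar> \<le> 8 * w * 1"
        unfolding abs_mult[of _ "f2 n x"] using b1 f w by (intro mult_mono) auto
      moreover have "\<bar>sin (w * x) * g2 n x * f1 n x\<bar> \<le> 8 * w * 1"
        unfolding abs_mult[of _ "f1 n x"] using b2 f w by (intro mult_mono) auto
      ultimately show ?thesis unfolding D_def w_def[symmetric] by linarith
    qed
    show "(\<lambda>n. D n x) \<longlonglongrightarrow> freq X k * cos (freq X k * x)" if x: "x \<in> {0<..<X}" for x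
    proof -
      have g: "(\<lambda>n. real (Suc n) * flat_exp 2 (real (Suc n) * a - 1)) \<longlonglongrightarrow> 0" if a: "a > 0" for a
      proof (rule Lim_transform_eventually)
        show "(\<lambda>n. real (Suc n) * (exp (- 1 / (real (Suc n) * a - 1)) / (real (Suc n) * a - 1)\<^sup>2)) \<longlonglongrightarrow> 0"
          using a by real_asymp
        have lim: "filterlim (\<lambda>n. real (Suc n) * a - 1) at_top sequentially" using a by real_asymp
        show "\<forall>\<^sub>F n in sequentially. real (Suc n) * (exp (- 1 / (real (Suc n) * a - 1)) / (real (Suc n) * a - 1)\<^sup>2) =
            real (Suc n) * flat_exp 2 (real (Suc n) * a - 1)"
          using filterlim_at_top_dense[THEN iffD1, OF lim, rule_format, of 0]
          by eventually_elim (simp add: flat_exp_def)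
      qed
      have G1: "(\<lambda>n. g1 n x) \<longlonglongrightarrow> 0" unfolding g1_def using g[of x] x by (simp add: del: of_nat_Suc)
      have E: "(- real (Suc n)) * x + (real (Suc n) * X - 1) = real (Suc n) * (X - x) - 1" for n by (simp add: algebra_simps)
      have G2: "(\<lambda>n. g2 n x) \<longlonglongrightarrow> 0" unfolding g2_def E by (rule g) (use x in simp)
      have C: "(\<lambda>n. w * cos (w * x) * cutoff X n x) \<longlonglongrightarrow> w * cos (w * x) * 1"
        using cutoff_tendsto[of X x] x by (intro tendsto_mult tendsto_const) auto
      have T1: "(\<lambda>n. sin (w * x) * g1 n x * f2 n x) \<longlonglongrightarrow> 0"
      proof (rule Lim_null_comparison)
        show "\<forall>\<^sub>F n in sequentially. norm (sin (w * x) * g1 n x * f2 n x) \<le> \<bar>sin (w * x) * g1 n x\<bar> * 1"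
          unfolding real_norm_def abs_mult[of _ "f2 _ x"] by (intro always_eventually allI mult_left_mono f) auto
        show "(\<lambda>n. \<bar>sin (w * x) * g1 n x\<bar> * 1) \<longlonglongrightarrow> 0"
          using tendsto_rabs[OF tendsto_mult_left[OF G1, of "sin (w * x)"]] by simp
      qed
      have T2: "(\<lambda>n. sin (w * x) * g2 n x * f1 n x) \<longlonglongrightarrow> 0"
      proof (rule Lim_null_comparison)
        show "\<forall>\<^sub>F n in sequentially. norm (sin (w * x) * g2 n x * f1 n x) \<le> \<bar>sin (w * x) * g2 n x\<bar> * 1"
          unfolding real_norm_def abs_mult[of _ "f1 _ x"] by (intro always_eventually allI mult_left_mono f) auto
        show "(\<lambda>n. \<bar>sin (w * x) * g2 n x\<bar> * 1) \<longlonglongrightarrow> 0"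
          using tendsto_rabs[OF tendsto_mult_left[OF G2, of "sin (w * x)"]] by simp
      qed
      show ?thesis using tendsto_add[OF C tendsto_diff[OF T1 T2]] by (simp add: D_def w_def)
    qed
    have cf: "continuous_on UNIV (\<lambda>x. flat_exp j (a * x + b))" for j a b
      by (rule smooth_upto_continuous[OF smooth_upto_affine[OF smooth_upto_flat_exp[of 0]]])
    show "continuous_on UNIV (D n)" for n
      unfolding D_def[abs_def] g1_def g2_def f1_def f2_def
      by (intro continuous_intros cf smooth_upto_continuous[OF smooth_upto_cutoff[of 0]])
  qed
qed

section \<open>Modes of the rectangle, their coefficients and finite sine sums\<close>

context rectangle
begin

definition sine :: "nat \<times> nat \<Rightarrow> plane \<Rightarrow> real" where
  "sine i = tensor (\<lambda>s. sin (freq X1 (fst i) * s)) (\<lambda>t. sin (freq X2 (snd i) * t)) 1"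

definition dfreq :: "plane \<Rightarrow> nat \<times> nat \<Rightarrow> real" where
  "dfreq b i = (if b = (1, 0) then freq X1 (fst i) else freq X2 (snd i))"

definition lam :: "nat \<times> nat \<Rightarrow> real" where
  "lam i = (freq X1 (fst i))\<^sup>2 + (freq X2 (snd i))\<^sup>2"

text \<open>The squared L2 norm common to all \<open>sine i\<close>. Coefficients are left
  unnormalised, so expansions divide by it.\<close>

definition Nn :: real where "Nn = X1 * X2 / 4"

definition coef :: "(plane \<Rightarrow> 'b::euclidean_space) \<Rightarrow> nat \<times> nat \<Rightarrow> 'b" where
  "coef u i = (\<integral>x. sine i x *\<^sub>R u x \<partial>Lb)"

text \<open>Double series are summed over growing squares throughout; any fixed index lies in all
  late squares.\<close>

definition Q :: "nat \<Rightarrow> (nat \<times> nat) set" where "Q n = {..<n} \<times> {..<n}"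

definition ssum :: "nat \<Rightarrow> (nat \<times> nat \<Rightarrow> 'b::euclidean_space) \<Rightarrow> plane \<Rightarrow> 'b" where
  "ssum n c x = (\<Sum>i\<in>Q n. sine i x *\<^sub>R c i)"

lemma finite_Q [simp]: "finite (Q n)" by (simp add: Q_def)

lemma Nn_pos: "Nn > 0" using X1 X2 by (simp add: Nn_def)

lemma lam_pos: "lam i > 0"
  unfolding lam_def using freq_pos[OF X1, of "fst i"] by (intro add_pos_nonneg) auto

lemma sum_dfreq: "(dfreq (1,0) i)\<^sup>2 + (dfreq (0,1) i)\<^sup>2 = lam i"
  by (simp add: dfreq_def lam_def)

lemma C_inf_sine: "C_inf (sine i)"
  unfolding sine_def by (intro C_inf_tensor smooth_upto_sin)

lemma sine_le_1: "\<bar>sine i x\<bar> \<le> 1"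
  by (simp add: sine_def tensor_def abs_mult mult_le_one)

lemma sine_continuous: "continuous_on UNIV (sine i)"
  by (rule C_k_continuous[OF C_inf_imp_C_k[OF C_inf_sine]])

lemma sine_L2: "sine i \<in> L2_space Lb"
  by (rule continuous_imp_L2[OF sine_continuous])

lemma partial_sine_L2: "b \<in> Basis \<Longrightarrow> (\<lambda>x. pder b (sine i) x) \<in> L2_space Lb"
  by (rule continuous_imp_L2[OF C_k_continuous[OF C_inf_imp_C_k[OF C_inf_partial[OF C_inf_sine]]]])

lemma sine_orthogonal: "(\<integral>x. sine i x * sine j x \<partial>Lb) = (if i = j then Nn else 0)"
proof -
  have "(\<integral>x. sine i x * sine j x \<partial>Lb) =
      (\<integral>x. tensor (\<lambda>s. sin (freq X1 (fst i) * s) * sin (freq X1 (fst j) * s))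
        (\<lambda>t. sin (freq X2 (snd i) * t) * sin (freq X2 (snd j) * t)) (1::real) x \<partial>Lb)"
    by (simp add: sine_def tensor_def mult_ac)
  also have "\<dots> = (if fst i = fst j then X1 / 2 else 0) * (if snd i = snd j then X2 / 2 else 0)"
    by (subst integral_tensor) (auto intro!: continuous_intros simp: integral_sin_sin X1 X2)
  finally show ?thesis by (cases i; cases j) (auto simp: Nn_def)
qed

lemma sine_second_partial:
  assumes "b \<in> Basis"
  shows "pder b (\<lambda>x. pder b (sine i) x) x = - (dfreq b i)\<^sup>2 * sine i x"
proof -
  have s: "((\<lambda>s. sin (w * s)) has_real_derivative w * cos (w * x)) (at x)" for w x :: real
    by (auto intro!: derivative_eq_intros)
  have c: "((\<lambda>s. w * cos (w * s)) has_real_derivative - (w\<^sup>2) * sin (w * x)) (at x)" for w x :: real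
    by (auto intro!: derivative_eq_intros simp: power2_eq_square)
  consider "b = (1, 0)" | "b = (0, 1)" using assms by (auto simp: Basis_real_prod)
  then show ?thesis
  proof cases
    case 1
    show ?thesis unfolding 1 sine_def frechet_tensor(1)[OF s s]
      using fun_cong[OF frechet_tensor(1)[OF c s], of "freq X1 (fst i)" "freq X2 (snd i)" "1::real" x]
      by (simp add: tensor_def dfreq_def)
  next
    case 2
    show ?thesis unfolding 2 sine_def frechet_tensor(2)[OF s s]
      using fun_cong[OF frechet_tensor(2)[OF s c], of "freq X1 (fst i)" "freq X2 (snd i)" "1::real" x]
      by (simp add: tensor_def dfreq_def)
  qed
qed

lemma L2_bounded_convergence:
  fixes f :: "nat \<Rightarrow> plane \<Rightarrow> 'b::euclidean_space"
  assumes m: "\<And>n. f n \<in> borel_measurable Lb" "g \<in> borel_measurable Lb"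
    and b: "\<And>n x. x \<in> Om \<Longrightarrow> norm (f n x) \<le> C" "\<And>x. x \<in> Om \<Longrightarrow> norm (g x) \<le> C"
    and lim: "\<And>x. x \<in> Om \<Longrightarrow> (\<lambda>n. f n x) \<longlonglongrightarrow> g x"
  shows "(\<lambda>n. L2_norm Lb (\<lambda>x. f n x - g x)) \<longlonglongrightarrow> 0"
proof -
  interpret finite_measure Lb by (rule finite_Lb)
  note [measurable] = m
  have "(\<lambda>n. \<integral>x. (norm (f n x - g x))\<^sup>2 \<partial>Lb) \<longlonglongrightarrow> (\<integral>x. 0 \<partial>Lb)"
  proof (rule integral_dominated_convergence)
    show "(\<lambda>x. (norm (f n x - g x))\<^sup>2) \<in> borel_measurable Lb" for n by measurable
    show "integrable Lb (\<lambda>x. (2 * C)\<^sup>2)" by simp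
    show "AE x in Lb. (\<lambda>n. (norm (f n x - g x))\<^sup>2) \<longlonglongrightarrow> 0"
    proof (rule AE_I2)
      fix x assume "x \<in> space Lb"
      then have "(\<lambda>n. (norm (f n x - g x))\<^sup>2) \<longlonglongrightarrow> (norm (g x - g x))\<^sup>2"
        by (intro tendsto_intros lim) simp
      then show "(\<lambda>n. (norm (f n x - g x))\<^sup>2) \<longlonglongrightarrow> 0" by simp
    qed
    show "AE x in Lb. norm ((norm (f n x - g x))\<^sup>2) \<le> (2 * C)\<^sup>2" for n
    proof (rule AE_I2)
      fix x assume "x \<in> space Lb"
      then have "norm (f n x - g x) \<le> 2 * C" using norm_triangle_ineq4[of "f n x" "g x"] b(1)[of x n] b(2)[of x] by simp
      then show "norm ((norm (f n x - g x))\<^sup>2) \<le> (2 * C)\<^sup>2"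
        unfolding real_norm_def abs_power2 by (rule power_mono) auto
    qed
  qed auto
  then have "(\<lambda>n. sqrt (\<integral>x. (norm (f n x - g x))\<^sup>2 \<partial>Lb)) \<longlonglongrightarrow> sqrt 0"
    by (intro tendsto_real_sqrt) simp
  then show ?thesis by (simp add: L2_norm_def)
qed

lemma C_1_weak_partial_norm:
  fixes u v :: "plane \<Rightarrow> 'b::euclidean_space"
  assumes "C_k (Suc 0) u" "C_k (Suc 0) v" "b \<in> Basis"
  shows "L2_norm Lb (\<lambda>x. wpart b u x - wpart b v x) =
    L2_norm Lb (\<lambda>x. pder b u x - pder b v x)"
proof (rule L2_norm_cong_AE)
  show "(\<lambda>x. wpart b u x - wpart b v x) \<in> borel_measurable Lb"
    by (intro borel_measurable_diff L2_space_measurable Sobolev_H1_weak_partial(1) C_1_Sobolev_H1(1) assms)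
  show "(\<lambda>x. pder b u x - pder b v x) \<in> borel_measurable Lb"
    by (intro borel_measurable_diff L2_space_measurable continuous_imp_L2 C_1_continuous_partial assms)
  show "AE x in Lb. wpart b u x - wpart b v x =
      pder b u x - pder b v x"
    using C_1_Sobolev_H1(2)[OF assms(1,3)] C_1_Sobolev_H1(2)[OF assms(2,3)] by eventually_elim simp
qed

lemma tensor_L2_convergence:
  fixes c :: "'b::euclidean_space"
  assumes cont: "\<And>n. continuous_on UNIV (a n)" "\<And>n. continuous_on UNIV (b n)"
      "continuous_on UNIV a'" "continuous_on UNIV b'"
    and bd: "\<And>n s. \<bar>a n s\<bar> \<le> K" "\<And>n s. \<bar>b n s\<bar> \<le> J"
    and lim: "\<And>s. s \<in> {0<..<X1} \<Longrightarrow> (\<lambda>n. a n s) \<longlonglongrightarrow> a' s" "\<And>t. t \<in> {0<..<X2} \<Longrightarrow> (\<lambda>n. b n t) \<longlonglongrightarrow> b' t"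
  shows "(\<lambda>n. L2_norm Lb (\<lambda>x. tensor (a n) (b n) c x - tensor a' b' c x)) \<longlonglongrightarrow> 0"
proof -
  have K0: "K \<ge> 0" "J \<ge> 0" using bd(1)[of 0 0] bd(2)[of 0 0] by linarith+
  have m: "tensor p q c \<in> borel_measurable Lb" if "continuous_on UNIV p" "continuous_on UNIV q" for p q
    using C_k_tensor[of 0 p q c] that by (intro borel_imp_Lb borel_measurable_continuous_onI) simp
  have n: "norm (tensor (a n) (b n) c x) \<le> K * J * norm c" for n x
    unfolding tensor_def norm_scaleR abs_mult using bd K0 by (intro mult_right_mono mult_mono) auto
  have l: "(\<lambda>n. tensor (a n) (b n) c x) \<longlonglongrightarrow> tensor a' b' c x" if "x \<in> Om" for x
    unfolding tensor_def using that by (intro tendsto_scaleR tendsto_mult lim tendsto_const) (auto simp: rect_def)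
  show ?thesis
  proof (rule L2_bounded_convergence[OF m m n _ l])
    show "norm (tensor a' b' c x) \<le> K * J * norm c" if "x \<in> Om" for x
      by (rule LIMSEQ_le_const2[OF tendsto_norm[OF l[OF that]]]) (use n in blast)
  qed (use cont in auto)
qed

lemma sine_scaleR_tensor:
  "(\<lambda>x. sine i x *\<^sub>R c) = tensor (\<lambda>s. sin (freq X1 (fst i) * s)) (\<lambda>t. sin (freq X2 (snd i) * t)) c"
  by (simp add: sine_def tensor_def fun_eq_iff)

text \<open>Cutting off both factors gives test functions; by
  \<open>sin_times_cutoff_derivative\<close> their derivatives stay bounded, so bounded convergence
  yields convergence in \<open>H1\<close>.\<close>

lemma sine_scaleR_H10:
  fixes c :: "'b::euclidean_space"
  shows "(\<lambda>x. sine i x *\<^sub>R c) \<in> H10"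
proof -
  let ?s1 = "\<lambda>s. sin (freq X1 (fst i) * s)" and ?s2 = "\<lambda>t. sin (freq X2 (snd i) * t)"
  define u where "u = tensor ?s1 ?s2 c"
  define a where "a n s = ?s1 s * cutoff X1 n s" for n s
  define b where "b n t = ?s2 t * cutoff X2 n t" for n t
  define \<phi> where "\<phi> n = tensor (a n) (b n) c" for n
  obtain D1 where D1': "\<And>n x. ((\<lambda>x. ?s1 x * cutoff X1 n x) has_real_derivative D1 n x) (at x)" "\<And>n x. \<bar>D1 n x\<bar> \<le> 17 * freq X1 (fst i)"
    "\<And>x. x \<in> {0<..<X1} \<Longrightarrow> (\<lambda>n. D1 n x) \<longlonglongrightarrow> freq X1 (fst i) * cos (freq X1 (fst i) * x)" "\<And>n. continuous_on UNIV (D1 n)"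
    by (rule sin_times_cutoff_derivative[OF X1, of "fst i"]) blast
  have "(a n has_real_derivative D1 n x) (at x)" for n x using D1'(1) by (simp add: a_def[abs_def])
  note D1 = this D1'(2-)
  obtain D2 where D2': "\<And>n x. ((\<lambda>x. ?s2 x * cutoff X2 n x) has_real_derivative D2 n x) (at x)" "\<And>n x. \<bar>D2 n x\<bar> \<le> 17 * freq X2 (snd i)"
    "\<And>x. x \<in> {0<..<X2} \<Longrightarrow> (\<lambda>n. D2 n x) \<longlonglongrightarrow> freq X2 (snd i) * cos (freq X2 (snd i) * x)" "\<And>n. continuous_on UNIV (D2 n)"
    by (rule sin_times_cutoff_derivative[OF X2, of "snd i"]) blast
  have "(b n has_real_derivative D2 n x) (at x)" for n x using D2'(1) by (simp add: b_def[abs_def])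
  note D2 = this D2'(2-)
  have sm: "smooth_upto k (a n)" "smooth_upto k (b n)" for k n
    unfolding a_def[abs_def] b_def[abs_def] by (rule smooth_upto_mult[OF smooth_upto_sin smooth_upto_cutoff])+
  have C\<phi>: "C_inf (\<phi> n)" for n unfolding \<phi>_def by (intro C_inf_tensor sm)
  have Cu: "C_inf u" unfolding u_def by (intro C_inf_tensor smooth_upto_sin)
  have t: "\<phi> n \<in> test_functions Om" for n
  proof (rule test_functionsI[OF C\<phi>])
    define r where "r = 1 / real (Suc n)"
    have r: "r > 0" by (simp add: r_def)
    let ?K = "{r .. X1 - r} \<times> {r .. X2 - r}"
    show "compact ?K" by (intro compact_Times) auto
    have "{r .. X1 - r} \<subseteq> {0<..<X1}" "{r .. X2 - r} \<subseteq> {0<..<X2}" using r by auto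
    then show "?K \<subseteq> Om" unfolding rect_def by (rule Sigma_mono)
    show "x \<in> ?K" if "\<phi> n x \<noteq> 0" for x
    proof -
      have "cutoff X1 n (fst x) \<noteq> 0" "cutoff X2 n (snd x) \<noteq> 0" using that by (auto simp: \<phi>_def tensor_def a_def b_def)
      then show ?thesis unfolding r_def by (cases x) (auto dest!: cutoff_support simp del: of_nat_Suc)
    qed
  qed
  have ca: "continuous_on UNIV (a n)" "continuous_on UNIV (b n)" for n
    by (rule smooth_upto_continuous[OF sm(1)[of 0]], rule smooth_upto_continuous[OF sm(2)[of 0]])
  have ba: "\<bar>a n s\<bar> \<le> 1" "\<bar>b n s\<bar> \<le> 1" for n s
    unfolding a_def b_def abs_mult using cutoff_bounds by (auto intro!: mult_le_one)
  have la: "(\<lambda>n. a n s) \<longlonglongrightarrow> ?s1 s" if "s \<in> {0<..<X1}" for s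
    unfolding a_def using tendsto_mult_left[OF cutoff_tendsto[of X1 s], of "?s1 s"] that by simp
  have lb: "(\<lambda>n. b n s) \<longlonglongrightarrow> ?s2 s" if "s \<in> {0<..<X2}" for s
    unfolding b_def using tendsto_mult_left[OF cutoff_tendsto[of X2 s], of "?s2 s"] that by simp
  have s: "((\<lambda>s. sin (w * s)) has_real_derivative w * cos (w * x)) (at x)" for w x :: real
    by (auto intro!: derivative_eq_intros)
  have "(\<lambda>n. H1_norm Om (\<lambda>x. \<phi> n x - u x)) \<longlonglongrightarrow> 0"
  proof (rule H1_tendstoI)
    show "\<phi> n \<in> H1" for n by (rule C_1_Sobolev_H1(1)[OF C_inf_imp_C_k[OF C\<phi>]])
    show "u \<in> H1" by (rule C_1_Sobolev_H1(1)[OF C_inf_imp_C_k[OF Cu]])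
    show "(\<lambda>n. L2_norm Lb (\<lambda>x. \<phi> n x - u x)) \<longlonglongrightarrow> 0"
      unfolding \<phi>_def u_def
      by (rule tensor_L2_convergence[OF ca _ _ ba la lb]) (auto intro!: continuous_intros)
    fix d :: "plane" assume d: "d \<in> Basis"
    have eq: "L2_norm Lb (\<lambda>x. wpart d (\<phi> n) x - wpart d u x) =
        L2_norm Lb (\<lambda>x. pder d (\<phi> n) x - pder d u x)" for n
      by (rule C_1_weak_partial_norm[OF C_inf_imp_C_k[OF C\<phi>] C_inf_imp_C_k[OF Cu] d])
    consider "d = (1, 0)" | "d = (0, 1)" using d by (auto simp: Basis_real_prod)
    then show "(\<lambda>n. L2_norm Lb (\<lambda>x. wpart d (\<phi> n) x - wpart d u x)) \<longlonglongrightarrow> 0"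
    proof cases
      case 1
      have "pder d (\<phi> n) x = tensor (D1 n) (b n) c x" for n x
        using fun_cong[OF frechet_tensor(1)[OF D1(1) D2(1)], of n n c x] by (simp add: 1 \<phi>_def)
      moreover have "pder d u x = tensor (\<lambda>s. freq X1 (fst i) * cos (freq X1 (fst i) * s)) ?s2 c x" for x
        using fun_cong[OF frechet_tensor(1)[OF s s]] by (simp add: 1 u_def)
      ultimately show ?thesis unfolding eq
        using tensor_L2_convergence[OF D1(4) ca(2) _ _ D1(2) ba(2) D1(3) lb, of c] by (simp add: continuous_intros)
    next
      case 2
      have "pder d (\<phi> n) x = tensor (a n) (D2 n) c x" for n x
        using fun_cong[OF frechet_tensor(2)[OF D1(1) D2(1)], of n n c x] by (simp add: 2 \<phi>_def)
      moreover have "pder d u x = tensor ?s1 (\<lambda>s. freq X2 (snd i) * cos (freq X2 (snd i) * s)) c x" for x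
        using fun_cong[OF frechet_tensor(2)[OF s s]] by (simp add: 2 u_def)
      ultimately show ?thesis unfolding eq
        using tensor_L2_convergence[OF ca(1) D2(4) _ _ ba(1) D2(2) la D2(3), of c] by (simp add: continuous_intros)
    qed
  qed
  moreover have "u \<in> H1" by (rule C_1_Sobolev_H1(1)[OF C_inf_imp_C_k[OF Cu]])
  ultimately have "u \<in> H10" unfolding Sobolev_H10_def using t by auto
  then show ?thesis unfolding u_def sine_scaleR_tensor .
qed

lemma Sobolev_H10_add:
  fixes u v :: "plane \<Rightarrow> 'b::euclidean_space"
  shows "u \<in> H10 \<Longrightarrow> v \<in> H10 \<Longrightarrow> (\<lambda>x. u x + v x) \<in> H10"
  using Sobolev_H10_lin[of "\<lambda>x. x" "\<lambda>x. x" u v] by (simp add: bounded_linear_ident)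

lemma Sobolev_H10_linear:
  fixes u :: "plane \<Rightarrow> 'b::euclidean_space" and T :: "'b \<Rightarrow> 'b"
  shows "u \<in> H10 \<Longrightarrow> bounded_linear T \<Longrightarrow> (\<lambda>x. T (u x)) \<in> H10"
  using Sobolev_H10_lin[of T "\<lambda>x. 0" u u] by (simp add: bounded_linear_zero)

lemma Sobolev_H10_diff:
  fixes u v :: "plane \<Rightarrow> 'b::euclidean_space"
  shows "u \<in> H10 \<Longrightarrow> v \<in> H10 \<Longrightarrow> (\<lambda>x. u x - v x) \<in> H10"
  using Sobolev_H10_lin[of "\<lambda>x. x" "\<lambda>x. - x" u v] by (simp add: bounded_linear_ident bounded_linear_minus)

lemma ssum_H10: "ssum n c \<in> H10"
proof -
  have "finite I \<Longrightarrow> (\<lambda>x. \<Sum>i\<in>I. sine i x *\<^sub>R c i) \<in> H10" for I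
  proof (induction I rule: finite_induct)
    case empty
    show ?case using sine_scaleR_H10[of "(0,0)" 0] by simp
  next
    case (insert i I)
    then show ?case using Sobolev_H10_add[OF sine_scaleR_H10[of i "c i"] insert.IH] by simp
  qed
  then show ?thesis unfolding ssum_def[abs_def] by simp
qed

lemma ssum_C_inf: "C_inf (ssum n c)"
  unfolding ssum_def[abs_def] sine_scaleR_tensor
  by (intro C_inf_sum finite_Q) (simp add: sine_scaleR_tensor C_inf_tensor smooth_upto_sin)

lemma ssum_L2: "ssum n c \<in> L2_space Lb"
  by (rule continuous_imp_L2[OF C_k_continuous[OF C_inf_imp_C_k[OF ssum_C_inf]]])

lemma partial_ssum: "pder b (ssum n c) x = (\<Sum>i\<in>Q n. pder b (sine i) x *\<^sub>R c i)"
proof -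
  have "(ssum n c has_derivative (\<lambda>b. \<Sum>i\<in>Q n. pder b (sine i) x *\<^sub>R c i)) (at x)"
    unfolding ssum_def[abs_def]
    by (intro has_derivative_sum has_derivative_scaleR_left frechet_derivative_worksI
        C_1_differentiable[OF C_inf_imp_C_k[OF C_inf_sine]])
  then show ?thesis by (simp add: frechet_derivative_eqI)
qed

lemma coef_integrable: "u \<in> L2_space Lb \<Longrightarrow> integrable Lb (\<lambda>x. sine i x *\<^sub>R u x)"
  by (intro L2_integrable_scaleR sine_L2)

lemma coef_add:
  "u \<in> L2_space Lb \<Longrightarrow> v \<in> L2_space Lb \<Longrightarrow> coef (\<lambda>x. u x + v x) i = coef u i + coef v i"
  by (simp add: coef_def scaleR_add_right coef_integrable)

lemma coef_diff:
  "u \<in> L2_space Lb \<Longrightarrow> v \<in> L2_space Lb \<Longrightarrow> coef (\<lambda>x. u x - v x) i = coef u i - coef v i"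
  by (simp add: coef_def scaleR_diff_right coef_integrable)

lemma coef_linear:
  fixes u :: "plane \<Rightarrow> 'b::euclidean_space" and T :: "'b \<Rightarrow> 'c::euclidean_space"
  assumes "u \<in> L2_space Lb" "bounded_linear T"
  shows "coef (\<lambda>x. T (u x)) i = T (coef u i)"
proof -
  have "coef (\<lambda>x. T (u x)) i = (\<integral>x. T (sine i x *\<^sub>R u x) \<partial>Lb)"
    by (simp add: coef_def linear_scale[OF bounded_linear.linear[OF assms(2)]])
  then show ?thesis unfolding coef_def using integral_bounded_linear[OF assms(2) coef_integrable[OF assms(1)]] by simp
qed

lemma coef_norm_le: "u \<in> L2_space Lb \<Longrightarrow> norm (coef u i) \<le> L2_norm Lb (sine i) * L2_norm Lb u"
  unfolding coef_def by (intro L2_integrable_scaleR sine_L2)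

lemma coef_cong_AE:
  assumes "u \<in> L2_space Lb" "v \<in> L2_space Lb" "AE x in Lb. u x = v x"
  shows "coef u i = coef v i"
  unfolding coef_def
proof (rule integral_cong_AE)
  show "(\<lambda>x. sine i x *\<^sub>R u x) \<in> borel_measurable Lb" "(\<lambda>x. sine i x *\<^sub>R v x) \<in> borel_measurable Lb"
    using coef_integrable[OF assms(1)] coef_integrable[OF assms(2)] by auto
qed (use assms(3) in auto)

lemma coef_ssum: "coef (ssum n c) j = (if j \<in> Q n then Nn *\<^sub>R c j else 0)"
proof -
  have "coef (ssum n c) j = (\<integral>x. (\<Sum>i\<in>Q n. (sine j x * sine i x) *\<^sub>R c i) \<partial>Lb)"
    by (simp add: coef_def ssum_def scaleR_sum_right)
  also have "\<dots> = (\<Sum>i\<in>Q n. (\<integral>x. sine j x * sine i x \<partial>Lb) *\<^sub>R c i)"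
    using L2_integrable_scaleR(1)[OF sine_L2 sine_L2]
    by (subst Bochner_Integration.integral_sum) auto
  also have "\<dots> = (\<Sum>i\<in>Q n. if i = j then Nn *\<^sub>R c j else 0)"
    by (intro sum.cong) (auto simp: sine_orthogonal)
  finally show ?thesis by simp
qed

text \<open>The functions \<open>f i\<close> are left open because the formula is needed both for
  the sines and for their partial derivatives.\<close>

lemma inner_sum_scaleR:
  fixes u :: "plane \<Rightarrow> 'b::euclidean_space" and f :: "nat \<times> nat \<Rightarrow> plane \<Rightarrow> real"
  assumes u: "u \<in> L2_space Lb" and f: "\<And>i. f i \<in> L2_space Lb"
  shows "(\<integral>x. u x \<bullet> (\<Sum>i\<in>Q n. f i x *\<^sub>R c i) \<partial>Lb) = (\<Sum>i\<in>Q n. (\<integral>x. f i x *\<^sub>R u x \<partial>Lb) \<bullet> c i)"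
proof -
  have "(\<integral>x. u x \<bullet> (\<Sum>i\<in>Q n. f i x *\<^sub>R c i) \<partial>Lb) = (\<integral>x. (\<Sum>i\<in>Q n. (f i x *\<^sub>R u x) \<bullet> c i) \<partial>Lb)"
    by (simp add: inner_sum_right)
  also have "\<dots> = (\<Sum>i\<in>Q n. (\<integral>x. (f i x *\<^sub>R u x) \<bullet> c i \<partial>Lb))"
    by (intro Bochner_Integration.integral_sum integrable_inner_left L2_integrable_scaleR f u) 
  also have "\<dots> = (\<Sum>i\<in>Q n. (\<integral>x. f i x *\<^sub>R u x \<partial>Lb) \<bullet> c i)"
    by (intro sum.cong refl integral_inner_left impI L2_integrable_scaleR f u)
  finally show ?thesis .
qed

lemma inner_ssum:
  fixes u :: "plane \<Rightarrow> 'b::euclidean_space"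
  assumes "u \<in> L2_space Lb"
  shows "(\<integral>x. u x \<bullet> ssum n c x \<partial>Lb) = (\<Sum>i\<in>Q n. coef u i \<bullet> c i)"
  unfolding ssum_def coef_def by (rule inner_sum_scaleR[OF assms sine_L2])

lemma ssum_norm: "(L2_norm Lb (ssum n c))\<^sup>2 = (\<Sum>i\<in>Q n. Nn * (norm (c i))\<^sup>2)"
proof -
  have "(L2_norm Lb (ssum n c))\<^sup>2 = (\<integral>x. ssum n c x \<bullet> ssum n c x \<partial>Lb)"
    unfolding L2_norm_sq by (simp add: power2_norm_eq_inner)
  also have "\<dots> = (\<Sum>i\<in>Q n. Nn * (norm (c i))\<^sup>2)"
    unfolding inner_ssum[OF ssum_L2] by (intro sum.cong refl) (simp add: coef_ssum power2_norm_eq_inner)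
  finally show ?thesis .
qed

definition proj :: "nat \<Rightarrow> (plane \<Rightarrow> 'b::euclidean_space) \<Rightarrow> plane \<Rightarrow> 'b" where
  "proj n u = ssum n (\<lambda>i. coef u i /\<^sub>R Nn)"

lemma proj_error:
  fixes u :: "plane \<Rightarrow> 'b::euclidean_space"
  assumes u: "u \<in> L2_space Lb"
  shows "(L2_norm Lb (\<lambda>x. u x - proj n u x))\<^sup>2 = (L2_norm Lb u)\<^sup>2 - (\<Sum>i\<in>Q n. (norm (coef u i))\<^sup>2 / Nn)"
proof -
  have "(\<Sum>i\<in>Q n. coef u i \<bullet> (coef u i /\<^sub>R Nn)) = (\<Sum>i\<in>Q n. (norm (coef u i))\<^sup>2 / Nn)"
    by (intro sum.cong refl) (simp add: power2_norm_eq_inner divide_inverse mult.commute)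
  moreover have "(\<Sum>i\<in>Q n. Nn * (norm (coef u i /\<^sub>R Nn))\<^sup>2) = (\<Sum>i\<in>Q n. (norm (coef u i))\<^sup>2 / Nn)"
    using Nn_pos by (intro sum.cong refl) (simp add: power_mult_distrib field_simps power2_eq_square)
  ultimately show ?thesis
    unfolding proj_def L2_norm_diff_sq[OF u ssum_L2] inner_ssum[OF u] ssum_norm by simp
qed

lemma bessel:
  fixes u :: "plane \<Rightarrow> 'b::euclidean_space"
  assumes "u \<in> L2_space Lb"
  shows "(\<Sum>i\<in>Q n. (norm (coef u i))\<^sup>2 / Nn) \<le> (L2_norm Lb u)\<^sup>2"
  using proj_error[OF assms, of n] zero_le_power2[of "L2_norm Lb (\<lambda>x. u x - proj n u x)"] by linarith

text \<open>Completing the square in \<open>c\<close>, with minimum at \<open>d\<close> divided by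
  \<open>a\<close>. It gives best approximation in L2 and, with frequency weights, for each partial
  derivative.\<close>

lemma complete_square_bound:
  fixes d c :: "'b::euclidean_space" assumes "a > 0"
  shows "- ((norm d)\<^sup>2 / a) \<le> a * (norm c)\<^sup>2 - 2 * (d \<bullet> c)"
proof -
  have "0 \<le> (norm (a *\<^sub>R c - d))\<^sup>2 / a" using assms by simp
  also have "(norm (a *\<^sub>R c - d))\<^sup>2 = a\<^sup>2 * (norm c)\<^sup>2 - 2 * a * (d \<bullet> c) + (norm d)\<^sup>2"
    unfolding power2_norm_eq_inner by (simp add: inner_simps inner_commute power2_eq_square algebra_simps)
  also have "\<dots> / a = a * (norm c)\<^sup>2 - 2 * (d \<bullet> c) + (norm d)\<^sup>2 / a"
    using assms by (simp add: field_simps power2_eq_square)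
  finally show ?thesis by simp
qed

lemma proj_best:
  fixes u :: "plane \<Rightarrow> 'b::euclidean_space"
  assumes u: "u \<in> L2_space Lb"
  shows "L2_norm Lb (\<lambda>x. u x - proj n u x) \<le> L2_norm Lb (\<lambda>x. u x - ssum n c x)"
proof (rule power2_le_imp_le)
  have "(\<Sum>i\<in>Q n. - ((norm (coef u i))\<^sup>2 / Nn)) \<le> (\<Sum>i\<in>Q n. Nn * (norm (c i))\<^sup>2 - 2 * (coef u i \<bullet> c i))"
    by (intro sum_mono complete_square_bound Nn_pos)
  then have "- (\<Sum>i\<in>Q n. (norm (coef u i))\<^sup>2 / Nn) \<le> (\<Sum>i\<in>Q n. Nn * (norm (c i))\<^sup>2) - 2 * (\<Sum>i\<in>Q n. coef u i \<bullet> c i)"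
    by (simp add: sum_subtractf sum_distrib_left sum_negf)
  then show "(L2_norm Lb (\<lambda>x. u x - proj n u x))\<^sup>2 \<le> (L2_norm Lb (\<lambda>x. u x - ssum n c x))\<^sup>2"
    unfolding proj_error[OF u] L2_norm_diff_sq[OF u ssum_L2] inner_ssum[OF u] ssum_norm by simp
qed simp

end

subsection \<open>Completeness of the sine system\<close>

text \<open>Multiplying a sine by one of the two cosine generators only shifts its index, so a
  cosine polynomial times the lowest mode is a finite sine sum. Cosine polynomials form an algebra,
  to which Stone--Weierstrass applies; sine sums do not.\<close>

inductive cos_poly :: "real \<Rightarrow> real \<Rightarrow> (plane \<Rightarrow> real) \<Rightarrow> bool" for X1 X2 where
  const: "cos_poly X1 X2 (\<lambda>x. c)"
| cos1: "cos_poly X1 X2 (\<lambda>x. cos (freq X1 0 * fst x))"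
| cos2: "cos_poly X1 X2 (\<lambda>x. cos (freq X2 0 * snd x))"
| add: "cos_poly X1 X2 f \<Longrightarrow> cos_poly X1 X2 g \<Longrightarrow> cos_poly X1 X2 (\<lambda>x. f x + g x)"
| mult: "cos_poly X1 X2 f \<Longrightarrow> cos_poly X1 X2 g \<Longrightarrow> cos_poly X1 X2 (\<lambda>x. f x * g x)"

text \<open>For \<open>k = 0\<close> the second term of the product formula has frequency 0 and
  vanishes; the case distinction keeps the truncated \<open>k - 1\<close> from producing a wrong
  mode.\<close>

lemma cos_mult_sin_freq:
  "cos (freq X 0 * x) * sin (freq X k * x) =
    (1/2) * sin (freq X (Suc k) * x) + (if k = 0 then 0 else (1/2) * sin (freq X (k - 1) * x))"
proof -
  have 1: "freq X (Suc k) * x = freq X k * x + freq X 0 * x" by (cases "X = 0") (simp_all add: freq_def field_simps)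
  have *: "cos (freq X 0 * x) * sin (freq X k * x) = (sin (freq X k * x + freq X 0 * x) + sin (freq X k * x - freq X 0 * x)) / 2"
    by (simp add: sin_add sin_diff)
  show ?thesis
  proof (cases k)
    case 0 show ?thesis using * unfolding 1 by (simp add: 0)
  next
    case (Suc j)
    then have "freq X (k - 1) * x = freq X k * x - freq X 0 * x" by (cases "X = 0") (simp_all add: freq_def field_simps)
    then show ?thesis using * 1 Suc by simp
  qed
qed

context rectangle
begin

inductive sine_span :: "(plane \<Rightarrow> real) \<Rightarrow> bool" where
  basis: "sine_span (sine i)"
| scale: "sine_span f \<Longrightarrow> sine_span (\<lambda>x. c * f x)"
| add: "sine_span f \<Longrightarrow> sine_span g \<Longrightarrow> sine_span (\<lambda>x. f x + g x)"

lemma Q_mono: "m \<le> n \<Longrightarrow> Q m \<subseteq> Q n"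
  by (auto simp: Q_def)

lemma ssum_extend: "m \<le> n \<Longrightarrow> ssum m c = ssum n (\<lambda>i. if i \<in> Q m then c i else 0)"
  unfolding ssum_def[abs_def]
  by (intro ext sum.mono_neutral_cong_left) (use Q_mono in auto)

lemma sine_span_ssum: "sine_span f \<Longrightarrow> \<exists>m c. f = ssum m c"
proof (induction rule: sine_span.induct)
  case (basis i)
  have "i \<in> Q (Suc (max (fst i) (snd i)))" by (cases i) (auto simp: Q_def)
  then have "sine i x = ssum (Suc (max (fst i) (snd i))) (\<lambda>j. if j = i then 1 else 0) x" for x
    by (simp add: ssum_def if_distrib sum.delta' cong: if_cong)
  then show ?case by blast
next
  case (scale f c)
  then obtain m d where "f = ssum m d" by blast
  then have "(\<lambda>x. c * f x) = ssum m (\<lambda>i. c * d i)"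
    by (auto simp: ssum_def fun_eq_iff sum_distrib_left mult_ac)
  then show ?case by blast
next
  case (add f g)
  then obtain m c n d where *: "f = ssum m c" "g = ssum n d" by blast
  define c' where "c' = (\<lambda>i. if i \<in> Q m then c i else 0)"
  define d' where "d' = (\<lambda>i. if i \<in> Q n then d i else 0)"
  have "f = ssum (max m n) c'" "g = ssum (max m n) d'"
    unfolding * c'_def d'_def by (rule ssum_extend; simp)+
  then have "(\<lambda>x. f x + g x) = ssum (max m n) (\<lambda>i. c' i + d' i)"
    by (auto simp: ssum_def fun_eq_iff sum.distrib scaleR_add_right distrib_left)
  then show ?case by blast
qed

lemma sine_span_cos1: "sine_span f \<Longrightarrow> sine_span (\<lambda>x. cos (freq X1 0 * fst x) * f x)"
proof (induction rule: sine_span.induct)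
  case (basis i)
  have eq: "cos (freq X1 0 * fst x) * sine i x =
      (1/2) * sine (Suc (fst i), snd i) x + (if fst i = 0 then 0 else 1/2) * sine (fst i - 1, snd i) x" for x
  proof -
    have *: "cos (freq X1 0 * fst x) * sine i x = (cos (freq X1 0 * fst x) * sin (freq X1 (fst i) * fst x)) * sin (freq X2 (snd i) * snd x)"
      by (simp add: sine_def tensor_def mult_ac)
    show ?thesis unfolding * cos_mult_sin_freq by (auto simp: sine_def tensor_def algebra_simps)
  qed
  show ?case unfolding eq by (rule sine_span.add[OF sine_span.scale[OF sine_span.basis] sine_span.scale[OF sine_span.basis]])
next
  case (scale f c)
  then have "sine_span (\<lambda>x. c * (cos (freq X1 0 * fst x) * f x))" by (intro sine_span.scale)
  then show ?case by (simp add: mult_ac)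
next
  case (add f g)
  then show ?case unfolding distrib_left by (intro sine_span.add)
qed

lemma sine_span_cos2: "sine_span f \<Longrightarrow> sine_span (\<lambda>x. cos (freq X2 0 * snd x) * f x)"
proof (induction rule: sine_span.induct)
  case (basis i)
  have eq: "cos (freq X2 0 * snd x) * sine i x =
      (1/2) * sine (fst i, Suc (snd i)) x + (if snd i = 0 then 0 else 1/2) * sine (fst i, snd i - 1) x" for x
  proof -
    have *: "cos (freq X2 0 * snd x) * sine i x = (cos (freq X2 0 * snd x) * sin (freq X2 (snd i) * snd x)) * sin (freq X1 (fst i) * fst x)"
      by (simp add: sine_def tensor_def mult_ac)
    show ?thesis unfolding * cos_mult_sin_freq by (auto simp: sine_def tensor_def algebra_simps)
  qed
  show ?case unfolding eq by (rule sine_span.add[OF sine_span.scale[OF sine_span.basis] sine_span.scale[OF sine_span.basis]])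
next
  case (scale f c)
  then have "sine_span (\<lambda>x. c * (cos (freq X2 0 * snd x) * f x))" by (intro sine_span.scale)
  then show ?case by (simp add: mult_ac)
next
  case (add f g)
  then show ?case unfolding distrib_left by (intro sine_span.add)
qed

lemma sine_span_cos_poly: "cos_poly X1 X2 q \<Longrightarrow> sine_span f \<Longrightarrow> sine_span (\<lambda>x. q x * f x)"
proof (induction arbitrary: f rule: cos_poly.induct)
  case (const c) then show ?case by (rule sine_span.scale)
next
  case cos1 then show ?case by (rule sine_span_cos1)
next
  case cos2 then show ?case by (rule sine_span_cos2)
next
  case (add p q) then show ?case unfolding distrib_right by (intro sine_span.add) auto
next
  case (mult p q)
  then have "sine_span (\<lambda>x. p x * (q x * f x))" by blast
  then show ?case by (simp only: mult.assoc)
qed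

lemma cos_poly_continuous: "cos_poly X1 X2 f \<Longrightarrow> continuous_on S f"
  by (induction rule: cos_poly.induct) (auto intro!: continuous_intros)

lemma cos_poly_dense:
  assumes "continuous_on ({0..X1} \<times> {0..X2}) f" "e > 0"
  shows "\<exists>q. cos_poly X1 X2 q \<and> (\<forall>x\<in>{0..X1} \<times> {0..X2}. \<bar>f x - q x\<bar> < e)"
proof -
  \<comment> \<open>\<open>freq X 0 * s\<close> stays between 0 and \<open>pi\<close>, where the
    cosine is injective, so the two generators separate points.\<close>
  have inj: "cos (freq X 0 * s) \<noteq> cos (freq X 0 * t)" if "X > 0" "s \<in> {0..X}" "t \<in> {0..X}" "s \<noteq> t" for X s t
  proof
    assume "cos (freq X 0 * s) = cos (freq X 0 * t)"
    moreover have "0 \<le> freq X 0 * s \<and> freq X 0 * s \<le> pi" if "s \<in> {0..X}" for s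
      using that \<open>X > 0\<close> by (simp add: freq_def divide_le_eq)
    ultimately have "freq X 0 * s = freq X 0 * t" using that cos_inj_pi by blast
    then show False using that freq_pos[of X 0] by simp
  qed
  interpret function_ring_on "Collect (cos_poly X1 X2)" "{0..X1} \<times> {0..X2}"
  proof
    show "compact ({0..X1} \<times> {0..X2})" by (intro compact_Times) auto
    fix x y :: "plane" assume xy: "x \<in> {0..X1} \<times> {0..X2}" "y \<in> {0..X1} \<times> {0..X2}" "x \<noteq> y"
    then consider "fst x \<noteq> fst y" | "snd x \<noteq> snd y" by (auto simp: prod_eq_iff)
    then show "\<exists>f\<in>Collect (cos_poly X1 X2). f x \<noteq> f y"
    proof cases
      case 1
      then have "cos (freq X1 0 * fst x) \<noteq> cos (freq X1 0 * fst y)" using xy by (intro inj X1) auto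
      then show ?thesis by (intro bexI[of _ "\<lambda>x. cos (freq X1 0 * fst x)"]) (simp_all add: cos_poly.cos1)
    next
      case 2
      then have "cos (freq X2 0 * snd x) \<noteq> cos (freq X2 0 * snd y)" using xy by (intro inj X2) auto
      then show ?thesis by (intro bexI[of _ "\<lambda>x. cos (freq X2 0 * snd x)"]) (simp_all add: cos_poly.cos2)
    qed
  qed (auto intro: cos_poly.intros cos_poly_continuous)
  obtain F where F: "F \<in> UNIV \<rightarrow> Collect (cos_poly X1 X2)" "uniform_limit ({0..X1} \<times> {0..X2}) F f sequentially"
    using Stone_Weierstrass[OF assms(1)] by blast
  from uniform_limitD[OF F(2) assms(2)] obtain n where "\<forall>x\<in>{0..X1} \<times> {0..X2}. dist (F n x) (f x) < e"
    by (auto simp: eventually_sequentially)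
  then show ?thesis using F(1) by (intro exI[of _ "F n"]) (auto simp: dist_real_def abs_minus_commute)
qed

text \<open>Completeness stated for a single function, so that it can be propagated: from scalar
  test functions to linear images, sums and L2 limits.\<close>

definition sine_conv :: "(plane \<Rightarrow> 'b::euclidean_space) \<Rightarrow> bool" where
  "sine_conv u \<longleftrightarrow> u \<in> L2_space Lb \<and> (\<lambda>n. L2_norm Lb (\<lambda>x. u x - proj n u x)) \<longlonglongrightarrow> 0"

lemma proj_error_antimono:
  fixes u :: "plane \<Rightarrow> 'b::euclidean_space"
  assumes u: "u \<in> L2_space Lb" and "m \<le> n"
  shows "L2_norm Lb (\<lambda>x. u x - proj n u x) \<le> L2_norm Lb (\<lambda>x. u x - ssum m c x)"
  unfolding ssum_extend[OF assms(2)] by (rule proj_best[OF u])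

lemma sine_convI:
  fixes u :: "plane \<Rightarrow> 'b::euclidean_space"
  assumes u: "u \<in> L2_space Lb"
    and a: "\<And>e. e > 0 \<Longrightarrow> \<exists>m c. L2_norm Lb (\<lambda>x. u x - ssum m c x) < e"
  shows "sine_conv u"
  unfolding sine_conv_def
proof (intro conjI u LIMSEQ_I)
  fix e :: real assume "e > 0"
  then obtain m c where "L2_norm Lb (\<lambda>x. u x - ssum m c x) < e" using a by blast
  then show "\<exists>no. \<forall>n\<ge>no. norm (L2_norm Lb (\<lambda>x. u x - proj n u x) - 0) < e"
    using proj_error_antimono[OF u] by (intro exI[of _ m]) (auto intro: le_less_trans)
qed

text \<open>Division by the lowest mode, positive inside, leaves a continuous function because the
  support stays away from the boundary. Approximating this quotient by a cosine polynomial and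
  multiplying back gives a sine sum.\<close>

lemma sine_conv_test_function:
  fixes \<phi> :: "plane \<Rightarrow> real"
  assumes \<phi>: "\<phi> \<in> test_functions Om"
  shows "sine_conv \<phi>"
proof (rule sine_convI[OF test_function_L2(1)[OF \<phi>]])
  fix e :: real assume e: "e > 0"
  \<comment> \<open>Turns a uniform error into an L2 error on the rectangle; the added 1 keeps the
    divisor positive.\<close>
  define V where "V = sqrt (measure Lb Om) + 1"
  have V: "V > 0" by (simp add: V_def add_nonneg_pos)
  define ratio where "ratio x = \<phi> x / sine (0,0) x" for x
  have pos: "sine (0,0) x > 0" if "x \<in> Om" for x
  proof -
    have "sin (freq X 0 * s) > 0" if "X > 0" "0 < s" "s < X" for X s :: real
      using that by (intro sin_gt_zero) (auto simp: freq_def field_simps)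
    then show ?thesis using that X1 X2 by (auto simp: sine_def tensor_def rect_def)
  qed
  have c\<phi>: "continuous_on UNIV \<phi>" by (rule C_k_continuous[OF test_function_C_1[OF \<phi>]])
  have "open Om" unfolding rect_def by (intro open_Times) auto
  let ?K = "closure {x. \<phi> x \<noteq> 0}"
  have K: "?K \<subseteq> Om" using \<phi> by (simp add: test_functions_def)
  \<comment> \<open>Two open sets cover the plane: on the rectangle the divisor is positive, and off
    the support the numerator is 0, so the quotient is 0 even where the divisor vanishes.\<close>
  have "continuous_on (Om \<union> - ?K) ratio"
  proof (rule continuous_on_open_Un)
    show "open Om" by fact
    show "open (- ?K)" by auto
    show "continuous_on Om ratio" unfolding ratio_def
      using pos by (intro continuous_on_divide continuous_on_subset[OF c\<phi>] continuous_on_subset[OF sine_continuous]) force+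
    have "ratio x = 0" if "x \<in> - ?K" for x
      using that closure_subset[of "{x. \<phi> x \<noteq> 0}"] by (auto simp: ratio_def)
    then show "continuous_on (- ?K) ratio" by (intro continuous_on_eq[OF continuous_on_const[of _ 0]]) auto
  qed
  moreover have "Om \<union> - ?K = UNIV" using K by auto
  ultimately have "continuous_on UNIV ratio" by simp
  then have "continuous_on ({0..X1} \<times> {0..X2}) ratio" by (rule continuous_on_subset) simp
  from cos_poly_dense[OF this, of "e / (2 * V)"] e V obtain q where
    q: "cos_poly X1 X2 q" "\<And>x. x \<in> {0..X1} \<times> {0..X2} \<Longrightarrow> \<bar>ratio x - q x\<bar> < e / (2 * V)" by auto
  obtain m c where mc: "(\<lambda>x. q x * sine (0,0) x) = ssum m c"
    using sine_span_ssum[OF sine_span_cos_poly[OF q(1) sine_span.basis]] by blast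
  have bd: "\<bar>\<phi> x - ssum m c x\<bar> \<le> e / (2 * V)" if x: "x \<in> Om" for x
  proof -
    have "\<phi> x - ssum m c x = (ratio x - q x) * sine (0,0) x"
      using pos[OF x] by (simp add: ratio_def mc[symmetric] left_diff_distrib)
    moreover have "\<bar>(ratio x - q x) * sine (0,0) x\<bar> \<le> e / (2 * V) * 1"
      unfolding abs_mult using q(2)[of x] x Om_subset e V by (intro mult_mono sine_le_1 less_imp_le[OF q(2)]) auto
    ultimately show ?thesis by simp
  qed
  interpret finite_measure Lb by (rule finite_Lb)
  have "(L2_norm Lb (\<lambda>x. \<phi> x - ssum m c x))\<^sup>2 \<le> (\<integral>x. (e / (2 * V))\<^sup>2 \<partial>Lb)"
    unfolding L2_norm_sq
  proof (rule integral_mono)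
    show "integrable Lb (\<lambda>x. (norm (\<phi> x - ssum m c x))\<^sup>2)"
      by (intro L2_space_integrable_sq L2_space_diff test_function_L2(1)[OF \<phi>] ssum_L2)
    show "(norm (\<phi> x - ssum m c x))\<^sup>2 \<le> (e / (2 * V))\<^sup>2" if "x \<in> space Lb" for x
      using bd[of x] that by (intro power_mono) auto
  qed simp
  also have "\<dots> = (e / (2 * V) * sqrt (measure Lb Om))\<^sup>2"
    unfolding power_mult_distrib[of "e / (2 * V)"] by (simp add: mult.commute)
  finally have "L2_norm Lb (\<lambda>x. \<phi> x - ssum m c x) \<le> e / (2 * V) * sqrt (measure Lb Om)"
    by (rule power2_le_imp_le) (use e V in simp)
  also have "\<dots> \<le> e / (2 * V) * V" using e V by (intro mult_left_mono) (auto simp: V_def)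
  also have "\<dots> < e" using e V by simp
  finally show "\<exists>m c. L2_norm Lb (\<lambda>x. \<phi> x - ssum m c x) < e" by blast
qed

lemma ssum_linear: "bounded_linear T \<Longrightarrow> T (ssum n c x) = ssum n (\<lambda>i. T (c i)) x"
  by (simp add: ssum_def linear_sum[OF bounded_linear.linear] linear_scale[OF bounded_linear.linear])

lemma ssum_add: "ssum n c x + ssum n d x = ssum n (\<lambda>i. c i + d i) x"
  by (simp add: ssum_def sum.distrib scaleR_add_right)

lemma L2_norm_linear_le:
  fixes T :: "'b::euclidean_space \<Rightarrow> 'c::euclidean_space"
  assumes "bounded_linear T"
  obtains K where "K > 0" "\<And>(M :: 'a measure) w. w \<in> L2_space M \<Longrightarrow> L2_norm M (\<lambda>x. T (w x)) \<le> K * L2_norm M w"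
proof -
  obtain K where K: "K > 0" "\<And>x. norm (T x) \<le> norm x * K" using bounded_linear.pos_bounded[OF assms] by blast
  have "L2_norm M (\<lambda>x. T (w x)) \<le> K * L2_norm M w" if w: "w \<in> L2_space M" for M :: "'a measure" and w
  proof -
    have "L2_norm M (\<lambda>x. T (w x)) \<le> L2_norm M (\<lambda>x. K *\<^sub>R w x)"
      by (rule L2_norm_mono[OF L2_space_scaleR[OF w] L2_space_measurable[OF L2_space_linear[OF w assms]]])
        (use K in \<open>simp add: mult.commute\<close>)
    then show ?thesis using K(1) by simp
  qed
  with K(1) that show ?thesis by blast
qed

lemma sine_conv_linear:
  fixes u :: "plane \<Rightarrow> 'b::euclidean_space" and T :: "'b \<Rightarrow> 'c::euclidean_space"
  assumes u: "sine_conv u" and T: "bounded_linear T"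
  shows "sine_conv (\<lambda>x. T (u x))"
proof -
  have uL: "u \<in> L2_space Lb" using u by (simp add: sine_conv_def)
  obtain K where K: "K > 0" "\<And>(M :: plane measure) w. w \<in> L2_space M \<Longrightarrow> L2_norm M (\<lambda>x. T (w x)) \<le> K * L2_norm M w"
    by (rule L2_norm_linear_le[OF T]) blast
  have eq: "T (u x) - proj n (\<lambda>x. T (u x)) x = T (u x - proj n u x)" for n x
    by (simp add: proj_def ssum_linear[OF T] coef_linear[OF uL T] linear_diff[OF bounded_linear.linear[OF T]]
        linear_scale[OF bounded_linear.linear[OF T]])
  have "(\<lambda>n. L2_norm Lb (\<lambda>x. T (u x - proj n u x))) \<longlonglongrightarrow> 0"
  proof (rule Lim_null_comparison)
    show "\<forall>\<^sub>F n in sequentially. norm (L2_norm Lb (\<lambda>x. T (u x - proj n u x))) \<le> K * L2_norm Lb (\<lambda>x. u x - proj n u x)"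
      using K(2)[OF L2_space_diff[OF uL ssum_L2]] by (simp add: proj_def)
    show "(\<lambda>n. K * L2_norm Lb (\<lambda>x. u x - proj n u x)) \<longlonglongrightarrow> 0"
      using u by (intro tendsto_mult_right_zero) (simp add: sine_conv_def)
  qed
  then show ?thesis using L2_space_linear[OF uL T] by (simp add: sine_conv_def eq)
qed

lemma sine_conv_add:
  fixes u v :: "plane \<Rightarrow> 'b::euclidean_space"
  assumes u: "sine_conv u" and v: "sine_conv v"
  shows "sine_conv (\<lambda>x. u x + v x)"
proof -
  have L: "u \<in> L2_space Lb" "v \<in> L2_space Lb" using u v by (auto simp: sine_conv_def)
  have "proj n (\<lambda>x. u x + v x) x = proj n u x + proj n v x" for n x
    unfolding proj_def ssum_add by (simp add: coef_add[OF L] scaleR_add_right)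
  then have eq: "(u x + v x) - proj n (\<lambda>x. u x + v x) x = (u x - proj n u x) + (v x - proj n v x)" for n x
    by simp
  have "(\<lambda>n. L2_norm Lb (\<lambda>x. (u x - proj n u x) + (v x - proj n v x))) \<longlonglongrightarrow> 0"
  proof (rule Lim_null_comparison)
    show "\<forall>\<^sub>F n in sequentially. norm (L2_norm Lb (\<lambda>x. (u x - proj n u x) + (v x - proj n v x))) \<le>
        L2_norm Lb (\<lambda>x. u x - proj n u x) + L2_norm Lb (\<lambda>x. v x - proj n v x)"
      using L2_norm_triangle[OF L2_space_diff[OF L(1) ssum_L2] L2_space_diff[OF L(2) ssum_L2]] by (simp add: proj_def)
    show "(\<lambda>n. L2_norm Lb (\<lambda>x. u x - proj n u x) + L2_norm Lb (\<lambda>x. v x - proj n v x)) \<longlonglongrightarrow> 0"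
      using u v by (auto simp: sine_conv_def intro: tendsto_add_zero)
  qed
  then show ?thesis using L2_space_add[OF L] by (simp add: sine_conv_def eq)
qed

lemma sine_conv_limit:
  fixes u :: "plane \<Rightarrow> 'b::euclidean_space"
  assumes \<phi>: "\<And>k. sine_conv (\<phi> k)" and u: "u \<in> L2_space Lb"
    and lim: "(\<lambda>k. L2_norm Lb (\<lambda>x. \<phi> k x - u x)) \<longlonglongrightarrow> 0"
  shows "sine_conv u"
proof (rule sine_convI[OF u])
  fix e :: real assume e: "e > 0"
  have L: "\<phi> k \<in> L2_space Lb" for k using \<phi> by (simp add: sine_conv_def)
  obtain k where k: "L2_norm Lb (\<lambda>x. \<phi> k x - u x) < e / 2"
    using LIMSEQ_D[OF lim, of "e/2"] e by auto
  have "(\<lambda>n. L2_norm Lb (\<lambda>x. \<phi> k x - proj n (\<phi> k) x)) \<longlonglongrightarrow> 0" using \<phi> by (simp add: sine_conv_def)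
  from LIMSEQ_D[OF this, of "e/2"] e obtain n where "L2_norm Lb (\<lambda>x. \<phi> k x - proj n (\<phi> k) x) < e / 2" by auto
  then have "L2_norm Lb (\<lambda>x. u x - ssum n (\<lambda>i. coef (\<phi> k) i /\<^sub>R Nn) x) < e"
    using L2_norm_triangle3[OF u L[of k] ssum_L2[of n "\<lambda>i. coef (\<phi> k) i /\<^sub>R Nn"]] k L2_norm_minus_commute[of Lb u "\<phi> k"]
    unfolding proj_def by linarith
  then show "\<exists>m c. L2_norm Lb (\<lambda>x. u x - ssum m c x) < e" by blast
qed

lemma sine_conv_test_function':
  fixes \<phi> :: "plane \<Rightarrow> 'b::euclidean_space"
  assumes \<phi>: "\<phi> \<in> test_functions Om"
  shows "sine_conv \<phi>"
proof -
  have 1: "sine_conv (\<lambda>x. (\<phi> x \<bullet> b) *\<^sub>R b)" for b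
    by (rule sine_conv_linear[OF sine_conv_test_function[OF test_functions_bounded_linear[OF \<phi> bounded_linear_inner_left]]
          bounded_linear_scaleR_left])
  have "finite F \<Longrightarrow> sine_conv (\<lambda>x. \<Sum>b\<in>F. (\<phi> x \<bullet> b) *\<^sub>R b)" for F
  proof (induction F rule: finite_induct)
    case empty show ?case using 1[of 0] by simp
  next
    case (insert b F) then show ?case using sine_conv_add[OF 1[of b] insert.IH] by simp
  qed
  from this[of Basis] show ?thesis by (simp add: euclidean_representation)
qed

lemma sine_conv_H10:
  fixes u :: "plane \<Rightarrow> 'b::euclidean_space"
  assumes "u \<in> H10" shows "sine_conv u"
proof -
  obtain \<phi> where \<phi>: "\<And>k. \<phi> k \<in> test_functions Om" "(\<lambda>k. L2_norm Lb (\<lambda>x. \<phi> k x - u x)) \<longlonglongrightarrow> 0"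
    by (rule Sobolev_H10_approx[OF assms]) blast
  show ?thesis
    by (rule sine_conv_limit[OF sine_conv_test_function'[OF \<phi>(1)] Sobolev_H1_L2[OF Sobolev_H10_H1[OF assms]] \<phi>(2)])
qed

text \<open>Completeness is asked of the scalar factor, so \<open>u\<close> may be any
  square-integrable function, such as a Laplacian about whose boundary values nothing is
  known.\<close>

lemma parseval:
  fixes \<psi> :: "plane \<Rightarrow> real" and u :: "plane \<Rightarrow> 'b::euclidean_space"
  assumes \<psi>: "sine_conv \<psi>" and u: "u \<in> L2_space Lb"
  shows "(\<lambda>n. \<Sum>i\<in>Q n. (coef \<psi> i / Nn) *\<^sub>R coef u i) \<longlonglongrightarrow> (\<integral>x. \<psi> x *\<^sub>R u x \<partial>Lb)"
proof -
  have L: "\<psi> \<in> L2_space Lb" using \<psi> by (simp add: sine_conv_def)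
  have "(\<lambda>n. \<integral>x. proj n \<psi> x *\<^sub>R u x \<partial>Lb) \<longlonglongrightarrow> (\<integral>x. \<psi> x *\<^sub>R u x \<partial>Lb)"
    by (rule L2_tendsto_scaleR[OF _ L u])
      (use \<psi> in \<open>auto simp: sine_conv_def proj_def ssum_L2 L2_norm_minus_commute[of Lb _ \<psi>]\<close>)
  moreover have "(\<integral>x. proj n \<psi> x *\<^sub>R u x \<partial>Lb) = (\<Sum>i\<in>Q n. (coef \<psi> i / Nn) *\<^sub>R coef u i)" for n
  proof -
    have "(\<integral>x. proj n \<psi> x *\<^sub>R u x \<partial>Lb) = (\<integral>x. (\<Sum>i\<in>Q n. (coef \<psi> i / Nn) *\<^sub>R (sine i x *\<^sub>R u x)) \<partial>Lb)"
      by (simp add: proj_def ssum_def scaleR_sum_left divide_inverse mult_ac)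
    also have "\<dots> = (\<Sum>i\<in>Q n. (\<integral>x. (coef \<psi> i / Nn) *\<^sub>R (sine i x *\<^sub>R u x) \<partial>Lb))"
      by (intro Bochner_Integration.integral_sum integrable_scaleR_right impI coef_integrable u)
    also have "\<dots> = (\<Sum>i\<in>Q n. (coef \<psi> i / Nn) *\<^sub>R coef u i)"
      unfolding coef_def by (simp only: integral_scaleR_right)
    finally show ?thesis .
  qed
  ultimately show ?thesis by simp
qed

subsection \<open>Partial derivatives and sine coefficients\<close>

text \<open>The boundary term is absent because \<open>u\<close> is a limit of test functions;
  \<open>\<psi>\<close> may be nonzero on the boundary, as the derivatives of sines are.\<close>

lemma H10_partial_by_parts:
  fixes u :: "plane \<Rightarrow> 'b::euclidean_space" and \<psi> :: "plane \<Rightarrow> real"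
  assumes u: "u \<in> H10" and \<psi>: "C_k (Suc 0) \<psi>" and b: "b \<in> Basis"
  shows "(\<integral>x. \<psi> x *\<^sub>R wpart b u x \<partial>Lb) = - (\<integral>x. pder b \<psi> x *\<^sub>R u x \<partial>Lb)"
proof -
  obtain \<phi> where \<phi>: "\<And>k. \<phi> k \<in> test_functions Om" "\<And>k. \<phi> k \<in> H1"
    "(\<lambda>k. L2_norm Lb (\<lambda>x. \<phi> k x - u x)) \<longlonglongrightarrow> 0"
    "\<And>i. i \<in> Basis \<Longrightarrow> (\<lambda>k. L2_norm Lb (\<lambda>x. wpart i (\<phi> k) x - wpart i u x)) \<longlonglongrightarrow> 0"
    by (rule Sobolev_H10_approx[OF u]) blast
  note uH = Sobolev_H10_H1[OF u]
  have L\<psi>: "\<psi> \<in> L2_space Lb" "(\<lambda>x. pder b \<psi> x) \<in> L2_space Lb"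
    by (rule continuous_imp_L2[OF C_k_continuous[OF \<psi>]], rule continuous_imp_L2[OF C_1_continuous_partial[OF \<psi> b]])
  have 1: "(\<lambda>k. \<integral>x. \<psi> x *\<^sub>R wpart b (\<phi> k) x \<partial>Lb) \<longlonglongrightarrow> (\<integral>x. \<psi> x *\<^sub>R wpart b u x \<partial>Lb)"
    by (rule L2_tendsto_scaleR_right[OF Sobolev_H1_weak_partial(1)[OF \<phi>(2) b] Sobolev_H1_weak_partial(1)[OF uH b] L\<psi>(1) \<phi>(4)[OF b]])
  have 2: "(\<lambda>k. \<integral>x. pder b \<psi> x *\<^sub>R \<phi> k x \<partial>Lb) \<longlonglongrightarrow> (\<integral>x. pder b \<psi> x *\<^sub>R u x \<partial>Lb)"
    by (rule L2_tendsto_scaleR_right[OF Sobolev_H1_L2[OF \<phi>(2)] Sobolev_H1_L2[OF uH] L\<psi>(2) \<phi>(3)])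
  have "(\<integral>x. \<psi> x *\<^sub>R wpart b (\<phi> k) x \<partial>Lb) = - (\<integral>x. pder b \<psi> x *\<^sub>R \<phi> k x \<partial>Lb)" for k
  proof -
    note C = test_function_C_1[OF \<phi>(1)[of k]]
    have "(\<integral>x. \<psi> x *\<^sub>R wpart b (\<phi> k) x \<partial>Lb) = (\<integral>x. \<psi> x *\<^sub>R pder b (\<phi> k) x \<partial>Lb)"
    proof (rule integral_cong_AE)
      show "(\<lambda>x. \<psi> x *\<^sub>R wpart b (\<phi> k) x) \<in> borel_measurable Lb"
        by (intro borel_measurable_scaleR L2_space_measurable L\<psi> Sobolev_H1_weak_partial \<phi> b)
      show "(\<lambda>x. \<psi> x *\<^sub>R pder b (\<phi> k) x) \<in> borel_measurable Lb"
        by (intro borel_measurable_scaleR L2_space_measurable L\<psi> continuous_imp_L2 C_1_continuous_partial C b)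
      show "AE x in Lb. \<psi> x *\<^sub>R wpart b (\<phi> k) x = \<psi> x *\<^sub>R pder b (\<phi> k) x"
        using C_1_Sobolev_H1(2)[OF C b] by eventually_elim simp
    qed
    also have "\<dots> = - (\<integral>x. pder b \<psi> x *\<^sub>R \<phi> k x \<partial>Lb)"
      using integration_by_parts[OF \<psi> C b] test_function_zero[OF \<phi>(1)[of k]] by simp
    finally show ?thesis .
  qed
  then have "(\<lambda>k. \<integral>x. \<psi> x *\<^sub>R wpart b (\<phi> k) x \<partial>Lb) \<longlonglongrightarrow> - (\<integral>x. pder b \<psi> x *\<^sub>R u x \<partial>Lb)"
    using tendsto_minus[OF 2] by simp
  then show ?thesis using 1 LIMSEQ_unique by blast
qed

text \<open>The mirror case: \<open>v\<close> carries no boundary condition and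
  \<open>\<psi>\<close> does. It is applied to first derivatives of \<open>H10\<close> functions,
  tested with sines.\<close>

lemma H1_partial_by_parts:
  fixes v :: "plane \<Rightarrow> 'b::euclidean_space" and \<psi> :: "plane \<Rightarrow> real"
  assumes v: "v \<in> H1" and \<psi>: "\<psi> \<in> H10" "C_k (Suc 0) \<psi>" and b: "b \<in> Basis"
  shows "(\<integral>x. \<psi> x *\<^sub>R wpart b v x \<partial>Lb) = - (\<integral>x. pder b \<psi> x *\<^sub>R v x \<partial>Lb)"
proof -
  obtain \<phi> where \<phi>: "\<And>k. \<phi> k \<in> test_functions Om" "\<And>k. \<phi> k \<in> H1"
    "(\<lambda>k. L2_norm Lb (\<lambda>x. \<phi> k x - \<psi> x)) \<longlonglongrightarrow> 0"
    "\<And>i. i \<in> Basis \<Longrightarrow> (\<lambda>k. L2_norm Lb (\<lambda>x. wpart i (\<phi> k) x - wpart i \<psi> x)) \<longlonglongrightarrow> 0"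
    by (rule Sobolev_H10_approx[OF \<psi>(1)]) blast
  have eq: "L2_norm Lb (\<lambda>x. wpart b (\<phi> k) x - wpart b \<psi> x) =
      L2_norm Lb (\<lambda>x. pder b (\<phi> k) x - pder b \<psi> x)" for k
    by (rule C_1_weak_partial_norm[OF test_function_C_1[OF \<phi>(1)] \<psi>(2) b])
  note vL = Sobolev_H1_L2[OF v] Sobolev_H1_weak_partial[OF v b]
  have 1: "(\<lambda>k. \<integral>x. \<phi> k x *\<^sub>R wpart b v x \<partial>Lb) \<longlonglongrightarrow> (\<integral>x. \<psi> x *\<^sub>R wpart b v x \<partial>Lb)"
    by (rule L2_tendsto_scaleR[OF test_function_L2(1)[OF \<phi>(1)] continuous_imp_L2[OF C_k_continuous[OF \<psi>(2)]] vL(2) \<phi>(3)])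
  have 2: "(\<lambda>k. \<integral>x. pder b (\<phi> k) x *\<^sub>R v x \<partial>Lb) \<longlonglongrightarrow> (\<integral>x. pder b \<psi> x *\<^sub>R v x \<partial>Lb)"
    by (rule L2_tendsto_scaleR[OF test_function_L2(2)[OF \<phi>(1) b] continuous_imp_L2[OF C_1_continuous_partial[OF \<psi>(2) b]] vL(1)])
      (use \<phi>(4)[OF b] in \<open>simp only: eq\<close>)
  have "(\<integral>x. \<phi> k x *\<^sub>R wpart b v x \<partial>Lb) = - (\<integral>x. pder b (\<phi> k) x *\<^sub>R v x \<partial>Lb)" for k
    using vL(3) \<phi>(1) unfolding has_weak_partial_def by simp
  then have "(\<lambda>k. \<integral>x. \<phi> k x *\<^sub>R wpart b v x \<partial>Lb) \<longlonglongrightarrow> - (\<integral>x. pder b \<psi> x *\<^sub>R v x \<partial>Lb)"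
    using tendsto_minus[OF 2] by simp
  then show ?thesis using 1 LIMSEQ_unique by blast
qed

lemma sine_H10: "sine i \<in> H10"
  using sine_scaleR_H10[of i "1::real"] by simp

lemma partial_sine_coef:
  fixes u :: "plane \<Rightarrow> 'b::euclidean_space"
  assumes u: "u \<in> H10" and b: "b \<in> Basis"
  shows "(\<integral>x. pder b (sine i) x *\<^sub>R wpart b u x \<partial>Lb) = (dfreq b i)\<^sup>2 *\<^sub>R coef u i"
  using H10_partial_by_parts[OF u C_inf_imp_C_k[OF C_inf_partial[OF C_inf_sine b]] b, of i]
  by (simp add: sine_second_partial[OF b] coef_def scaleR_scaleR[symmetric] del: scaleR_scaleR)

lemma coef_second_partial:
  fixes u :: "plane \<Rightarrow> 'b::euclidean_space"
  assumes u: "u \<in> H10" and b: "b \<in> Basis" and v: "wpart b u \<in> H1"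
  shows "coef (wpart b (wpart b u)) i = - (dfreq b i)\<^sup>2 *\<^sub>R coef u i"
  using H1_partial_by_parts[OF v sine_H10 C_inf_imp_C_k[OF C_inf_sine] b, of i] partial_sine_coef[OF u b, of i]
  by (simp add: coef_def)

text \<open>Two integrations by parts move the Laplacian onto the sine; the boundary condition is
  supplied once by the sine and once by \<open>u\<close>.\<close>

lemma coef_laplacian:
  fixes u :: "plane \<Rightarrow> 'b::euclidean_space"
  assumes u: "u \<in> H10" "u \<in> Sobolev_H2 Om"
  shows "laplacian Om u \<in> L2_space Lb" and "coef (laplacian Om u) i = - lam i *\<^sub>R coef u i"
proof -
  have v: "wpart b u \<in> H1" if "b \<in> Basis" for b
    using u(2) that by (simp add: Sobolev_H2_def)
  have eq: "laplacian Om u = (\<lambda>x. wpart (1,0) (wpart (1,0) u) x + wpart (0,1) (wpart (0,1) u) x)"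
    by (simp add: fun_eq_iff laplacian_def Basis_real_prod)
  have b: "(1,0) \<in> (Basis :: plane set)" "(0,1) \<in> (Basis :: plane set)" by (auto simp: Basis_real_prod)
  note L = Sobolev_H1_weak_partial(1)[OF v[OF b(1)] b(1)] Sobolev_H1_weak_partial(1)[OF v[OF b(2)] b(2)]
  show "laplacian Om u \<in> L2_space Lb" unfolding eq by (rule L2_space_add[OF L])
  show "coef (laplacian Om u) i = - lam i *\<^sub>R coef u i"
    unfolding eq coef_add[OF L] coef_second_partial[OF u(1) b(1) v[OF b(1)]] coef_second_partial[OF u(1) b(2) v[OF b(2)]]
      sum_dfreq[symmetric] by (simp add: scaleR_left_distrib scaleR_diff_left)
qed

text \<open>The partial derivatives of the sines are still orthogonal, so the error is a diagonal
  quadratic form in \<open>c\<close>, weighted by squared frequencies.\<close>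

lemma partial_ssum_error:
  fixes u :: "plane \<Rightarrow> 'b::euclidean_space"
  assumes u: "u \<in> H10" and b: "b \<in> Basis"
  shows "(L2_norm Lb (\<lambda>x. wpart b u x - wpart b (ssum n c) x))\<^sup>2 =
    (L2_norm Lb (wpart b u))\<^sup>2 + (\<Sum>i\<in>Q n. (dfreq b i)\<^sup>2 * (Nn * (norm (c i))\<^sup>2 - 2 * (coef u i \<bullet> c i)))"
proof -
  note C = C_inf_imp_C_k[OF ssum_C_inf[of n c]]
  have ip: "(\<integral>x. wpart b w x \<bullet> wpart b (ssum n c) x \<partial>Lb) = (\<Sum>i\<in>Q n. (dfreq b i)\<^sup>2 * (coef w i \<bullet> c i))"
    if w: "w \<in> H10" for w :: "plane \<Rightarrow> 'b"
  proof -
    note wL = Sobolev_H1_weak_partial(1)[OF Sobolev_H10_H1[OF w] b]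
    have "(\<integral>x. wpart b w x \<bullet> wpart b (ssum n c) x \<partial>Lb) =
        (\<integral>x. wpart b w x \<bullet> (\<Sum>i\<in>Q n. pder b (sine i) x *\<^sub>R c i) \<partial>Lb)"
    proof (rule integral_cong_AE)
      show "(\<lambda>x. wpart b w x \<bullet> wpart b (ssum n c) x) \<in> borel_measurable Lb"
        by (intro borel_measurable_inner L2_space_measurable wL Sobolev_H1_weak_partial(1) C_1_Sobolev_H1(1) C b)
      show "(\<lambda>x. wpart b w x \<bullet> (\<Sum>i\<in>Q n. pder b (sine i) x *\<^sub>R c i)) \<in> borel_measurable Lb"
        by (intro borel_measurable_inner borel_measurable_sum borel_measurable_scaleR borel_measurable_const
            L2_space_measurable[OF wL] L2_space_measurable[OF partial_sine_L2[OF b]])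
      show "AE x in Lb. wpart b w x \<bullet> wpart b (ssum n c) x =
          wpart b w x \<bullet> (\<Sum>i\<in>Q n. pder b (sine i) x *\<^sub>R c i)"
        using C_1_Sobolev_H1(2)[OF C b] by eventually_elim (simp add: partial_ssum)
    qed
    also have "\<dots> = (\<Sum>i\<in>Q n. (dfreq b i)\<^sup>2 * (coef w i \<bullet> c i))"
      unfolding inner_sum_scaleR[OF wL partial_sine_L2[OF b]] partial_sine_coef[OF w b] by simp
    finally show ?thesis .
  qed
  have "(L2_norm Lb (wpart b (ssum n c)))\<^sup>2 = (\<integral>x. wpart b (ssum n c) x \<bullet> wpart b (ssum n c) x \<partial>Lb)"
    unfolding L2_norm_sq by (simp add: power2_norm_eq_inner)
  also have "\<dots> = (\<Sum>i\<in>Q n. (dfreq b i)\<^sup>2 * (Nn * (norm (c i))\<^sup>2))"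
    unfolding ip[OF ssum_H10] by (intro sum.cong refl) (simp add: coef_ssum power2_norm_eq_inner)
  finally show ?thesis
    unfolding L2_norm_diff_sq[OF Sobolev_H1_weak_partial(1)[OF Sobolev_H10_H1[OF u] b] Sobolev_H1_weak_partial(1)[OF C_1_Sobolev_H1(1)[OF C] b]]
    by (simp add: ip[OF u] right_diff_distrib sum_subtractf sum_distrib_left mult_ac)
qed

lemma partial_proj_error:
  fixes u :: "plane \<Rightarrow> 'b::euclidean_space"
  assumes u: "u \<in> H10" and b: "b \<in> Basis"
  shows "(L2_norm Lb (\<lambda>x. wpart b u x - wpart b (proj n u) x))\<^sup>2 =
    (L2_norm Lb (wpart b u))\<^sup>2 - (\<Sum>i\<in>Q n. (dfreq b i)\<^sup>2 * (norm (coef u i))\<^sup>2 / Nn)"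
proof -
  have "Nn * (norm (coef u i /\<^sub>R Nn))\<^sup>2 - 2 * (coef u i \<bullet> (coef u i /\<^sub>R Nn)) = - ((norm (coef u i))\<^sup>2 / Nn)" for i
    using Nn_pos unfolding power2_norm_eq_inner by (simp add: divide_inverse)
  then show ?thesis unfolding proj_def partial_ssum_error[OF assms] by (simp add: sum_negf)
qed

text \<open>The minimiser of the diagonal form does not depend on its weights, so the L2 projection
  is at once the best approximation of each partial derivative. This spares a separate theory of
  cosine expansions.\<close>

lemma partial_proj_best:
  fixes u :: "plane \<Rightarrow> 'b::euclidean_space"
  assumes u: "u \<in> H10" and b: "b \<in> Basis"
  shows "L2_norm Lb (\<lambda>x. wpart b u x - wpart b (proj n u) x) \<le>
    L2_norm Lb (\<lambda>x. wpart b u x - wpart b (ssum n c) x)"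
proof (rule power2_le_imp_le)
  have "(\<Sum>i\<in>Q n. (dfreq b i)\<^sup>2 * - ((norm (coef u i))\<^sup>2 / Nn)) \<le>
      (\<Sum>i\<in>Q n. (dfreq b i)\<^sup>2 * (Nn * (norm (c i))\<^sup>2 - 2 * (coef u i \<bullet> c i)))"
    by (intro sum_mono mult_left_mono complete_square_bound Nn_pos) auto
  then show "(L2_norm Lb (\<lambda>x. wpart b u x - wpart b (proj n u) x))\<^sup>2 \<le>
      (L2_norm Lb (\<lambda>x. wpart b u x - wpart b (ssum n c) x))\<^sup>2"
    unfolding partial_proj_error[OF assms] partial_ssum_error[OF assms] by (simp add: sum_negf)
qed simp

lemma coef_H1_bound:
  fixes u :: "plane \<Rightarrow> 'b::euclidean_space"
  assumes u: "u \<in> H10"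
  shows "(\<Sum>i\<in>Q n. lam i * (norm (coef u i))\<^sup>2 / Nn) \<le> (H1_norm Om u)\<^sup>2"
proof -
  have *: "(\<Sum>i\<in>Q n. (dfreq b i)\<^sup>2 * (norm (coef u i))\<^sup>2 / Nn) \<le> (L2_norm Lb (wpart b u))\<^sup>2" if "b \<in> Basis" for b
    using partial_proj_error[OF u that, of n]
      zero_le_power2[of "L2_norm Lb (\<lambda>x. wpart b u x - wpart b (proj n u) x)"] by linarith
  have "(\<Sum>i\<in>Q n. lam i * (norm (coef u i))\<^sup>2 / Nn) =
      (\<Sum>i\<in>Q n. (dfreq (1,0) i)\<^sup>2 * (norm (coef u i))\<^sup>2 / Nn) + (\<Sum>i\<in>Q n. (dfreq (0,1) i)\<^sup>2 * (norm (coef u i))\<^sup>2 / Nn)"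
    by (simp add: sum_dfreq[symmetric] sum.distrib[symmetric] add_divide_distrib distrib_right)
  moreover have "(1,0) \<in> (Basis :: plane set)" "(0,1) \<in> (Basis :: plane set)"
    by (auto simp: Basis_real_prod)
  ultimately show ?thesis using *[of "(1,0)"] *[of "(0,1)"] zero_le_power2[of "L2_norm Lb u"] unfolding H1_norm_sq
    by linarith
qed

text \<open>After one more integration by parts the squared error is the pairing of the projection
  error of \<open>\<phi>\<close> with its second derivative, which tends to 0 by completeness of the
  sines alone.\<close>

lemma partial_proj_test_function:
  fixes \<phi> :: "plane \<Rightarrow> 'b::euclidean_space"
  assumes \<phi>: "\<phi> \<in> test_functions Om" and b: "b \<in> Basis"
  shows "(\<lambda>n. L2_norm Lb (\<lambda>x. wpart b \<phi> x - wpart b (proj n \<phi>) x)) \<longlonglongrightarrow> 0"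
proof -
  have CI: "C_inf \<phi>" using \<phi> by (simp add: test_functions_def)
  note C = C_inf_imp_C_k[OF CI, of "Suc 0"] and CP = C_inf_imp_C_k[OF C_inf_partial[OF CI b], of "Suc 0"]
  let ?d = "\<lambda>x. pder b \<phi> x"
  let ?dd = "\<lambda>x. pder b ?d x"
  have Ld: "\<phi> \<in> L2_space Lb" "?d \<in> L2_space Lb" "?dd \<in> L2_space Lb"
    by (rule continuous_imp_L2[OF C_k_continuous[OF C]], rule continuous_imp_L2[OF C_1_continuous_partial[OF C b]],
        rule continuous_imp_L2[OF C_1_continuous_partial[OF CP b]])
  have \<phi>H: "\<phi> \<in> H10"
    unfolding Sobolev_H10_def using \<phi> C_1_Sobolev_H1(1)[OF C]
    by (auto intro!: exI[of _ "\<lambda>k. \<phi>"] simp: H1_norm_def Basis_real_prod)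
      (use weak_partial_props(4)[of "\<lambda>x. 0" _ "\<lambda>x. 0 :: 'b"] in \<open>simp add: has_weak_partial_def\<close>)
  have sumint: "(\<integral>x. (\<Sum>c\<in>Basis. f c x \<bullet> c) \<partial>Lb) = (\<Sum>c\<in>Basis. (\<integral>x. f c x \<partial>Lb) \<bullet> c)"
    if "\<And>c. integrable Lb (f c)" for f :: "'b \<Rightarrow> plane \<Rightarrow> 'b"
  proof -
    have "(\<integral>x. (\<Sum>c\<in>Basis. f c x \<bullet> c) \<partial>Lb) = (\<Sum>c\<in>Basis. (\<integral>x. f c x \<bullet> c \<partial>Lb))"
      by (intro Bochner_Integration.integral_sum integrable_inner_left impI that)
    also have "\<dots> = (\<Sum>c\<in>Basis. (\<integral>x. f c x \<partial>Lb) \<bullet> c)"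
      by (intro sum.cong refl integral_inner_left impI that)
    finally show ?thesis .
  qed
  \<comment> \<open>The inner product is split into components because
    \<open>integration_by_parts\<close> pairs a scalar function with a vector-valued one.\<close>
  have n1: "(L2_norm Lb (wpart b \<phi>))\<^sup>2 = - (\<integral>x. \<phi> x \<bullet> ?dd x \<partial>Lb)"
  proof -
    have "L2_norm Lb (wpart b \<phi>) = L2_norm Lb ?d"
      by (rule weak_partial_props(4)[OF Ld(2) C_1_has_weak_partial[OF C b]])
    then have "(L2_norm Lb (wpart b \<phi>))\<^sup>2 = (\<integral>x. ?d x \<bullet> ?d x \<partial>Lb)"
      by (simp add: L2_norm_sq power2_norm_eq_inner)
    also have "\<dots> = (\<integral>x. (\<Sum>c\<in>Basis. ((?d x \<bullet> c) *\<^sub>R ?d x) \<bullet> c) \<partial>Lb)"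
      by (subst euclidean_inner) simp
    also have "\<dots> = (\<Sum>c\<in>Basis. (\<integral>x. (?d x \<bullet> c) *\<^sub>R ?d x \<partial>Lb) \<bullet> c)"
      by (rule sumint) (intro L2_integrable_scaleR L2_space_linear[OF Ld(2) bounded_linear_inner_left] Ld)
    also have "\<dots> = (\<Sum>c\<in>Basis. (- (\<integral>x. (\<phi> x \<bullet> c) *\<^sub>R ?dd x \<partial>Lb)) \<bullet> c)"
    proof (intro sum.cong refl arg_cong2[where f = inner])
      fix c :: 'b
      have hd: "((\<lambda>x. \<phi> x \<bullet> c) has_derivative (\<lambda>h. pder h \<phi> x \<bullet> c)) (at x)" for x
        by (intro has_derivative_inner_left frechet_derivative_worksI C_1_differentiable C)
      have "(\<integral>x. pder b (\<lambda>x. \<phi> x \<bullet> c) x *\<^sub>R ?d x \<partial>Lb) = - (\<integral>x. (\<phi> x \<bullet> c) *\<^sub>R ?dd x \<partial>Lb)"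
        by (rule integration_by_parts[OF C_k_bounded_linear[OF bounded_linear_inner_left C] CP b])
          (simp add: test_function_zero[OF \<phi>])
      then show "(\<integral>x. (?d x \<bullet> c) *\<^sub>R ?d x \<partial>Lb) = - (\<integral>x. (\<phi> x \<bullet> c) *\<^sub>R ?dd x \<partial>Lb)"
        by (simp add: frechet_derivative_eqI[OF hd])
    qed
    also have "\<dots> = - (\<integral>x. (\<Sum>c\<in>Basis. ((\<phi> x \<bullet> c) *\<^sub>R ?dd x) \<bullet> c) \<partial>Lb)"
      by (subst sumint) (auto intro!: L2_integrable_scaleR L2_space_linear[OF Ld(1) bounded_linear_inner_left] Ld simp: sum_negf)
    also have "(\<integral>x. (\<Sum>c\<in>Basis. ((\<phi> x \<bullet> c) *\<^sub>R ?dd x) \<bullet> c) \<partial>Lb) = (\<integral>x. \<phi> x \<bullet> ?dd x \<partial>Lb)"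
      by (subst (2) euclidean_inner) simp
    finally show ?thesis .
  qed
  have cdd: "coef ?dd i = - (dfreq b i)\<^sup>2 *\<^sub>R coef \<phi> i" for i
  proof -
    have wd: "wpart b \<phi> \<in> L2_space Lb" "AE x in Lb. wpart b \<phi> x = ?d x"
      using weak_partial_props[OF Ld(2) C_1_has_weak_partial[OF C b]] by auto
    have "coef ?dd i = - (\<integral>x. pder b (sine i) x *\<^sub>R ?d x \<partial>Lb)"
      unfolding coef_def
      using H1_partial_by_parts[OF C_1_Sobolev_H1(1)[OF CP] sine_H10 C_inf_imp_C_k[OF C_inf_sine] b, of i]
        coef_cong_AE[OF Ld(3) _ AE_symmetric[OF C_1_Sobolev_H1(2)[OF CP b]], of i]
        Sobolev_H1_weak_partial(1)[OF C_1_Sobolev_H1(1)[OF CP] b]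
      by (simp add: coef_def)
    also have "(\<integral>x. pder b (sine i) x *\<^sub>R ?d x \<partial>Lb) =
        (\<integral>x. pder b (sine i) x *\<^sub>R wpart b \<phi> x \<partial>Lb)"
    proof (rule integral_cong_AE)
      show "(\<lambda>x. pder b (sine i) x *\<^sub>R ?d x) \<in> borel_measurable Lb"
        "(\<lambda>x. pder b (sine i) x *\<^sub>R wpart b \<phi> x) \<in> borel_measurable Lb"
        by (intro borel_measurable_scaleR L2_space_measurable partial_sine_L2 b Ld wd)+
    qed (use wd(2) in auto)
    also have "\<dots> = (dfreq b i)\<^sup>2 *\<^sub>R coef \<phi> i" by (rule partial_sine_coef[OF \<phi>H b])
    finally show ?thesis by simp
  qed
  have "(\<Sum>i\<in>Q n. (dfreq b i)\<^sup>2 * (norm (coef \<phi> i))\<^sup>2 / Nn) = - (\<integral>x. proj n \<phi> x \<bullet> ?dd x \<partial>Lb)" for n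
  proof -
    have "(\<integral>x. proj n \<phi> x \<bullet> ?dd x \<partial>Lb) = (\<Sum>i\<in>Q n. coef ?dd i \<bullet> (coef \<phi> i /\<^sub>R Nn))"
      unfolding proj_def inner_commute[of _ "frechet_derivative _ _ _"] by (rule inner_ssum[OF Ld(3)])
    then show ?thesis
      by (simp add: cdd sum_negf[symmetric] power2_norm_eq_inner divide_inverse mult_ac)
  qed
  then have eq: "(L2_norm Lb (\<lambda>x. wpart b \<phi> x - wpart b (proj n \<phi>) x))\<^sup>2 =
      (\<integral>x. proj n \<phi> x \<bullet> ?dd x \<partial>Lb) - (\<integral>x. \<phi> x \<bullet> ?dd x \<partial>Lb)" for n
    unfolding partial_proj_error[OF \<phi>H b] n1 by simp
  have sc: "sine_conv \<phi>" by (rule sine_conv_test_function'[OF \<phi>])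
  have "(\<lambda>n. \<integral>x. proj n \<phi> x \<bullet> ?dd x \<partial>Lb) \<longlonglongrightarrow> (\<integral>x. \<phi> x \<bullet> ?dd x \<partial>Lb)"
    by (rule L2_tendsto_inner[OF _ Ld(1,3)])
      (use sc in \<open>auto simp: sine_conv_def proj_def ssum_L2 L2_norm_minus_commute[of Lb _ \<phi>]\<close>)
  then have "(\<lambda>n. (L2_norm Lb (\<lambda>x. wpart b \<phi> x - wpart b (proj n \<phi>) x))\<^sup>2) \<longlonglongrightarrow> 0"
    unfolding eq using LIM_zero by blast
  from tendsto_real_sqrt[OF this] show ?thesis by simp
qed

text \<open>Best approximation allows comparison with the projections of a nearby test function, for
  which convergence is already known.\<close>

lemma proj_H1_tendsto:
  fixes u :: "plane \<Rightarrow> 'b::euclidean_space"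
  assumes u: "u \<in> H10"
  shows "(\<lambda>n. H1_norm Om (\<lambda>x. proj n u x - u x)) \<longlonglongrightarrow> 0"
proof (rule H1_tendstoI)
  note uH = Sobolev_H10_H1[OF u]
  show "proj n u \<in> H1" for n unfolding proj_def by (rule Sobolev_H10_H1[OF ssum_H10])
  note PH = this
  show "u \<in> H1" by fact
  show "(\<lambda>n. L2_norm Lb (\<lambda>x. proj n u x - u x)) \<longlonglongrightarrow> 0"
    using sine_conv_H10[OF u] by (simp add: sine_conv_def L2_norm_minus_commute[of Lb _ u])
  fix b :: "plane" assume b: "b \<in> Basis"
  show "(\<lambda>n. L2_norm Lb (\<lambda>x. wpart b (proj n u) x - wpart b u x)) \<longlonglongrightarrow> 0"
  proof (rule LIMSEQ_I)
    fix e :: real assume e: "e > 0"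
    obtain \<phi> where \<phi>: "\<And>k. \<phi> k \<in> test_functions Om" "\<And>k. \<phi> k \<in> H1"
      "(\<lambda>k. L2_norm Lb (\<lambda>x. \<phi> k x - u x)) \<longlonglongrightarrow> 0"
      "\<And>i. i \<in> Basis \<Longrightarrow> (\<lambda>k. L2_norm Lb (\<lambda>x. wpart i (\<phi> k) x - wpart i u x)) \<longlonglongrightarrow> 0"
      by (rule Sobolev_H10_approx[OF u]) blast
    obtain k where k: "L2_norm Lb (\<lambda>x. wpart b (\<phi> k) x - wpart b u x) < e / 2"
      using LIMSEQ_D[OF \<phi>(4)[OF b], of "e/2"] e by auto
    obtain N where N: "\<And>n. n \<ge> N \<Longrightarrow> L2_norm Lb (\<lambda>x. wpart b (\<phi> k) x - wpart b (proj n (\<phi> k)) x) < e / 2"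
      using LIMSEQ_D[OF partial_proj_test_function[OF \<phi>(1)[of k] b], of "e/2"] e by auto
    have "L2_norm Lb (\<lambda>x. wpart b (proj n u) x - wpart b u x) < e" if "n \<ge> N" for n
    proof -
      have "L2_norm Lb (\<lambda>x. wpart b (proj n u) x - wpart b u x) =
          L2_norm Lb (\<lambda>x. wpart b u x - wpart b (proj n u) x)" by (rule L2_norm_minus_commute)
      also have "\<dots> \<le> L2_norm Lb (\<lambda>x. wpart b u x - wpart b (proj n (\<phi> k)) x)"
        unfolding proj_def[of n "\<phi> k"] by (rule partial_proj_best[OF u b])
      also have "\<dots> \<le> L2_norm Lb (\<lambda>x. wpart b u x - wpart b (\<phi> k) x)
          + L2_norm Lb (\<lambda>x. wpart b (\<phi> k) x - wpart b (proj n (\<phi> k)) x)"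
        unfolding proj_def
        by (intro L2_norm_triangle3 Sobolev_H1_weak_partial(1) uH \<phi> b Sobolev_H10_H1[OF ssum_H10])
      also have "L2_norm Lb (\<lambda>x. wpart b u x - wpart b (\<phi> k) x) =
          L2_norm Lb (\<lambda>x. wpart b (\<phi> k) x - wpart b u x)" by (rule L2_norm_minus_commute)
      finally show ?thesis using k N[OF that] by simp
    qed
    then show "\<exists>no. \<forall>n\<ge>no. norm (L2_norm Lb (\<lambda>x. wpart b (proj n u) x - wpart b u x) - 0) < e" by auto
  qed
qed

end

section \<open>Complex vectors and the matrix exponential\<close>

lemma cdot_add_left: "cdot (u + v) w = cdot u w + cdot v w"
  by (simp add: cdot_def sum.distrib distrib_right)

lemma cdot_add_right: "cdot u (v + w) = cdot u v + cdot u w"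
  by (simp add: cdot_def sum.distrib distrib_left)

lemma cdot_smult_left: "cdot (c *s u) v = c * cdot u v"
  by (simp add: cdot_def sum_distrib_left mult_ac)

lemma cdot_smult_right: "cdot u (c *s v) = cnj c * cdot u v"
  by (simp add: cdot_def sum_distrib_left mult_ac)

lemma Re_cdot: "Re (cdot u v) = u \<bullet> v"
  by (simp add: cdot_def inner_vec_def inner_complex_def)

lemma scaleR_eq_smult: "r *\<^sub>R v = complex_of_real r *s (v :: complex^'n)"
  by (simp only: vec_eq_iff vector_scaleR_component vector_smult_component) (simp add: scaleR_conv_of_real)

lemma norm_smult: "norm (c *s (v :: complex^'n)) = cmod c * norm v"
  by (simp add: norm_vec_def L2_set_def norm_mult power_mult_distrib sum_distrib_left[symmetric] real_sqrt_mult)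

lemma cdot_zero [simp]: "cdot 0 v = 0" "cdot u 0 = 0"
  by (simp_all add: cdot_def)

text \<open>Rotating \<open>u\<close> by a unit complex factor makes the pairing real and
  nonnegative; the real Cauchy--Schwarz inequality then applies.\<close>

lemma norm_cdot_le: "cmod (cdot u v) \<le> norm u * norm v"
proof (cases "cdot u v = 0")
  case False
  define c where "c = cnj (cdot u v) / cmod (cdot u v)"
  have c: "cmod c = 1" using False by (simp add: c_def norm_divide)
  have "c * cdot u v = cmod (cdot u v)"
    using False by (simp add: c_def complex_norm_square[symmetric] mult.commute power2_eq_square)
  then have "cmod (cdot u v) = Re (cdot (c *s u) v)" by (simp add: cdot_smult_left)
  also have "\<dots> \<le> norm (c *s u) * norm v" unfolding Re_cdot by (rule norm_cauchy_schwarz)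
  finally show ?thesis by (simp add: norm_smult c)
qed simp

lemma bounded_bilinear_cdot: "bounded_bilinear (cdot :: complex^'n \<Rightarrow> _)"
proof
  show "\<exists>K. \<forall>a b :: complex^'n. norm (cdot a b) \<le> norm a * norm b * K"
    using norm_cdot_le by (intro exI[of _ 1]) auto
qed (simp_all add: cdot_add_left cdot_add_right scaleR_eq_smult cdot_smult_left cdot_smult_right, simp_all add: scaleR_conv_of_real)

lemma bounded_bilinear_smult: "bounded_bilinear (\<lambda>c (v :: complex^'n). c *s v)"
proof
  show "\<exists>K. \<forall>a (b :: complex^'n). norm (a *s b) \<le> norm a * norm b * K"
    by (intro exI[of _ 1]) (simp add: norm_smult)
qed (simp_all only: scaleR_eq_smult vec_eq_iff vector_smult_component vector_add_component scaleR_conv_of_real,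
    simp_all add: algebra_simps)

lemmas bounded_linear_cdot_right = bounded_bilinear.bounded_linear_right[OF bounded_bilinear_cdot]
lemmas bounded_linear_cdot_left = bounded_bilinear.bounded_linear_left[OF bounded_bilinear_cdot]

lemma cdot_diff_left: "cdot (u - v) w = cdot u w - cdot v w"
  by (rule bounded_bilinear.diff_left[OF bounded_bilinear_cdot])

lemma cdot_scaleR_left: "cdot (r *\<^sub>R u) v = r *\<^sub>R cdot u v"
  by (rule bounded_bilinear.scaleR_left[OF bounded_bilinear_cdot])

lemma cdot_scaleR_right: "cdot u (r *\<^sub>R v) = r *\<^sub>R cdot u v"
  by (rule bounded_bilinear.scaleR_right[OF bounded_bilinear_cdot])

lemma cdot_adjoint: "cdot (N *v x) y = cdot x (conj_transpose N *v y)"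
proof -
  have "cdot (N *v x) y = (\<Sum>i\<in>UNIV. \<Sum>j\<in>UNIV. N $ i $ j * x $ j * cnj (y $ i))"
    by (simp add: cdot_def matrix_vector_mult_def sum_distrib_right)
  also have "\<dots> = (\<Sum>j\<in>UNIV. \<Sum>i\<in>UNIV. N $ i $ j * x $ j * cnj (y $ i))" by (rule sum.swap)
  also have "\<dots> = cdot x (conj_transpose N *v y)"
    by (simp add: cdot_def matrix_vector_mult_def conj_transpose_def sum_distrib_left mult_ac)
  finally show ?thesis .
qed

lemma conj_transpose_conj_transpose [simp]: "conj_transpose (conj_transpose N) = N"
  by (simp add: conj_transpose_def vec_eq_iff)

lemma cdot_adjoint': "cdot (conj_transpose N *v x) y = cdot x (N *v y)"
  by (simp add: cdot_adjoint)

lemma mat_mult_vec: "mat c *v v = c *s (v :: 'a::comm_semiring_1^'n)"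
proof -
  have "(mat c *v v) $ i = (\<Sum>j\<in>UNIV. if j = i then c * v $ i else 0)" for i
    unfolding matrix_vector_mult_def mat_def vec_lambda_beta by (intro sum.cong) auto
  then show ?thesis by (simp add: vec_eq_iff)
qed

lemma mv_smult: "N *v (c *s v) = c *s (N *v (v :: complex^'n))"
  by (simp add: matrix_vector_mult_def vec_eq_iff sum_distrib_left mult_ac)

lemmas mv_simps = matrix_vector_mult_add_rdistrib matrix_vector_mult_diff_rdistrib mat_mult_vec
  matrix_vector_mul_assoc[symmetric] matrix_vector_right_distrib matrix_vector_mult_diff_distrib mv_smult

text \<open>Cayley--Hamilton in the factored form used by Newton interpolation.\<close>

lemma characteristic_roots_2:
  fixes M :: "complex^2^2"
  obtains \<theta>1 \<theta>2 where "\<And>v. M *v (M *v v - \<theta>1 *s v) = \<theta>2 *s (M *v v - \<theta>1 *s v)"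
proof -
  define t d where "t = M $ 1 $ 1 + M $ 2 $ 2" and "d = M $ 1 $ 1 * M $ 2 $ 2 - M $ 1 $ 2 * M $ 2 $ 1"
  define r where "r = csqrt (t\<^sup>2 - 4 * d)"
  have r: "r\<^sup>2 = t\<^sup>2 - 4 * d" by (simp add: r_def)
  \<comment> \<open>The roots of the characteristic polynomial with trace \<open>t\<close> and
    determinant \<open>d\<close>. Only their sum and product enter below, so a vanishing
    discriminant is harmless.\<close>
  define \<theta>1 \<theta>2 where "\<theta>1 = (t + r) / 2" and "\<theta>2 = (t - r) / 2"
  have s: "\<theta>2 = t - \<theta>1" by (simp add: \<theta>1_def \<theta>2_def field_simps)
  have "\<theta>1 * \<theta>2 = (t\<^sup>2 - r\<^sup>2) / 4" by (simp add: \<theta>1_def \<theta>2_def field_simps power2_eq_square)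
  then have p: "\<theta>1 * (t - \<theta>1) = d" by (simp add: r s)
  have "M *v (M *v v - \<theta>1 *s v) = \<theta>2 *s (M *v v - \<theta>1 *s v)" for v
  proof -
    have "(M *v (M *v v - \<theta>1 *s v)) $ i - (\<theta>2 *s (M *v v - \<theta>1 *s v)) $ i = (\<theta>1 * (t - \<theta>1) - d) * v $ i" if "i = 1 \<or> i = 2" for i
      using that by (auto simp: matrix_vector_mult_def sum_2 s t_def d_def algebra_simps)
    then show ?thesis by (simp add: vec_eq_iff forall_2 p)
  qed
  then show ?thesis by (rule that)
qed

text \<open>The divided difference of \<open>x \<mapsto> exp (x * s)\<close> at the nodes
  \<open>a\<close> and \<open>b\<close>, with its confluent value when they coincide.\<close>

definition dexp :: "complex \<Rightarrow> complex \<Rightarrow> complex \<Rightarrow> complex" where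
  "dexp a b s = (if a = b then s * exp (a * s) else (exp (b * s) - exp (a * s)) / (b - a))"

text \<open>Both branches satisfy one and the same linear equation, so the flow can be
  differentiated without distinguishing equal from distinct roots.\<close>

lemma dexp_has_derivative: "(dexp a b has_field_derivative b * dexp a b s + exp (a * s)) (at s)"
proof (cases "a = b")
  case True
  have "((\<lambda>s. s * exp (a * s)) has_field_derivative a * (s * exp (a * s)) + exp (a * s)) (at s)"
    by (auto intro!: derivative_eq_intros)
  then show ?thesis using True by (simp add: dexp_def[abs_def])
next
  case False
  have "((\<lambda>s. (exp (b * s) - exp (a * s)) / (b - a)) has_field_derivative (exp (b * s) * b - exp (a * s) * a) / (b - a)) (at s)"
    using False by (auto intro!: derivative_eq_intros)
  moreover have "(exp (b * s) * b - exp (a * s) * a) / (b - a) = b * ((exp (b * s) - exp (a * s)) / (b - a)) + exp (a * s)"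
    using False by (simp add: field_simps)
  ultimately show ?thesis using False by (simp add: dexp_def[abs_def])
qed

text \<open>This is the coefficient of \<open>Nm\<close> in the product of the matrix exponentials
  at \<open>s\<close> and \<open>- s\<close>, which must be the identity.\<close>

lemma dexp_inverse: "exp (a * s) * dexp a b (- s) + dexp a b s * exp (- (a * s)) + dexp a b s * dexp a b (- s) * (b - a) = 0"
proof (cases "a = b")
  case True then show ?thesis by (simp add: dexp_def exp_minus)
next
  case False
  define x y where "x = exp (a * s)" and "y = exp (b * s)"
  have nz: "x \<noteq> 0" "y \<noteq> 0" "b - a \<noteq> 0" using False by (simp_all add: x_def y_def)
  have "x * ((1/y - 1/x) / (b - a)) + (y - x) / (b - a) * (1/x) + (y - x) / (b - a) * ((1/y - 1/x) / (b - a)) * (b - a)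
      = (x * (1/y - 1/x) + (y - x) * (1/x) + (y - x) * (1/y - 1/x)) / (b - a)"
    using nz(3) by (simp add: add_divide_distrib)
  also have "x * (1/y - 1/x) + (y - x) * (1/x) + (y - x) * (1/y - 1/x) = 0"
    using nz by (simp add: field_simps)
  finally show ?thesis using False by (simp add: dexp_def exp_minus x_def y_def divide_inverse)
qed

text \<open>The assumed identity says that the adjoint matrix minus \<open>\<theta>1\<close> maps
  into the eigenspace of \<open>\<theta>2\<close>. It avoids a Jordan form and covers equal
  roots.\<close>

locale heat_system = rectangle X1 X2 for X1 X2 +
  fixes A :: "complex^2^2" and B :: "complex^'m^2" and \<theta>1 \<theta>2 :: complex
  assumes char: "\<And>v. conj_transpose A *v (conj_transpose A *v v - \<theta>1 *s v) = \<theta>2 *s (conj_transpose A *v v - \<theta>1 *s v)"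
begin

abbreviation "Ms \<equiv> conj_transpose A"
abbreviation "Nm v \<equiv> Ms *v v - \<theta>1 *s v"

text \<open>The exponential of \<open>s Ms\<close>, by Newton interpolation at the roots \<open>\<theta>1\<close>, \<open>\<theta>2\<close>.\<close>

definition Em :: "real \<Rightarrow> complex^2^2" where
  "Em s = mat (exp (\<theta>1 * of_real s)) + mat (dexp \<theta>1 \<theta>2 (of_real s)) ** (Ms - mat \<theta>1)"

abbreviation "flow i s v \<equiv> exp (- (lam i * s)) *\<^sub>R (Em s *v v)"
text \<open>\<open>conj_transpose (Em s)\<close> is the exponential of \<open>s\<close> times
  \<open>A\<close>: \<open>dflow\<close> propagates the controlled state, \<open>flow\<close> the
  adjoint one.\<close>

abbreviation "dflow i s v \<equiv> exp (- (lam i * s)) *\<^sub>R (conj_transpose (Em s) *v v)"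

lemma Em_apply: "Em s *v v = exp (\<theta>1 * of_real s) *s v + dexp \<theta>1 \<theta>2 (of_real s) *s Nm v"
  by (simp add: Em_def mv_simps)

lemma Em_0: "Em 0 *v v = v"
  by (simp add: Em_apply dexp_def)

lemma Nm_Nm: "Nm (Nm v) = (\<theta>2 - \<theta>1) *s Nm v"
  unfolding char by (simp add: vec_eq_iff algebra_simps)

lemma Nm_lin: "Nm (x + y) = Nm x + Nm y" "Nm (c *s x) = c *s Nm x" "Nm (r *\<^sub>R x) = r *\<^sub>R Nm x"
  unfolding scaleR_eq_smult by (simp_all add: mv_simps vec_eq_iff algebra_simps)

text \<open>Since \<open>Nm\<close> composed with itself is \<open>\<theta>2 - \<theta>1\<close>
  times \<open>Nm\<close>, the product stays in the span of the identity and \<open>Nm\<close>,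
  leaving two scalar identities.\<close>

lemma Em_inverse: "Em s *v (Em (- s) *v v) = v"
proof -
  define a b where "a = exp (\<theta>1 * complex_of_real s)" and "b = dexp \<theta>1 \<theta>2 (complex_of_real s)"
  define a' b' where "a' = exp (- (\<theta>1 * complex_of_real s))" and "b' = dexp \<theta>1 \<theta>2 (- complex_of_real s)"
  have 1: "a * a' = 1" by (simp add: a_def a'_def exp_minus)
  have 2: "a * b' + b * a' + b * b' * (\<theta>2 - \<theta>1) = 0"
    unfolding a_def b_def a'_def b'_def by (rule dexp_inverse)
  have "Em s *v (Em (- s) *v v) = a *s (a' *s v + b' *s Nm v) + b *s Nm (a' *s v + b' *s Nm v)"
    by (simp add: Em_apply a_def b_def a'_def b'_def)
  also have "\<dots> = (a * a') *s v + (a * b' + b * a' + b * b' * (\<theta>2 - \<theta>1)) *s Nm v"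
    unfolding Nm_lin Nm_Nm by (simp add: vec_eq_iff algebra_simps)
  finally show ?thesis by (simp add: 1 2)
qed

lemma exp_of_real_vderiv:
  "((\<lambda>s. exp (a * complex_of_real s)) has_vector_derivative a * exp (a * of_real s)) (at s)"
  "((\<lambda>s. dexp a b (complex_of_real s)) has_vector_derivative b * dexp a b (of_real s) + exp (a * of_real s)) (at s)"
  by (rule has_vector_derivative_real_field, auto intro!: derivative_eq_intros)
     (rule has_vector_derivative_real_field, rule dexp_has_derivative)

lemma continuous_exp_dexp: "continuous_on UNIV (\<lambda>s. exp (a * complex_of_real s))"
  "continuous_on UNIV (\<lambda>s. dexp a b (complex_of_real s))"
  by (intro continuous_intros)
     (intro continuous_at_imp_continuous_on ballI has_vector_derivative_continuous[OF exp_of_real_vderiv(2)])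

lemma Em_adjoint_apply: "conj_transpose (Em s) *v x = cnj (exp (\<theta>1 * of_real s)) *s x
      + cnj (dexp \<theta>1 \<theta>2 (of_real s)) *s (conj_transpose (Ms - mat \<theta>1) *v x)"
proof -
  have "cdot (conj_transpose (Em s) *v x) y = cdot (cnj (exp (\<theta>1 * of_real s)) *s x
      + cnj (dexp \<theta>1 \<theta>2 (of_real s)) *s (conj_transpose (Ms - mat \<theta>1) *v x)) y" for y
    unfolding cdot_adjoint' cdot_add_left cdot_smult_left Em_apply cdot_add_right cdot_smult_right
    by (simp add: mv_simps)
  then have "cdot (conj_transpose (Em s) *v x - (cnj (exp (\<theta>1 * of_real s)) *s x
      + cnj (dexp \<theta>1 \<theta>2 (of_real s)) *s (conj_transpose (Ms - mat \<theta>1) *v x))) y = 0" for y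
    by (simp add: cdot_diff_left)
  then show ?thesis by (metis Re_cdot inner_eq_zero_iff right_minus_eq zero_complex.sel(1))
qed

lemma Em_continuous: "continuous_on UNIV (\<lambda>s. conj_transpose (Em s) *v x)"
  unfolding Em_adjoint_apply
  by (auto intro!: continuous_intros continuous_exp_dexp bounded_bilinear.continuous_on[OF bounded_bilinear_smult])

lemma Em_adjoint_bound:
  obtains K where "K > 0" "\<And>s x. s \<in> {0..T} \<Longrightarrow> norm (conj_transpose (Em s) *v x) \<le> K * norm x"
    "\<And>s x. s \<in> {0..T} \<Longrightarrow> norm (Em s *v x) \<le> K * norm x"
proof -
  obtain J where J: "J > 0" "\<And>x. norm ((Ms - mat \<theta>1) *v x) \<le> norm x * J"
    using bounded_linear.pos_bounded[OF matrix_vector_mul_bounded_linear] by blast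
  have "compact ((\<lambda>s. exp (\<theta>1 * complex_of_real s)) ` {0..T})" "compact ((\<lambda>s. dexp \<theta>1 \<theta>2 (complex_of_real s)) ` {0..T})"
    by (intro compact_continuous_image continuous_on_subset[OF continuous_exp_dexp(1)] continuous_on_subset[OF continuous_exp_dexp(2)]; simp)+
  then have "bounded ((\<lambda>s. exp (\<theta>1 * complex_of_real s)) ` {0..T})" "bounded ((\<lambda>s. dexp \<theta>1 \<theta>2 (complex_of_real s)) ` {0..T})"
    by (auto intro: compact_imp_bounded)
  then obtain a b where ab: "\<And>s. s \<in> {0..T} \<Longrightarrow> cmod (exp (\<theta>1 * of_real s)) \<le> a"
    "\<And>s. s \<in> {0..T} \<Longrightarrow> cmod (dexp \<theta>1 \<theta>2 (of_real s)) \<le> b"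
    unfolding bounded_iff ball_simps by blast
  define K where "K = \<bar>a\<bar> + \<bar>b\<bar> * J + 1"
  have K: "K > 0" using J by (simp add: K_def add_nonneg_pos)
  have 1: "norm (Em s *v x) \<le> K * norm x" if s: "s \<in> {0..T}" for s x
  proof -
    have "norm (Em s *v x) \<le> cmod (exp (\<theta>1 * of_real s)) * norm x + cmod (dexp \<theta>1 \<theta>2 (of_real s)) * norm ((Ms - mat \<theta>1) *v x)"
    proof -
      have Nx: "(Ms - mat \<theta>1) *v x = Nm x" by (simp add: mv_simps)
      show ?thesis unfolding Em_apply Nx norm_smult[symmetric] by (rule norm_triangle_ineq)
    qed
    also have "\<dots> \<le> \<bar>a\<bar> * norm x + \<bar>b\<bar> * (norm x * J)"
      using ab[OF s] by (intro add_mono mult_mono J mult_nonneg_nonneg) (use J in auto)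
    also have "\<dots> \<le> K * norm x" by (simp add: K_def algebra_simps)
    finally show ?thesis .
  qed
  \<comment> \<open>The adjoint inherits the bound: the square of the norm of \<open>?y\<close> is
    the pairing of \<open>x\<close> with \<open>Em s *v ?y\<close>.\<close>
  have 2: "norm (conj_transpose (Em s) *v x) \<le> K * norm x" if s: "s \<in> {0..T}" for s x
  proof -
    let ?y = "conj_transpose (Em s) *v x"
    have "norm ?y * norm ?y = Re (cdot ?y ?y)" by (simp add: Re_cdot power2_norm_eq_inner[symmetric] power2_eq_square)
    also have "\<dots> = Re (cdot x (Em s *v ?y))" by (simp add: cdot_adjoint')
    also have "\<dots> \<le> norm x * norm (Em s *v ?y)" unfolding Re_cdot by (rule norm_cauchy_schwarz)
    also have "\<dots> \<le> norm x * (K * norm ?y)" by (intro mult_left_mono 1 s) auto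
    finally have "norm ?y * norm ?y \<le> (K * norm x) * norm ?y" by (simp add: mult_ac)
    then show ?thesis using K by (cases "norm ?y = 0") (auto simp: mult_le_cancel_right)
  qed
  show ?thesis using that[OF K 2 1] .
qed

section \<open>Fourier coefficients of the adjoint flow\<close>

text \<open>Taking a sine coefficient is continuous on L2, so it commutes with the limit of
  difference quotients and turns the Laplacian into multiplication by
  \<open>- lam i\<close>.\<close>

lemma adjoint_solution_coef_deriv:
  assumes z: "adjoint_solution Om A \<tau> \<zeta> z" and t: "t \<in> {0<..<\<tau>}"
  shows "((\<lambda>t. coef (z t) i) has_vector_derivative lam i *\<^sub>R coef (z t) i - Ms *v coef (z t) i) (at t)"
proof -
  have zH: "\<And>s. s \<in> {0..\<tau>} \<Longrightarrow> z s \<in> H10" and zt: "z t \<in> Sobolev_H2 Om"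
    and lim: "((\<lambda>s. L2_norm Lb (\<lambda>x. (z s x - z t x) /\<^sub>R (s - t) + (laplacian Om (z t) x + Ms *v z t x))) \<longlongrightarrow> 0) (at t)"
    using z t unfolding adjoint_solution_def by auto
  have zL: "s \<in> {0..\<tau>} \<Longrightarrow> z s \<in> L2_space Lb" for s using zH Sobolev_H10_H1 Sobolev_H1_L2 by blast
  have tt: "t \<in> {0..\<tau>}" using t by auto
  note lap = coef_laplacian[OF zH[OF tt] zt]
  let ?D = "lam i *\<^sub>R coef (z t) i - Ms *v coef (z t) i"
  have bl: "bounded_linear (\<lambda>v. Ms *v v)" by (rule matrix_vector_mul_bounded_linear)
  have zM: "(\<lambda>x. Ms *v z t x) \<in> L2_space Lb" by (rule L2_space_linear[OF zL[OF tt] bl])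
  have "((\<lambda>s. (coef (z s) i - coef (z t) i) /\<^sub>R (s - t) - ?D) \<longlongrightarrow> 0) (at t)"
  proof (rule Lim_null_comparison)
    have "\<forall>\<^sub>F s in at t. s \<in> {0<..<\<tau>}" using t by (intro eventually_at_in_open') auto
    then show "\<forall>\<^sub>F s in at t. norm ((coef (z s) i - coef (z t) i) /\<^sub>R (s - t) - ?D) \<le>
        L2_norm Lb (sine i) * L2_norm Lb (\<lambda>x. (z s x - z t x) /\<^sub>R (s - t) + (laplacian Om (z t) x + Ms *v z t x))"
    proof eventually_elim
      fix s assume "s \<in> {0<..<\<tau>}"
      then have s: "z s \<in> L2_space Lb" by (intro zL) auto
      have d: "(\<lambda>x. (z s x - z t x) /\<^sub>R (s - t)) \<in> L2_space Lb"
        by (intro L2_space_scaleR L2_space_diff s zL tt)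
      have "coef (\<lambda>x. (z s x - z t x) /\<^sub>R (s - t) + (laplacian Om (z t) x + Ms *v z t x)) i =
          (coef (z s) i - coef (z t) i) /\<^sub>R (s - t) - ?D"
        unfolding coef_add[OF d L2_space_add[OF lap(1) zM]] coef_add[OF lap(1) zM] coef_linear[OF zL[OF tt] bl]
          coef_linear[OF L2_space_diff[OF s zL[OF tt]] bounded_linear_scaleR_right] coef_diff[OF s zL[OF tt]] lap(2)
        by simp
      then show "norm ((coef (z s) i - coef (z t) i) /\<^sub>R (s - t) - ?D) \<le>
        L2_norm Lb (sine i) * L2_norm Lb (\<lambda>x. (z s x - z t x) /\<^sub>R (s - t) + (laplacian Om (z t) x + Ms *v z t x))"
        using coef_norm_le[OF L2_space_add[OF d L2_space_add[OF lap(1) zM]], of i] by simp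
    qed
    show "((\<lambda>s. L2_norm Lb (sine i) * L2_norm Lb (\<lambda>x. (z s x - z t x) /\<^sub>R (s - t) + (laplacian Om (z t) x + Ms *v z t x))) \<longlongrightarrow> 0) (at t)"
      using lim by (rule tendsto_mult_right_zero)
  qed
  from tendsto_norm_zero[OF this]
  have "((\<lambda>s. norm (coef (z s) i - coef (z t) i - (s - t) *\<^sub>R ?D) / norm (s - t)) \<longlongrightarrow> 0) (at t)"
  proof (rule Lim_transform_eventually)
    have "norm (x /\<^sub>R r - ?D) = norm (x - r *\<^sub>R ?D) / norm r" if "r \<noteq> 0" for x and r :: real
    proof -
      have "x /\<^sub>R r - ?D = (x - r *\<^sub>R ?D) /\<^sub>R r" using that by (simp add: scaleR_diff_right)
      then show ?thesis by (simp add: divide_inverse mult.commute)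
    qed
    then show "\<forall>\<^sub>F s in at t. norm ((coef (z s) i - coef (z t) i) /\<^sub>R (s - t) - ?D) =
        norm (coef (z s) i - coef (z t) i - (s - t) *\<^sub>R ?D) / norm (s - t)"
      unfolding eventually_at_filter by (intro always_eventually allI impI) simp
  qed
  then show ?thesis
    unfolding has_vector_derivative_def has_derivative_iff_norm by (simp add: bounded_linear_scaleR_left)
qed

text \<open>The equation is imposed only on the open interval; continuity into \<open>H1\<close>
  carries the coefficients to both end times.\<close>

lemma adjoint_solution_coef_continuous:
  assumes z: "adjoint_solution Om A \<tau> \<zeta> z"
  shows "continuous_on {0..\<tau>} (\<lambda>t. coef (z t) i)"
  unfolding continuous_on_def
proof (intro ballI)
  fix t assume t: "t \<in> {0..\<tau>}"
  have zH: "\<And>s. s \<in> {0..\<tau>} \<Longrightarrow> z s \<in> H10"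
    and lim: "((\<lambda>s. H1_norm Om (\<lambda>x. z s x - z t x)) \<longlongrightarrow> 0) (at t within {0..\<tau>})"
    using z t unfolding adjoint_solution_def by auto
  have zL: "s \<in> {0..\<tau>} \<Longrightarrow> z s \<in> L2_space Lb" for s using zH Sobolev_H10_H1 Sobolev_H1_L2 by blast
  have "((\<lambda>s. coef (z s) i - coef (z t) i) \<longlongrightarrow> 0) (at t within {0..\<tau>})"
  proof (rule Lim_null_comparison)
    show "\<forall>\<^sub>F s in at t within {0..\<tau>}. norm (coef (z s) i - coef (z t) i) \<le> L2_norm Lb (sine i) * H1_norm Om (\<lambda>x. z s x - z t x)"
      unfolding eventually_at_filter
    proof (intro always_eventually allI impI)
      fix s assume "s \<in> {0..\<tau>}"
      then show "norm (coef (z s) i - coef (z t) i) \<le> L2_norm Lb (sine i) * H1_norm Om (\<lambda>x. z s x - z t x)"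
        using coef_norm_le[OF L2_space_diff[OF zL zL[OF t]], of s i] coef_diff[OF zL zL[OF t], of s i]
          mult_left_mono[OF L2_le_H1_norm[of "\<lambda>x. z s x - z t x"] L2_norm_nonneg[of Lb "sine i"]] by simp
    qed
    show "((\<lambda>s. L2_norm Lb (sine i) * H1_norm Om (\<lambda>x. z s x - z t x)) \<longlongrightarrow> 0) (at t within {0..\<tau>})"
      using lim by (rule tendsto_mult_right_zero)
  qed
  then show "((\<lambda>t. coef (z t) i) \<longlongrightarrow> coef (z t) i) (at t within {0..\<tau>})" by (rule LIM_zero_cancel)
qed

text \<open>Uniqueness for the coefficient equation by an integrating factor: the inverse propagator
  applied to the coefficient is constant. Hence any adjoint solution, however obtained, has these
  coefficients.\<close>

theorem adjoint_solution_coef: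
  assumes z: "adjoint_solution Om A \<tau> \<zeta> z" and \<zeta>: "\<zeta> \<in> H10" and t: "t \<in> {0..\<tau>}"
  shows "coef (z t) i = flow i (\<tau> - t) (coef \<zeta> i)"
proof -
  define c where "c t = coef (z t) i" for t
  define e a b where "e t = complex_of_real (exp (lam i * (\<tau> - t)))" and "a t = exp (\<theta>1 * complex_of_real (t - \<tau>))"
    and "b t = dexp \<theta>1 \<theta>2 (complex_of_real (t - \<tau>))" for t
  \<comment> \<open>\<open>e t\<close> undoes the scalar decay, while \<open>a t\<close> and
    \<open>b t\<close> assemble \<open>Em (t - \<tau>)\<close>; the constant value of
    \<open>g\<close> is the coefficient at time \<open>\<tau>\<close>.\<close>
  define g where "g t = e t *s (a t *s c t + b t *s Nm (c t))" for t
  have cont: "continuous_on {0..\<tau>} c" unfolding c_def by (rule adjoint_solution_coef_continuous[OF z])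
  have bl: "bounded_linear (\<lambda>v. Nm v)"
    by (intro bounded_linear_sub matrix_vector_mul_bounded_linear bounded_bilinear.bounded_linear_right[OF bounded_bilinear_smult])
  have ce: "(e has_vector_derivative - (lam i * e t)) (at t)" for t
    unfolding e_def by (rule has_vector_derivative_of_real[where D = "- (lam i * exp (lam i * (\<tau> - t)))", simplified])
      (auto intro!: derivative_eq_intros simp: has_real_derivative_iff_has_vector_derivative[symmetric])
  have sh: "((\<lambda>t. t - \<tau>) has_vector_derivative 1) (at t)" for t
    by (auto intro!: derivative_eq_intros)
  have ca: "(a has_vector_derivative \<theta>1 * a t) (at t)" for t
    using vector_diff_chain_at[OF sh exp_of_real_vderiv(1)[of \<theta>1 "t - \<tau>"]] by (simp add: a_def[abs_def] o_def)
  have cb: "(b has_vector_derivative \<theta>2 * b t + a t) (at t)" for t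
    using vector_diff_chain_at[OF sh exp_of_real_vderiv(2)[of \<theta>1 \<theta>2 "t - \<tau>"]] by (simp add: a_def b_def[abs_def] o_def)
  have "g t = g \<tau>" if "t \<in> {0..\<tau>}" for t
  proof -
    have tau: "\<tau> \<in> {0..\<tau>}" using that by auto
    have cg: "continuous_on {0..\<tau>} g" unfolding g_def
      by (intro bounded_bilinear.continuous_on[OF bounded_bilinear_smult] continuous_on_add cont
          bounded_linear.continuous_on[OF bl] continuous_at_imp_continuous_on ballI
          has_vector_derivative_continuous[OF ce] has_vector_derivative_continuous[OF ca] has_vector_derivative_continuous[OF cb])
    have dg: "(g has_derivative (\<lambda>h. 0)) (at t within {0..\<tau>})" if t: "t \<in> {0..\<tau>} - {0, \<tau>}" for t
    proof -
      have cd: "(c has_vector_derivative lam i *\<^sub>R c t - Ms *v c t) (at t)"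
        unfolding c_def by (rule adjoint_solution_coef_deriv[OF z]) (use t in auto)
      note B = bounded_bilinear.has_vector_derivative[OF bounded_bilinear_smult]
      have Nd: "Nm (lam i *\<^sub>R c t - Ms *v c t) = lam i *\<^sub>R Nm (c t) - \<theta>2 *s Nm (c t)"
        using char[of "c t"] unfolding scaleR_eq_smult by (simp add: mv_simps vec_eq_iff algebra_simps)
      have "(g has_vector_derivative
          e t *s ((a t *s (lam i *\<^sub>R c t - Ms *v c t) + (\<theta>1 * a t) *s c t)
            + (b t *s Nm (lam i *\<^sub>R c t - Ms *v c t) + (\<theta>2 * b t + a t) *s Nm (c t)))
          + (- (lam i * e t)) *s (a t *s c t + b t *s Nm (c t))) (at t)"
        unfolding g_def
        by (rule B[OF ce has_vector_derivative_add[OF B[OF ca cd] B[OF cb bounded_linear.has_vector_derivative[OF bl cd]]]])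
      also have "e t *s ((a t *s (lam i *\<^sub>R c t - Ms *v c t) + (\<theta>1 * a t) *s c t)
            + (b t *s Nm (lam i *\<^sub>R c t - Ms *v c t) + (\<theta>2 * b t + a t) *s Nm (c t)))
          + (- (lam i * e t)) *s (a t *s c t + b t *s Nm (c t)) = 0"
        unfolding Nd by (simp add: vec_eq_iff algebra_simps scaleR_eq_smult)
      finally show ?thesis
        unfolding has_vector_derivative_def by (auto intro: has_derivative_at_withinI)
    qed
    \<comment> \<open>The two end times form the exceptional set, where only continuity of
      \<open>g\<close> is available.\<close>
    have eq: "g s = g 0" if "s \<in> {0..\<tau>}" for s
      by (rule has_derivative_zero_unique_strong_interval[OF _ cg refl dg that, of "{0, \<tau>}"]) auto
    show ?thesis using eq[OF that] eq[OF tau] by simp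
  qed
  moreover have gE: "g t = e t *s (Em (t - \<tau>) *v c t)" for t
    unfolding g_def a_def b_def Em_apply by (rule refl)
  ultimately have "e t *s (Em (t - \<tau>) *v c t) = c \<tau>"
    using t by (metis Em_0 diff_self e_def exp_zero mult_zero_right of_real_1 vector_smult_lid)
  moreover have "c \<tau> = coef \<zeta> i"
  proof -
    have "z \<tau> \<in> H10" "AE x in Lb. z \<tau> x = \<zeta> x" using z t by (auto simp: adjoint_solution_def)
    then show ?thesis unfolding c_def using \<zeta>
      by (intro coef_cong_AE Sobolev_H1_L2 Sobolev_H10_H1)
  qed
  ultimately have "Em (\<tau> - t) *v coef \<zeta> i = e t *s (Em (\<tau> - t) *v (Em (- (\<tau> - t)) *v c t))"
    by (simp add: mv_smult[symmetric])
  then have "Em (\<tau> - t) *v coef \<zeta> i = exp (lam i * (\<tau> - t)) *\<^sub>R c t"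
    unfolding Em_inverse by (simp add: e_def scaleR_eq_smult)
  then have "flow i (\<tau> - t) (coef \<zeta> i) = c t"
    by (simp add: exp_minus)
  then show ?thesis by (simp add: c_def)
qed

end

section \<open>Normal derivatives\<close>

context rectangle
begin

abbreviation "sg \<equiv> rect_surface X1 X2"
abbreviation "nu \<equiv> rect_normal X1 X2"

section \<open>Integration against arc length on the boundary\<close>

lemma borel_section [measurable]:
  "(\<lambda>s::real. (c, s)) \<in> borel_measurable borel" "(\<lambda>s::real. (s, c)) \<in> borel_measurable borel" for c :: real
  by (intro borel_measurable_continuous_onI continuous_intros)+

lemma borel_section_on:
  fixes f :: "plane \<Rightarrow> 'b::topological_space"
  assumes "f \<in> borel_measurable borel"
  shows "(\<lambda>s. f (c, s)) \<in> borel_measurable (lborel_on S)" "(\<lambda>s. f (s, c)) \<in> borel_measurable (lborel_on S)"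
  using measurable_compose[OF borel_section(1) assms] measurable_compose[OF borel_section(2) assms]
  by (auto intro!: measurable_restrict_space1)

lemma borel_sg: "(f :: plane \<Rightarrow> 'b::topological_space) \<in> borel_measurable borel \<Longrightarrow> f \<in> borel_measurable sg"
  unfolding measurable_cong_sets[OF sets_rect_surface refl] .

lemma emeasure_Ioo_finite: "emeasure lborel {0<..<X::real} < top"
  by (cases "0 \<le> X") simp_all

lemma finite_measure_interval: "finite_measure (lborel_on {0<..<X::real})"
  using emeasure_Ioo_finite[of X] by (intro finite_measureI) (simp add: emeasure_restrict_space space_restrict_space)

text \<open>The surface measure is given through its values on sets; induction over nonnegative
  measurable functions turns this into the sum of four edge integrals.\<close>

lemma nn_integral_sg:
  assumes "f \<in> borel_measurable borel"
  shows "(\<integral>\<^sup>+x. f x \<partial>sg) = (\<integral>\<^sup>+s. f (0, s) \<partial>I2) + (\<integral>\<^sup>+s. f (X1, s) \<partial>I2) + (\<integral>\<^sup>+s. f (s, 0) \<partial>I1) + (\<integral>\<^sup>+s. f (s, X2) \<partial>I1)"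
  using assms
proof (induction rule: borel_measurable_induct)
  case (cong f g)
  then show ?case by (simp cong: nn_integral_cong)
next
  case (set S)
  have m: "(\<integral>\<^sup>+s. indicator S (p s) \<partial>lborel_on {0<..<X}) = emeasure lborel {s \<in> {0<..<X}. p s \<in> S}"
    if p: "p \<in> borel_measurable borel" for p :: "real \<Rightarrow> plane" and X :: real
  proof -
    have "(\<integral>\<^sup>+s. indicator S (p s) \<partial>lborel_on {0<..<X}) = (\<integral>\<^sup>+s. indicator {s \<in> {0<..<X}. p s \<in> S} s \<partial>lborel)"
      by (subst nn_integral_restrict_space) (auto intro!: nn_integral_cong simp: indicator_def)
    also have "\<dots> = emeasure lborel {s \<in> {0<..<X}. p s \<in> S}"
    proof (rule nn_integral_indicator)
      have "p -` S \<inter> space borel \<in> sets borel" using p set by (rule measurable_sets)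
      then have "p -` S \<inter> {0<..<X} \<in> sets borel" by auto
      moreover have "p -` S \<inter> {0<..<X} = {s \<in> {0<..<X}. p s \<in> S}" by auto
      ultimately show "{s \<in> {0<..<X}. p s \<in> S} \<in> sets lborel" by simp
    qed
    finally show ?thesis .
  qed
  show ?case using set by (simp add: m borel_section emeasure_rect_surface)
next
  case (mult u c)
  then show ?case by (simp add: nn_integral_cmult borel_section_on borel_sg distrib_left)
next
  case (add u v)
  then show ?case by (simp add: nn_integral_add borel_section_on borel_sg ac_simps)
next
  case (seq U)
  have [measurable]: "U i \<in> borel_measurable borel" for i using seq by auto
  have "incseq U" using seq by blast
  then have mono': "U m x \<le> U n x" if "m \<le> n" for m n x using that by (metis incseqD le_funD)
  have ia: "incseq f \<Longrightarrow> incseq g \<Longrightarrow> incseq (\<lambda>i. f i + g i)" for f g :: "nat \<Rightarrow> ennreal"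
    by (auto simp: incseq_def intro: add_mono)
  have mono: "incseq (\<lambda>i. \<integral>\<^sup>+s. U i (p s) \<partial>M)" for p and M :: "real measure"
    unfolding incseq_def by (intro allI impI nn_integral_mono mono')
  have s: "(\<integral>\<^sup>+s. (SUP i. U i) (p s) \<partial>lborel_on {0<..<X}) = (SUP i. \<integral>\<^sup>+s. U i (p s) \<partial>lborel_on {0<..<X})"
    if [measurable]: "p \<in> borel_measurable borel" for p and X :: real
    unfolding SUP_apply
    by (rule nn_integral_monotone_convergence_SUP) (auto simp: incseq_def le_fun_def intro!: measurable_restrict_space1 mono')
  have "(\<integral>\<^sup>+x. (SUP i. U i) x \<partial>sg) = (SUP i. \<integral>\<^sup>+x. U i x \<partial>sg)"
    unfolding SUP_apply by (rule nn_integral_monotone_convergence_SUP) (auto intro: \<open>incseq U\<close> borel_sg)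
  also have "\<dots> = (SUP i. \<integral>\<^sup>+s. U i (0, s) \<partial>I2) + (SUP i. \<integral>\<^sup>+s. U i (X1, s) \<partial>I2)
      + (SUP i. \<integral>\<^sup>+s. U i (s, 0) \<partial>I1) + (SUP i. \<integral>\<^sup>+s. U i (s, X2) \<partial>I1)"
    unfolding seq.IH by (simp only: ennreal_SUP_add mono ia)
  finally show ?case by (simp only: s[OF borel_section(1)] s[OF borel_section(2)])
qed

lemma finite_sg: "finite_measure sg"
proof
  have "emeasure sg (space sg) = (\<integral>\<^sup>+x. 1 \<partial>sg)" by simp
  also have "\<dots> < \<infinity>" unfolding nn_integral_sg[OF borel_measurable_const] by (simp add: emeasure_restrict_space space_restrict_space emeasure_Ioo_finite)
  finally show "emeasure sg (space sg) \<noteq> \<infinity>" by simp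
qed

text \<open>Boundedness keeps the edge integrals of the positive and negative parts finite, so that
  \<open>enn2real\<close> is additive on them.\<close>

lemma integral_sg_real:
  fixes f :: "plane \<Rightarrow> real"
  assumes [measurable]: "f \<in> borel_measurable borel" and b: "\<And>x. \<bar>f x\<bar> \<le> C"
  shows "(\<integral>x. f x \<partial>sg) = (\<integral>s. f (0, s) \<partial>I2) + (\<integral>s. f (X1, s) \<partial>I2) + (\<integral>s. f (s, 0) \<partial>I1) + (\<integral>s. f (s, X2) \<partial>I1)"
proof -
  interpret S: finite_measure sg by (rule finite_sg)
  have i: "integrable (lborel_on {0<..<X}) (\<lambda>s. f (p s))" if [measurable]: "p \<in> borel_measurable borel" for p and X :: real
    by (rule finite_measure.integrable_const_bound[OF finite_measure_interval, of _ C]) (use b in \<open>auto intro!: measurable_restrict_space1\<close>)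
  have isg: "integrable sg f" by (rule S.integrable_const_bound[of _ C]) (use b in \<open>auto intro: borel_sg\<close>)
  have fin: "(\<integral>\<^sup>+s. ennreal (g (p s)) \<partial>lborel_on {0<..<X}) < top"
    if b: "\<And>x. \<bar>g x\<bar> \<le> C" for g :: "plane \<Rightarrow> real" and p and X :: real
  proof -
    have "(\<integral>\<^sup>+s. ennreal (g (p s)) \<partial>lborel_on {0<..<X}) \<le> (\<integral>\<^sup>+s. ennreal C \<partial>lborel_on {0<..<X})"
      using b by (intro nn_integral_mono ennreal_leI) (metis abs_le_D1)
    also have "\<dots> < top" by (simp add: emeasure_restrict_space space_restrict_space ennreal_mult_less_top emeasure_Ioo_finite)
    finally show ?thesis .
  qed
  have e: "enn2real (\<integral>\<^sup>+x. ennreal (g x) \<partial>sg) = enn2real (\<integral>\<^sup>+s. ennreal (g (0, s)) \<partial>I2) + enn2real (\<integral>\<^sup>+s. ennreal (g (X1, s)) \<partial>I2)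
      + enn2real (\<integral>\<^sup>+s. ennreal (g (s, 0)) \<partial>I1) + enn2real (\<integral>\<^sup>+s. ennreal (g (s, X2)) \<partial>I1)"
    if [measurable]: "g \<in> borel_measurable borel" and "\<And>x. \<bar>g x\<bar> \<le> C" for g :: "plane \<Rightarrow> real"
    using fin[of g X2 "\<lambda>s. (0, s)", OF that(2)] fin[of g X2 "\<lambda>s. (X1, s)", OF that(2)]
      fin[of g X1 "\<lambda>s. (s, 0)", OF that(2)] fin[of g X1 "\<lambda>s. (s, X2)", OF that(2)]
    by (subst nn_integral_sg) (simp_all add: enn2real_plus)
  show ?thesis
    unfolding real_lebesgue_integral_def[OF isg] real_lebesgue_integral_def[OF i[OF borel_section(1)]]
      real_lebesgue_integral_def[OF i[OF borel_section(2)]]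
    using e[of f] e[of "\<lambda>x. - f x"] b by simp
qed

lemma integral_sg:
  fixes f :: "plane \<Rightarrow> 'b::euclidean_space"
  assumes f [measurable]: "f \<in> borel_measurable borel" and b: "\<And>x. norm (f x) \<le> C"
  shows "(\<integral>x. f x \<partial>sg) = (\<integral>s. f (0, s) \<partial>I2) + (\<integral>s. f (X1, s) \<partial>I2) + (\<integral>s. f (s, 0) \<partial>I1) + (\<integral>s. f (s, X2) \<partial>I1)"
proof (rule euclidean_eqI)
  fix c :: 'b assume c: "c \<in> Basis"
  interpret S: finite_measure sg by (rule finite_sg)
  have i: "integrable (lborel_on {0<..<X}) (\<lambda>s. f (p s))" if [measurable]: "p \<in> borel_measurable borel" for p and X :: real
    by (rule finite_measure.integrable_const_bound[OF finite_measure_interval, of _ C]) (use b in \<open>auto intro!: measurable_restrict_space1\<close>)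
  have isg: "integrable sg f" by (rule S.integrable_const_bound[of _ C]) (use b in \<open>auto intro: borel_sg\<close>)
  have "\<bar>f x \<bullet> c\<bar> \<le> C" for x using b[of x] Basis_le_norm[OF c, of "f x"] by simp
  moreover have "(\<lambda>x. f x \<bullet> c) \<in> borel_measurable borel" by measurable
  ultimately have "(\<integral>x. f x \<bullet> c \<partial>sg) = (\<integral>s. f (0, s) \<bullet> c \<partial>I2) + (\<integral>s. f (X1, s) \<bullet> c \<partial>I2)
    + (\<integral>s. f (s, 0) \<bullet> c \<partial>I1) + (\<integral>s. f (s, X2) \<bullet> c \<partial>I1)"
    by (intro integral_sg_real)
  then   show "(\<integral>x. f x \<partial>sg) \<bullet> c = ((\<integral>s. f (0, s) \<partial>I2) + (\<integral>s. f (X1, s) \<partial>I2) + (\<integral>s. f (s, 0) \<partial>I1) + (\<integral>s. f (s, X2) \<partial>I1)) \<bullet> c"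
    using i[OF borel_section(1)] i[OF borel_section(2)] isg by (simp add: inner_add_left)
qed

text \<open>\<open>sg\<close> is a measure on the whole plane, but points off the open edges,
  corners included, carry no mass. Estimates on the closed rectangle therefore suffice.\<close>

lemma AE_sg_boundary:
  "AE x in sg. x \<in> {0, X1} \<times> {0<..<X2} \<union> {0<..<X1} \<times> {0, X2}"
proof (rule AE_I)
  let ?N = "- ({0, X1} \<times> {0<..<X2} \<union> {0<..<X1} \<times> {0, X2})"
  have "{0, X1} \<times> {0<..<X2} \<union> {0<..<X1} \<times> {0, X2} \<in> sets borel"
    by (intro sets.Un) (simp_all add: borel_Times)
  then show N: "?N \<in> sets sg" unfolding sets_rect_surface by (rule borel_comp)
  have e: "{s \<in> {0<..<X2}. (0, s) \<in> ?N} = {}" "{s \<in> {0<..<X2}. (X1, s) \<in> ?N} = {}"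
    "{s \<in> {0<..<X1}. (s, 0) \<in> ?N} = {}" "{s \<in> {0<..<X1}. (s, X2) \<in> ?N} = {}" by auto
  show "emeasure sg ?N = 0" unfolding emeasure_rect_surface[OF N[unfolded sets_rect_surface]] e by simp
qed auto

lemma continuous_bounded_rect:
  fixes f :: "plane \<Rightarrow> 'b::euclidean_space"
  assumes "continuous_on UNIV f"
  obtains C where "C \<ge> 0" "\<And>x. x \<in> {0..X1} \<times> {0..X2} \<Longrightarrow> norm (f x) \<le> C"
proof -
  have "compact (f ` ({0..X1} \<times> {0..X2}))"
    by (intro compact_continuous_image continuous_on_subset[OF assms] compact_Times) auto
  then have "bounded (f ` ({0..X1} \<times> {0..X2}))" by (rule compact_imp_bounded)
  then obtain C where C: "\<And>x. x \<in> {0..X1} \<times> {0..X2} \<Longrightarrow> norm (f x) \<le> C"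
    unfolding bounded_iff by auto
  have "norm (f x) \<le> \<bar>C\<bar>" if "x \<in> {0..X1} \<times> {0..X2}" for x using C[OF that] by simp
  then show ?thesis by (rule that[OF abs_ge_zero])
qed

lemma continuous_sg_L2:
  fixes f :: "plane \<Rightarrow> 'b::euclidean_space"
  assumes "continuous_on UNIV f"
  shows "f \<in> L2_space sg"
proof (rule L2_spaceI)
  interpret S: finite_measure sg by (rule finite_sg)
  show [measurable]: "f \<in> borel_measurable sg"
    using borel_measurable_continuous_onI[OF assms] by (simp cong: measurable_cong_sets)
  obtain C where C: "C \<ge> 0" "\<And>x. x \<in> {0..X1} \<times> {0..X2} \<Longrightarrow> norm (f x) \<le> C" by (rule continuous_bounded_rect[OF assms]) blast
  show "integrable sg (\<lambda>x. (norm (f x))\<^sup>2)"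
  proof (rule S.integrable_const_bound[of _ "C\<^sup>2"])
    show "AE x in sg. norm ((norm (f x))\<^sup>2) \<le> C\<^sup>2"
      using AE_sg_boundary by eventually_elim (use C X1 X2 in \<open>auto intro!: power_mono\<close>)
  qed measurable
qed

lemma nu_measurable [measurable]: "(\<lambda>x. nu x \<bullet> b) \<in> borel_measurable borel"
proof -
  have [measurable]: "fst \<in> borel_measurable (borel :: plane measure)" "snd \<in> borel_measurable (borel :: plane measure)"
    by (intro borel_measurable_continuous_onI continuous_on_fst continuous_on_snd continuous_on_id)+
  have "(\<lambda>x. nu x \<bullet> b) = (\<lambda>x. if fst x = 0 then - fst b else if fst x = X1 then fst b else if snd x = 0 then - snd b else snd b)"
    by (cases b) (auto simp: rect_normal_def fun_eq_iff)
  also have "\<dots> \<in> borel_measurable borel" by measurable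
  finally show ?thesis .
qed

lemma nu_bounded: "\<bar>nu x \<bullet> b\<bar> \<le> norm b"
  using Cauchy_Schwarz_ineq2[of "nu x" b] by (auto simp: rect_normal_def norm_Pair)

lemma divergence_sg:
  fixes F :: "plane \<Rightarrow> 'b::euclidean_space"
  assumes F: "C_k (Suc 0) F" and b: "b \<in> Basis"
  shows "(\<integral>x. pder b F x \<partial>Lb) = (\<integral>x. (nu x \<bullet> b) *\<^sub>R F x \<partial>sg)"
proof -
  let ?R = "{0..X1} \<times> {0..X2}"
  note cF = C_k_continuous[OF F]
  obtain C where C: "C \<ge> 0" "\<And>x. x \<in> ?R \<Longrightarrow> norm (F x) \<le> C" by (rule continuous_bounded_rect[OF cF]) blast
  have [measurable]: "F \<in> borel_measurable borel" by (rule borel_measurable_continuous_onI[OF cF])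
  have [measurable]: "?R \<in> sets borel" by (simp add: borel_Times)
  \<comment> \<open>The indicator bounds the integrand on the whole plane, as
    \<open>integral_sg\<close> demands, and changes nothing almost everywhere.\<close>
  let ?f = "\<lambda>x. indicator ?R x *\<^sub>R ((nu x \<bullet> b) *\<^sub>R F x)"
  have "(\<integral>x. (nu x \<bullet> b) *\<^sub>R F x \<partial>sg) = (\<integral>x. ?f x \<partial>sg)"
  proof (rule integral_cong_AE)
    show "(\<lambda>x. (nu x \<bullet> b) *\<^sub>R F x) \<in> borel_measurable sg" "?f \<in> borel_measurable sg"
      unfolding measurable_cong_sets[OF sets_rect_surface refl] by measurable
    show "AE x in sg. (nu x \<bullet> b) *\<^sub>R F x = ?f x"
      using AE_sg_boundary by eventually_elim (use X1 X2 in \<open>auto simp: indicator_def\<close>)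
  qed
  also have "\<dots> = (\<integral>s. ?f (0, s) \<partial>I2) + (\<integral>s. ?f (X1, s) \<partial>I2) + (\<integral>s. ?f (s, 0) \<partial>I1) + (\<integral>s. ?f (s, X2) \<partial>I1)"
  proof (rule integral_sg)
    show "?f \<in> borel_measurable borel" by measurable
    show "norm (?f x) \<le> norm b * C" for x
      using nu_bounded[of x b] C by (auto simp: indicator_def intro!: mult_mono)
  qed
  also have "\<dots> = (\<integral>s. (- fst b) *\<^sub>R F (0, s) \<partial>I2) + (\<integral>s. fst b *\<^sub>R F (X1, s) \<partial>I2)
      + (\<integral>s. (- snd b) *\<^sub>R F (s, 0) \<partial>I1) + (\<integral>s. snd b *\<^sub>R F (s, X2) \<partial>I1)"
    by (intro arg_cong2[where f = "(+)"] Bochner_Integration.integral_cong refl)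
      (use X1 X2 in \<open>cases b, auto simp: rect_normal_def indicator_def space_restrict_space\<close>)+
  finally have eq: "(\<integral>x. (nu x \<bullet> b) *\<^sub>R F x \<partial>sg) = fst b *\<^sub>R ((\<integral>s. F (X1, s) \<partial>I2) - (\<integral>s. F (0, s) \<partial>I2))
      + snd b *\<^sub>R ((\<integral>s. F (s, X2) \<partial>I1) - (\<integral>s. F (s, 0) \<partial>I1))"
    by (simp add: scaleR_diff_right)
  have i: "integrable (lborel_on {0<..<X}) (\<lambda>s. F (p s))" if p: "continuous_on UNIV p" for p :: "real \<Rightarrow> plane" and X :: real
  proof -
    have "continuous_on {0..X} (\<lambda>s. F (p s))"
      by (rule continuous_on_compose2[OF cF continuous_on_subset[OF p]]) auto
    from borel_integrable_compact[OF compact_Icc this]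
    have "set_integrable lborel {0..X} (\<lambda>s. F (p s))" by (simp add: set_integrable_def)
    then have "set_integrable lborel {0<..<X} (\<lambda>s. F (p s))" by (rule set_integrable_subset) auto
    then show ?thesis by (simp add: set_integrable_def integrable_restrict_space)
  qed
  have c: "continuous_on UNIV (\<lambda>s::real. (a, s))" "continuous_on UNIV (\<lambda>s::real. (s, a))" for a :: real
    by (intro continuous_intros)+
  show ?thesis
    unfolding eq using b divergence_rect[OF F] i[OF c(1)] i[OF c(2)] by (auto simp: Basis_real_prod)
qed

text \<open>Gauss--Green for a function with trace \<open>G\<close>: it holds for the smooth
  functions defining the trace, and each of the three integrals passes to the limit.\<close>

lemma L2_norm_sg_tendsto_imp:
  fixes G :: "plane \<Rightarrow> 'b::euclidean_space"
  assumes v: "has_trace Om sg v G" and b: "b \<in> Basis" and \<psi>: "C_k (Suc 0) \<psi>"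
  shows "(\<integral>x. ((nu x \<bullet> b) * \<psi> x) *\<^sub>R G x \<partial>sg) =
    (\<integral>x. \<psi> x *\<^sub>R wpart b v x \<partial>Lb) + (\<integral>x. pder b \<psi> x *\<^sub>R v x \<partial>Lb)"
proof -
  obtain \<phi> where \<phi>: "\<And>k::nat. C_inf (\<phi> k)" "(\<lambda>k. H1_norm Om (\<lambda>x. \<phi> k x - v x)) \<longlonglongrightarrow> 0"
    "(\<lambda>k. L2_norm sg (\<lambda>x. \<phi> k x - G x)) \<longlonglongrightarrow> 0" and vH: "v \<in> H1" and G: "G \<in> L2_space sg"
    using v unfolding has_trace_def by blast
  have C: "C_k (Suc 0) (\<phi> k)" for k by (rule C_inf_imp_C_k[OF \<phi>(1)])
  note H = C_1_Sobolev_H1(1)[OF C]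
  note lim = H1_tendsto_imp[OF \<phi>(2) H vH]
  have L\<psi>: "\<psi> \<in> L2_space Lb" "(\<lambda>x. pder b \<psi> x) \<in> L2_space Lb"
    by (rule continuous_imp_L2[OF C_k_continuous[OF \<psi>]], rule continuous_imp_L2[OF C_1_continuous_partial[OF \<psi> b]])
  have w: "(\<lambda>x. (nu x \<bullet> b) * \<psi> x) \<in> L2_space sg"
  proof (rule L2_space_bound[OF continuous_sg_L2[OF C_k_continuous[OF \<psi>]], of _ "norm b"])
    have [measurable]: "\<psi> \<in> borel_measurable borel" by (rule borel_measurable_continuous_onI[OF C_k_continuous[OF \<psi>]])
    show "(\<lambda>x. (nu x \<bullet> b) * \<psi> x) \<in> borel_measurable sg"
      unfolding measurable_cong_sets[OF sets_rect_surface refl] by measurable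
    show "norm ((nu x \<bullet> b) * \<psi> x) \<le> norm b * norm (\<psi> x)" for x
      using nu_bounded by (simp add: abs_mult mult_right_mono)
  qed
  have 1: "(\<lambda>k. \<integral>x. \<psi> x *\<^sub>R wpart b (\<phi> k) x \<partial>Lb) \<longlonglongrightarrow> (\<integral>x. \<psi> x *\<^sub>R wpart b v x \<partial>Lb)"
    by (rule L2_tendsto_scaleR_right[OF Sobolev_H1_weak_partial(1)[OF H b] Sobolev_H1_weak_partial(1)[OF vH b] L\<psi>(1) lim(2)[OF b]])
  have 2: "(\<lambda>k. \<integral>x. pder b \<psi> x *\<^sub>R \<phi> k x \<partial>Lb) \<longlonglongrightarrow> (\<integral>x. pder b \<psi> x *\<^sub>R v x \<partial>Lb)"
    by (rule L2_tendsto_scaleR_right[OF Sobolev_H1_L2[OF H] Sobolev_H1_L2[OF vH] L\<psi>(2) lim(1)])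
  have 3: "(\<lambda>k. \<integral>x. ((nu x \<bullet> b) * \<psi> x) *\<^sub>R \<phi> k x \<partial>sg) \<longlonglongrightarrow> (\<integral>x. ((nu x \<bullet> b) * \<psi> x) *\<^sub>R G x \<partial>sg)"
    by (rule L2_tendsto_scaleR_right[OF continuous_sg_L2[OF C_k_continuous[OF C]] G w \<phi>(3)])
  have "(\<integral>x. ((nu x \<bullet> b) * \<psi> x) *\<^sub>R \<phi> k x \<partial>sg) =
      (\<integral>x. \<psi> x *\<^sub>R wpart b (\<phi> k) x \<partial>Lb) + (\<integral>x. pder b \<psi> x *\<^sub>R \<phi> k x \<partial>Lb)" for k
  proof -
    have "(\<integral>x. ((nu x \<bullet> b) * \<psi> x) *\<^sub>R \<phi> k x \<partial>sg) = (\<integral>x. pder b (\<lambda>x. \<psi> x *\<^sub>R \<phi> k x) x \<partial>Lb)"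
      unfolding divergence_sg[OF C_1_scaleR_fun[OF \<psi> C] b] by simp
    also have "\<dots> = (\<integral>x. \<psi> x *\<^sub>R pder b (\<phi> k) x \<partial>Lb) + (\<integral>x. pder b \<psi> x *\<^sub>R \<phi> k x \<partial>Lb)"
      by (rule integral_partial_scaleR[OF \<psi> C b])
    also have "(\<integral>x. \<psi> x *\<^sub>R pder b (\<phi> k) x \<partial>Lb) = (\<integral>x. \<psi> x *\<^sub>R wpart b (\<phi> k) x \<partial>Lb)"
    proof (rule integral_cong_AE)
      show "(\<lambda>x. \<psi> x *\<^sub>R wpart b (\<phi> k) x) \<in> borel_measurable Lb"
        by (intro borel_measurable_scaleR L2_space_measurable L\<psi> Sobolev_H1_weak_partial H b)
      show "(\<lambda>x. \<psi> x *\<^sub>R pder b (\<phi> k) x) \<in> borel_measurable Lb"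
        by (intro borel_measurable_scaleR L2_space_measurable L\<psi> continuous_imp_L2 C_1_continuous_partial C b)
      show "AE x in Lb. \<psi> x *\<^sub>R pder b (\<phi> k) x = \<psi> x *\<^sub>R wpart b (\<phi> k) x"
        using C_1_Sobolev_H1(2)[OF C[of k] b] by eventually_elim simp
    qed
    finally show ?thesis .
  qed
  then show ?thesis using LIMSEQ_unique[OF 3] tendsto_add[OF 1 2] by simp
qed

text \<open>Green's formula against an eigenfunction \<open>\<psi>\<close> of the Laplacian that
  need not vanish on the boundary: \<open>z\<close> has zero boundary values, so only the term with
  its normal derivative survives.\<close>

lemma green_H10:
  fixes z :: "plane \<Rightarrow> 'b::euclidean_space"
  assumes z: "z \<in> H10" and h: "has_normal_derivative Om sg nu z h" and hm: "h \<in> borel_measurable sg"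
    and \<psi>: "C_inf \<psi>"
    and \<mu>: "\<And>x. (\<Sum>b\<in>Basis. pder b (\<lambda>x. pder b \<psi> x) x) = \<mu> * \<psi> x"
  shows "(\<integral>x. \<psi> x *\<^sub>R h x \<partial>sg) = (\<integral>x. \<psi> x *\<^sub>R (laplacian Om z x - \<mu> *\<^sub>R z x) \<partial>Lb)"
proof -
  obtain G where zH2: "z \<in> Sobolev_H2 Om" and G: "\<And>b. b \<in> Basis \<Longrightarrow> has_trace Om sg (wpart b z) (G b)"
    and hG: "AE x in sg. h x = (\<Sum>b\<in>Basis. (nu x \<bullet> b) *\<^sub>R G b x)"
    using h unfolding has_normal_derivative_def by blast
  note C = C_inf_imp_C_k[OF \<psi>, of "Suc 0"]
  have GL: "b \<in> Basis \<Longrightarrow> G b \<in> L2_space sg" for b using G by (simp add: has_trace_def)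
  have v: "wpart b z \<in> H1" if "b \<in> Basis" for b
    using zH2 that by (simp add: Sobolev_H2_def)
  have \<psi>m [measurable]: "\<psi> \<in> borel_measurable borel" by (rule borel_measurable_continuous_onI[OF C_k_continuous[OF C]])
  have \<psi>L: "\<psi> \<in> L2_space Lb" by (rule continuous_imp_L2[OF C_k_continuous[OF C]])
  have zL: "z \<in> L2_space Lb" by (intro Sobolev_H1_L2 Sobolev_H10_H1 z)
  have w: "(\<lambda>x. (nu x \<bullet> b) * \<psi> x) \<in> L2_space sg" for b
  proof (rule L2_space_bound[OF continuous_sg_L2[OF C_k_continuous[OF C]], of _ "norm b"])
    show "(\<lambda>x. (nu x \<bullet> b) * \<psi> x) \<in> borel_measurable sg"
      unfolding measurable_cong_sets[OF sets_rect_surface refl] by measurable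
    show "norm ((nu x \<bullet> b) * \<psi> x) \<le> norm b * norm (\<psi> x)" for x
      using nu_bounded by (simp add: abs_mult mult_right_mono)
  qed
  have "(\<integral>x. \<psi> x *\<^sub>R h x \<partial>sg) = (\<integral>x. (\<Sum>b\<in>Basis. ((nu x \<bullet> b) * \<psi> x) *\<^sub>R G b x) \<partial>sg)"
  proof (rule integral_cong_AE)
    show "(\<lambda>x. \<psi> x *\<^sub>R h x) \<in> borel_measurable sg"
      using hm unfolding measurable_cong_sets[OF sets_rect_surface refl] by measurable
    show "(\<lambda>x. \<Sum>b\<in>Basis. ((nu x \<bullet> b) * \<psi> x) *\<^sub>R G b x) \<in> borel_measurable sg"
      by (intro borel_measurable_sum borel_measurable_scaleR L2_space_measurable w GL)
    show "AE x in sg. \<psi> x *\<^sub>R h x = (\<Sum>b\<in>Basis. ((nu x \<bullet> b) * \<psi> x) *\<^sub>R G b x)"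
      using hG by eventually_elim (simp add: scaleR_sum_right mult.commute)
  qed
  also have "\<dots> = (\<Sum>b\<in>Basis. \<integral>x. ((nu x \<bullet> b) * \<psi> x) *\<^sub>R G b x \<partial>sg)"
    by (intro Bochner_Integration.integral_sum L2_integrable_scaleR w GL)
  also have "\<dots> = (\<Sum>b\<in>Basis. (\<integral>x. \<psi> x *\<^sub>R wpart b (wpart b z) x \<partial>Lb)
      - (\<integral>x. pder b (\<lambda>x. pder b \<psi> x) x *\<^sub>R z x \<partial>Lb))"
  proof (rule sum.cong[OF refl])
    fix b :: "plane" assume b: "b \<in> Basis"
    show "(\<integral>x. ((nu x \<bullet> b) * \<psi> x) *\<^sub>R G b x \<partial>sg) = (\<integral>x. \<psi> x *\<^sub>R wpart b (wpart b z) x \<partial>Lb)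
      - (\<integral>x. pder b (\<lambda>x. pder b \<psi> x) x *\<^sub>R z x \<partial>Lb)"
      unfolding L2_norm_sg_tendsto_imp[OF G[OF b] b C]
      using H10_partial_by_parts[OF z C_inf_imp_C_k[OF C_inf_partial[OF \<psi> b]] b] by simp
  qed
  also have "\<dots> = (\<Sum>b\<in>Basis. \<integral>x. \<psi> x *\<^sub>R wpart b (wpart b z) x
      - pder b (\<lambda>x. pder b \<psi> x) x *\<^sub>R z x \<partial>Lb)"
    by (intro sum.cong refl Bochner_Integration.integral_diff[symmetric] L2_integrable_scaleR \<psi>L zL
        Sobolev_H1_weak_partial(1) v continuous_imp_L2 C_1_continuous_partial C_inf_imp_C_k[OF C_inf_partial[OF \<psi>]])
  also have "\<dots> = (\<integral>x. (\<Sum>b\<in>Basis. \<psi> x *\<^sub>R wpart b (wpart b z) x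
      - pder b (\<lambda>x. pder b \<psi> x) x *\<^sub>R z x) \<partial>Lb)"
    by (intro Bochner_Integration.integral_sum[symmetric] Bochner_Integration.integrable_diff L2_integrable_scaleR \<psi>L zL
        Sobolev_H1_weak_partial(1) v continuous_imp_L2 C_1_continuous_partial C_inf_imp_C_k[OF C_inf_partial[OF \<psi>]])
  also have "\<dots> = (\<integral>x. \<psi> x *\<^sub>R (laplacian Om z x - \<mu> *\<^sub>R z x) \<partial>Lb)"
    by (intro Bochner_Integration.integral_cong refl)
      (simp add: sum_subtractf scaleR_sum_left[symmetric] \<mu> laplacian_def scaleR_sum_right scaleR_diff_right mult.commute)
  finally show ?thesis .
qed

text \<open>Boundary values are arbitrary here, so the cut-off products need not converge in
  \<open>H1\<close>; their L2 convergence is enough for \<open>sine_conv\<close>.\<close>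

lemma sine_conv_tensor:
  assumes a: "\<And>k. smooth_upto k a" and b: "\<And>k. smooth_upto k b"
  shows "sine_conv (tensor a b (1::real))"
proof (rule sine_conv_limit)
  define \<phi> where "\<phi> n = tensor (\<lambda>s. a s * cutoff X1 n s) (\<lambda>t. b t * cutoff X2 n t) (1::real)" for n
  have ca: "continuous_on S a" "continuous_on S b" for S
    using continuous_on_subset[OF smooth_upto_continuous[OF a[of 0]]] continuous_on_subset[OF smooth_upto_continuous[OF b[of 0]]] by auto
  show "tensor a b 1 \<in> L2_space Lb"
    by (rule continuous_imp_L2[OF C_k_continuous[OF C_inf_imp_C_k[OF C_inf_tensor[OF a b]]]])
  have bd: "\<exists>K. \<forall>n s. \<bar>f s * cutoff X n s\<bar> \<le> K" if f: "\<And>S. continuous_on S f" for f and X :: real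
  proof -
    have "bounded (f ` {0..X})" by (intro compact_imp_bounded compact_continuous_image f) simp
    then obtain K where K: "\<And>s. s \<in> {0..X} \<Longrightarrow> \<bar>f s\<bar> \<le> K" unfolding bounded_iff real_norm_def ball_simps by blast
    have "\<bar>f s * cutoff X n s\<bar> \<le> \<bar>K\<bar>" for n s
    proof (cases "cutoff X n s = 0")
      case False
      from cutoff_support[OF this] have "1 / real (Suc n) \<le> s" "s \<le> X - 1 / real (Suc n)" by auto
      moreover have "1 / real (Suc n) > 0" by simp
      ultimately have "0 \<le> s" "s \<le> X" by linarith+
      then have "s \<in> {0..X}" by simp
      then have "\<bar>f s\<bar> * \<bar>cutoff X n s\<bar> \<le> \<bar>K\<bar> * 1"
        using K[of s] cutoff_bounds[of X n s] by (intro mult_mono) auto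
      then show ?thesis by (simp add: abs_mult)
    qed simp
    then show ?thesis by blast
  qed
  obtain K where K: "\<And>n s. \<bar>a s * cutoff X1 n s\<bar> \<le> K" using bd[OF ca(1), of X1] by blast
  obtain J where J: "\<And>n s. \<bar>b s * cutoff X2 n s\<bar> \<le> J" using bd[OF ca(2), of X2] by blast
  have sm: "smooth_upto k (\<lambda>s. a s * cutoff X1 n s)" "smooth_upto k (\<lambda>s. b s * cutoff X2 n s)" for k n
    by (rule smooth_upto_mult[OF a smooth_upto_cutoff], rule smooth_upto_mult[OF b smooth_upto_cutoff])
  show "sine_conv (\<phi> n)" for n
  proof (rule sine_conv_test_function, rule test_functionsI)
    show "C_inf (\<phi> n)" unfolding \<phi>_def by (intro C_inf_tensor sm)
    define r where "r = 1 / real (Suc n)"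
    have r: "r > 0" by (simp add: r_def)
    let ?K = "{r .. X1 - r} \<times> {r .. X2 - r}"
    show "compact ?K" by (intro compact_Times) auto
    have "{r .. X1 - r} \<subseteq> {0<..<X1}" "{r .. X2 - r} \<subseteq> {0<..<X2}" using r by auto
    then show "?K \<subseteq> Om" unfolding rect_def by (rule Sigma_mono)
    show "x \<in> ?K" if "\<phi> n x \<noteq> 0" for x
    proof -
      have "cutoff X1 n (fst x) \<noteq> 0" "cutoff X2 n (snd x) \<noteq> 0" using that by (auto simp: \<phi>_def tensor_def)
      then show ?thesis unfolding r_def by (cases x) (auto dest!: cutoff_support simp del: of_nat_Suc)
    qed
  qed
  have l: "(\<lambda>n. f s * cutoff X n s) \<longlonglongrightarrow> f s" if "s \<in> {0<..<X}" for f s X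
    using tendsto_mult_left[OF cutoff_tendsto[of X s], of "f s"] that by simp
  show "(\<lambda>n. L2_norm Lb (\<lambda>x. \<phi> n x - tensor a b 1 x)) \<longlonglongrightarrow> 0"
    unfolding \<phi>_def
    by (rule tensor_L2_convergence[where K = K and J = J])
      (intro smooth_upto_continuous[OF sm(1)[of 0]] smooth_upto_continuous[OF sm(2)[of 0]] ca K J l; assumption)+
qed

text \<open>Equal to a sine on the left edge and zero on the other three, and an eigenfunction of
  the Laplacian because the other factor is affine. Testing with it reads off one sine coefficient
  of the normal derivative on that edge; \<open>lift_top\<close> does the same on the top
  edge.\<close>

definition lift_left :: "nat \<Rightarrow> plane \<Rightarrow> real" where
  "lift_left l = tensor (\<lambda>s. (- 1 / X1) * s + 1) (\<lambda>t. sin (freq X2 l * t)) 1"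

definition lift_top :: "nat \<Rightarrow> plane \<Rightarrow> real" where
  "lift_top k = tensor (\<lambda>s. sin (freq X1 k * s)) (\<lambda>t. (1 / X2) * t + 0) 1"

lemma sine_conv_lift: "sine_conv (lift_left l)" "sine_conv (lift_top k)"
  unfolding lift_left_def lift_top_def by (intro sine_conv_tensor smooth_upto_linear smooth_upto_sin)+

lemma C_inf_lift: "C_inf (lift_left l)" "C_inf (lift_top k)"
  unfolding lift_left_def lift_top_def by (intro C_inf_tensor smooth_upto_linear smooth_upto_sin)+

lemma laplacian_lift:
  "(\<Sum>b\<in>Basis. pder b (\<lambda>x. pder b (lift_left l) x) x) = - (freq X2 l)\<^sup>2 * lift_left l x"
  "(\<Sum>b\<in>Basis. pder b (\<lambda>x. pder b (lift_top k) x) x) = - (freq X1 k)\<^sup>2 * lift_top k x"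
proof -
  have s: "((\<lambda>s. sin (w * s)) has_real_derivative w * cos (w * x)) (at x)" for w x :: real
    by (auto intro!: derivative_eq_intros)
  have c: "((\<lambda>s. w * cos (w * s)) has_real_derivative - (w\<^sup>2) * sin (w * x)) (at x)" for w x :: real
    by (auto intro!: derivative_eq_intros simp: power2_eq_square)
  have l: "((\<lambda>s. a * s + b) has_real_derivative a) (at x)" for a b x :: real
    by (auto intro!: derivative_eq_intros)
  have k: "((\<lambda>s. a) has_real_derivative 0) (at x)" for a x :: real by simp
  show "(\<Sum>b\<in>Basis. pder b (\<lambda>x. pder b (lift_left l) x) x) = - (freq X2 l)\<^sup>2 * lift_left l x"
  proof -
    have "pder (1, 0) (\<lambda>x. pder (1, 0) (lift_left l) x) x = 0"
      unfolding lift_left_def frechet_tensor(1)[OF l s]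
      using fun_cong[OF frechet_tensor(1)[OF k s], of "- 1 / X1" "freq X2 l" "1::real" x] by (simp add: tensor_def)
    moreover have "pder (0, 1) (\<lambda>x. pder (0, 1) (lift_left l) x) x = - (freq X2 l)\<^sup>2 * lift_left l x"
      unfolding lift_left_def frechet_tensor(2)[OF l s]
      using fun_cong[OF frechet_tensor(2)[OF l c], of "- 1 / X1" 1 "freq X2 l" "1::real" x] by (simp add: tensor_def)
    ultimately show ?thesis by (simp add: Basis_real_prod)
  qed
  show "(\<Sum>b\<in>Basis. pder b (\<lambda>x. pder b (lift_top k) x) x) = - (freq X1 k)\<^sup>2 * lift_top k x"
  proof -
    have "pder (1, 0) (\<lambda>x. pder (1, 0) (lift_top k) x) x = - (freq X1 k)\<^sup>2 * lift_top k x" for k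
      unfolding lift_top_def frechet_tensor(1)[OF s l]
      using fun_cong[OF frechet_tensor(1)[OF c l], of "freq X1 k" "1 / X2" 0 "1::real" x] by (simp add: tensor_def)
    moreover have "pder (0, 1) (\<lambda>x. pder (0, 1) (lift_top k') x) x = 0" for k'
      unfolding lift_top_def frechet_tensor(2)[OF s l]
      using fun_cong[OF frechet_tensor(2)[OF s k], of "freq X1 k'" "1 / X2" "1::real" x] by (simp add: tensor_def)
    ultimately show ?thesis by (simp add: Basis_real_prod)
  qed
qed

lemma integral_linear_sin:
  assumes X: "X > 0"
  shows "(\<integral>s. sin (freq X k * s) * (a * s + b) \<partial>lborel_on {0<..<X}) = (b + (-1) ^ k * (a * X + b)) / freq X k"
proof -
  let ?w = "freq X k"
  have w: "?w > 0" by (rule freq_pos[OF X])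
  have "(\<integral>s. sin (?w * s) * (a * s + b) \<partial>lborel_on {0<..<X}) =
      (\<lambda>s. a * sin (?w * s) / ?w\<^sup>2 - (a * s + b) * cos (?w * s) / ?w) X - (\<lambda>s. a * sin (?w * s) / ?w\<^sup>2 - (a * s + b) * cos (?w * s) / ?w) 0"
  proof (rule integral_lborel_on_interval_FTC)
    show "((\<lambda>s. a * sin (?w * s) / ?w\<^sup>2 - (a * s + b) * cos (?w * s) / ?w) has_vector_derivative sin (?w * x) * (a * x + b)) (at x)" for x
      unfolding has_real_derivative_iff_has_vector_derivative[symmetric]
      using w by (auto intro!: derivative_eq_intros simp: field_simps power2_eq_square)
  qed (use X in \<open>auto intro!: continuous_intros\<close>)
  also have "\<dots> = (b + (-1) ^ k * (a * X + b)) / ?w"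
    using sin_freq_end[OF X, of k] cos_freq_end[OF X, of k] by (simp add: add_divide_distrib mult.commute)
  finally show ?thesis .
qed

lemma coef_lift:
  "coef (lift_left l) i = (if snd i = l then X2 / (2 * freq X1 (fst i)) else 0)"
  "coef (lift_top k) i = (if fst i = k then (-1) ^ snd i * X1 / (2 * freq X2 (snd i)) else 0)"
proof -
  have "coef (lift_left l) i = (\<integral>x. tensor (\<lambda>s. sin (freq X1 (fst i) * s) * ((- 1 / X1) * s + 1)) (\<lambda>t. sin (freq X2 (snd i) * t) * sin (freq X2 l * t)) (1::real) x \<partial>Lb)"
    unfolding coef_def by (intro Bochner_Integration.integral_cong refl) (simp only: sine_def lift_left_def tensor_def real_scaleR_def mult_1_right ac_simps)
  also have "\<dots> = (\<integral>s. sin (freq X1 (fst i) * s) * ((- 1 / X1) * s + 1) \<partial>I1) * (\<integral>t. sin (freq X2 (snd i) * t) * sin (freq X2 l * t) \<partial>I2)"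
    by (subst integral_tensor) (use X1 X2 in \<open>auto intro!: continuous_intros\<close>)
  also have "\<dots> = (if snd i = l then X2 / (2 * freq X1 (fst i)) else 0)"
    unfolding integral_linear_sin[OF X1] integral_sin_sin[OF X2] using less_imp_neq[OF X1, symmetric] by simp
  finally show "coef (lift_left l) i = (if snd i = l then X2 / (2 * freq X1 (fst i)) else 0)" .
  have "coef (lift_top k) i = (\<integral>x. tensor (\<lambda>s. sin (freq X1 (fst i) * s) * sin (freq X1 k * s)) (\<lambda>t. sin (freq X2 (snd i) * t) * ((1 / X2) * t + 0)) (1::real) x \<partial>Lb)"
    unfolding coef_def by (intro Bochner_Integration.integral_cong refl) (simp only: sine_def lift_top_def tensor_def real_scaleR_def mult_1_right ac_simps)
  also have "\<dots> = (\<integral>s. sin (freq X1 (fst i) * s) * sin (freq X1 k * s) \<partial>I1) * (\<integral>t. sin (freq X2 (snd i) * t) * ((1 / X2) * t + 0) \<partial>I2)"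
    by (subst integral_tensor) (use X1 X2 in \<open>auto intro!: continuous_intros\<close>)
  also have "\<dots> = (if fst i = k then (-1) ^ snd i * X1 / (2 * freq X2 (snd i)) else 0)"
    unfolding integral_linear_sin[OF X2] integral_sin_sin[OF X1] using less_imp_neq[OF X2, symmetric] by simp
  finally show "coef (lift_top k) i = (if fst i = k then (-1) ^ snd i * X1 / (2 * freq X2 (snd i)) else 0)" .
qed

text \<open>Green's formula and Parseval combine: the Laplacian contributes a difference of
  eigenvalues, the explicit lift coefficient divides by a frequency. The weights are those of a
  termwise normal derivative of the sines, obtained without differentiating the series.\<close>

lemma normal_derivative_series:
  fixes z :: "plane \<Rightarrow> 'b::euclidean_space"
  assumes z: "z \<in> H10" and h: "has_normal_derivative Om sg nu z h" and hm: "h \<in> borel_measurable sg"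
  shows "(\<lambda>n. \<Sum>i\<in>Q n. (if snd i = l then - freq X1 (fst i) / Nn else 0) *\<^sub>R coef z i) \<longlonglongrightarrow> (2 / X2) *\<^sub>R (\<integral>x. lift_left l x *\<^sub>R h x \<partial>sg)"
    and "(\<lambda>n. \<Sum>i\<in>Q n. (if fst i = k then - ((-1) ^ snd i * freq X2 (snd i)) / Nn else 0) *\<^sub>R coef z i) \<longlonglongrightarrow> (2 / X1) *\<^sub>R (\<integral>x. lift_top k x *\<^sub>R h x \<partial>sg)"
proof -
  have z2: "z \<in> Sobolev_H2 Om" using h by (simp add: has_normal_derivative_def)
  note lap = coef_laplacian[OF z z2]
  have zL: "z \<in> L2_space Lb" by (intro Sobolev_H1_L2 Sobolev_H10_H1 z)
  have key: "(\<lambda>n. \<Sum>i\<in>Q n. (c * (coef \<psi> i / Nn) * (w\<^sup>2 - lam i)) *\<^sub>R coef z i) \<longlonglongrightarrow> c *\<^sub>R (\<integral>x. \<psi> x *\<^sub>R h x \<partial>sg)"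
    if \<psi>: "sine_conv \<psi>" "C_inf \<psi>" and
      w: "\<And>x. (\<Sum>b\<in>Basis. pder b (\<lambda>x. pder b \<psi> x) x) = - (w\<^sup>2) * \<psi> x" for \<psi> w c
  proof -
    have uL: "(\<lambda>x. laplacian Om z x - (- (w\<^sup>2)) *\<^sub>R z x) \<in> L2_space Lb"
      by (intro L2_space_diff lap L2_space_scaleR zL)
    have cu: "coef (\<lambda>x. laplacian Om z x - (- (w\<^sup>2)) *\<^sub>R z x) i = (w\<^sup>2 - lam i) *\<^sub>R coef z i" for i
      unfolding coef_diff[OF lap(1) L2_space_scaleR[OF zL]] lap(2) coef_linear[OF zL bounded_linear_scaleR_right]
      by (simp add: scaleR_left_diff_distrib)
    from tendsto_scaleR[OF tendsto_const parseval[OF \<psi>(1) uL], of c]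
    show ?thesis unfolding green_H10[OF z h hm \<psi>(2) w] cu by (simp add: scaleR_sum_right mult_ac)
  qed
  \<comment> \<open>For \<open>snd i = l\<close> the difference of eigenvalues is
    \<open>- (freq X1 (fst i))\<^sup>2\<close>, and the lift coefficient cancels one power of this
    frequency.\<close>
  have "2 / X2 * (coef (lift_left l) i / Nn) * ((freq X2 l)\<^sup>2 - lam i) = (if snd i = l then - freq X1 (fst i) / Nn else 0)" for i
    using X1 X2 freq_pos[OF X1, of "fst i"] by (auto simp: coef_lift lam_def power2_eq_square)
  then show "(\<lambda>n. \<Sum>i\<in>Q n. (if snd i = l then - freq X1 (fst i) / Nn else 0) *\<^sub>R coef z i) \<longlonglongrightarrow> (2 / X2) *\<^sub>R (\<integral>x. lift_left l x *\<^sub>R h x \<partial>sg)"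
    using key[OF sine_conv_lift(1)[of l] C_inf_lift(1) laplacian_lift(1), of "2 / X2"] by (simp only:)
  \<comment> \<open>The sign \<open>(-1) ^ snd i\<close> comes from the cosine at the upper end of
    the second variable.\<close>
  have "2 / X1 * (coef (lift_top k) i / Nn) * ((freq X1 k)\<^sup>2 - lam i) = (if fst i = k then - ((-1) ^ snd i * freq X2 (snd i)) / Nn else 0)" for i
    using X1 X2 freq_pos[OF X2, of "snd i"] by (auto simp: coef_lift lam_def power2_eq_square)
  then show "(\<lambda>n. \<Sum>i\<in>Q n. (if fst i = k then - ((-1) ^ snd i * freq X2 (snd i)) / Nn else 0) *\<^sub>R coef z i) \<longlonglongrightarrow> (2 / X1) *\<^sub>R (\<integral>x. lift_top k x *\<^sub>R h x \<partial>sg)"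
    using key[OF sine_conv_lift(2)[of k] C_inf_lift(2) laplacian_lift(2), of "2 / X1"] by (simp only:)
qed

end

section \<open>Coefficient description of the dual space\<close>

lemma borel_measurable_cdot:
  fixes f g :: "'a \<Rightarrow> complex^'n"
  assumes "f \<in> borel_measurable M" "g \<in> borel_measurable M"
  shows "(\<lambda>x. cdot (f x) (g x)) \<in> borel_measurable M"
  by (rule borel_measurable_continuous_Pair[OF assms])
    (intro bounded_bilinear.continuous_on[OF bounded_bilinear_cdot] continuous_intros)

text \<open>Counting measure makes square-summable families an instance of \<open>L2_space\<close>,
  so Cauchy--Schwarz and the density criterion apply to them unchanged.\<close>

abbreviation "CS \<equiv> count_space (UNIV :: (nat \<times> nat) set)"

context rectangle
begin

lemma sum_Q_integral: "(\<Sum>i\<in>Q n. f i) = (\<integral>i. indicator (Q n) i *\<^sub>R f i \<partial>CS)"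
  for f :: "nat \<times> nat \<Rightarrow> 'b::{banach, second_countable_topology}"
proof -
  have fin: "finite {i. indicator (Q n) i *\<^sub>R f i \<noteq> 0}"
    by (rule finite_subset[OF _ finite_Q[of n]]) (auto simp: indicator_def)
  then show ?thesis
    by (subst lebesgue_integral_count_space_finite_support) (auto intro!: sum.mono_neutral_cong_right simp: indicator_def)
qed

lemma eventually_in_Q: "\<forall>\<^sub>F n in sequentially. i \<in> Q n"
  by (rule eventually_sequentiallyI[of "Suc (max (fst i) (snd i))"]) (cases i; auto simp: Q_def)

text \<open>Absolute summability, expressed as integrability, makes the square partial sums converge
  by dominated convergence.\<close>

lemma Q_limit:
  fixes f :: "nat \<times> nat \<Rightarrow> 'b::{banach, second_countable_topology}"
  assumes "integrable CS f"
  shows "(\<lambda>n. \<Sum>i\<in>Q n. f i) \<longlonglongrightarrow> (\<integral>i. f i \<partial>CS)"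
  unfolding sum_Q_integral
proof (rule integral_dominated_convergence)
  show "integrable CS (\<lambda>i. norm (f i))" using assms by simp
  show "AE i in CS. (\<lambda>n. indicator (Q n) i *\<^sub>R f i) \<longlonglongrightarrow> f i"
  proof (rule AE_I2)
    fix i
    show "(\<lambda>n. indicator (Q n) i *\<^sub>R f i) \<longlonglongrightarrow> f i"
      by (rule tendsto_eventually) (use eventually_in_Q[of i] in \<open>auto elim: eventually_mono\<close>)
  qed
qed (auto simp: indicator_def)

lemma L2_CS_I:
  fixes u :: "nat \<times> nat \<Rightarrow> 'b::euclidean_space"
  assumes b: "\<And>n. (\<Sum>i\<in>Q n. (norm (u i))\<^sup>2) \<le> C"
  shows "u \<in> L2_space CS" and "(L2_norm CS u)\<^sup>2 \<le> C"
proof -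
  have C: "C \<ge> 0" using b[of 0] by (simp add: Q_def)
  have "(\<integral>\<^sup>+i. ennreal ((norm (u i))\<^sup>2) \<partial>CS) = (\<integral>\<^sup>+i. (SUP n. indicator (Q n) i * ennreal ((norm (u i))\<^sup>2)) \<partial>CS)"
  proof (rule nn_integral_cong, rule sym, rule antisym)
    fix i
    show "(SUP n. indicator (Q n) i * ennreal ((norm (u i))\<^sup>2)) \<le> ennreal ((norm (u i))\<^sup>2)"
      by (rule SUP_least) (auto simp: indicator_def)
    obtain n where "i \<in> Q n" using eventually_happens[OF eventually_in_Q[of i]] by auto
    then show "ennreal ((norm (u i))\<^sup>2) \<le> (SUP n. indicator (Q n) i * ennreal ((norm (u i))\<^sup>2))"
      by (intro SUP_upper2[of n]) auto
  qed
  also have "\<dots> = (SUP n. \<integral>\<^sup>+i. indicator (Q n) i * ennreal ((norm (u i))\<^sup>2) \<partial>CS)"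
    by (rule nn_integral_monotone_convergence_SUP)
      (auto simp: incseq_def le_fun_def indicator_def dest: Q_mono)
  also have "\<dots> \<le> ennreal C"
  proof (rule SUP_least)
    fix n
    have "(\<integral>\<^sup>+i. indicator (Q n) i * ennreal ((norm (u i))\<^sup>2) \<partial>CS) = (\<Sum>i\<in>Q n. ennreal ((norm (u i))\<^sup>2))"
      by (subst nn_integral_count_space'[of "Q n"]) (auto simp: indicator_def)
    also have "\<dots> \<le> ennreal C" using b[of n] by (subst sum_ennreal) (auto intro: ennreal_leI)
    finally show "(\<integral>\<^sup>+i. indicator (Q n) i * ennreal ((norm (u i))\<^sup>2) \<partial>CS) \<le> ennreal C" .
  qed
  finally have le: "(\<integral>\<^sup>+i. ennreal ((norm (u i))\<^sup>2) \<partial>CS) \<le> ennreal ((sqrt C)\<^sup>2)" using C by simp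
  show "u \<in> L2_space CS" by (rule L2_from_nn_bound(1)[OF _ _ le]) (use C in auto)
  have "L2_norm CS u \<le> sqrt C" by (rule L2_from_nn_bound(2)[OF _ _ le]) (use C in auto)
  then show "(L2_norm CS u)\<^sup>2 \<le> C" using C by (metis L2_norm_nonneg power_mono real_sqrt_pow2)
qed

lemma L2_CS_sum_le:
  fixes u :: "nat \<times> nat \<Rightarrow> 'b::euclidean_space"
  assumes "u \<in> L2_space CS"
  shows "(\<Sum>i\<in>Q n. (norm (u i))\<^sup>2) \<le> (L2_norm CS u)\<^sup>2"
  unfolding sum_Q_integral L2_norm_sq
proof (rule integral_mono)
  show "integrable CS (\<lambda>i. indicator (Q n) i *\<^sub>R (norm (u i))\<^sup>2)"
    by (rule Bochner_Integration.integrable_bound[OF L2_space_integrable_sq[OF assms]]) (auto simp: indicator_def)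
qed (auto simp: indicator_def L2_space_integrable_sq[OF assms])

text \<open>
  \<open>Fn b\<close> is the functional with sine coefficients \<open>b\<close>; \<open>hm1 b\<close> makes it bounded, as the \<open>H\<^sup>1\<close> norm of \<open>\<zeta>\<close> dominates the
  \<open>\<ell>\<^sup>2\<close> norm of \<open>sqrt (lam i) *\<^sub>R coef \<zeta> i\<close>.
\<close>

definition hm1 :: "(nat \<times> nat \<Rightarrow> complex^'n) \<Rightarrow> bool" where
  "hm1 b \<longleftrightarrow> (\<lambda>i. b i /\<^sub>R sqrt (lam i)) \<in> L2_space CS"

definition hnorm :: "(nat \<times> nat \<Rightarrow> complex^'n) \<Rightarrow> real" where
  "hnorm b = L2_norm CS (\<lambda>i. b i /\<^sub>R sqrt (lam i))"

definition Fn :: "(nat \<times> nat \<Rightarrow> complex^'n) \<Rightarrow> (plane \<Rightarrow> complex^'n) \<Rightarrow> complex" where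
  "Fn b \<zeta> = (1 / Nn) *\<^sub>R (\<integral>i. cdot (b i) (coef \<zeta> i) \<partial>CS)"

lemma hm1_diff: "hm1 b \<Longrightarrow> hm1 c \<Longrightarrow> hm1 (\<lambda>i. b i - c i)"
  using L2_space_diff[of "\<lambda>i. b i /\<^sub>R sqrt (lam i)" CS "\<lambda>i. c i /\<^sub>R sqrt (lam i)"] by (simp add: hm1_def scaleR_diff_right)

lemma coef_weighted_L2:
  fixes \<zeta> :: "plane \<Rightarrow> complex^'n"
  assumes "\<zeta> \<in> H10"
  shows "(\<lambda>i. sqrt (lam i) *\<^sub>R coef \<zeta> i) \<in> L2_space CS"
    and "L2_norm CS (\<lambda>i. sqrt (lam i) *\<^sub>R coef \<zeta> i) \<le> sqrt Nn * H1_norm Om \<zeta>"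
proof -
  have b: "(\<Sum>i\<in>Q n. (norm (sqrt (lam i) *\<^sub>R coef \<zeta> i))\<^sup>2) \<le> Nn * (H1_norm Om \<zeta>)\<^sup>2" for n
  proof -
    have "(\<Sum>i\<in>Q n. (norm (sqrt (lam i) *\<^sub>R coef \<zeta> i))\<^sup>2) = Nn * (\<Sum>i\<in>Q n. lam i * (norm (coef \<zeta> i))\<^sup>2 / Nn)"
      using Nn_pos lam_pos by (simp add: sum_distrib_left power_mult_distrib less_imp_le)
    also have "\<dots> \<le> Nn * (H1_norm Om \<zeta>)\<^sup>2" using coef_H1_bound[OF assms] Nn_pos by (intro mult_left_mono) auto
    finally show ?thesis .
  qed
  show "(\<lambda>i. sqrt (lam i) *\<^sub>R coef \<zeta> i) \<in> L2_space CS" by (rule L2_CS_I(1)[OF b])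
  show "L2_norm CS (\<lambda>i. sqrt (lam i) *\<^sub>R coef \<zeta> i) \<le> sqrt Nn * H1_norm Om \<zeta>"
    by (rule power2_le_imp_le) (use L2_CS_I(2)[OF b] Nn_pos in \<open>auto simp: power_mult_distrib\<close>)
qed

lemma Fn_bound:
  assumes b: "hm1 b" and \<zeta>: "\<zeta> \<in> H10"
  shows "integrable CS (\<lambda>i. cdot (b i) (coef \<zeta> i))"
    and "norm (Fn b \<zeta>) \<le> hnorm b / sqrt Nn * H1_norm Om \<zeta>"
proof -
  \<comment> \<open>The weight \<open>sqrt (lam i)\<close> is moved from one factor to the other, so
    both sides of the duality become plain l2 norms.\<close>
  have le: "norm (cdot (b i) (coef \<zeta> i)) \<le> 1 * (norm (b i /\<^sub>R sqrt (lam i)) * norm (sqrt (lam i) *\<^sub>R coef \<zeta> i))" for i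
  proof -
    have "sqrt (lam i) > 0" using lam_pos by simp
    then show ?thesis using norm_cdot_le[of "b i" "coef \<zeta> i"] by (simp add: field_simps)
  qed
  note * = L2_bilinear[OF b[unfolded hm1_def] coef_weighted_L2(1)[OF \<zeta>] _ le]
  show "integrable CS (\<lambda>i. cdot (b i) (coef \<zeta> i))" by (rule *(1)) auto
  have "norm (\<integral>i. cdot (b i) (coef \<zeta> i) \<partial>CS) \<le> hnorm b * L2_norm CS (\<lambda>i. sqrt (lam i) *\<^sub>R coef \<zeta> i)"
    using *(2) by (simp add: hnorm_def)
  also have "\<dots> \<le> hnorm b * (sqrt Nn * H1_norm Om \<zeta>)"
    by (intro mult_left_mono coef_weighted_L2 \<zeta>) (simp add: hnorm_def)
  finally have "(1 / Nn) * norm (\<integral>i. cdot (b i) (coef \<zeta> i) \<partial>CS) \<le> (1 / Nn) * (hnorm b * (sqrt Nn * H1_norm Om \<zeta>))"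
    using Nn_pos by (intro mult_left_mono) auto
  also have "\<dots> = hnorm b / sqrt Nn * H1_norm Om \<zeta>"
    using Nn_pos by (simp add: field_simps)
  finally show "norm (Fn b \<zeta>) \<le> hnorm b / sqrt Nn * H1_norm Om \<zeta>" using Nn_pos by (simp add: Fn_def)
qed

lemma Fn_diff:
  assumes "hm1 b" "hm1 c" "\<zeta> \<in> H10"
  shows "Fn (\<lambda>i. b i - c i) \<zeta> = Fn b \<zeta> - Fn c \<zeta>"
  by (simp add: Fn_def cdot_diff_left Fn_bound(1) assms scaleR_diff_right)

lemma H10_L2: "\<zeta> \<in> H10 \<Longrightarrow> \<zeta> \<in> L2_space Lb"
  by (intro Sobolev_H1_L2 Sobolev_H10_H1)

lemma bounded_linear_smult: "bounded_linear (\<lambda>v::complex^'n. c *s v)"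
  by (rule bounded_bilinear.bounded_linear_right[OF bounded_bilinear_smult])

lemma Fn_Sobolev_Hm1: "hm1 b \<Longrightarrow> Fn b \<in> Sobolev_Hm1 Om"
proof -
  assume b: "hm1 b"
  have 1: "Fn b (\<lambda>x. u x + v x) = Fn b u + Fn b v" if "u \<in> H10" "v \<in> H10" for u v
    using that Fn_bound(1)[OF b] by (simp add: Fn_def coef_add H10_L2 cdot_add_right scaleR_add_right)
  have 2: "Fn b (\<lambda>x. c *s u x) = cnj c * Fn b u" if "u \<in> H10" for u c
    using that Fn_bound(1)[OF b that] by (simp add: Fn_def coef_linear[OF H10_L2 bounded_linear_smult] cdot_smult_right)
  show ?thesis unfolding Sobolev_Hm1_def using 1 2 Fn_bound(2)[OF b] by blast
qed

lemma zero_H10: "(\<lambda>x. 0 :: 'b::euclidean_space) \<in> H10" "H1_norm Om (\<lambda>x. 0 :: 'b) = 0"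
proof -
  show "(\<lambda>x. 0 :: 'b) \<in> H10" using sine_scaleR_H10[of "(0,0)" "0 :: 'b"] by simp
  have "L2_norm Lb (wpart b (\<lambda>x. 0 :: 'b)) = 0" for b
    using weak_partial_props(4)[of "\<lambda>x. 0 :: 'b" b "\<lambda>x. 0 :: 'b"] by (simp add: has_weak_partial_def)
  then show "H1_norm Om (\<lambda>x. 0 :: 'b) = 0" by (simp add: H1_norm_def)
qed

lemma Hm1_norm_le:
  fixes b :: "nat \<times> nat \<Rightarrow> complex^2"
  assumes b: "hm1 b" and F: "\<And>\<zeta>. \<zeta> \<in> H10 \<Longrightarrow> F \<zeta> = Fn b \<zeta>"
  shows "Hm1_norm Om F \<le> hnorm b / sqrt Nn"
  unfolding Hm1_norm_def
proof (rule cSUP_least)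
  have "(\<lambda>x. 0 :: complex^2) \<in> {\<zeta> \<in> H10. H1_norm Om \<zeta> \<le> 1}" by (simp add: zero_H10)
  then show "{\<zeta> \<in> H10. H1_norm Om (\<zeta> :: _ \<Rightarrow> complex^2) \<le> 1} \<noteq> {}" by blast
  fix \<zeta> :: "plane \<Rightarrow> complex^2" assume "\<zeta> \<in> {\<zeta> \<in> H10. H1_norm Om \<zeta> \<le> 1}"
  then have \<zeta>: "\<zeta> \<in> H10" "H1_norm Om \<zeta> \<le> 1" by auto
  have "norm (F \<zeta>) \<le> hnorm b / sqrt Nn * H1_norm Om \<zeta>" using Fn_bound(2)[OF b \<zeta>(1)] F[OF \<zeta>(1)] by simp
  also have "\<dots> \<le> hnorm b / sqrt Nn * 1"
    using \<zeta>(2) Nn_pos by (intro mult_left_mono) (auto simp: hnorm_def)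
  finally show "norm (F \<zeta>) \<le> hnorm b / sqrt Nn" by simp
qed

lemma ssum_H1_norm: "(H1_norm Om (ssum n c))\<^sup>2 = (\<Sum>i\<in>Q n. Nn * (1 + lam i) * (norm (c i))\<^sup>2)"
proof -
  \<comment> \<open>A finite sine sum is its own projection, so the error formula with error 0
    yields the norms of its derivatives.\<close>
  have pr: "proj n (ssum n c) = ssum n c"
    unfolding proj_def by (auto simp: ssum_def coef_ssum fun_eq_iff Nn_pos less_imp_neq[OF Nn_pos, symmetric] intro!: sum.cong)
  have p: "(L2_norm Lb (wpart b (ssum n c)))\<^sup>2 = (\<Sum>i\<in>Q n. (dfreq b i)\<^sup>2 * (Nn * (norm (c i))\<^sup>2))" if "b \<in> Basis" for b
  proof -
    have "(L2_norm Lb (wpart b (ssum n c)))\<^sup>2 = (\<Sum>i\<in>Q n. (dfreq b i)\<^sup>2 * (norm (coef (ssum n c) i))\<^sup>2 / Nn)"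
      using partial_proj_error[OF ssum_H10[of n c] that, of n] unfolding pr by simp
    also have "\<dots> = (\<Sum>i\<in>Q n. (dfreq b i)\<^sup>2 * (Nn * (norm (c i))\<^sup>2))"
      using Nn_pos by (intro sum.cong refl) (simp add: coef_ssum power_mult_distrib power2_eq_square)
    finally show ?thesis .
  qed
  have B: "(1,0) \<in> (Basis :: plane set)" "(0,1) \<in> (Basis :: plane set)" by (auto simp: Basis_real_prod)
  show ?thesis
    unfolding H1_norm_sq ssum_norm p[OF B(1)] p[OF B(2)] sum_dfreq[symmetric] sum.distrib[symmetric]
    by (intro sum.cong refl) (simp add: algebra_simps)
qed

lemma lam_ge: "lam (0,0) \<le> lam i"
proof -
  have "freq X 0 \<le> freq X k" if "X > 0" for X k using that by (simp add: freq_def divide_right_mono)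
  then show ?thesis unfolding lam_def using X1 X2 freq_pos by (intro add_mono power_mono) (auto intro: less_imp_le)
qed

lemma inverse_sqrt_lam_le: "1 / sqrt (lam i) \<le> 1 / sqrt (lam (0,0))"
  using lam_ge[of i] lam_pos[of "(0,0)"] by (intro divide_left_mono) (auto intro: lam_pos)

lemma Hm1_linear:
  assumes F: "F \<in> Sobolev_Hm1 Om"
  shows "u \<in> H10 \<Longrightarrow> v \<in> H10 \<Longrightarrow> F (\<lambda>x. u x + v x) = F u + F v"
    and "u \<in> H10 \<Longrightarrow> F (\<lambda>x. c *s u x) = cnj c * F u"
    and "u \<in> H10 \<Longrightarrow> v \<in> H10 \<Longrightarrow> F (\<lambda>x. u x - v x) = F u - F v"
proof -
  show a: "F (\<lambda>x. u x + v x) = F u + F v" if "u \<in> H10" "v \<in> H10" for u v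
    using F that by (auto simp: Sobolev_Hm1_def)
  show s: "F (\<lambda>x. c *s u x) = cnj c * F u" if "u \<in> H10" for u c
    using F that by (auto simp: Sobolev_Hm1_def)
  show "F (\<lambda>x. u x - v x) = F u - F v" if "u \<in> H10" "v \<in> H10"
    using a[OF that(1) Sobolev_H10_linear[OF that(2) bounded_linear_smult[of "-1"]]] s[OF that(2), of "-1"] by simp
qed

lemma Hm1_coefficients:
  fixes F :: "(plane \<Rightarrow> complex^2) \<Rightarrow> complex"
  assumes F: "F \<in> Sobolev_Hm1 Om"
  obtains b where "\<And>n c. F (ssum n c) = (\<Sum>i\<in>Q n. cdot (b i) (c i))"
proof -
  \<comment> \<open>\<open>F\<close> is antilinear, so its value on a sine times \<open>c\<close>
    involves the conjugates of the entries of \<open>c\<close>: exactly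
    \<open>cdot (b i) c\<close>.\<close>
  define b :: "nat \<times> nat \<Rightarrow> complex^2" where "b i = (\<chi> j. F (\<lambda>x. sine i x *\<^sub>R axis j 1))" for i
  have e: "F (\<lambda>x. sine i x *\<^sub>R c) = cdot (b i) c" for i c
  proof -
    have "(\<lambda>x. sine i x *\<^sub>R c) = (\<lambda>x. c $ 1 *s (sine i x *\<^sub>R axis 1 1) + c $ 2 *s (sine i x *\<^sub>R axis 2 1))"
      by (auto simp: fun_eq_iff vec_eq_iff forall_2 axis_def scaleR_eq_smult mult.commute)
    then show ?thesis
      by (simp add: Hm1_linear[OF F] sine_scaleR_H10 Sobolev_H10_linear[OF sine_scaleR_H10 bounded_linear_smult] cdot_def sum_2 b_def mult.commute)
  qed
  have z: "F (\<lambda>x. 0) = 0" using e[of "(0,0)" 0] by simp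
  have s: "finite I \<Longrightarrow> F (\<lambda>x. \<Sum>i\<in>I. sine i x *\<^sub>R c i) = (\<Sum>i\<in>I. cdot (b i) (c i)) \<and> (\<lambda>x. \<Sum>i\<in>I. sine i x *\<^sub>R c i) \<in> H10" for I c
  proof (induction I rule: finite_induct)
    case empty then show ?case using z sine_scaleR_H10[of "(0,0)" "0 :: complex^2"] by simp
  next
    case (insert i I)
    then show ?case using Hm1_linear(1)[OF F sine_scaleR_H10[of i "c i"]] e Sobolev_H10_add[OF sine_scaleR_H10[of i "c i"]] by simp
  qed
  have "F (ssum n c) = (\<Sum>i\<in>Q n. cdot (b i) (c i))" for n c
    using s[OF finite_Q, of c n] unfolding ssum_def[abs_def] by blast
  then show ?thesis by (rule that)
qed

text \<open>Riesz representation by duality: on the sine sum with coefficients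
  \<open>b i /\<^sub>R lam i\<close> the functional equals \<open>S\<close>, while the squared norm
  of that sum is at most \<open>K * S\<close>; this bounds \<open>S\<close> independently of
  \<open>n\<close>. Convergence of projections in \<open>H1\<close> does the rest.\<close>

theorem Hm1_representation:
  fixes F :: "(plane \<Rightarrow> complex^2) \<Rightarrow> complex"
  assumes F: "F \<in> Sobolev_Hm1 Om"
  obtains b where "hm1 b" "\<And>\<zeta>. \<zeta> \<in> H10 \<Longrightarrow> F \<zeta> = Fn b \<zeta>"
proof -
  obtain b where b: "\<And>n c. F (ssum n c) = (\<Sum>i\<in>Q n. cdot (b i) (c i))" using Hm1_coefficients[OF F] by blast
  obtain C0 where C0: "\<And>u. u \<in> H10 \<Longrightarrow> norm (F u) \<le> C0 * H1_norm Om u"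
    using F unfolding Sobolev_Hm1_def by blast
  define C where "C = \<bar>C0\<bar>"
  have C: "norm (F u) \<le> C * H1_norm Om u" if "u \<in> H10" for u
    using C0[OF that] mult_right_mono[OF abs_ge_self[of C0] H1_norm_nonneg[of u]] by (simp add: C_def)
  \<comment> \<open>Bounds \<open>Nn * (1 / lam i + 1)\<close> for all \<open>i\<close>, since
    \<open>lam (0,0)\<close> is the smallest eigenvalue.\<close>
  define K where "K = Nn * (1 / lam (0,0) + 1)"
  have K: "K > 0" using Nn_pos lam_pos[of "(0,0)"] by (simp add: K_def add_pos_pos)
  have S: "(\<Sum>i\<in>Q n. (norm (b i /\<^sub>R sqrt (lam i)))\<^sup>2) \<le> C\<^sup>2 * K" for n
  proof -
    define S where "S = (\<Sum>i\<in>Q n. (norm (b i))\<^sup>2 / lam i)"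
    have S0: "S \<ge> 0" unfolding S_def by (intro sum_nonneg divide_nonneg_pos lam_pos) simp
    have eq: "(norm (b i /\<^sub>R sqrt (lam i)))\<^sup>2 = (norm (b i))\<^sup>2 / lam i" for i
      using lam_pos[of i] by (simp add: power_mult_distrib power_inverse divide_inverse mult.commute)
    let ?u = "ssum n (\<lambda>i. b i /\<^sub>R lam i)"
    have "F ?u = (\<Sum>i\<in>Q n. complex_of_real ((norm (b i))\<^sup>2 / lam i))"
      unfolding b
    proof (intro sum.cong refl)
      fix i
      have "cdot (b i) (b i) = complex_of_real ((norm (b i))\<^sup>2)"
        by (simp add: cdot_def power2_norm_eq_inner inner_vec_def complex_eq_iff inner_complex_def)
      then show "cdot (b i) (b i /\<^sub>R lam i) = complex_of_real ((norm (b i))\<^sup>2 / lam i)"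
        unfolding cdot_scaleR_right by (simp add: scaleR_conv_of_real divide_inverse mult.commute)
    qed
    then have "F ?u = complex_of_real S" by (simp only: S_def of_real_sum)
    then have FS: "norm (F ?u) = S" using S0 by simp
    have "(H1_norm Om ?u)\<^sup>2 \<le> K * S"
      unfolding ssum_H1_norm S_def sum_distrib_left
    proof (rule sum_mono)
      fix i
      have l: "lam i > 0" "lam (0,0) \<le> lam i" "lam (0,0) > 0" using lam_pos lam_ge by auto
      have "Nn * (1 + lam i) * (norm (b i /\<^sub>R lam i))\<^sup>2 = Nn * (1 / lam i + 1) * ((norm (b i))\<^sup>2 / lam i)"
        using l by (simp add: power_mult_distrib field_simps power2_eq_square)
      also have "\<dots> \<le> K * ((norm (b i))\<^sup>2 / lam i)"
        unfolding K_def using l Nn_pos by (intro mult_right_mono mult_left_mono add_right_mono) (auto intro: frac_le)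
      finally show "Nn * (1 + lam i) * (norm (b i /\<^sub>R lam i))\<^sup>2 \<le> K * ((norm (b i))\<^sup>2 / lam i)" .
    qed
    moreover have "S \<le> C * H1_norm Om ?u" using C[OF ssum_H10] FS by metis
    then have "S\<^sup>2 \<le> C\<^sup>2 * (H1_norm Om ?u)\<^sup>2" using S0 power_mono[of S "C * H1_norm Om ?u" 2] by (simp add: power_mult_distrib)
    ultimately have "S\<^sup>2 \<le> C\<^sup>2 * (K * S)" by (meson mult_left_mono order_trans zero_le_power2)
    then have "S * S \<le> (C\<^sup>2 * K) * S" by (simp add: power2_eq_square mult_ac)
    then have "S \<le> C\<^sup>2 * K" using S0 K by (cases "S = 0") (auto simp: mult_le_cancel_right)
    then show ?thesis by (simp only: eq S_def)
  qed
  have h: "hm1 b" unfolding hm1_def by (rule L2_CS_I(1)[OF S])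
  have "F \<zeta> = Fn b \<zeta>" if \<zeta>: "\<zeta> \<in> H10" for \<zeta>
  proof (rule LIMSEQ_unique)
    have pH: "proj n \<zeta> \<in> H10" for n unfolding proj_def by (rule ssum_H10)
    have "(\<lambda>n. F (proj n \<zeta>) - F \<zeta>) \<longlonglongrightarrow> 0"
    proof (rule Lim_null_comparison)
      show "\<forall>\<^sub>F n in sequentially. norm (F (proj n \<zeta>) - F \<zeta>) \<le> C * H1_norm Om (\<lambda>x. proj n \<zeta> x - \<zeta> x)"
        using C[OF Sobolev_H10_diff[OF pH \<zeta>]] by (simp add: Hm1_linear(3)[OF F pH \<zeta>])
      show "(\<lambda>n. C * H1_norm Om (\<lambda>x. proj n \<zeta> x - \<zeta> x)) \<longlonglongrightarrow> 0"
        by (rule tendsto_mult_right_zero[OF proj_H1_tendsto[OF \<zeta>]])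
    qed
    then show "(\<lambda>n. F (proj n \<zeta>)) \<longlonglongrightarrow> F \<zeta>" by (rule LIM_zero_cancel)
    have "F (proj n \<zeta>) = (1 / Nn) *\<^sub>R (\<Sum>i\<in>Q n. cdot (b i) (coef \<zeta> i))" for n
      unfolding proj_def b by (simp add: cdot_scaleR_right scaleR_sum_right divide_inverse)
    then show "(\<lambda>n. F (proj n \<zeta>)) \<longlonglongrightarrow> Fn b \<zeta>"
      unfolding Fn_def using tendsto_scaleR[OF tendsto_const Q_limit[OF Fn_bound(1)[OF h \<zeta>]], of "1 / Nn"] by simp
  qed
  with h show ?thesis by (rule that)
qed

text \<open>Dominated convergence over the modes, with the time-independent majorant
  \<open>D\<close>; each single mode is continuous. Limits in time are taken along
  sequences.\<close>

lemma Fn_continuous: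
  fixes b :: "real \<Rightarrow> nat \<times> nat \<Rightarrow> complex^2"
  assumes c: "\<And>i. continuous_on {0..T} (\<lambda>t. b t i)" and D: "(\<lambda>i. D i / sqrt (lam i)) \<in> L2_space CS"
    and bd: "\<And>t i. t \<in> {0..T} \<Longrightarrow> norm (b t i) \<le> D i" and h: "\<And>t. t \<in> {0..T} \<Longrightarrow> hm1 (b t)"
    and t: "t \<in> {0..T}"
  shows "((\<lambda>s. Hm1_norm Om (\<lambda>\<zeta>. Fn (b s) \<zeta> - Fn (b t) \<zeta>)) \<longlongrightarrow> 0) (at t within {0..T})"
proof (rule Lim_null_comparison)
  have ev: "\<forall>\<^sub>F s in at t within {0..T}. s \<in> {0..T}" by (simp add: eventually_at_filter)
  then show "\<forall>\<^sub>F s in at t within {0..T}. norm (Hm1_norm Om (\<lambda>\<zeta>. Fn (b s) \<zeta> - Fn (b t) \<zeta>)) \<le> hnorm (\<lambda>i. b s i - b t i) / sqrt Nn"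
  proof eventually_elim
    fix s assume s: "s \<in> {0..T}"
    have d: "hm1 (\<lambda>i. b s i - b t i)" by (intro hm1_diff h s t)
    \<comment> \<open>A supremum of reals is meaningful only for a bounded set; nonnegativity is
      read off from the value at the zero function together with an upper bound.\<close>
    have "0 \<le> Hm1_norm Om (\<lambda>\<zeta>. Fn (b s) \<zeta> - Fn (b t) \<zeta>)"
      unfolding Hm1_norm_def
    proof (rule cSUP_upper2)
      show "(\<lambda>x. 0) \<in> {\<zeta> \<in> H10. H1_norm Om \<zeta> \<le> 1}"
        by (simp add: zero_H10)
      show "bdd_above ((\<lambda>\<zeta>. norm (Fn (b s) \<zeta> - Fn (b t) \<zeta>)) ` {\<zeta> \<in> H10. H1_norm Om \<zeta> \<le> 1})"
      proof (rule bdd_aboveI2)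
        fix \<zeta> :: "plane \<Rightarrow> complex^2" assume "\<zeta> \<in> {\<zeta> \<in> H10. H1_norm Om \<zeta> \<le> 1}"
        then have \<zeta>: "\<zeta> \<in> H10" "H1_norm Om \<zeta> \<le> 1" by auto
        have "norm (Fn (b s) \<zeta> - Fn (b t) \<zeta>) \<le> hnorm (\<lambda>i. b s i - b t i) / sqrt Nn * H1_norm Om \<zeta>"
          using Fn_bound(2)[OF d \<zeta>(1)] Fn_diff[OF h[OF s] h[OF t] \<zeta>(1)] by simp
        also have "\<dots> \<le> hnorm (\<lambda>i. b s i - b t i) / sqrt Nn * 1"
          using \<zeta>(2) Nn_pos by (intro mult_left_mono) (auto simp: hnorm_def)
        finally show "norm (Fn (b s) \<zeta> - Fn (b t) \<zeta>) \<le> hnorm (\<lambda>i. b s i - b t i) / sqrt Nn" by simp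
      qed
    qed simp
    moreover have "Hm1_norm Om (\<lambda>\<zeta>. Fn (b s) \<zeta> - Fn (b t) \<zeta>) \<le> hnorm (\<lambda>i. b s i - b t i) / sqrt Nn"
      by (rule Hm1_norm_le[OF d]) (rule Fn_diff[OF h[OF s] h[OF t], symmetric])
    ultimately show "norm (Hm1_norm Om (\<lambda>\<zeta>. Fn (b s) \<zeta> - Fn (b t) \<zeta>)) \<le> hnorm (\<lambda>i. b s i - b t i) / sqrt Nn" by simp
  qed
  have "((\<lambda>s. \<integral>i. (norm ((b s i - b t i) /\<^sub>R sqrt (lam i)))\<^sup>2 \<partial>CS) \<longlongrightarrow> 0) (at t within {0..T})"
    unfolding tendsto_at_iff_sequentially o_def
  proof (intro allI impI)
    fix X :: "nat \<Rightarrow> real" assume X: "\<forall>n. X n \<in> {0..T} - {t}" "X \<longlonglongrightarrow> t"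
    have "(\<lambda>n. \<integral>i. (norm ((b (X n) i - b t i) /\<^sub>R sqrt (lam i)))\<^sup>2 \<partial>CS) \<longlonglongrightarrow> (\<integral>i. 0 \<partial>CS)"
    proof (rule integral_dominated_convergence)
      show "integrable CS (\<lambda>i. 4 * (norm (D i / sqrt (lam i)))\<^sup>2)" using L2_space_integrable_sq[OF D] by simp
      show "AE i in CS. (\<lambda>n. (norm ((b (X n) i - b t i) /\<^sub>R sqrt (lam i)))\<^sup>2) \<longlonglongrightarrow> 0"
      proof (rule AE_I2)
        fix i
        have "(\<lambda>n. b (X n) i) \<longlonglongrightarrow> b t i"
          using c[of i, unfolded continuous_on_sequentially, rule_format, of t X] t X by (auto simp: o_def)
        then have "(\<lambda>n. (norm ((b (X n) i - b t i) /\<^sub>R sqrt (lam i)))\<^sup>2) \<longlonglongrightarrow> (norm ((b t i - b t i) /\<^sub>R sqrt (lam i)))\<^sup>2"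
          by (intro tendsto_intros)
        then show "(\<lambda>n. (norm ((b (X n) i - b t i) /\<^sub>R sqrt (lam i)))\<^sup>2) \<longlonglongrightarrow> 0" by simp
      qed
      show "AE i in CS. norm ((norm ((b (X n) i - b t i) /\<^sub>R sqrt (lam i)))\<^sup>2) \<le> 4 * (norm (D i / sqrt (lam i)))\<^sup>2" for n
      proof (rule AE_I2)
        fix i
        have "norm (b (X n) i - b t i) \<le> 2 * D i"
          using norm_triangle_ineq4[of "b (X n) i" "b t i"] bd[of "X n" i] bd[OF t, of i] X by auto
        then have "norm ((b (X n) i - b t i) /\<^sub>R sqrt (lam i)) \<le> 2 * (D i / sqrt (lam i))"
          using lam_pos[of i] by (simp add: divide_inverse mult_left_mono mult.commute mult.assoc)
        then have "(norm ((b (X n) i - b t i) /\<^sub>R sqrt (lam i)))\<^sup>2 \<le> (2 * (D i / sqrt (lam i)))\<^sup>2"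
          by (intro power_mono) auto
        then show "norm ((norm ((b (X n) i - b t i) /\<^sub>R sqrt (lam i)))\<^sup>2) \<le> 4 * (norm (D i / sqrt (lam i)))\<^sup>2"
          by (simp only: power_mult_distrib real_norm_def abs_power2 power2_abs) simp
      qed
    qed auto
    then show "(\<lambda>n. \<integral>i. (norm ((b (X n) i - b t i) /\<^sub>R sqrt (lam i)))\<^sup>2 \<partial>CS) \<longlonglongrightarrow> 0" by simp
  qed
  from tendsto_real_sqrt[OF this]
  have "((\<lambda>s. hnorm (\<lambda>i. b s i - b t i)) \<longlongrightarrow> 0) (at t within {0..T})" by (simp add: hnorm_def L2_norm_def)
  then show "((\<lambda>s. hnorm (\<lambda>i. b s i - b t i) / sqrt Nn) \<longlongrightarrow> 0) (at t within {0..T})"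
    by (rule tendsto_divide_zero)
qed

subsection \<open>Square-integrable representatives\<close>

text \<open>The space-time sine sums are Cauchy because their squared distances are increments of a
  bounded increasing sequence. A subsequence converges in L2 of the rectangle for almost every time,
  which identifies the limit with \<open>Fn (b t)\<close>.\<close>

lemma Fn_L2_representative:
  fixes b :: "real \<Rightarrow> nat \<times> nat \<Rightarrow> complex^2"
  assumes bL: "\<And>i. (\<lambda>t. b t i) \<in> L2_space (lborel_on {0<..<T})" and h: "\<And>t. t \<in> {0<..<T} \<Longrightarrow> hm1 (b t)"
    and bd: "\<And>n. (\<Sum>i\<in>Q n. (L2_norm (lborel_on {0<..<T}) (\<lambda>t. b t i))\<^sup>2) \<le> C"
  shows "\<exists>w. (\<lambda>(t, x). w t x) \<in> L2_space (lborel_on {0<..<T} \<Otimes>\<^sub>M Lb) \<and>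
    (AE t in lborel_on {0<..<T}. \<forall>\<zeta>\<in>H10. Fn (b t) \<zeta> = (\<integral>x. cdot (w t x) (\<zeta> x) \<partial>Lb))"
proof -
  let ?I = "lborel_on {0<..<T}"
  interpret L: finite_measure Lb by (rule finite_Lb)
  interpret I: finite_measure ?I by (rule finite_measure_interval)
  interpret P: pair_sigma_finite ?I Lb ..
  define W where "W n = (\<lambda>(t, x). ssum n (\<lambda>i. b t i /\<^sub>R Nn) x)" for n
  have sq: "integrable (?I \<Otimes>\<^sub>M Lb) (\<lambda>(t, x). (norm (ssum n (c t) x))\<^sup>2) \<and> (\<lambda>(t, x). ssum n (c t) x) \<in> borel_measurable (?I \<Otimes>\<^sub>M Lb)"
    if c: "\<And>i. (\<lambda>t. c t i) \<in> L2_space ?I" for n and c :: "real \<Rightarrow> nat \<times> nat \<Rightarrow> complex^2"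
  proof
    have [measurable]: "(\<lambda>t. c t i) \<in> borel_measurable ?I" for i by (rule L2_space_measurable[OF c])
    have [measurable]: "sine i \<in> borel_measurable Lb" for i by (rule L2_space_measurable[OF sine_L2])
    show m [measurable]: "(\<lambda>(t, x). ssum n (c t) x) \<in> borel_measurable (?I \<Otimes>\<^sub>M Lb)"
      unfolding ssum_def by measurable
    show "integrable (?I \<Otimes>\<^sub>M Lb) (\<lambda>(t, x). (norm (ssum n (c t) x))\<^sup>2)"
    proof (rule P.Fubini_integrable)
      show "(\<lambda>(t, x). (norm (ssum n (c t) x))\<^sup>2) \<in> borel_measurable (?I \<Otimes>\<^sub>M Lb)" by measurable
      have "integrable ?I (\<lambda>t. \<Sum>i\<in>Q n. Nn * (norm (c t i))\<^sup>2)"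
        by (intro Bochner_Integration.integrable_sum integrable_mult_right L2_space_integrable_sq c)
      then show "integrable ?I (\<lambda>t. \<integral>x. norm ((\<lambda>(t, x). (norm (ssum n (c t) x))\<^sup>2) (t, x)) \<partial>Lb)"
        by (simp add: L2_norm_sq[symmetric] ssum_norm)
      show "AE t in ?I. integrable Lb (\<lambda>x. (\<lambda>(t, x). (norm (ssum n (c t) x))\<^sup>2) (t, x))"
        by (rule AE_I2) (simp add: L2_space_integrable_sq[OF ssum_L2])
    qed
  qed
  have nrm: "(L2_norm (?I \<Otimes>\<^sub>M Lb) (\<lambda>(t, x). ssum n (c t) x))\<^sup>2 = (\<Sum>i\<in>Q n. Nn * (L2_norm ?I (\<lambda>t. c t i))\<^sup>2)"
    if c: "\<And>i. (\<lambda>t. c t i) \<in> L2_space ?I" for n and c :: "real \<Rightarrow> nat \<times> nat \<Rightarrow> complex^2"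
  proof -
    have "(L2_norm (?I \<Otimes>\<^sub>M Lb) (\<lambda>(t, x). ssum n (c t) x))\<^sup>2 = (\<integral>y. (\<lambda>(t, x). (norm (ssum n (c t) x))\<^sup>2) y \<partial>(?I \<Otimes>\<^sub>M Lb))"
      unfolding L2_norm_sq by (intro Bochner_Integration.integral_cong refl) (auto split: prod.splits)
    also have "\<dots> = (\<integral>t. (\<integral>x. (norm (ssum n (c t) x))\<^sup>2 \<partial>Lb) \<partial>?I)"
      using P.integral_fst'[OF conjunct1[OF sq[OF c]]] by simp
    also have "\<dots> = (\<integral>t. (\<Sum>i\<in>Q n. Nn * (norm (c t i))\<^sup>2) \<partial>?I)"
      by (simp add: L2_norm_sq[symmetric] ssum_norm)
    also have "\<dots> = (\<Sum>i\<in>Q n. Nn * (L2_norm ?I (\<lambda>t. c t i))\<^sup>2)"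
      by (subst Bochner_Integration.integral_sum) (auto simp: L2_norm_sq intro: L2_space_integrable_sq c)
    finally show ?thesis .
  qed
  have bN: "(\<lambda>t. b t i /\<^sub>R Nn) \<in> L2_space ?I" for i by (intro L2_space_scaleR bL)
  have WL: "W n \<in> L2_space (?I \<Otimes>\<^sub>M Lb)" for n
    unfolding W_def using sq[OF bN, of n] by (auto intro!: L2_spaceI simp: case_prod_unfold)
  define s where "s n = (\<Sum>i\<in>Q n. (L2_norm ?I (\<lambda>t. b t i))\<^sup>2)" for n
  have diff: "(L2_norm (?I \<Otimes>\<^sub>M Lb) (\<lambda>y. W n y - W m y))\<^sup>2 = (s n - s m) / Nn" if mn: "m \<le> n" for m n
  proof -
    \<comment> \<open>The difference of two partial sums is one sine sum over the new indices, to
      which the norm formula applies.\<close>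
    define c where "c t i = (if i \<in> Q m then 0 else b t i /\<^sub>R Nn)" for t i
    have cL: "(\<lambda>t. c t i) \<in> L2_space ?I" for i using bN[of i] by (cases "i \<in> Q m") (simp_all add: c_def)
    have "W n y - W m y = (\<lambda>(t, x). ssum n (c t) x) y" for y
      unfolding W_def ssum_extend[OF mn]
      by (auto simp: ssum_def c_def sum_subtractf[symmetric] scaleR_diff_right[symmetric] split: prod.splits intro!: sum.cong)
    then have "(L2_norm (?I \<Otimes>\<^sub>M Lb) (\<lambda>y. W n y - W m y))\<^sup>2 = (\<Sum>i\<in>Q n. Nn * (L2_norm ?I (\<lambda>t. c t i))\<^sup>2)"
      using nrm[OF cL] by simp
    also have "\<dots> = (\<Sum>i\<in>Q n - Q m. (L2_norm ?I (\<lambda>t. b t i))\<^sup>2 / Nn)"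
      using Nn_pos by (intro sum.mono_neutral_cong_right) (auto simp: c_def power_mult_distrib power2_eq_square field_simps)
    also have "\<dots> = (s n - s m) / Nn"
      by (simp add: s_def sum_divide_distrib[symmetric] sum_diff[OF finite_Q Q_mono[OF mn]])
    finally show ?thesis .
  qed
  have "incseq s" unfolding incseq_def s_def using Q_mono by (auto intro!: sum_mono2)
  moreover have "s n \<le> C" for n unfolding s_def by (rule bd)
  ultimately have "convergent s" using incseq_convergent unfolding convergent_def by metis
  then have cau: "Cauchy s" by (simp add: Cauchy_convergent_iff)
  have "\<exists>v\<in>L2_space (?I \<Otimes>\<^sub>M Lb). (\<lambda>n. L2_norm (?I \<Otimes>\<^sub>M Lb) (\<lambda>y. W n y - v y)) \<longlonglongrightarrow> 0"
  proof (rule L2_complete[OF WL])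
    fix e :: real assume e: "e > 0"
    then obtain N where N: "\<And>m n. m \<ge> N \<Longrightarrow> n \<ge> N \<Longrightarrow> dist (s m) (s n) < e\<^sup>2 * Nn"
      using metric_CauchyD[OF cau, of "e\<^sup>2 * Nn"] Nn_pos by auto
    have le: "L2_norm (?I \<Otimes>\<^sub>M Lb) (\<lambda>y. W n y - W m y) < e" if "m \<le> n" "m \<ge> N" for m n
    proof (rule power2_less_imp_less)
      show "(L2_norm (?I \<Otimes>\<^sub>M Lb) (\<lambda>y. W n y - W m y))\<^sup>2 < e\<^sup>2"
        unfolding diff[OF that(1)] using N[of n m] that Nn_pos by (simp add: dist_real_def divide_less_eq)
    qed (use e in simp)
    have "L2_norm (?I \<Otimes>\<^sub>M Lb) (\<lambda>y. W m y - W n y) < e" if "m \<ge> N" "n \<ge> N" for m n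
      using le[of m n] le[of n m] that L2_norm_minus_commute[of _ "W m" "W n"] by (cases "m \<le> n") auto
    then show "\<exists>N. \<forall>m\<ge>N. \<forall>n\<ge>N. L2_norm (?I \<Otimes>\<^sub>M Lb) (\<lambda>y. W m y - W n y) < e" by blast
  qed
  then obtain v where v: "v \<in> L2_space (?I \<Otimes>\<^sub>M Lb)" and lim: "(\<lambda>n. L2_norm (?I \<Otimes>\<^sub>M Lb) (\<lambda>y. W n y - v y)) \<longlonglongrightarrow> 0" by auto
  define f where "f n t = (\<integral>x. (norm (W n (t, x) - v (t, x)))\<^sup>2 \<partial>Lb)" for n t
  have id: "integrable (?I \<Otimes>\<^sub>M Lb) (\<lambda>y. (norm (W n y - v y))\<^sup>2)" for n
    by (intro L2_space_integrable_sq L2_space_diff WL v)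
  \<comment> \<open>The slice errors tend to 0 in L1 of time, so a subsequence tends to 0 for almost
    every \<open>t\<close>.\<close>
  have "\<exists>r. strict_mono r \<and> (AE t in ?I. (\<lambda>n. f (r n) t) \<longlonglongrightarrow> 0)"
  proof (rule tendsto_L1_AE_subseq)
    show "integrable ?I (f n)" for n unfolding f_def by (rule P.integrable_fst'[OF id])
    have "(\<integral>t. norm (f n t) \<partial>?I) = (L2_norm (?I \<Otimes>\<^sub>M Lb) (\<lambda>y. W n y - v y))\<^sup>2" for n
      unfolding L2_norm_sq using P.integral_fst'[OF id] by (simp add: f_def)
    then show "(\<lambda>n. \<integral>t. norm (f n t) \<partial>?I) \<longlonglongrightarrow> 0" using tendsto_power[OF lim, of 2] by simp
  qed
  then obtain r :: "nat \<Rightarrow> nat" where r: "strict_mono r" "AE t in ?I. (\<lambda>n. f (r n) t) \<longlonglongrightarrow> 0" by blast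
  have AEv: "AE t in ?I. integrable Lb (\<lambda>x. (norm (v (t, x)))\<^sup>2)"
    by (rule P.AE_integrable_fst'[OF L2_space_integrable_sq[OF v]])
  have "AE t in ?I. t \<in> {0<..<T}" by (rule AE_I2) (simp add: space_restrict_space)
  with r(2) AEv have "AE t in ?I. \<forall>\<zeta>\<in>H10. Fn (b t) \<zeta> = (\<integral>x. cdot (v (t, x)) (\<zeta> x) \<partial>Lb)"
  proof eventually_elim
    fix t assume f: "(\<lambda>n. f (r n) t) \<longlonglongrightarrow> 0" and iv: "integrable Lb (\<lambda>x. (norm (v (t, x)))\<^sup>2)" and t: "t \<in> {0<..<T}"
    have "v \<in> borel_measurable (?I \<Otimes>\<^sub>M Lb)" using v by auto
    from measurable_compose[OF measurable_Pair1' this, of t] t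
    have vm: "(\<lambda>x. v (t, x)) \<in> borel_measurable Lb" by (simp add: space_restrict_space)
    have vL: "(\<lambda>x. v (t, x)) \<in> L2_space Lb" by (rule L2_spaceI[OF vm iv])
    let ?w = "\<lambda>n. ssum n (\<lambda>i. b t i /\<^sub>R Nn)"
    have lim: "(\<lambda>n. L2_norm Lb (\<lambda>x. ?w (r n) x - v (t, x))) \<longlonglongrightarrow> 0"
      using tendsto_real_sqrt[OF f] by (simp add: f_def W_def L2_norm_def)
    show "\<forall>\<zeta>\<in>H10. Fn (b t) \<zeta> = (\<integral>x. cdot (v (t, x)) (\<zeta> x) \<partial>Lb)"
    proof
      fix \<zeta> :: "plane \<Rightarrow> complex^2" assume \<zeta>: "\<zeta> \<in> H10"
      note zL = H10_L2[OF \<zeta>]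
      have ci: "integrable Lb (\<lambda>x. cdot (u x) (\<zeta> x))" and cb: "norm (\<integral>x. cdot (u x) (\<zeta> x) \<partial>Lb) \<le> L2_norm Lb u * L2_norm Lb \<zeta>"
        if u: "u \<in> L2_space Lb" for u :: "plane \<Rightarrow> complex^2"
      proof -
        have m: "(\<lambda>x. cdot (u x) (\<zeta> x)) \<in> borel_measurable Lb"
          by (rule borel_measurable_cdot[OF L2_space_measurable[OF u] L2_space_measurable[OF zL]])
        note * = L2_bilinear[OF u zL m, of 1]
        show "integrable Lb (\<lambda>x. cdot (u x) (\<zeta> x))" by (rule *(1)) (simp_all add: norm_cdot_le)
        show "norm (\<integral>x. cdot (u x) (\<zeta> x) \<partial>Lb) \<le> L2_norm Lb u * L2_norm Lb \<zeta>" using *(2) by (simp add: norm_cdot_le)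
      qed
      have sum: "(\<integral>x. cdot (?w n x) (\<zeta> x) \<partial>Lb) = (1 / Nn) *\<^sub>R (\<Sum>i\<in>Q n. cdot (b t i) (coef \<zeta> i))" for n
      proof -
        have "(\<integral>x. cdot (?w n x) (\<zeta> x) \<partial>Lb) = (\<integral>x. (\<Sum>i\<in>Q n. cdot (b t i /\<^sub>R Nn) (sine i x *\<^sub>R \<zeta> x)) \<partial>Lb)"
          unfolding ssum_def bounded_bilinear.sum_left[OF bounded_bilinear_cdot] cdot_scaleR_left[of "sine _ _"] cdot_scaleR_right ..
        also have "\<dots> = (\<Sum>i\<in>Q n. \<integral>x. cdot (b t i /\<^sub>R Nn) (sine i x *\<^sub>R \<zeta> x) \<partial>Lb)"
          by (intro Bochner_Integration.integral_sum integrable_bounded_linear[OF bounded_linear_cdot_right] coef_integrable zL)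
        also have "\<dots> = (\<Sum>i\<in>Q n. cdot (b t i /\<^sub>R Nn) (coef \<zeta> i))"
          unfolding coef_def by (intro sum.cong refl integral_bounded_linear[OF bounded_linear_cdot_right] coef_integrable zL)
        finally show ?thesis by (simp add: cdot_scaleR_left scaleR_sum_right divide_inverse)
      qed
      have 1: "(\<lambda>n. \<integral>x. cdot (?w (r n) x) (\<zeta> x) \<partial>Lb) \<longlonglongrightarrow> Fn (b t) \<zeta>"
        unfolding sum Fn_def
        by (rule tendsto_scaleR[OF tendsto_const LIMSEQ_subseq_LIMSEQ[OF Q_limit[OF Fn_bound(1)[OF h[OF t] \<zeta>]] r(1), unfolded o_def]])
      have "(\<lambda>n. (\<integral>x. cdot (?w (r n) x) (\<zeta> x) \<partial>Lb) - (\<integral>x. cdot (v (t, x)) (\<zeta> x) \<partial>Lb)) \<longlonglongrightarrow> 0"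
      proof (rule Lim_null_comparison)
        show "\<forall>\<^sub>F n in sequentially. norm ((\<integral>x. cdot (?w (r n) x) (\<zeta> x) \<partial>Lb) - (\<integral>x. cdot (v (t, x)) (\<zeta> x) \<partial>Lb))
            \<le> L2_norm Lb (\<lambda>x. ?w (r n) x - v (t, x)) * L2_norm Lb \<zeta>"
          using cb[OF L2_space_diff[OF ssum_L2 vL]] by (simp add: cdot_diff_left ci ssum_L2 vL)
        show "(\<lambda>n. L2_norm Lb (\<lambda>x. ?w (r n) x - v (t, x)) * L2_norm Lb \<zeta>) \<longlonglongrightarrow> 0"
          by (rule tendsto_mult_left_zero[OF lim])
      qed
      then have "(\<lambda>n. \<integral>x. cdot (?w (r n) x) (\<zeta> x) \<partial>Lb) \<longlonglongrightarrow> (\<integral>x. cdot (v (t, x)) (\<zeta> x) \<partial>Lb)" by (rule LIM_zero_cancel)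
      with 1 show "Fn (b t) \<zeta> = (\<integral>x. cdot (v (t, x)) (\<zeta> x) \<partial>Lb)" by (rule LIMSEQ_unique)
    qed
  qed
  then show ?thesis using v by (intro exI[of _ "\<lambda>t x. v (t, x)"]) simp
qed

end

section \<open>Reachable coefficients\<close>

lemma borel_measurable_smult:
  fixes f :: "'a \<Rightarrow> complex" and g :: "'a \<Rightarrow> complex^'n"
  assumes "f \<in> borel_measurable M" "g \<in> borel_measurable M"
  shows "(\<lambda>x. f x *s g x) \<in> borel_measurable M"
  by (rule borel_measurable_continuous_Pair[OF assms])
    (intro bounded_bilinear.continuous_on[OF bounded_bilinear_smult] continuous_intros)

lemma borel_measurable_matrix_vector:
  fixes g :: "'a \<Rightarrow> complex^'n" and N :: "complex^'n^'m"
  assumes "g \<in> borel_measurable M"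
  shows "(\<lambda>x. N *v g x) \<in> borel_measurable M"
  by (rule measurable_compose[OF assms borel_measurable_continuous_onI[OF linear_continuous_on[OF matrix_vector_mul_bounded_linear]]])

lemma freq_series_bound:
  assumes X: "X > 0"
  obtains S where "S \<ge> 0" "\<And>n. (\<Sum>k<n. 1 / (freq X k)\<^sup>2) \<le> S"
proof -
  have "summable (\<lambda>n. inverse (real n ^ 2))" by (rule inverse_power_summable) simp
  then have s: "summable (\<lambda>n. X\<^sup>2 / pi\<^sup>2 * inverse (real (Suc n) ^ 2))"
    by (subst (asm) summable_Suc_iff[symmetric]) (rule summable_mult)
  have eq: "1 / (freq X k)\<^sup>2 = X\<^sup>2 / pi\<^sup>2 * inverse (real (Suc k) ^ 2)" for k
    by (simp add: freq_def power_mult_distrib power_divide inverse_eq_divide)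
  show ?thesis
  proof (rule that)
    show "0 \<le> (\<Sum>k. X\<^sup>2 / pi\<^sup>2 * inverse (real (Suc k) ^ 2))" by (rule suminf_nonneg[OF s]) simp
    show "(\<Sum>k<n. 1 / (freq X k)\<^sup>2) \<le> (\<Sum>k. X\<^sup>2 / pi\<^sup>2 * inverse (real (Suc k) ^ 2))" for n
      unfolding eq by (rule sum_le_suminf[OF s]) auto
  qed
qed

lemma sum_of_bool_less_le: "(\<Sum>l<n. of_bool (l < L) * c :: real) \<le> real L * c" if "c \<ge> 0"
proof -
  have "(\<Sum>l<n. of_bool (l < L) * c) = real (card ({..<n} \<inter> {..<L})) * c"
    by (simp add: sum_distrib_right[symmetric] of_bool_def sum.If_cases lessThan_def)
  also have "\<dots> \<le> real L * c"
    using card_mono[of "{..<L}" "{..<n} \<inter> {..<L}"] that by (intro mult_right_mono) auto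
  finally show ?thesis .
qed

context rectangle
begin

text \<open>Integration in time gains a full factor \<open>1 / lam i\<close>; this parabolic
  smoothing pays for the growth of the boundary source in \<open>i\<close>.\<close>

lemma integral_exp_le:
  assumes "\<tau> \<ge> 0"
  shows "integrable (lborel_on {0<..<\<tau>}) (\<lambda>t. exp (- (lam i * (\<tau> - t))))"
    and "(\<integral>t. exp (- (lam i * (\<tau> - t))) \<partial>lborel_on {0<..<\<tau>}) \<le> 1 / lam i"
    and "(\<integral>t. exp (- (lam i * t)) \<partial>lborel_on {0<..<\<tau>}) \<le> 1 / lam i"
proof -
  have l: "lam i > 0" by (rule lam_pos)
  show "integrable (lborel_on {0<..<\<tau>}) (\<lambda>t. exp (- (lam i * (\<tau> - t))))"
  proof (rule finite_measure.integrable_const_bound[OF finite_measure_interval, of _ 1])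
    show "AE t in lborel_on {0<..<\<tau>}. norm (exp (- (lam i * (\<tau> - t)))) \<le> 1"
      using l by (intro AE_I2) (auto simp: space_restrict_space)
  qed (auto intro!: measurable_restrict_space1)
  have "(\<integral>t. exp (- (lam i * (\<tau> - t))) \<partial>lborel_on {0<..<\<tau>}) =
      (\<lambda>t. exp (- (lam i * (\<tau> - t))) / lam i) \<tau> - (\<lambda>t. exp (- (lam i * (\<tau> - t))) / lam i) 0"
  proof (rule integral_lborel_on_interval_FTC[OF assms])
    show "((\<lambda>t. exp (- (lam i * (\<tau> - t))) / lam i) has_vector_derivative exp (- (lam i * (\<tau> - t)))) (at t)" for t
      unfolding has_real_derivative_iff_has_vector_derivative[symmetric] using l by (auto intro!: derivative_eq_intros)
  qed (auto intro!: continuous_intros)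
  then show "(\<integral>t. exp (- (lam i * (\<tau> - t))) \<partial>lborel_on {0<..<\<tau>}) \<le> 1 / lam i" using l by simp
  have "(\<integral>t. exp (- (lam i * t)) \<partial>lborel_on {0<..<\<tau>}) =
      (\<lambda>t. - exp (- (lam i * t)) / lam i) \<tau> - (\<lambda>t. - exp (- (lam i * t)) / lam i) 0"
  proof (rule integral_lborel_on_interval_FTC[OF assms])
    show "((\<lambda>t. - exp (- (lam i * t)) / lam i) has_vector_derivative exp (- (lam i * t))) (at t)" for t
      unfolding has_real_derivative_iff_has_vector_derivative[symmetric] using l by (auto intro!: derivative_eq_intros)
  qed (auto intro!: continuous_intros)
  then show "(\<integral>t. exp (- (lam i * t)) \<partial>lborel_on {0<..<\<tau>}) \<le> 1 / lam i" using l by simp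
qed

text \<open>The moving frequency divided by \<open>lam\<close> is at most its own inverse, which is
  square-summable along each of finitely many lines. Over all pairs of indices the series would
  diverge, which is why controls have finitely many modes.\<close>

lemma strip_freq_L2:
  "(\<lambda>i. of_bool (snd i < L) * freq X1 (fst i) / lam i) \<in> L2_space CS"
  "(\<lambda>i. of_bool (fst i < L) * freq X2 (snd i) / lam i) \<in> L2_space CS"
proof -
  have le: "(of_bool P * w / l)\<^sup>2 \<le> of_bool P * (1 / w\<^sup>2)" if "w > 0" "w\<^sup>2 \<le> l" for P :: bool and w l :: real
  proof -
    have l: "l > 0" using that zero_less_power[OF that(1), of 2] by linarith
    then have "w / l \<le> 1 / w" using that by (simp add: pos_divide_le_eq pos_le_divide_eq power2_eq_square)
    moreover have "0 \<le> w / l" using that l by simp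
    ultimately have "(w / l)\<^sup>2 \<le> (1 / w)\<^sup>2" by (intro power_mono) auto
    then show ?thesis by (simp add: power_divide)
  qed
  obtain S where S: "S \<ge> 0" "\<And>n. (\<Sum>k<n. 1 / (freq X1 k)\<^sup>2) \<le> S" by (rule freq_series_bound[OF X1]) blast
  obtain R where R: "R \<ge> 0" "\<And>n. (\<Sum>k<n. 1 / (freq X2 k)\<^sup>2) \<le> R" by (rule freq_series_bound[OF X2]) blast
  show "(\<lambda>i. of_bool (snd i < L) * freq X1 (fst i) / lam i) \<in> L2_space CS"
  proof (rule L2_CS_I(1))
    fix n
    have "(\<Sum>i\<in>Q n. (norm (of_bool (snd i < L) * freq X1 (fst i) / lam i))\<^sup>2) \<le> (\<Sum>i\<in>Q n. of_bool (snd i < L) * (1 / (freq X1 (fst i))\<^sup>2))"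
      unfolding real_norm_def power2_abs by (intro sum_mono le freq_pos X1) (simp add: lam_def)
    also have "\<dots> = (\<Sum>k<n. \<Sum>l<n. of_bool (l < L) * (1 / (freq X1 k)\<^sup>2))"
      unfolding Q_def sum.cartesian_product by (simp add: case_prod_unfold)
    also have "\<dots> \<le> (\<Sum>k<n. real L * (1 / (freq X1 k)\<^sup>2))" by (intro sum_mono sum_of_bool_less_le) simp
    also have "\<dots> \<le> real L * S" unfolding sum_distrib_left[symmetric] by (intro mult_left_mono S) simp
    finally show "(\<Sum>i\<in>Q n. (norm (of_bool (snd i < L) * freq X1 (fst i) / lam i))\<^sup>2) \<le> real L * S" .
  qed
  show "(\<lambda>i. of_bool (fst i < L) * freq X2 (snd i) / lam i) \<in> L2_space CS"
  proof (rule L2_CS_I(1))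
    fix n
    have "(\<Sum>i\<in>Q n. (norm (of_bool (fst i < L) * freq X2 (snd i) / lam i))\<^sup>2) \<le> (\<Sum>i\<in>Q n. of_bool (fst i < L) * (1 / (freq X2 (snd i))\<^sup>2))"
      unfolding real_norm_def power2_abs by (intro sum_mono le freq_pos X2) (simp add: lam_def)
    also have "\<dots> = (\<Sum>k<n. \<Sum>l<n. of_bool (k < L) * (1 / (freq X2 l)\<^sup>2))"
      unfolding Q_def sum.cartesian_product by (simp add: case_prod_unfold)
    also have "\<dots> = (\<Sum>l<n. \<Sum>k<n. of_bool (k < L) * (1 / (freq X2 l)\<^sup>2))" by (rule sum.swap)
    also have "\<dots> \<le> (\<Sum>l<n. real L * (1 / (freq X2 l)\<^sup>2))" by (intro sum_mono sum_of_bool_less_le) simp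
    also have "\<dots> \<le> real L * R" unfolding sum_distrib_left[symmetric] by (intro mult_left_mono R) simp
    finally show "(\<Sum>i\<in>Q n. (norm (of_bool (fst i < L) * freq X2 (snd i) / lam i))\<^sup>2) \<le> real L * R" .
  qed
qed

end

text \<open>Boundary controls are finite sine sums, with coefficients \<open>p\<close> on the left and \<open>q\<close> on the top edge.\<close>

definition admissible :: "nat \<Rightarrow> (nat \<Rightarrow> real \<Rightarrow> complex^'m) \<Rightarrow> (nat \<Rightarrow> real \<Rightarrow> complex^'m) \<Rightarrow> bool" where
  "admissible L p q \<longleftrightarrow> (\<forall>l. p l \<in> borel_measurable borel \<and> q l \<in> borel_measurable borel) \<and>
     (\<exists>K. \<forall>l t. norm (p l t) \<le> K \<and> norm (q l t) \<le> K) \<and> (\<forall>l\<ge>L. \<forall>t. p l t = 0 \<and> q l t = 0)"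

context heat_system
begin

text \<open>\<open>ctrl p q \<tau>\<close> are the coefficients, by Duhamel, of the state reached at time \<open>\<tau>\<close> from zero initial data.\<close>

definition src :: "(nat \<Rightarrow> real \<Rightarrow> complex^'m) \<Rightarrow> (nat \<Rightarrow> real \<Rightarrow> complex^'m) \<Rightarrow> nat \<times> nat \<Rightarrow> real \<Rightarrow> complex^2" where
  "src p q i t = freq X1 (fst i) *\<^sub>R (B *v p (snd i) t) + ((-1) ^ snd i * freq X2 (snd i)) *\<^sub>R (B *v q (fst i) t)"

definition ctrl :: "(nat \<Rightarrow> real \<Rightarrow> complex^'m) \<Rightarrow> (nat \<Rightarrow> real \<Rightarrow> complex^'m) \<Rightarrow> real \<Rightarrow> nat \<times> nat \<Rightarrow> complex^2" where
  "ctrl p q \<tau> i = (\<integral>t. dflow i (\<tau> - t) (src p q i t) \<partial>lborel_on {0<..<\<tau>})"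

text \<open>The factors \<open>2 / X2\<close> and \<open>2 / X1\<close> match those in
  \<open>normal_derivative_series\<close>, so the boundary pairing reproduces \<open>src\<close> up
  to the single constant \<open>- 1 / Nn\<close>.\<close>

definition ctrl_fun :: "nat \<Rightarrow> (nat \<Rightarrow> real \<Rightarrow> complex^'m) \<Rightarrow> (nat \<Rightarrow> real \<Rightarrow> complex^'m) \<Rightarrow> real \<Rightarrow> plane \<Rightarrow> complex^'m" where
  "ctrl_fun L p q t x =
    (\<Sum>l<L. (indicator (rect_left X1 X2) x * (2 / X2) * sin (freq X2 l * snd x)) *\<^sub>R p l t) +
    (\<Sum>k<L. (indicator (rect_top X1 X2) x * (2 / X1) * sin (freq X1 k * fst x)) *\<^sub>R q k t)"

lemma src_measurable: "admissible L p q \<Longrightarrow> src p q i \<in> borel_measurable borel"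
  unfolding src_def[abs_def] admissible_def
  by (intro borel_measurable_add borel_measurable_scaleR borel_measurable_const borel_measurable_matrix_vector) auto

text \<open>The source grows like a frequency, and only on the first \<open>L\<close> rows and
  columns. This gives a majorant uniform in time whose quotient by \<open>lam\<close> is
  square-summable.\<close>

lemma src_bound:
  assumes "admissible L p q"
  obtains gam where "\<And>i. gam i \<ge> 0" "\<And>i t. norm (src p q i t) \<le> gam i" "(\<lambda>i. gam i / lam i) \<in> L2_space CS"
proof -
  obtain K where K: "\<And>l t. norm (p l t) \<le> K \<and> norm (q l t) \<le> K" and L: "\<And>l t. l \<ge> L \<Longrightarrow> p l t = 0 \<and> q l t = 0"
    using assms unfolding admissible_def by blast
  obtain J where J: "J > 0" "\<And>v. norm (B *v v) \<le> norm v * J"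
    using bounded_linear.pos_bounded[OF matrix_vector_mul_bounded_linear] by blast
  have K0: "K \<ge> 0" using K[of 0 0] norm_ge_zero order_trans by blast
  define gam where "gam i = (K * J) * (of_bool (snd i < L) * freq X1 (fst i)) + (K * J) * (of_bool (fst i < L) * freq X2 (snd i))" for i
  have Bb: "norm (B *v p l t) \<le> of_bool (l < L) * (K * J)" "norm (B *v q l t) \<le> of_bool (l < L) * (K * J)" for l t
  proof -
    have "norm (B *v v) \<le> of_bool (l < L) * (K * J)" if "norm v \<le> K" "l \<ge> L \<Longrightarrow> v = 0" for v
    proof (cases "l < L")
      case True
      then show ?thesis using order_trans[OF J(2)[of v] mult_right_mono[OF that(1) less_imp_le[OF J(1)]]] by simp
    qed (use that in simp)
    then show "norm (B *v p l t) \<le> of_bool (l < L) * (K * J)" "norm (B *v q l t) \<le> of_bool (l < L) * (K * J)"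
      using K L by auto
  qed
  show ?thesis
  proof (rule that)
    have fp: "freq X1 k > 0" "freq X2 k > 0" for k using X1 X2 freq_pos by auto
    show "gam i \<ge> 0" for i unfolding gam_def using K0 J(1) fp by (intro add_nonneg_nonneg mult_nonneg_nonneg) (auto intro: less_imp_le)
    show "norm (src p q i t) \<le> gam i" for i t
    proof -
      have "norm (src p q i t) \<le> freq X1 (fst i) * norm (B *v p (snd i) t) + freq X2 (snd i) * norm (B *v q (fst i) t)"
        unfolding src_def by (rule order_trans[OF norm_triangle_ineq]) (use fp in \<open>simp add: abs_mult less_imp_le\<close>)
      also have "\<dots> \<le> freq X1 (fst i) * (of_bool (snd i < L) * (K * J)) + freq X2 (snd i) * (of_bool (fst i < L) * (K * J))"
        using fp by (intro add_mono mult_left_mono Bb) (auto intro: less_imp_le)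
      also have "\<dots> = gam i" by (simp add: gam_def mult_ac)
      finally show ?thesis .
    qed
    have "(\<lambda>i. (K * J) *\<^sub>R (of_bool (snd i < L) * freq X1 (fst i) / lam i) + (K * J) *\<^sub>R (of_bool (fst i < L) * freq X2 (snd i) / lam i)) \<in> L2_space CS"
      by (intro L2_space_add L2_space_scaleR strip_freq_L2)
    then show "(\<lambda>i. gam i / lam i) \<in> L2_space CS" by (simp add: gam_def add_divide_distrib)
  qed
qed

lemma kernel_measurable:
  assumes "admissible L p q"
  shows "(\<lambda>t. dflow i (\<tau> - t) (src p q i t)) \<in> borel_measurable borel"
proof -
  note src_measurable[OF assms, of i]
  moreover have "(\<lambda>t. cnj (exp (\<theta>1 * of_real (\<tau> - t)))) \<in> borel_measurable borel"
    "(\<lambda>t. cnj (dexp \<theta>1 \<theta>2 (of_real (\<tau> - t)))) \<in> borel_measurable borel"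
    by (intro borel_measurable_continuous_onI continuous_intros continuous_on_compose2[OF continuous_exp_dexp(2)]; simp)+
  ultimately show ?thesis
    unfolding Em_adjoint_apply
    by (intro borel_measurable_scaleR borel_measurable_add borel_measurable_smult borel_measurable_matrix_vector) auto
qed

lemma ctrl_integrable_bound:
  assumes ad: "admissible L p q" and gam: "\<And>t. norm (src p q i t) \<le> gam i" and \<tau>: "\<tau> \<in> {0..T}"
    and K: "K > 0" "\<And>s x. s \<in> {0..T} \<Longrightarrow> norm (conj_transpose (Em s) *v x) \<le> K * norm x"
  shows "integrable (lborel_on {0<..<\<tau>}) (\<lambda>t. dflow i (\<tau> - t) (src p q i t))"
    and "norm (ctrl p q \<tau> i) \<le> K * (gam i / lam i)"
proof -
  have le: "norm (dflow i (\<tau> - t) (src p q i t)) \<le> K * gam i * exp (- (lam i * (\<tau> - t)))"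
    if "t \<in> {0<..<\<tau>}" for t
  proof -
    have "norm (conj_transpose (Em (\<tau> - t)) *v src p q i t) \<le> K * norm (src p q i t)" using that \<tau> by (intro K) auto
    also have "\<dots> \<le> K * gam i" using K by (intro mult_left_mono gam) auto
    finally show ?thesis by (simp add: mult.commute mult_left_mono)
  qed
  have ie: "integrable (lborel_on {0<..<\<tau>}) (\<lambda>t. K * gam i * exp (- (lam i * (\<tau> - t))))"
    using \<tau> by (intro integrable_mult_right integral_exp_le) auto
  show int: "integrable (lborel_on {0<..<\<tau>}) (\<lambda>t. dflow i (\<tau> - t) (src p q i t))"
    by (rule Bochner_Integration.integrable_bound[OF ie])
      (use le in \<open>auto intro!: AE_I2 measurable_restrict_space1 kernel_measurable[OF ad] order_trans[OF _ abs_ge_self] simp: space_restrict_space\<close>)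
  have "norm (ctrl p q \<tau> i) \<le> (\<integral>t. norm (dflow i (\<tau> - t) (src p q i t)) \<partial>lborel_on {0<..<\<tau>})"
    unfolding ctrl_def by (rule integral_norm_bound)
  also have "\<dots> \<le> (\<integral>t. K * gam i * exp (- (lam i * (\<tau> - t))) \<partial>lborel_on {0<..<\<tau>})"
    by (rule integral_mono[OF integrable_norm[OF int] ie]) (use le in \<open>simp add: space_restrict_space\<close>)
  also have "\<dots> = K * gam i * (\<integral>t. exp (- (lam i * (\<tau> - t))) \<partial>lborel_on {0<..<\<tau>})" by simp
  also have "\<dots> \<le> K * gam i * (1 / lam i)"
    using \<tau> K order_trans[OF norm_ge_zero gam] by (intro mult_left_mono integral_exp_le mult_nonneg_nonneg) auto
  finally show "norm (ctrl p q \<tau> i) \<le> K * (gam i / lam i)" by simp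
qed

lemma ctrl_continuous:
  assumes ad: "admissible L p q"
  shows "continuous_on {0..T} (\<lambda>\<tau>. ctrl p q \<tau> i)"
  unfolding continuous_on_sequentially
proof (intro ballI allI impI)
  fix X :: "nat \<Rightarrow> real" and \<tau> assume X: "(\<forall>n. X n \<in> {0..T}) \<and> X \<longlonglongrightarrow> \<tau>" and \<tau>: "\<tau> \<in> {0..T}"
  obtain gam where gam: "\<And>i. gam i \<ge> 0" "\<And>i t. norm (src p q i t) \<le> gam i" by (rule src_bound[OF ad]) blast
  obtain K where K: "K > 0" "\<And>s x. s \<in> {0..T} \<Longrightarrow> norm (conj_transpose (Em s) *v x) \<le> K * norm x"
    by (rule Em_adjoint_bound[of T]) blast
  define k where "k s t = dflow i (s - t) (src p q i t)" for s t
  have km: "k s \<in> borel_measurable lborel" for s unfolding k_def[abs_def] using kernel_measurable[OF ad] by simp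
  have c: "ctrl p q s i = (\<integral>t. indicator {0<..<s} t *\<^sub>R k s t \<partial>lborel)" for s
    unfolding ctrl_def k_def by (rule integral_restrict_space) simp
  have "(\<lambda>n. \<integral>t. indicator {0<..<X n} t *\<^sub>R k (X n) t \<partial>lborel) \<longlonglongrightarrow> (\<integral>t. indicator {0<..<\<tau>} t *\<^sub>R k \<tau> t \<partial>lborel)"
  proof (rule integral_dominated_convergence)
    show "(\<lambda>t. indicator {0<..<\<tau>} t *\<^sub>R k \<tau> t) \<in> borel_measurable lborel"
      "(\<lambda>t. indicator {0<..<X n} t *\<^sub>R k (X n) t) \<in> borel_measurable lborel" for n
      by (intro borel_measurable_scaleR borel_measurable_indicator km; simp)+
    show "integrable lborel (\<lambda>t. indicator {0..T} t *\<^sub>R (K * gam i))"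
      using \<tau> by (intro integrable_scaleR_left impI integrable_real_indicator) (auto simp: emeasure_lborel_Icc_eq)
    \<comment> \<open>At \<open>t = \<tau>\<close> the moving indicator may oscillate; that point is
      discarded.\<close>
    show "AE t in lborel. (\<lambda>n. indicator {0<..<X n} t *\<^sub>R k (X n) t) \<longlonglongrightarrow> indicator {0<..<\<tau>} t *\<^sub>R k \<tau> t"
      using AE_lborel_singleton[of \<tau>]
    proof eventually_elim
      fix t assume t: "t \<noteq> \<tau>"
      have kc: "(\<lambda>n. k (X n) t) \<longlonglongrightarrow> k \<tau> t"
      proof -
        have "continuous_on UNIV (\<lambda>s. k s t)" unfolding k_def
          by (intro continuous_intros continuous_on_compose2[OF Em_continuous]) auto
        then show ?thesis using X by (auto simp: continuous_on_sequentially o_def)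
      qed
      have "(\<lambda>n. indicator {0<..<X n} t :: real) \<longlonglongrightarrow> indicator {0<..<\<tau>} t"
      proof (cases "t < \<tau>")
        case True
        have "\<forall>\<^sub>F n in sequentially. t < X n" using X True by (intro order_tendstoD(1)) auto
        then show ?thesis by (intro tendsto_eventually) (auto elim!: eventually_mono simp: indicator_def True)
      next
        case False
        then have "\<forall>\<^sub>F n in sequentially. X n < t" using X t by (intro order_tendstoD(2)[of _ \<tau>]) auto
        then show ?thesis by (intro tendsto_eventually) (use False in \<open>auto elim!: eventually_mono simp: indicator_def\<close>)
      qed
      then show "(\<lambda>n. indicator {0<..<X n} t *\<^sub>R k (X n) t) \<longlonglongrightarrow> indicator {0<..<\<tau>} t *\<^sub>R k \<tau> t"
        by (rule tendsto_scaleR[OF _ kc])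
    qed
    show "AE t in lborel. norm (indicator {0<..<X n} t *\<^sub>R k (X n) t) \<le> indicator {0..T} t *\<^sub>R (K * gam i)" for n
    proof (rule AE_I2)
      fix t
      show "norm (indicator {0<..<X n} t *\<^sub>R k (X n) t) \<le> indicator {0..T} t *\<^sub>R (K * gam i)"
      proof (cases "t \<in> {0<..<X n}")
        case True
        then have t: "t \<in> {0..T}" "X n - t \<in> {0..T}" using X by (auto intro: less_imp_le order_trans dest: spec[of _ n])
        have "norm (k (X n) t) \<le> 1 * norm (conj_transpose (Em (X n - t)) *v src p q i t)"
          unfolding k_def norm_scaleR using t lam_pos[of i] by (intro mult_right_mono) auto
        also have "\<dots> \<le> K * norm (src p q i t)" using K(2)[OF t(2)] by simp
        also have "\<dots> \<le> K * gam i" using K by (intro mult_left_mono gam) auto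
        finally show ?thesis using True t by simp
      qed (use K gam in \<open>auto simp: indicator_def\<close>)
    qed
  qed
  then show "((\<lambda>\<tau>. ctrl p q \<tau> i) \<circ> X) \<longlonglongrightarrow> ctrl p q \<tau> i" by (simp add: c o_def)
qed

text \<open>Fubini between modes and time moves the propagator to the other factor. In each mode the
  time integral is at most a constant times \<open>gam i / lam i\<close> times
  \<open>norm (\<zeta> i)\<close>, a product of square-summable families. General l2 families are
  allowed because the density argument applies this to weighted ones.\<close>

lemma ctrl_dual:
  assumes ad: "admissible L p q" and \<zeta>: "\<zeta> \<in> L2_space CS" and \<tau>: "\<tau> \<ge> 0"
  shows "(\<integral>i. cdot (ctrl p q \<tau> i) (\<zeta> i) \<partial>CS) =
      (\<integral>t. (\<integral>i. cdot (src p q i t) (flow i (\<tau> - t) (\<zeta> i)) \<partial>CS) \<partial>lborel_on {0<..<\<tau>})"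
    and "AE t in lborel_on {0<..<\<tau>}. integrable CS (\<lambda>i. cdot (src p q i t) (flow i (\<tau> - t) (\<zeta> i)))"
    and "(\<lambda>t. \<integral>i. cdot (src p q i t) (flow i (\<tau> - t) (\<zeta> i)) \<partial>CS) \<in> borel_measurable (lborel_on {0<..<\<tau>})"
    and "integrable (lborel_on {0<..<\<tau>}) (\<lambda>t. \<integral>i. cdot (src p q i t) (flow i (\<tau> - t) (\<zeta> i)) \<partial>CS)"
proof -
  let ?I = "lborel_on {0<..<\<tau>}"
  interpret I: finite_measure ?I by (rule finite_measure_interval)
  interpret C: sigma_finite_measure CS by (rule sigma_finite_measure_count_space_countable) simp
  interpret P: pair_sigma_finite CS ?I ..
  obtain gam where gam: "\<And>i. gam i \<ge> 0" "\<And>i t. norm (src p q i t) \<le> gam i" "(\<lambda>i. gam i / lam i) \<in> L2_space CS"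
    by (rule src_bound[OF ad]) blast
  obtain K where K: "K > 0" "\<And>s x. s \<in> {0..\<tau>} \<Longrightarrow> norm (conj_transpose (Em s) *v x) \<le> K * norm x"
    by (rule Em_adjoint_bound[of \<tau>]) blast
  define f where "f i t = cdot (dflow i (\<tau> - t) (src p q i t)) (\<zeta> i)" for i t
  have f_eq: "f i t = cdot (src p q i t) (flow i (\<tau> - t) (\<zeta> i))" for i t
    by (simp add: f_def cdot_scaleR_left cdot_scaleR_right cdot_adjoint')
  have tau: "\<tau> \<in> {0..\<tau>}" using \<tau> by simp
  have ki: "integrable ?I (\<lambda>t. dflow i (\<tau> - t) (src p q i t))" for i
    by (rule ctrl_integrable_bound(1)[OF ad gam(2) tau K])
  have fi: "integrable ?I (f i)" for i
    unfolding f_def by (rule integrable_bounded_linear[OF bounded_linear_cdot_left ki])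
  have fn: "(\<integral>t. norm (f i t) \<partial>?I) \<le> K * (gam i / lam i) * norm (\<zeta> i)" for i
  proof -
    have "(\<integral>t. norm (f i t) \<partial>?I) \<le> (\<integral>t. K * gam i * norm (\<zeta> i) * exp (- (lam i * (\<tau> - t))) \<partial>?I)"
    proof (rule integral_mono[OF integrable_norm[OF fi]])
      show "integrable ?I (\<lambda>t. K * gam i * norm (\<zeta> i) * exp (- (lam i * (\<tau> - t))))"
        by (intro integrable_mult_right integral_exp_le \<tau>)
      fix t assume "t \<in> space ?I"
      then have "\<tau> - t \<in> {0..\<tau>}" by (auto simp: space_restrict_space)
      from K(2)[OF this, of "src p q i t"]
      have "norm (conj_transpose (Em (\<tau> - t)) *v src p q i t) \<le> K * gam i"
        using order_trans mult_left_mono[OF gam(2)[of i t] less_imp_le[OF K(1)]] by blast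
      then have "norm (conj_transpose (Em (\<tau> - t)) *v src p q i t) * norm (\<zeta> i) \<le> K * gam i * norm (\<zeta> i)"
        by (intro mult_right_mono) auto
      then have "exp (- (lam i * (\<tau> - t))) * norm (cdot (conj_transpose (Em (\<tau> - t)) *v src p q i t) (\<zeta> i)) \<le> exp (- (lam i * (\<tau> - t))) * (K * gam i * norm (\<zeta> i))"
        using norm_cdot_le order_trans by (intro mult_left_mono) (blast, simp)
      then show "norm (f i t) \<le> K * gam i * norm (\<zeta> i) * exp (- (lam i * (\<tau> - t)))"
        by (simp add: f_def cdot_scaleR_left mult_ac)
    qed
    also have "\<dots> = K * gam i * norm (\<zeta> i) * (\<integral>t. exp (- (lam i * (\<tau> - t))) \<partial>?I)" by simp
    also have "\<dots> \<le> K * gam i * norm (\<zeta> i) * (1 / lam i)"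
      using K gam(1) by (intro mult_left_mono integral_exp_le \<tau> mult_nonneg_nonneg) auto
    finally show ?thesis by (simp add: mult_ac)
  qed
  have int: "integrable (CS \<Otimes>\<^sub>M ?I) (\<lambda>(i, t). f i t)"
  proof (rule P.Fubini_integrable)
    show "(\<lambda>(i, t). f i t) \<in> borel_measurable (CS \<Otimes>\<^sub>M ?I)"
      by (rule measurable_pair_measure_countable1) (use fi in \<open>auto simp: borel_measurable_integrable\<close>)
    have "integrable CS (\<lambda>i. K * (norm (gam i / lam i) * norm (\<zeta> i)))"
      by (intro integrable_mult_right L2_integrable_norm_mult gam \<zeta>)
    then have "integrable CS (\<lambda>i. \<integral>t. norm (f i t) \<partial>?I)"
      by (rule Bochner_Integration.integrable_bound)
        (use fn gam(1) lam_pos K in \<open>auto intro!: AE_I2 simp: abs_of_nonneg mult_ac less_imp_le\<close>)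
    then show "integrable CS (\<lambda>i. \<integral>t. norm ((\<lambda>(i, t). f i t) (i, t)) \<partial>?I)" by simp
    show "AE i in CS. integrable ?I (\<lambda>t. (\<lambda>(i, t). f i t) (i, t))" using fi by simp
  qed
  have "(\<integral>i. cdot (ctrl p q \<tau> i) (\<zeta> i) \<partial>CS) = (\<integral>i. (\<integral>t. f i t \<partial>?I) \<partial>CS)"
    unfolding ctrl_def f_def by (simp add: integral_bounded_linear[OF bounded_linear_cdot_left ki])
  also have "\<dots> = (\<integral>t. (\<integral>i. f i t \<partial>CS) \<partial>?I)" by (rule P.Fubini_integral[symmetric, OF int])
  finally show "(\<integral>i. cdot (ctrl p q \<tau> i) (\<zeta> i) \<partial>CS) =
      (\<integral>t. (\<integral>i. cdot (src p q i t) (flow i (\<tau> - t) (\<zeta> i)) \<partial>CS) \<partial>?I)" by (simp only: f_eq)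
  show "AE t in ?I. integrable CS (\<lambda>i. cdot (src p q i t) (flow i (\<tau> - t) (\<zeta> i)))"
    using P.AE_integrable_snd[OF int] by (simp only: f_eq)
  show "integrable ?I (\<lambda>t. \<integral>i. cdot (src p q i t) (flow i (\<tau> - t) (\<zeta> i)) \<partial>CS)"
    using P.integrable_snd[OF int] by (simp only: f_eq)
  then show "(\<lambda>t. \<integral>i. cdot (src p q i t) (flow i (\<tau> - t) (\<zeta> i)) \<partial>CS) \<in> borel_measurable ?I"
    by (rule borel_measurable_integrable)
qed

text \<open>On the boundary the control is a combination of lifts, so each control mode meets one
  series of \<open>normal_derivative_series\<close>; the finitely many modes reassemble
  \<open>src\<close>. The summability hypothesis turns square partial sums into an integral over all
  modes.\<close>

lemma boundary_pairing:
  assumes ad: "admissible L p q" and z: "z \<in> H10" and h: "has_normal_derivative Om sg nu z h"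
    and hL: "h \<in> L2_space sg" and i: "integrable CS (\<lambda>i. cdot (src p q i t) (coef z i))"
  shows "(LINT x:active_edges|sg. cdot (B *v ctrl_fun L p q t x) (h x)) =
    - ((1 / Nn) *\<^sub>R (\<integral>i. cdot (src p q i t) (coef z i) \<partial>CS))"
proof -
  have L0: "l \<ge> L \<Longrightarrow> p l t = 0" "l \<ge> L \<Longrightarrow> q l t = 0" for l using ad by (auto simp: admissible_def)
  let ?v = "\<lambda>l. B *v p l t" and ?w = "\<lambda>k. B *v q k t"
  have lc: "continuous_on UNIV (lift_left l)" "continuous_on UNIV (lift_top l)" for l
    by (rule C_k_continuous[OF C_inf_imp_C_k[OF C_inf_lift(1)]], rule C_k_continuous[OF C_inf_imp_C_k[OF C_inf_lift(2)]])
  have li: "integrable sg (\<lambda>x. lift_left l x *\<^sub>R h x)" "integrable sg (\<lambda>x. lift_top l x *\<^sub>R h x)" for l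
    by (intro L2_integrable_scaleR continuous_sg_L2 lc hL)+
  let ?F = "\<lambda>x. (\<Sum>l<L. cdot (?v l) ((2 / X2) *\<^sub>R (lift_left l x *\<^sub>R h x))) + (\<Sum>k<L. cdot (?w k) ((2 / X1) *\<^sub>R (lift_top k x *\<^sub>R h x)))"
  have iF: "integrable sg (\<lambda>x. cdot (?v l) ((2 / X2) *\<^sub>R (lift_left l x *\<^sub>R h x)))"
    "integrable sg (\<lambda>x. cdot (?w l) ((2 / X1) *\<^sub>R (lift_top l x *\<^sub>R h x)))" for l
    by (intro integrable_bounded_linear[OF bounded_linear_cdot_right] integrable_scaleR_right impI li)+
  have lr: "rect_left X1 X2 \<in> sets borel" "rect_top X1 X2 \<in> sets borel" by (simp_all add: rect_left_def rect_top_def borel_Times)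
  have cfm: "ctrl_fun L p q t \<in> borel_measurable sg"
  proof (rule borel_sg)
    have "(\<lambda>x. sin (w * snd x)) \<in> borel_measurable (borel :: plane measure)"
      "(\<lambda>x. sin (w * fst x)) \<in> borel_measurable (borel :: plane measure)" for w
      by (intro borel_measurable_continuous_onI continuous_intros)+
    then show "ctrl_fun L p q t \<in> borel_measurable borel"
      unfolding ctrl_fun_def[abs_def] using lr
      by (intro borel_measurable_add borel_measurable_sum borel_measurable_scaleR borel_measurable_times borel_measurable_indicator
          borel_measurable_const)
  qed
  have "(LINT x:active_edges|sg. cdot (B *v ctrl_fun L p q t x) (h x)) = (\<integral>x. ?F x \<partial>sg)"
    unfolding set_lebesgue_integral_def
  proof (rule integral_cong_AE)
    show "?F \<in> borel_measurable sg" by (intro borel_measurable_integrable Bochner_Integration.integrable_add Bochner_Integration.integrable_sum iF)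
    show "(\<lambda>x. indicator active_edges x *\<^sub>R cdot (B *v ctrl_fun L p q t x) (h x)) \<in> borel_measurable sg"
      using lr by (intro borel_measurable_scaleR borel_measurable_indicator borel_measurable_cdot borel_measurable_matrix_vector cfm L2_space_measurable hL) simp
    show "AE x in sg. indicator active_edges x *\<^sub>R cdot (B *v ctrl_fun L p q t x) (h x) = ?F x"
      using AE_sg_boundary
    proof eventually_elim
      fix x assume x: "x \<in> {0, X1} \<times> {0<..<X2} \<union> {0<..<X1} \<times> {0, X2}"
      have se: "sin (freq X1 k * X1) = 0" "sin (freq X2 k * X2) = 0" for k using X1 X2 sin_freq_end by auto
      \<comment> \<open>Restricted to the boundary the lifts are exactly the edge sines; on the
        other edges they vanish, by the affine factor or by a zero of the sine.\<close>
      have lift: "lift_left l x = indicator (rect_left X1 X2) x * sin (freq X2 l * snd x)"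
        "lift_top l x = indicator (rect_top X1 X2) x * sin (freq X1 l * fst x)" for l
        using x X1 X2 se by (auto simp: lift_left_def lift_top_def tensor_def rect_left_def rect_top_def)
      have "indicator active_edges x *\<^sub>R ctrl_fun L p q t x = ctrl_fun L p q t x"
        by (auto simp: ctrl_fun_def indicator_def)
      then have "indicator active_edges x *\<^sub>R cdot (B *v ctrl_fun L p q t x) (h x) = cdot (B *v ctrl_fun L p q t x) (h x)"
        by (auto simp: indicator_def split: if_splits)
      moreover have "B *v ctrl_fun L p q t x = (\<Sum>l<L. ((2 / X2) * lift_left l x) *\<^sub>R ?v l) + (\<Sum>k<L. ((2 / X1) * lift_top k x) *\<^sub>R ?w k)"
        unfolding ctrl_fun_def lift
        by (simp add: matrix_vector_right_distrib linear_sum[OF bounded_linear.linear[OF matrix_vector_mul_bounded_linear]]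
            linear_scale[OF bounded_linear.linear[OF matrix_vector_mul_bounded_linear]] mult_ac)
      moreover have "cdot ((\<Sum>l<L. ((2 / X2) * lift_left l x) *\<^sub>R ?v l) + (\<Sum>k<L. ((2 / X1) * lift_top k x) *\<^sub>R ?w k)) (h x) = ?F x"
        by (simp add: cdot_add_left bounded_bilinear.sum_left[OF bounded_bilinear_cdot] cdot_scaleR_left cdot_scaleR_right)
      ultimately show "indicator active_edges x *\<^sub>R cdot (B *v ctrl_fun L p q t x) (h x) = ?F x" by (simp only:)
    qed
  qed
  also have "\<dots> = (\<Sum>l<L. cdot (?v l) ((2 / X2) *\<^sub>R (\<integral>x. lift_left l x *\<^sub>R h x \<partial>sg))) + (\<Sum>k<L. cdot (?w k) ((2 / X1) *\<^sub>R (\<integral>x. lift_top k x *\<^sub>R h x \<partial>sg)))"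
  proof -
    have b: "(\<integral>x. cdot u (c *\<^sub>R g x) \<partial>sg) = cdot u (c *\<^sub>R (\<integral>x. g x \<partial>sg))" if "integrable sg g" for u :: "complex^2" and c g
      using integral_bounded_linear[OF bounded_linear_cdot_right integrable_scaleR_right[OF that]] by simp
    have "(\<integral>x. ?F x \<partial>sg) = (\<integral>x. (\<Sum>l<L. cdot (?v l) ((2 / X2) *\<^sub>R (lift_left l x *\<^sub>R h x))) \<partial>sg)
        + (\<integral>x. (\<Sum>k<L. cdot (?w k) ((2 / X1) *\<^sub>R (lift_top k x *\<^sub>R h x))) \<partial>sg)"
      by (intro Bochner_Integration.integral_add Bochner_Integration.integrable_sum iF)
    also have "\<dots> = (\<Sum>l<L. \<integral>x. cdot (?v l) ((2 / X2) *\<^sub>R (lift_left l x *\<^sub>R h x)) \<partial>sg)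
        + (\<Sum>k<L. \<integral>x. cdot (?w k) ((2 / X1) *\<^sub>R (lift_top k x *\<^sub>R h x)) \<partial>sg)"
      by (intro arg_cong2[where f = "(+)"] Bochner_Integration.integral_sum iF)
    finally show ?thesis by (simp only: b[OF li(1)] b[OF li(2)])
  qed
  finally have lhs: "(LINT x:active_edges|sg. cdot (B *v ctrl_fun L p q t x) (h x)) = \<dots>" .
  note ser = normal_derivative_series[OF z h L2_space_measurable[OF hL]]
  have "(\<lambda>n. (\<Sum>l<L. cdot (?v l) (\<Sum>i\<in>Q n. (if snd i = l then - freq X1 (fst i) / Nn else 0) *\<^sub>R coef z i)) +
      (\<Sum>k<L. cdot (?w k) (\<Sum>i\<in>Q n. (if fst i = k then - ((-1) ^ snd i * freq X2 (snd i)) / Nn else 0) *\<^sub>R coef z i)))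
    \<longlonglongrightarrow> (LINT x:active_edges|sg. cdot (B *v ctrl_fun L p q t x) (h x))"
    unfolding lhs by (intro tendsto_add tendsto_sum bounded_linear.tendsto[OF bounded_linear_cdot_right] ser)
  also have "(\<lambda>n. (\<Sum>l<L. cdot (?v l) (\<Sum>i\<in>Q n. (if snd i = l then - freq X1 (fst i) / Nn else 0) *\<^sub>R coef z i)) +
      (\<Sum>k<L. cdot (?w k) (\<Sum>i\<in>Q n. (if fst i = k then - ((-1) ^ snd i * freq X2 (snd i)) / Nn else 0) *\<^sub>R coef z i)))
     = (\<lambda>n. - ((1 / Nn) *\<^sub>R (\<Sum>i\<in>Q n. cdot (src p q i t) (coef z i))))"
  proof (rule ext)
    fix n
    \<comment> \<open>Exchanging sums leaves one control mode for each index; the modes from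
      \<open>L\<close> on are zero, so the restriction \<open>l < L\<close> disappears.\<close>
    have a: "(\<Sum>l<L. cdot (u l) (\<Sum>i\<in>Q n. (if g i = l then c i else 0) *\<^sub>R coef z i)) = (\<Sum>i\<in>Q n. c i *\<^sub>R cdot (u (g i)) (coef z i))"
      if u: "\<forall>l\<ge>L. u l = 0" for u :: "nat \<Rightarrow> complex^2" and g c
    proof -
      have "(\<Sum>l<L. cdot (u l) (\<Sum>i\<in>Q n. (if g i = l then c i else 0) *\<^sub>R coef z i)) = (\<Sum>l<L. \<Sum>i\<in>Q n. (if g i = l then c i *\<^sub>R cdot (u (g i)) (coef z i) else 0))"
        unfolding bounded_bilinear.sum_right[OF bounded_bilinear_cdot] cdot_scaleR_right by (intro sum.cong refl) auto
      also have "\<dots> = (\<Sum>i\<in>Q n. \<Sum>l<L. (if g i = l then c i *\<^sub>R cdot (u (g i)) (coef z i) else 0))" by (rule sum.swap)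
      also have "\<dots> = (\<Sum>i\<in>Q n. c i *\<^sub>R cdot (u (g i)) (coef z i))"
        using u by (intro sum.cong refl) (auto simp: sum.delta not_less)
      finally show ?thesis .
    qed
    have z1: "\<forall>l\<ge>L. ?v l = 0" "\<forall>l\<ge>L. ?w l = 0" using L0 by simp_all
    show "(\<Sum>l<L. cdot (?v l) (\<Sum>i\<in>Q n. (if snd i = l then - freq X1 (fst i) / Nn else 0) *\<^sub>R coef z i)) +
      (\<Sum>k<L. cdot (?w k) (\<Sum>i\<in>Q n. (if fst i = k then - ((-1) ^ snd i * freq X2 (snd i)) / Nn else 0) *\<^sub>R coef z i))
      = - ((1 / Nn) *\<^sub>R (\<Sum>i\<in>Q n. cdot (src p q i t) (coef z i)))"
      unfolding a[OF z1(1)] a[OF z1(2)] unfolding sum.distrib[symmetric] scaleR_sum_right sum_negf[symmetric]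
      by (intro sum.cong refl) (simp add: src_def cdot_add_left cdot_scaleR_left scaleR_add_right)
  qed
  finally have "(\<lambda>n. - ((1 / Nn) *\<^sub>R (\<Sum>i\<in>Q n. cdot (src p q i t) (coef z i)))) \<longlonglongrightarrow>
    (LINT x:active_edges|sg. cdot (B *v ctrl_fun L p q t x) (h x))" .
  then show ?thesis
    using tendsto_minus[OF tendsto_scaleR[OF tendsto_const Q_limit[OF i], of "1 / Nn"]] LIMSEQ_unique by blast
qed

end

section \<open>Solutions by transposition\<close>

lemma bounded_imp_L2_space:
  fixes f :: "'a \<Rightarrow> 'b::euclidean_space"
  assumes "finite_measure M" "f \<in> borel_measurable M" "\<And>x. norm (f x) \<le> C"
  shows "f \<in> L2_space M"
proof (rule L2_spaceI[OF assms(2)])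
  show "integrable M (\<lambda>x. (norm (f x))\<^sup>2)"
    by (rule finite_measure.integrable_const_bound[OF assms(1), of _ "C\<^sup>2"])
      (use assms in \<open>auto intro!: AE_I2 power_mono\<close>)
qed

context heat_system
begin

lemma hm1I:
  fixes b :: "nat \<times> nat \<Rightarrow> complex^'n"
  assumes "(\<lambda>i. D i / sqrt (lam i)) \<in> L2_space CS" "\<And>i. norm (b i) \<le> D i"
  shows "hm1 b"
  unfolding hm1_def
proof (rule L2_space_bound[OF assms(1), of _ 1])
  fix i
  show "norm (b i /\<^sub>R sqrt (lam i)) \<le> 1 * norm (D i / sqrt (lam i))"
    using order_trans[OF norm_ge_zero assms(2)] lam_pos[of i] assms(2)[of i]
    by (simp add: divide_inverse mult.commute mult_right_mono abs_of_nonneg)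
qed simp

text \<open>Variation of constants mode by mode: the candidate state is prescribed through its
  coefficients instead of being found by solving an equation.\<close>

definition sol :: "(nat \<times> nat \<Rightarrow> complex^2) \<Rightarrow> (nat \<Rightarrow> real \<Rightarrow> complex^'m) \<Rightarrow> (nat \<Rightarrow> real \<Rightarrow> complex^'m) \<Rightarrow> real \<Rightarrow> nat \<times> nat \<Rightarrow> complex^2" where
  "sol b0 p q t i = dflow i t (b0 i) + ctrl p q t i"

lemma sol_continuous: "admissible L p q \<Longrightarrow> continuous_on {0..T} (\<lambda>t. sol b0 p q t i)"
  unfolding sol_def by (intro continuous_intros ctrl_continuous continuous_on_subset[OF Em_continuous]) auto

text \<open>\<open>D\<close> dominates uniformly in time, for continuity into \<open>H^-1\<close>,
  and \<open>C\<close> bounds the space-time norm. For the latter, integrating the free decay in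
  time gains \<open>1 / lam i\<close>, exactly what separates \<open>H^-1\<close> data from
  L2.\<close>

lemma sol_bounds:
  assumes ad: "admissible L p q" and b0: "hm1 b0" and T: "T \<ge> 0"
  obtains D C where "(\<lambda>i. D i / sqrt (lam i)) \<in> L2_space CS"
    "\<And>t i. t \<in> {0..T} \<Longrightarrow> norm (ctrl p q t i) \<le> D i"
    "\<And>t i. t \<in> {0..T} \<Longrightarrow> norm (sol b0 p q t i) \<le> D i"
    "\<And>i. (\<lambda>t. sol b0 p q t i) \<in> L2_space (lborel_on {0<..<T})"
    "\<And>n. (\<Sum>i\<in>Q n. (L2_norm (lborel_on {0<..<T}) (\<lambda>t. sol b0 p q t i))\<^sup>2) \<le> C"
proof -
  let ?I = "lborel_on {0<..<T}"
  obtain gam where gam: "\<And>i. gam i \<ge> 0" "\<And>i t. norm (src p q i t) \<le> gam i" "(\<lambda>i. gam i / lam i) \<in> L2_space CS"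
    by (rule src_bound[OF ad]) blast
  obtain K where K: "K > 0" "\<And>s x. s \<in> {0..T} \<Longrightarrow> norm (conj_transpose (Em s) *v x) \<le> K * norm x"
    by (rule Em_adjoint_bound[of T]) blast
  have cb: "norm (ctrl p q t i) \<le> K * (gam i / lam i)" if "t \<in> {0..T}" for t i
    by (rule ctrl_integrable_bound(2)[OF ad gam(2) that K])
  have fb: "norm (dflow i t (b0 i)) \<le> exp (- (lam i * t)) * (K * norm (b0 i))" if "t \<in> {0..T}" for t i
    using K(2)[OF that, of "b0 i"] by simp
  have sb: "norm (sol b0 p q t i) \<le> exp (- (lam i * t)) * (K * norm (b0 i)) + K * (gam i / lam i)" if "t \<in> {0..T}" for t i
    unfolding sol_def by (rule norm_triangle_mono[OF fb cb]) (fact that)+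
  have e1: "exp (- (lam i * t)) \<le> 1" if "t \<in> {0..T}" for t i using that lam_pos[of i] by simp
  define D where "D i = K * norm (b0 i) + K * (gam i / lam i)" for i
  have Db: "norm (sol b0 p q t i) \<le> D i" if "t \<in> {0..T}" for t i
  proof -
    have "exp (- (lam i * t)) * (K * norm (b0 i)) \<le> 1 * (K * norm (b0 i))" using K(1) by (intro mult_right_mono e1 that) simp
    then show ?thesis unfolding D_def using sb[OF that, of i] by linarith
  qed
  have bL: "(\<lambda>i. norm (b0 i /\<^sub>R sqrt (lam i))) \<in> L2_space CS" using b0 unfolding hm1_def by (rule L2_space_norm)
  have gL: "(\<lambda>i. (gam i / lam i) / sqrt (lam i)) \<in> L2_space CS"
  proof (rule L2_space_bound[OF gam(3), of _ "1 / sqrt (lam (0,0))"])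
    fix i
    from mult_right_mono[OF inverse_sqrt_lam_le, of "gam i / lam i"]
    show "norm ((gam i / lam i) / sqrt (lam i)) \<le> 1 / sqrt (lam (0,0)) * norm (gam i / lam i)"
      using gam(1)[of i] lam_pos[of i] by (simp add: abs_of_nonneg mult.commute)
  qed simp
  have D2: "(\<lambda>i. D i / sqrt (lam i)) \<in> L2_space CS"
  proof -
    have "(\<lambda>i. K *\<^sub>R norm (b0 i /\<^sub>R sqrt (lam i)) + K *\<^sub>R ((gam i / lam i) / sqrt (lam i))) \<in> L2_space CS"
      by (intro L2_space_add L2_space_scaleR bL gL)
    moreover have "K *\<^sub>R norm (b0 i /\<^sub>R sqrt (lam i)) + K *\<^sub>R ((gam i / lam i) / sqrt (lam i)) = D i / sqrt (lam i)" for i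
      using lam_pos[of i] by (simp add: D_def divide_inverse algebra_simps)
    ultimately show ?thesis by simp
  qed
  have m: "(\<lambda>t. sol b0 p q t i) \<in> borel_measurable ?I" for i
    using borel_measurable_continuous_on_restrict[OF continuous_on_subset[OF sol_continuous[OF ad]], of "{0<..<T}" T b0 i]
    by (simp add: greaterThanLessThan_subseteq_atLeastAtMost_iff cong: measurable_cong_sets sets_restrict_space_cong)
  have tI: "t \<in> space ?I \<Longrightarrow> t \<in> {0..T}" for t by (auto simp: space_restrict_space)
  let ?B = "\<lambda>i t. 2 * (K * norm (b0 i))\<^sup>2 * exp (- (lam i * t)) + 2 * (K * (gam i / lam i))\<^sup>2"
  have sq: "(norm (sol b0 p q t i))\<^sup>2 \<le> ?B i t" if "t \<in> {0..T}" for t i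
  proof -
    have "(norm (sol b0 p q t i))\<^sup>2 \<le> (exp (- (lam i * t)) * (K * norm (b0 i)) + K * (gam i / lam i))\<^sup>2"
      by (intro power_mono sb that) simp
    also have "\<dots> \<le> 2 * (exp (- (lam i * t)) * (K * norm (b0 i)))\<^sup>2 + 2 * (K * (gam i / lam i))\<^sup>2"
      using sum_squares_bound[of "exp (- (lam i * t)) * (K * norm (b0 i))" "K * (gam i / lam i)"] unfolding power2_sum by linarith
    \<comment> \<open>One of the two decay factors is bounded by 1, leaving a single exponential to
      integrate.\<close>
    also have "(exp (- (lam i * t)) * (K * norm (b0 i)))\<^sup>2 \<le> exp (- (lam i * t)) * (K * norm (b0 i))\<^sup>2"
      unfolding power_mult_distrib[of "exp (- (lam i * t))"] power2_eq_square[of "exp (- (lam i * t))"]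
      using mult_right_mono[OF e1[OF that, of i], of "exp (- (lam i * t))"] by (intro mult_right_mono) auto
    finally show ?thesis by (simp add: mult_ac)
  qed
  interpret I: finite_measure ?I by (rule finite_measure_interval)
  have ie: "integrable ?I (\<lambda>t. exp (- (lam i * t)))" for i
    by (rule I.integrable_const_bound[of _ 1]) (use e1[OF tI, of _ i] in \<open>auto intro!: AE_I2 measurable_restrict_space1 simp del: exp_le_one_iff\<close>)
  have iB: "integrable ?I (?B i)" for i by (intro Bochner_Integration.integrable_add integrable_mult_right ie I.integrable_const)
  have sL: "(\<lambda>t. sol b0 p q t i) \<in> L2_space ?I" for i
    by (rule L2_spaceI[OF m], rule Bochner_Integration.integrable_bound[OF iB[of i]])
      (use m[of i] sq[OF tI, of _ i] in \<open>auto intro!: AE_I2 order_trans[OF _ abs_ge_self]\<close>)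
  define C where "C = 2 * K\<^sup>2 * (L2_norm CS (\<lambda>i. b0 i /\<^sub>R sqrt (lam i)))\<^sup>2 + 2 * K\<^sup>2 * measure ?I (space ?I) * (L2_norm CS (\<lambda>i. gam i / lam i))\<^sup>2"
  have "(\<Sum>i\<in>Q n. (L2_norm ?I (\<lambda>t. sol b0 p q t i))\<^sup>2) \<le> C" for n
  proof -
    have "(L2_norm ?I (\<lambda>t. sol b0 p q t i))\<^sup>2 \<le> 2 * K\<^sup>2 * (norm (b0 i /\<^sub>R sqrt (lam i)))\<^sup>2 + 2 * K\<^sup>2 * measure ?I (space ?I) * (norm (gam i / lam i))\<^sup>2" for i
    proof -
      have "(L2_norm ?I (\<lambda>t. sol b0 p q t i))\<^sup>2 \<le> (\<integral>t. ?B i t \<partial>?I)"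
        unfolding L2_norm_sq by (intro integral_mono L2_space_integrable_sq sL iB sq tI)
      also have "\<dots> = 2 * (K * norm (b0 i))\<^sup>2 * (\<integral>t. exp (- (lam i * t)) \<partial>?I) + 2 * (K * (gam i / lam i))\<^sup>2 * measure ?I (space ?I)"
        by (simp add: ie)
      also have "\<dots> \<le> 2 * (K * norm (b0 i))\<^sup>2 * (1 / lam i) + 2 * (K * (gam i / lam i))\<^sup>2 * measure ?I (space ?I)"
        by (intro add_right_mono mult_left_mono integral_exp_le T) auto
      also have "\<dots> = 2 * K\<^sup>2 * (norm (b0 i /\<^sub>R sqrt (lam i)))\<^sup>2 + 2 * K\<^sup>2 * measure ?I (space ?I) * (norm (gam i / lam i))\<^sup>2"
        using lam_pos[of i] by (simp add: power_mult_distrib power_divide divide_inverse power_inverse mult_ac)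
      finally show ?thesis .
    qed
    then have "(\<Sum>i\<in>Q n. (L2_norm ?I (\<lambda>t. sol b0 p q t i))\<^sup>2) \<le>
        2 * K\<^sup>2 * (\<Sum>i\<in>Q n. (norm (b0 i /\<^sub>R sqrt (lam i)))\<^sup>2) + 2 * K\<^sup>2 * measure ?I (space ?I) * (\<Sum>i\<in>Q n. (norm (gam i / lam i))\<^sup>2)"
      unfolding sum_distrib_left sum.distrib[symmetric] by (rule sum_mono)
    also have "\<dots> \<le> C"
      unfolding C_def by (intro add_mono mult_left_mono L2_CS_sum_le b0[unfolded hm1_def] gam) auto
    finally show ?thesis .
  qed
  moreover have "norm (ctrl p q t i) \<le> D i" if "t \<in> {0..T}" for t i
    using cb[OF that, of i] K(1) by (simp add: D_def add_increasing)
  ultimately show ?thesis using that[OF D2 _ Db sL] by blast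
qed

lemma hm1_zero: "hm1 (\<lambda>i. 0 :: complex^'n)" by (simp add: hm1_def)

lemma ctrl_hm1:
  assumes "admissible L p q" "t \<ge> 0"
  shows "hm1 (ctrl p q t)"
proof -
  obtain D where "(\<lambda>i. D i / sqrt (lam i)) \<in> L2_space CS" "\<And>s i. s \<in> {0..t} \<Longrightarrow> norm (ctrl p q s i) \<le> D i"
    by (rule sol_bounds[OF assms(1) hm1_zero assms(2)]) blast
  then show ?thesis by (rule hm1I) (use assms in simp)
qed

lemma sol_hm1:
  assumes "admissible L p q" "hm1 b0" "t \<ge> 0"
  shows "hm1 (sol b0 p q t)"
proof -
  obtain D where "(\<lambda>i. D i / sqrt (lam i)) \<in> L2_space CS" "\<And>s i. s \<in> {0..t} \<Longrightarrow> norm (sol b0 p q s i) \<le> D i"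
    by (rule sol_bounds[OF assms]) blast
  then show ?thesis by (rule hm1I) (use assms in simp)
qed

lemma ctrl_fun_boundary_L2:
  assumes ad: "admissible L p q"
  shows "ctrl_fun L p q \<in> boundary_L2 T sg"
proof -
  let ?M = "lborel_on {0<..<T} \<Otimes>\<^sub>M sg"
  interpret I: finite_measure "lborel_on {0<..<T}" by (rule finite_measure_interval)
  interpret S: finite_measure sg by (rule finite_sg)
  interpret P: pair_sigma_finite "lborel_on {0<..<T}" sg ..
  have f: "finite_measure ?M"
  proof (rule finite_measureI)
    have "emeasure ?M (space ?M) = emeasure (lborel_on {0<..<T}) (space (lborel_on {0<..<T})) * emeasure sg (space sg)"
      unfolding space_pair_measure by (intro S.emeasure_pair_measure_Times sets.top)
    then show "emeasure ?M (space ?M) \<noteq> \<infinity>"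
      unfolding I.emeasure_eq_measure S.emeasure_eq_measure by (simp flip: ennreal_mult)
  qed
  obtain K where K: "\<And>l t. norm (p l t) \<le> K \<and> norm (q l t) \<le> K" using ad unfolding admissible_def by blast
  have pm: "p l \<in> borel_measurable borel" "q l \<in> borel_measurable borel" for l using ad by (auto simp: admissible_def)
  have lr: "rect_left X1 X2 \<in> sets borel" "rect_top X1 X2 \<in> sets borel" by (simp_all add: rect_left_def rect_top_def borel_Times)
  have [measurable]: "(\<lambda>z. p l (fst z)) \<in> borel_measurable ?M" "(\<lambda>z. q l (fst z)) \<in> borel_measurable ?M" for l
    by (rule measurable_compose[OF measurable_fst measurable_restrict_space1]; use pm in simp)+
  have "(\<lambda>x. indicator (rect_left X1 X2) x * (2 / X2) * sin (w * snd x)) \<in> borel_measurable sg"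
    "(\<lambda>x. indicator (rect_top X1 X2) x * (2 / X1) * sin (w * fst x)) \<in> borel_measurable sg" for w
    using lr by (intro borel_sg borel_measurable_times borel_measurable_indicator borel_measurable_const
        borel_measurable_continuous_onI continuous_intros; simp)+
  note this[THEN measurable_compose[OF measurable_snd], measurable]
  have "(\<lambda>(t, x). ctrl_fun L p q t x) \<in> borel_measurable ?M"
    unfolding ctrl_fun_def case_prod_beta by measurable
  moreover have "norm (ctrl_fun L p q t x) \<le> (\<Sum>l<L. \<bar>2 / X2\<bar> * K) + (\<Sum>k<L. \<bar>2 / X1\<bar> * K)" for t x
  proof -
    have "norm (c *\<^sub>R v) \<le> \<bar>a\<bar> * K" if "\<bar>c\<bar> \<le> \<bar>a\<bar>" "norm v \<le> K" for a c :: real and v :: "complex^'m"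
      unfolding norm_scaleR using that by (intro mult_mono) auto
    moreover have "\<bar>indicator S x * a * sin w\<bar> \<le> \<bar>a\<bar>" for a w :: real and S and x :: "plane"
      using mult_left_le[of "\<bar>sin w\<bar>" "\<bar>a\<bar>"] by (auto simp: indicator_def abs_mult)
    ultimately show ?thesis
      unfolding ctrl_fun_def using K by (intro norm_triangle_mono sum_norm_le) blast+
  qed
  ultimately show ?thesis unfolding boundary_L2_def by (auto intro!: bounded_imp_L2_space[OF f])
qed

text \<open>\<open>boundary_pairing\<close> holds at almost every time and is integrated; as the
  coefficients of the adjoint state are explicit, \<open>ctrl_dual\<close> recognises the result as
  the reached state paired with \<open>\<zeta>\<close>.\<close>

lemma control_pairing:
  assumes ad: "admissible L p q" and \<tau>: "\<tau> \<ge> 0" and \<zeta>: "\<zeta> \<in> H10" and z: "adjoint_solution Om A \<tau> \<zeta> z"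
    and h: "h \<in> boundary_L2 \<tau> sg" and nd: "AE t in lborel_on {0<..<\<tau>}. has_normal_derivative Om sg nu (z t) (h t)"
  shows "Fn (ctrl p q \<tau>) \<zeta> = - (LINT t:{0<..<\<tau>}|lborel. LINT x:active_edges|sg. cdot (B *v ctrl_fun L p q t x) (h t x))"
proof -
  let ?I = "lborel_on {0<..<\<tau>}" and ?\<gamma> = "active_edges"
  interpret I: finite_measure ?I by (rule finite_measure_interval)
  interpret S: finite_measure sg by (rule finite_sg)
  interpret P: pair_sigma_finite ?I sg ..
  let ?G = "\<lambda>t. LINT x:?\<gamma>|sg. cdot (B *v ctrl_fun L p q t x) (h t x)"
  let ?H = "\<lambda>t. \<integral>i. cdot (src p q i t) (flow i (\<tau> - t) (coef \<zeta> i)) \<partial>CS"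
  have zc: "coef (z t) i = flow i (\<tau> - t) (coef \<zeta> i)" if "t \<in> {0..\<tau>}" for t i
    using adjoint_solution_coef[OF z \<zeta> that] .
  have cL: "coef \<zeta> \<in> L2_space CS"
  proof (rule L2_CS_I(1))
    fix n
    show "(\<Sum>i\<in>Q n. (norm (coef \<zeta> i))\<^sup>2) \<le> Nn * (L2_norm Lb \<zeta>)\<^sup>2"
      using bessel[OF H10_L2[OF \<zeta>], of n] Nn_pos by (simp add: sum_divide_distrib[symmetric] divide_le_eq mult.commute)
  qed
  note dual = ctrl_dual[OF ad cL \<tau>]
  have hm: "(\<lambda>(t, x). h t x) \<in> L2_space (?I \<Otimes>\<^sub>M sg)" using h by (simp add: boundary_L2_def)
  \<comment> \<open>Square integrability of \<open>h\<close> in space-time passes to almost every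
    slice, as the pairing at a fixed time needs.\<close>
  have hs: "AE t in ?I. h t \<in> L2_space sg"
    using P.AE_integrable_fst'[OF L2_space_integrable_sq[OF hm]] AE_space
  proof eventually_elim
    case (elim t)
    then show ?case using measurable_compose[OF measurable_Pair1' L2_space_measurable[OF hm], of t] by (auto intro: L2_spaceI)
  qed
  have "?G \<in> borel_measurable ?I"
    unfolding set_lebesgue_integral_def
  proof (rule S.borel_measurable_lebesgue_integral)
    have "(\<lambda>z. h (fst z) (snd z)) \<in> borel_measurable (?I \<Otimes>\<^sub>M sg)"
      "(\<lambda>z. ctrl_fun L p q (fst z) (snd z)) \<in> borel_measurable (?I \<Otimes>\<^sub>M sg)"
      using L2_space_measurable[OF hm] ctrl_fun_boundary_L2[OF ad, of \<tau>] by (auto simp: case_prod_beta boundary_L2_def dest: L2_space_measurable)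
    then show "(\<lambda>(t, x). indicator ?\<gamma> x *\<^sub>R cdot (B *v ctrl_fun L p q t x) (h t x)) \<in> borel_measurable (?I \<Otimes>\<^sub>M sg)"
      unfolding case_prod_beta
      by (intro borel_measurable_scaleR borel_measurable_cdot borel_measurable_matrix_vector measurable_compose[OF measurable_snd borel_measurable_indicator])
        (auto simp: rect_left_def rect_top_def borel_Times)
  qed
  moreover have "AE t in ?I. ?G t = - ((1 / Nn) *\<^sub>R ?H t)"
    using hs nd dual(2) AE_space
  proof eventually_elim
    case (elim t)
    then have t: "t \<in> {0..\<tau>}" by (auto simp: space_restrict_space)
    have zH: "z t \<in> H10" using z t by (simp add: adjoint_solution_def)
    show ?case
      using boundary_pairing[OF ad zH elim(2,1)] elim(3) by (simp only: zc[OF t])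
  qed
  ultimately have "(\<integral>t. ?G t \<partial>?I) = (\<integral>t. - ((1 / Nn) *\<^sub>R ?H t) \<partial>?I)"
    by (intro integral_cong_AE borel_measurable_uminus borel_measurable_scaleR borel_measurable_const dual(3))
  also have "\<dots> = - Fn (ctrl p q \<tau>) \<zeta>" by (simp add: Fn_def dual(1))
  finally show ?thesis unfolding set_lebesgue_integral_def[of lborel] by (simp add: integral_restrict_space)
qed

text \<open>Existence by exhibiting the series. The duality identity holds against every adjoint
  solution because \<open>adjoint_solution_coef\<close> forces its coefficients.\<close>

theorem transposition_solution_series:
  assumes ad: "admissible L p q" and T: "T > 0" and b0: "hm1 b0" and y0: "\<And>\<zeta>. \<zeta> \<in> H10 \<Longrightarrow> y0 \<zeta> = Fn b0 \<zeta>"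
  shows "transposition_solution Om sg nu active_edges A B T y0 (ctrl_fun L p q) (\<lambda>t. Fn (sol b0 p q t))"
proof -
  have T0: "T \<ge> 0" using T by simp
  have h: "hm1 (sol b0 p q t)" if "t \<in> {0..T}" for t using sol_hm1[OF ad b0, of t] that by simp
  obtain D C where DC: "(\<lambda>i. D i / sqrt (lam i)) \<in> L2_space CS"
    "\<And>t i. t \<in> {0..T} \<Longrightarrow> norm (sol b0 p q t i) \<le> D i"
    "\<And>i. (\<lambda>t. sol b0 p q t i) \<in> L2_space (lborel_on {0<..<T})"
    "\<And>n. (\<Sum>i\<in>Q n. (L2_norm (lborel_on {0<..<T}) (\<lambda>t. sol b0 p q t i))\<^sup>2) \<le> C"
    by (rule sol_bounds[OF ad b0 T0]) blast
  have dual: "Fn (sol b0 p q \<tau>) \<zeta> - y0 (z 0) = - (LINT t:{0<..<\<tau>}|lborel. LINT x:active_edges|sg. cdot (B *v ctrl_fun L p q t x) (h t x))"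
    if \<tau>: "\<tau> \<in> {0..T}" and \<zeta>: "\<zeta> \<in> H10" and z: "adjoint_solution Om A \<tau> \<zeta> z"
      and hz: "h \<in> boundary_L2 \<tau> sg" "AE t in lborel_on {0<..<\<tau>}. has_normal_derivative Om sg nu (z t) (h t)" for \<tau> \<zeta> z h
  proof -
    have \<tau>0: "\<tau> \<ge> 0" using \<tau> by simp
    have ch: "hm1 (ctrl p q \<tau>)" by (rule ctrl_hm1[OF ad \<tau>0])
    have fh: "hm1 (\<lambda>i. sol b0 p q \<tau> i - ctrl p q \<tau> i)" by (rule hm1_diff[OF _ ch]) (use sol_hm1[OF ad b0 \<tau>0] in simp)
    have z0: "z 0 \<in> H10" using z \<tau>0 by (simp add: adjoint_solution_def)
    \<comment> \<open>The difference is the free part; paired with \<open>\<zeta>\<close> it gives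
      the initial data paired with \<open>z 0\<close>, since the two propagators are adjoint to each
      other.\<close>
    have "Fn (\<lambda>i. sol b0 p q \<tau> i - ctrl p q \<tau> i) \<zeta> = Fn b0 (z 0)"
      using adjoint_solution_coef[OF z \<zeta>, of 0] \<tau>0
      by (simp add: Fn_def sol_def cdot_scaleR_left cdot_scaleR_right cdot_adjoint')
    then have "Fn (sol b0 p q \<tau>) \<zeta> - y0 (z 0) = Fn (ctrl p q \<tau>) \<zeta>"
      using Fn_diff[OF sol_hm1[OF ad b0 \<tau>0] ch \<zeta>] y0[OF z0] by (simp add: algebra_simps)
    with control_pairing[OF ad \<tau>0 \<zeta> z hz] show ?thesis by simp
  qed
  show ?thesis
    unfolding transposition_solution_def
  proof (intro conjI ballI allI impI)
    show "Fn (sol b0 p q t) \<in> Sobolev_Hm1 Om" if "t \<in> {0..T}" for t by (rule Fn_Sobolev_Hm1[OF h[OF that]])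
    show "((\<lambda>s. Hm1_norm Om (\<lambda>\<zeta>. Fn (sol b0 p q s) \<zeta> - Fn (sol b0 p q t) \<zeta>)) \<longlongrightarrow> 0) (at t within {0..T})" if "t \<in> {0..T}" for t
      by (rule Fn_continuous[OF sol_continuous[OF ad] DC(1,2) h that])
    show "\<exists>w. (\<lambda>(t, x). w t x) \<in> L2_space (lborel_on {0<..<T} \<Otimes>\<^sub>M Lb) \<and>
      (AE t in lborel_on {0<..<T}. \<forall>\<zeta>\<in>H10. Fn (sol b0 p q t) \<zeta> = (\<integral>x. cdot (w t x) (\<zeta> x) \<partial>Lb))"
      by (rule Fn_L2_representative[OF DC(3) h DC(4)]) simp
  qed (rule dual)
qed

end

section \<open>Uniqueness for Dirichlet series\<close>

definition dirichlet :: "(nat \<Rightarrow> real) \<Rightarrow> (nat \<Rightarrow> complex) \<Rightarrow> complex \<Rightarrow> complex" where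
  "dirichlet \<mu> a z = (\<Sum>k. a k * exp (- (of_real (\<mu> k) * z)))"

text \<open>Absolute convergence at every positive \<open>s\<close>, with nothing claimed at 0: the
  coefficients met later are merely bounded.\<close>

definition dirichlet_conv :: "(nat \<Rightarrow> real) \<Rightarrow> (nat \<Rightarrow> complex) \<Rightarrow> bool" where
  "dirichlet_conv \<mu> a \<longleftrightarrow> (\<forall>s>0. summable (\<lambda>k. norm (a k) * exp (- (\<mu> k * s))))"

lemma dirichlet_convD: "dirichlet_conv \<mu> a \<Longrightarrow> s > 0 \<Longrightarrow> summable (\<lambda>k. norm (a k) * exp (- (\<mu> k * s)))"
  by (simp add: dirichlet_conv_def)

lemma dirichlet_summable_norm:
  "dirichlet_conv \<mu> a \<Longrightarrow> Re z > 0 \<Longrightarrow> summable (\<lambda>k. norm (a k * exp (- (of_real (\<mu> k) * z))))"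
  using dirichlet_convD[of \<mu> a "Re z"] by (simp add: norm_mult)

lemmas dirichlet_summable = summable_norm_cancel[OF dirichlet_summable_norm]

lemma dirichlet_zero_coeffs [simp]: "dirichlet \<mu> (\<lambda>k. 0) z = 0"
  by (simp add: dirichlet_def)

lemma dirichlet_conv_upd:
  assumes "dirichlet_conv \<mu> a"
  shows "dirichlet_conv \<mu> (a(K := 0))"
  unfolding dirichlet_conv_def
proof (intro allI impI)
  fix s :: real assume "s > 0"
  then show "summable (\<lambda>k. norm ((a(K := 0)) k) * exp (- (\<mu> k * s)))"
    by (rule summable_comparison_test'[OF dirichlet_convD[OF assms], where N = 0]) simp
qed

lemma dirichlet_upd:
  assumes "dirichlet_conv \<mu> a" "Re z > 0"
  shows "dirichlet \<mu> (a(K := 0)) z = dirichlet \<mu> a z - a K * exp (- (of_real (\<mu> K) * z))"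
proof -
  have "(\<lambda>k. (if k = K then a k * exp (- (of_real (\<mu> k) * z)) else 0)) sums (a K * exp (- (of_real (\<mu> K) * z)))" by (rule sums_single)
  from sums_diff[OF summable_sums[OF dirichlet_summable[OF assms]] this]
  have "(\<lambda>k. (a(K := 0)) k * exp (- (of_real (\<mu> k) * z))) sums (dirichlet \<mu> a z - a K * exp (- (of_real (\<mu> K) * z)))"
    unfolding dirichlet_def by (rule sums_cong[THEN iffD1, rotated]) simp
  then show ?thesis unfolding dirichlet_def[of \<mu> "a(K := 0)"] by (rule sums_unique[symmetric])
qed

lemma dirichlet_holomorphic:
  assumes c: "dirichlet_conv \<mu> a" and \<mu>: "\<And>k. \<mu> k > 0"
  shows "dirichlet \<mu> a holomorphic_on {z. Re z > 0}"
proof (rule holomorphic_uniform_sequence[where f = "\<lambda>n z. \<Sum>k<n. a k * exp (- (of_real (\<mu> k) * z))"])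
  show "open {z. Re z > 0}" by (rule open_halfspace_Re_gt)
  show "(\<lambda>z. \<Sum>k<n. a k * exp (- (of_real (\<mu> k) * z))) holomorphic_on {z. Re z > 0}" for n by (intro holomorphic_intros)
  fix x :: complex assume "x \<in> {z. Re z > 0}"
  then have d: "Re x / 2 > 0" by simp
  \<comment> \<open>On the disc of half the distance to the imaginary axis, the series at
    \<open>Re x / 2\<close> dominates uniformly.\<close>
  have ge: "Re z \<ge> Re x / 2" if "z \<in> cball x (Re x / 2)" for z
    using that abs_Re_le_cmod[of "x - z"] by (auto simp: dist_norm)
  have "uniform_limit (cball x (Re x / 2)) (\<lambda>n z. \<Sum>k<n. a k * exp (- (of_real (\<mu> k) * z))) (\<lambda>z. \<Sum>k. a k * exp (- (of_real (\<mu> k) * z))) sequentially"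
  proof (rule Weierstrass_m_test[OF _ dirichlet_convD[OF c d]])
    fix k z assume z: "z \<in> cball x (Re x / 2)"
    show "norm (a k * exp (- (of_real (\<mu> k) * z))) \<le> norm (a k) * exp (- (\<mu> k * (Re x / 2)))"
      using mult_left_mono[OF ge[OF z] less_imp_le[OF \<mu>[of k]]] by (simp add: norm_mult mult_left_mono)
  qed
  moreover have "cball x (Re x / 2) \<subseteq> {z. Re z > 0}" using ge d by fastforce
  ultimately show "\<exists>d>0. cball x d \<subseteq> {z. Re z > 0} \<and>
      uniform_limit (cball x d) (\<lambda>n z. \<Sum>k<n. a k * exp (- (of_real (\<mu> k) * z))) (dirichlet \<mu> a) sequentially"
    using d unfolding dirichlet_def[abs_def] by blast
qed

text \<open>After multiplication by \<open>exp (\<mu> K * s)\<close> the tail is at most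
  \<open>exp (\<mu> K * s - \<mu> (Suc K) * (s - 1))\<close> times the absolute tail at
  \<open>s = 1\<close>, which tends to 0 because the exponents increase strictly.\<close>

lemma dirichlet_leading:
  assumes mono: "strict_mono \<mu>" and c: "dirichlet_conv \<mu> a" and z: "\<And>k. k < K \<Longrightarrow> a k = 0"
  shows "((\<lambda>s. exp (of_real (\<mu> K * s)) * dirichlet \<mu> a (of_real s)) \<longlongrightarrow> a K) at_top"
proof -
  let ?t = "\<lambda>s k. a (k + Suc K) * exp (- (of_real (\<mu> (k + Suc K)) * complex_of_real s))"
  define C where "C = (\<Sum>k. norm (a (k + Suc K)) * exp (- (\<mu> (k + Suc K) * 1)))"
  have sC: "summable (\<lambda>k. norm (a (k + Suc K)) * exp (- (\<mu> (k + Suc K) * 1)))"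
    using dirichlet_convD[OF c zero_less_one] by (rule summable_ignore_initial_segment)
  have eq: "exp (of_real (\<mu> K * s)) * dirichlet \<mu> a (of_real s) - a K = exp (of_real (\<mu> K * s)) * (\<Sum>k. ?t s k)" if "s \<ge> 1" for s
  proof -
    have "dirichlet \<mu> a (of_real s) = (\<Sum>k. ?t s k) + (\<Sum>k<Suc K. a k * exp (- (of_real (\<mu> k) * of_real s)))"
      unfolding dirichlet_def by (rule suminf_split_initial_segment) (rule dirichlet_summable[OF c], use that in simp)
    also have "(\<Sum>k<Suc K. a k * exp (- (of_real (\<mu> k) * of_real s))) = a K * exp (- of_real (\<mu> K * s))" using z by simp
    finally show ?thesis by (simp add: exp_minus field_simps)
  qed
  have bd: "norm (exp (of_real (\<mu> K * s)) * (\<Sum>k. ?t s k)) \<le> exp (\<mu> K * s - \<mu> (Suc K) * (s - 1)) * C" if "s \<ge> 1" for s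
  proof -
    have sn: "summable (\<lambda>k. norm (?t s k))"
      using summable_ignore_initial_segment[OF dirichlet_summable_norm[OF c, of "of_real s"], of "Suc K"] that by simp
    have "norm (\<Sum>k. ?t s k) \<le> (\<Sum>k. norm (?t s k))" by (rule summable_norm[OF sn])
    also have "\<dots> \<le> (\<Sum>k. exp (- (\<mu> (Suc K) * (s - 1))) * (norm (a (k + Suc K)) * exp (- (\<mu> (k + Suc K) * 1))))"
    proof (rule suminf_le[OF _ sn summable_mult[OF sC]])
      fix k
      have "\<mu> (Suc K) * (s - 1) \<le> \<mu> (k + Suc K) * (s - 1)"
        using that strict_mono_leD[OF mono, of "Suc K" "k + Suc K"] by (intro mult_right_mono) auto
      then have "exp (- (\<mu> (k + Suc K) * s)) \<le> exp (- (\<mu> (Suc K) * (s - 1))) * exp (- (\<mu> (k + Suc K) * 1))"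
        unfolding exp_add[symmetric] by (simp add: algebra_simps)
      from mult_left_mono[OF this norm_ge_zero[of "a (k + Suc K)"]]
      show "norm (?t s k) \<le> exp (- (\<mu> (Suc K) * (s - 1))) * (norm (a (k + Suc K)) * exp (- (\<mu> (k + Suc K) * 1)))"
        by (simp add: norm_mult mult_ac)
    qed
    also have "\<dots> = exp (- (\<mu> (Suc K) * (s - 1))) * C" unfolding C_def by (rule suminf_mult[OF sC])
    finally have "norm (\<Sum>k. ?t s k) \<le> exp (- (\<mu> (Suc K) * (s - 1))) * C" .
    then show ?thesis
      unfolding norm_mult diff_conv_add_uminus[of "\<mu> K * s"] exp_add by (simp add: mult.assoc mult_left_mono)
  qed
  have g: "\<mu> (Suc K) > \<mu> K" using mono by (simp add: strict_mono_def)
  have "((\<lambda>s. exp (m * s - m' * (s - 1)) * C) \<longlongrightarrow> 0) at_top" if "m < m'" for m m' :: real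
  proof -
    define e where "e = m' - m"
    have "e > 0" using that by (simp add: e_def)
    then have "((\<lambda>s. exp (- (e * s)) * (exp m' * C)) \<longlongrightarrow> 0) at_top" by real_asymp
    then show ?thesis by (simp add: e_def exp_diff exp_minus exp_add field_simps)
  qed
  from this[OF g] have "((\<lambda>s. exp (of_real (\<mu> K * s)) * dirichlet \<mu> a (of_real s) - a K) \<longlongrightarrow> 0) at_top"
    by (rule Lim_null_comparison[rotated]) (use eq bd in \<open>auto intro!: eventually_mono[OF eventually_ge_at_top[of 1]]\<close>)
  then show ?thesis by (simp add: LIM_zero_iff)
qed

text \<open>Strong induction: once the earlier coefficients vanish, \<open>a k\<close> is the limit
  of a function that is identically 0.\<close>

lemma dirichlet_eq_0:
  assumes mono: "strict_mono \<mu>" and c: "dirichlet_conv \<mu> a" and z: "\<And>s. s > 0 \<Longrightarrow> dirichlet \<mu> a (of_real s) = 0"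
  shows "a k = 0"
proof (induction k rule: less_induct)
  case (less k)
  have "((\<lambda>s. exp (of_real (\<mu> k * s)) * dirichlet \<mu> a (of_real s)) \<longlongrightarrow> 0) at_top"
    by (rule tendsto_eventually) (use z in \<open>auto intro!: eventually_mono[OF eventually_gt_at_top[of 0]]\<close>)
  from tendsto_unique[OF trivial_limit_at_top_linorder dirichlet_leading[OF mono c less] this] show ?case .
qed

text \<open>Shifting \<open>s\<close> by \<open>h\<close> does not change the limit, so dividing
  gives \<open>exp (w * of_real h) = 1\<close> for every real \<open>h\<close>; differentiating at 0
  forces \<open>w = 0\<close>.\<close>

lemma exp_tendsto_imp_zero:
  fixes w c :: complex
  assumes l: "((\<lambda>s. exp (w * of_real s)) \<longlongrightarrow> c) at_top" and c: "c \<noteq> 0"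
  shows "w = 0"
proof -
  have e: "exp (w * of_real h) = 1" for h
  proof -
    have "((\<lambda>s. exp (w * of_real (h + s))) \<longlongrightarrow> c) at_top"
      by (rule filterlim_compose[OF l]) (rule filterlim_tendsto_add_at_top[OF tendsto_const filterlim_ident])
    from tendsto_divide[OF this l c]
    have "((\<lambda>s::real. exp (w * of_real h)) \<longlongrightarrow> 1) at_top" using c by (simp add: ring_distribs exp_add)
    then show ?thesis by (simp add: tendsto_const_iff)
  qed
  have "((\<lambda>h. exp (w * of_real h)) has_vector_derivative w) (at 0)"
    by (rule has_vector_derivative_eq_rhs[OF has_vector_derivative_real_field[where f = "\<lambda>z. exp (w * z)"]]) (auto intro!: derivative_eq_intros)
  then show ?thesis unfolding e using vector_derivative_unique_at[OF has_vector_derivative_const] by blast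
qed

text \<open>The leading terms of the two series must cancel; removing them, the claim follows by induction.\<close>

lemma dirichlet_pair_collision:
  assumes mono: "strict_mono \<mu>"
  shows "dirichlet_conv \<mu> a \<Longrightarrow> dirichlet_conv \<mu> b \<Longrightarrow>
    (\<And>s. s > 0 \<Longrightarrow> exp (\<theta>1 * of_real s) * dirichlet \<mu> a (of_real s) + exp (\<theta>2 * of_real s) * dirichlet \<mu> b (of_real s) = 0) \<Longrightarrow>
    a k \<noteq> 0 \<Longrightarrow> \<exists>k'. \<theta>1 - of_real (\<mu> k) = \<theta>2 - of_real (\<mu> k') \<and> b k' \<noteq> 0"
\<comment> \<open>The measure counts the nonzero coefficients of \<open>a\<close> below
  \<open>k\<close>; cancelling one leading pair lowers it.\<close>
proof (induction "card {j. j < k \<and> a j \<noteq> 0}" arbitrary: a b rule: less_induct)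
  case less
  note ca = less.prems(1) and cb = less.prems(2) and zero = less.prems(3) and ak = less.prems(4)
  obtain K where K: "a K \<noteq> 0" "\<And>j. j < K \<Longrightarrow> a j = 0" using ak exists_least_iff[of "\<lambda>j. a j \<noteq> 0"] by blast
  have "\<exists>j. b j \<noteq> 0"
  proof (rule ccontr)
    assume "\<not> (\<exists>j. b j \<noteq> 0)"
    then have "b = (\<lambda>j. 0)" by auto
    then have "dirichlet \<mu> a (of_real s) = 0" if "s > 0" for s using zero[OF that] by simp
    then show False using dirichlet_eq_0[OF mono ca] K(1) by blast
  qed
  then obtain K' where K': "b K' \<noteq> 0" "\<And>j. j < K' \<Longrightarrow> b j = 0" using exists_least_iff[of "\<lambda>j. b j \<noteq> 0"] by blast
  \<comment> \<open>The gap between the leading exponents: the quotient of the two normalised series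
    is exactly \<open>exp (w * of_real s)\<close>, yet it tends to a nonzero number.\<close>
  define w where "w = \<theta>2 - \<theta>1 + of_real (\<mu> K) - of_real (\<mu> K')"
  let ?P = "\<lambda>s. exp (of_real (\<mu> K * s)) * dirichlet \<mu> a (of_real s)" and ?R = "\<lambda>s. exp (of_real (\<mu> K' * s)) * dirichlet \<mu> b (of_real s)"
  note La = dirichlet_leading[OF mono ca K(2)] and Lb = dirichlet_leading[OF mono cb K'(2)]
  have PR: "exp (w * of_real s) * ?R s = - ?P s" if "s > 0" for s
  proof -
    have "dirichlet \<mu> b (of_real s) = - exp (\<theta>1 * of_real s - \<theta>2 * of_real s) * dirichlet \<mu> a (of_real s)"
      using zero[OF that] by (simp add: exp_diff field_simps add_eq_0_iff)
    then have "exp (w * of_real s) * ?R s = - (exp (w * of_real s) * exp (of_real (\<mu> K' * s)) * exp (\<theta>1 * of_real s - \<theta>2 * of_real s)) * dirichlet \<mu> a (of_real s)"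
      by simp
    also have "exp (w * of_real s) * exp (of_real (\<mu> K' * s)) * exp (\<theta>1 * of_real s - \<theta>2 * of_real s) = exp (of_real (\<mu> K * s))"
      unfolding exp_add[symmetric] by (simp add: w_def algebra_simps)
    finally show ?thesis by simp
  qed
  have "((\<lambda>s. - ?P s / ?R s) \<longlongrightarrow> - a K / b K') at_top" by (intro tendsto_divide tendsto_minus La Lb K')
  moreover have "\<forall>\<^sub>F s in at_top. ?R s \<noteq> 0" by (rule tendsto_imp_eventually_ne[OF Lb K'(1)])
  then have "\<forall>\<^sub>F s in at_top. - ?P s / ?R s = exp (w * of_real s)"
    using eventually_gt_at_top[of 0] by eventually_elim (metis PR nonzero_mult_div_cancel_right)
  ultimately have lim: "((\<lambda>s. exp (w * of_real s)) \<longlongrightarrow> - a K / b K') at_top" by (rule Lim_transform_eventually)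
  have w0: "w = 0" by (rule exp_tendsto_imp_zero[OF lim]) (use K K' in simp)
  have "- a K / b K' = 1" using tendsto_unique[OF _ lim[unfolded w0]] tendsto_const[of 1] by fastforce
  then have ab: "b K' = - a K" using K'(1) by (simp only: divide_eq_1_iff)
  \<comment> \<open>Equal exponents and opposite coefficients: the leading terms cancel exactly, so
    the identity survives their removal.\<close>
  have \<theta>: "\<theta>1 - of_real (\<mu> K) = \<theta>2 - of_real (\<mu> K')" using w0 by (simp add: w_def algebra_simps)
  show ?case
  proof (cases "k = K")
    case True then show ?thesis using \<theta> K'(1) by blast
  next
    case False
    then have "K < k" using K ak by (meson linorder_neqE_nat)
    then have "{j. j < k \<and> (a(K := 0)) j \<noteq> 0} \<subset> {j. j < k \<and> a j \<noteq> 0}" using K(1) by auto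
    then have l: "card {j. j < k \<and> (a(K := 0)) j \<noteq> 0} < card {j. j < k \<and> a j \<noteq> 0}" by (intro psubset_card_mono) auto
    have "\<exists>k'. \<theta>1 - of_real (\<mu> k) = \<theta>2 - of_real (\<mu> k') \<and> (b(K' := 0)) k' \<noteq> 0"
    proof (rule less.hyps[OF l dirichlet_conv_upd[OF ca] dirichlet_conv_upd[OF cb]])
      fix s :: real assume s: "s > 0"
      have "exp (\<theta>1 * of_real s) * exp (- (of_real (\<mu> K) * complex_of_real s)) = exp (\<theta>2 * of_real s) * exp (- (of_real (\<mu> K') * of_real s))"
        unfolding exp_add[symmetric] using \<theta> by (metis left_diff_distrib diff_conv_add_uminus)
      then show "exp (\<theta>1 * of_real s) * dirichlet \<mu> (a(K := 0)) (of_real s) + exp (\<theta>2 * of_real s) * dirichlet \<mu> (b(K' := 0)) (of_real s) = 0"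
        using zero[OF s] s by (simp add: dirichlet_upd ca cb ab algebra_simps)
    qed (use False ak in simp)
    then show ?thesis by (metis fun_upd_other fun_upd_same)
  qed
qed

text \<open>The factor \<open>s\<close> excludes cancellation: the leading terms would force
  \<open>s * exp (r * s)\<close> to a finite nonzero limit, yet it tends to 0 or to
  infinity.\<close>

lemma dirichlet_resonant_eq_0:
  assumes mono: "strict_mono \<mu>" and ca: "dirichlet_conv \<mu> a" and cb: "dirichlet_conv \<mu> b"
    and zero: "\<And>s. s > 0 \<Longrightarrow> dirichlet \<mu> a (of_real s) + of_real s * dirichlet \<mu> b (of_real s) = 0"
  shows "a k = 0 \<and> b k = 0"
proof -
  have b0: "b j = 0" for j
  proof (rule ccontr)
    assume "b j \<noteq> 0"
    then obtain K' where K': "b K' \<noteq> 0" "\<And>j. j < K' \<Longrightarrow> b j = 0" using exists_least_iff[of "\<lambda>j. b j \<noteq> 0"] by blast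
    have "\<exists>j. a j \<noteq> 0"
    proof (rule ccontr)
      assume "\<not> (\<exists>j. a j \<noteq> 0)"
      then have "a = (\<lambda>j. 0)" by auto
      then have "dirichlet \<mu> b (of_real s) = 0" if "s > 0" for s using zero[OF that] that by simp
      then show False using dirichlet_eq_0[OF mono cb] K'(1) by blast
    qed
    then obtain K where K: "a K \<noteq> 0" "\<And>j. j < K \<Longrightarrow> a j = 0" using exists_least_iff[of "\<lambda>j. a j \<noteq> 0"] by blast
    define r where "r = \<mu> K - \<mu> K'"
    let ?P = "\<lambda>s. exp (of_real (\<mu> K * s)) * dirichlet \<mu> a (of_real s)" and ?R = "\<lambda>s. exp (of_real (\<mu> K' * s)) * dirichlet \<mu> b (of_real s)"
    note La = dirichlet_leading[OF mono ca K(2)] and Lb = dirichlet_leading[OF mono cb K'(2)]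
    have PR: "of_real (s * exp (r * s)) * ?R s = - ?P s" if "s > 0" for s
    proof -
      have "of_real (exp (r * s)) * exp (of_real (\<mu> K' * s)) = exp (complex_of_real (\<mu> K * s))"
        unfolding exp_of_real of_real_mult[symmetric] exp_add[symmetric] by (simp add: r_def algebra_simps)
      moreover have "of_real s * dirichlet \<mu> b (of_real s) = - dirichlet \<mu> a (of_real s)" using zero[OF that] by (simp add: add_eq_0_iff)
      ultimately show ?thesis by (metis (no_types, opaque_lifting) mult.assoc mult.commute mult_minus_right of_real_mult)
    qed
    have "((\<lambda>s. - ?P s / ?R s) \<longlongrightarrow> - a K / b K') at_top" by (intro tendsto_divide tendsto_minus La Lb K')
    moreover have "\<forall>\<^sub>F s in at_top. ?R s \<noteq> 0" by (rule tendsto_imp_eventually_ne[OF Lb K'(1)])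
    then have "\<forall>\<^sub>F s in at_top. - ?P s / ?R s = complex_of_real (s * exp (r * s))"
      using eventually_gt_at_top[of 0] by eventually_elim (metis PR nonzero_mult_div_cancel_right)
    ultimately have "((\<lambda>s. complex_of_real (s * exp (r * s))) \<longlongrightarrow> - a K / b K') at_top" by (rule Lim_transform_eventually)
    from tendsto_norm[OF this] have lim: "((\<lambda>s. \<bar>s * exp (r * s)\<bar>) \<longlongrightarrow> norm (- a K / b K')) at_top" unfolding norm_of_real .
    show False
    proof (cases "r < 0")
      case True
      then have "((\<lambda>s. \<bar>s * exp (r * s)\<bar>) \<longlongrightarrow> 0) at_top" by real_asymp
      from tendsto_unique[OF _ this lim] show False using K K' by simp
    next
      case False
      have "filterlim (\<lambda>s. \<bar>s * exp (r * s)\<bar>) at_top at_top"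
      proof (rule filterlim_at_top_mono[OF filterlim_ident])
        show "\<forall>\<^sub>F s in at_top. s \<le> \<bar>s * exp (r * s)\<bar>"
          using eventually_gt_at_top[of 0] by eventually_elim (use False in \<open>simp add: abs_mult\<close>)
      qed
      from not_tendsto_and_filterlim_at_infinity[OF _ lim filterlim_at_top_imp_at_infinity[OF this]] show False by simp
    qed
  qed
  then have "b = (\<lambda>j. 0)" by auto
  then have "dirichlet \<mu> a (of_real s) = 0" if "s > 0" for s using zero[OF that] by simp
  then show ?thesis using dirichlet_eq_0[OF mono ca] b0 by blast
qed

text \<open>Vanishing almost everywhere on the time interval already provides zeros accumulating at
  \<open>T / 2\<close>, inside the half-plane of holomorphy; the identity theorem extends them to
  all \<open>s > 0\<close>.\<close>

lemma dirichlet_continuation: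
  fixes \<theta>1 \<theta>2 :: complex
  defines "G \<equiv> \<lambda>a b \<mu> z. exp (\<theta>1 * z) * dirichlet \<mu> a z + dexp \<theta>1 \<theta>2 z * dirichlet \<mu> b z"
  assumes \<mu>: "\<And>k. \<mu> k > 0" and c: "dirichlet_conv \<mu> a" "dirichlet_conv \<mu> b" and T: "T > 0"
    and ae: "AE t in lborel_on {0<..<T}. G a b \<mu> (of_real (T - t)) = 0" and s: "s > 0"
  shows "G a b \<mu> (of_real s) = 0"
proof -
  let ?S = "{z. Re z > 0}" and ?U = "{z. Re z > 0 \<and> G a b \<mu> z = 0}"
  have "dexp \<theta>1 \<theta>2 holomorphic_on ?S"
    by (rule holomorphic_on_subset[OF _ subset_UNIV]) (auto simp: holomorphic_on_open intro: dexp_has_derivative)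
  then have hol: "G a b \<mu> holomorphic_on ?S"
    unfolding G_def by (intro holomorphic_on_add holomorphic_on_mult holomorphic_intros dirichlet_holomorphic c \<mu>)
  have lp: "complex_of_real (T / 2) islimpt ?U"
    unfolding islimpt_approachable
  proof (intro allI impI)
    fix e :: real assume e: "e > 0"
    \<comment> \<open>An interval of positive measure within distance \<open>e\<close> of
      \<open>T / 2\<close> that misses the point itself, so it contains a usable zero.\<close>
    let ?A = "{max (T / 2 - e) 0<..<T / 2}"
    have pos: "emeasure lborel {c<..<d::real} > 0" if "c < d" for c d using that by simp
    have A: "?A \<subseteq> {0<..<T}" "emeasure lborel ?A > 0" using T by auto (rule pos, unfold max_less_iff_conj, use e T in simp)
    have "\<exists>t\<in>?A. G a b \<mu> (of_real (T - t)) = 0"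
    proof (rule ccontr)
      assume n: "\<not> (\<exists>t\<in>?A. G a b \<mu> (of_real (T - t)) = 0)"
      have "AE t in lborel. t \<in> {0<..<T} \<longrightarrow> G a b \<mu> (of_real (T - t)) = 0" using ae by (subst (asm) AE_restrict_space_iff) auto
      then have "AE t in lborel. t \<notin> ?A" by eventually_elim (use n A(1) in blast)
      then have "emeasure lborel ?A = 0" by (rule AE_iff_measurable[THEN iffD1, rotated 2]) (simp_all only: space_lborel, auto)
      then show False using A(2) by simp
    qed
    then obtain t where t: "t \<in> ?A" "G a b \<mu> (of_real (T - t)) = 0" by blast
    have "dist (complex_of_real (T - t)) (of_real (T / 2)) = \<bar>(T - t) - T / 2\<bar>" by (simp only: dist_of_real dist_real_def)
    moreover have "complex_of_real (T - t) \<noteq> of_real (T / 2)" using t(1) unfolding of_real_eq_iff by auto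
    ultimately show "\<exists>x'\<in>?U. x' \<noteq> complex_of_real (T / 2) \<and> dist x' (of_real (T / 2)) < e"
      using t T by (intro bexI[of _ "of_real (T - t)"]) (auto simp del: of_real_diff of_real_divide)
  qed
  show ?thesis
    by (rule analytic_continuation[OF hol _ _ _ _ lp])
      (use s T in \<open>auto simp: open_halfspace_Re_gt convex_connected convex_halfspace_Re_gt\<close>)
qed

text \<open>The inequality \<open>exp (- x) \<le> 1 / x\<close> for positive \<open>x\<close> trades
  exponential decay for summability of \<open>1 / m k\<close>.\<close>

lemma dirichlet_convI:
  assumes a: "\<And>k. norm (a k) \<le> C" and s: "summable (\<lambda>k. 1 / m k)" and m: "\<And>k. 0 < m k" "\<And>k. m k \<le> \<mu> k"
  shows "dirichlet_conv \<mu> a"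
  unfolding dirichlet_conv_def
proof (intro allI impI)
  fix s :: real assume s0: "s > 0"
  have "norm (norm (a k) * exp (- (\<mu> k * s))) \<le> C / s * (1 / m k)" for k
  proof -
    have "exp (- (\<mu> k * s)) \<le> exp (- (m k * s))" using m(2)[of k] s0 by simp
    also have "\<dots> \<le> 1 / (m k * s)"
      using exp_ge_add_one_self[of "m k * s"] mult_pos_pos[OF m(1)[of k] s0] unfolding exp_minus inverse_eq_divide by (intro divide_left_mono) (linarith, auto)
    finally have "norm (a k) * exp (- (\<mu> k * s)) \<le> C * (1 / (m k * s))"
      using order_trans[OF norm_ge_zero a] by (intro mult_mono a) auto
    then show ?thesis by (simp add: mult.commute)
  qed
  then show "summable (\<lambda>k. norm (a k) * exp (- (\<mu> k * s)))" by (rule summable_comparison_test'[OF summable_mult[OF s], where N = 0])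
qed

lemma dirichlet_lin:
  assumes a: "dirichlet_conv \<mu> a" and b: "dirichlet_conv \<mu> b"
  shows "dirichlet_conv \<mu> (\<lambda>k. a k + x * b k)"
    and "Re z > 0 \<Longrightarrow> dirichlet \<mu> (\<lambda>k. a k + x * b k) z = dirichlet \<mu> a z + x * dirichlet \<mu> b z"
proof -
  show "dirichlet_conv \<mu> (\<lambda>k. a k + x * b k)"
    unfolding dirichlet_conv_def
  proof (intro allI impI)
    fix s :: real assume s: "s > 0"
    show "summable (\<lambda>k. norm (a k + x * b k) * exp (- (\<mu> k * s)))"
    proof (rule summable_comparison_test'[OF summable_add[OF dirichlet_convD[OF a s] summable_mult[OF dirichlet_convD[OF b s]]], where N = 0])
      fix k
      have "norm (a k + x * b k) * exp (- (\<mu> k * s)) \<le> (norm (a k) + norm x * norm (b k)) * exp (- (\<mu> k * s))"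
        using norm_triangle_ineq[of "a k" "x * b k"] by (intro mult_right_mono) (auto simp: norm_mult)
      then show "norm (norm (a k + x * b k) * exp (- (\<mu> k * s))) \<le> norm (a k) * exp (- (\<mu> k * s)) + norm x * (norm (b k) * exp (- (\<mu> k * s)))"
        by (simp add: algebra_simps)
    qed
  qed
  assume z: "Re z > 0"
  from suminf_add[OF dirichlet_summable[OF a z] summable_mult[OF dirichlet_summable[OF b z]]] suminf_mult[OF dirichlet_summable[OF b z]]
  show "dirichlet \<mu> (\<lambda>k. a k + x * b k) z = dirichlet \<mu> a z + x * dirichlet \<mu> b z"
    unfolding dirichlet_def by (simp add: algebra_simps)
qed

lemma summable_inverse_freq_sq: "X > 0 \<Longrightarrow> summable (\<lambda>k. 1 / (freq X k)\<^sup>2)"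
  by (rule freq_series_bound, assumption) (rule summableI_nonneg_bounded[rotated], assumption, simp)

lemma freq_less: "X > 0 \<Longrightarrow> j < k \<Longrightarrow> freq X j < freq X k"
  by (simp add: freq_def divide_strict_right_mono)

text \<open>A family supported on one row or column becomes an ordinary series, the form in which
  the Dirichlet results are stated.\<close>

lemma integral_count_space_line:
  fixes f :: "'a \<Rightarrow> 'b::{banach, second_countable_topology}" and e :: "nat \<Rightarrow> 'a"
  assumes e: "inj e" and z: "\<And>i. i \<notin> range e \<Longrightarrow> f i = 0" and s: "summable (\<lambda>k. norm (f (e k)))"
  shows "(\<integral>i. f i \<partial>count_space UNIV) = (\<Sum>k. f (e k))"
proof -
  have "(\<integral>i. f i \<partial>count_space UNIV) = (\<integral>i. indicator (range e) i *\<^sub>R f i \<partial>count_space UNIV)"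
    by (rule Bochner_Integration.integral_cong) (auto simp: z indicator_def)
  also have "\<dots> = (\<integral>i. f i \<partial>count_space (range e))"
    by (subst integral_restrict_space[symmetric]) (simp_all add: restrict_count_space)
  also have "\<dots> = (\<integral>k. f (e k) \<partial>count_space UNIV)"
    by (rule integral_bij_count_space[symmetric]) (rule inj_on_imp_bij_betw[OF e])
  also have "\<dots> = (\<Sum>k. f (e k))" using s by (intro integral_count_space_nat) (simp add: integrable_count_space_nat_iff)
  finally show ?thesis .
qed

lemma sgn_mult_cnj: "sgn z * cnj z = of_real (norm z)"
  by (cases "z = 0") (simp_all add: sgn_eq complex_norm_square[symmetric] power2_eq_square)

lemma cdot_commute: "cdot u v = cnj (cdot v u)"
  by (simp add: cdot_def mult.commute)

text \<open>For distinct roots the divided difference splits into two pure exponentials: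
  \<open>a k - b k / (\<theta>2 - \<theta>1)\<close> carries the component of
  \<open>\<theta>1\<close> and \<open>b k\<close>, up to scale, that of \<open>\<theta>2\<close>.
  The pair result, used in both orders, gives the two claims.\<close>

lemma dexp_collision:
  assumes mono: "strict_mono \<mu>" and a: "dirichlet_conv \<mu> a" and b: "dirichlet_conv \<mu> b"
    and zero: "\<And>s. s > 0 \<Longrightarrow> exp (\<theta>1 * of_real s) * dirichlet \<mu> a (of_real s) + dexp \<theta>1 \<theta>2 (of_real s) * dirichlet \<mu> b (of_real s) = 0"
    and ne: "\<theta>1 \<noteq> \<theta>2"
  shows "a k - b k / (\<theta>2 - \<theta>1) \<noteq> 0 \<Longrightarrow> \<exists>k'. \<theta>1 - of_real (\<mu> k) = \<theta>2 - of_real (\<mu> k') \<and> b k' \<noteq> 0"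
    and "b k \<noteq> 0 \<Longrightarrow> \<exists>k'. \<theta>2 - of_real (\<mu> k) = \<theta>1 - of_real (\<mu> k') \<and> a k' - b k' / (\<theta>2 - \<theta>1) \<noteq> 0"
proof -
  define x where "x = 1 / (\<theta>2 - \<theta>1)"
  have x: "x \<noteq> 0" "y / (\<theta>2 - \<theta>1) = x * y" for y using ne by (auto simp: x_def)
  have z: "dirichlet_conv \<mu> (\<lambda>k. 0)" by (simp add: dirichlet_conv_def)
  note p = dirichlet_lin[OF a b, where x = "- x"] and q = dirichlet_lin[OF z b, where x = x]
  have 0: "exp (\<theta>1 * of_real s) * dirichlet \<mu> (\<lambda>k. a k + - x * b k) (of_real s) + exp (\<theta>2 * of_real s) * dirichlet \<mu> (\<lambda>k. 0 + x * b k) (of_real s) = 0"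
    if "s > 0" for s
  proof -
    have "Re (of_real s) > 0" using that by simp
    from p(2)[OF this] q(2)[OF this] zero[OF that] ne show ?thesis by (simp only: dexp_def x if_False dirichlet_zero_coeffs) (simp add: algebra_simps)
  qed
  show "a k - b k / (\<theta>2 - \<theta>1) \<noteq> 0 \<Longrightarrow> \<exists>k'. \<theta>1 - of_real (\<mu> k) = \<theta>2 - of_real (\<mu> k') \<and> b k' \<noteq> 0"
    using dirichlet_pair_collision[OF mono p(1) q(1) 0, of k] by (auto simp: x)
  show "b k \<noteq> 0 \<Longrightarrow> \<exists>k'. \<theta>2 - of_real (\<mu> k) = \<theta>1 - of_real (\<mu> k') \<and> a k' - b k' / (\<theta>2 - \<theta>1) \<noteq> 0"
    using dirichlet_pair_collision[OF mono q(1) p(1) 0[unfolded add.commute[of "exp (\<theta>1 * _) * _"]], of k] by (auto simp: x)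
qed

context heat_system
begin

section \<open>Density of the reachable set\<close>

text \<open>The row or column is abstracted to an injection \<open>e\<close>. Among the controls on
  that line in direction \<open>w\<close>, the one with phase \<open>sgn (F t)\<close> is chosen;
  orthogonality to this single control already makes the integral of \<open>norm (F t)\<close>
  vanish.\<close>

lemma line_vanish:
  fixes w :: "complex^'m" and c :: "nat \<Rightarrow> real" and d :: "nat \<times> nat \<Rightarrow> complex^2"
  defines "\<zeta> \<equiv> \<lambda>i. d i /\<^sub>R sqrt (lam i)"
  defines "a \<equiv> \<lambda>e k. c k *\<^sub>R cdot (\<zeta> (e k)) (B *v w)" and "b \<equiv> \<lambda>e k. c k *\<^sub>R cdot (Nm (\<zeta> (e k))) (B *v w)"
  assumes T: "T > 0" and d: "d \<in> L2_space CS" and e: "inj e" and c: "\<And>k. \<bar>c k\<bar> \<le> sqrt (lam (e k))"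
    and m: "summable (\<lambda>k. 1 / m k)" "\<And>k. 0 < m k" "\<And>k. m k \<le> lam (e k)"
    and ctl: "\<And>\<phi>. \<phi> \<in> borel_measurable borel \<Longrightarrow> \<forall>t. norm (\<phi> t) \<le> (1 :: real) \<Longrightarrow> \<exists>L p q. admissible L p q \<and>
       (\<forall>k t. src p q (e k) t = c k *\<^sub>R (B *v (\<phi> t *s w))) \<and> (\<forall>i t. i \<notin> range e \<longrightarrow> src p q i t = 0)"
    and orth: "\<And>L p q. admissible L p q \<Longrightarrow> Re (\<integral>i. cdot (ctrl p q T i) (\<zeta> i) \<partial>CS) = 0"
  shows "dirichlet_conv (\<lambda>k. lam (e k)) (a e)" and "dirichlet_conv (\<lambda>k. lam (e k)) (b e)"
    and "s > 0 \<Longrightarrow> exp (\<theta>1 * of_real s) * dirichlet (\<lambda>k. lam (e k)) (a e) (of_real s)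
      + dexp \<theta>1 \<theta>2 (of_real s) * dirichlet (\<lambda>k. lam (e k)) (b e) (of_real s) = 0"
proof -
  let ?\<mu> = "\<lambda>k. lam (e k)" and ?I = "lborel_on {0<..<T}"
  have dn: "norm (d i) \<le> L2_norm CS d" for i
  proof -
    obtain n where "i \<in> Q n" using eventually_in_Q[of i] eventually_happens by fastforce
    then have "(norm (d i))\<^sup>2 \<le> (\<Sum>i\<in>Q n. (norm (d i))\<^sup>2)" by (intro member_le_sum) auto
    then have "(norm (d i))\<^sup>2 \<le> (L2_norm CS d)\<^sup>2" using L2_CS_sum_le[OF d, of n] by linarith
    then show ?thesis by (rule power2_le_imp_le) simp
  qed
  \<comment> \<open>The weight \<open>c k\<close> is at most \<open>sqrt (lam (e k))\<close>, the
    factor divided out in \<open>\<zeta>\<close>, so the Dirichlet coefficients are bounded.\<close>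
  have cb: "norm (c k *\<^sub>R cdot v (B *v w)) \<le> K * L2_norm CS d * norm (B *v w)" if v: "norm v \<le> K * norm (\<zeta> (e k))" and K: "K \<ge> 0" for k v K
  proof -
    have sl: "sqrt (lam (e k)) > 0" using lam_pos by simp
    have "norm (c k *\<^sub>R cdot v (B *v w)) \<le> sqrt (lam (e k)) * (norm v * norm (B *v w))"
      unfolding norm_scaleR using sl by (intro mult_mono norm_cdot_le) (auto simp: c)
    also have "\<dots> \<le> sqrt (lam (e k)) * (K * norm (\<zeta> (e k)) * norm (B *v w))" using v sl by (intro mult_left_mono mult_right_mono) auto
    also have "\<dots> = K * norm (d (e k)) * norm (B *v w)" using sl by (simp add: \<zeta>_def)
    also have "\<dots> \<le> K * L2_norm CS d * norm (B *v w)" using K by (intro mult_left_mono mult_right_mono dn) auto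
    finally show ?thesis .
  qed
  obtain J where J: "J > 0" "\<And>v. norm ((Ms - mat \<theta>1) *v v) \<le> norm v * J"
    using bounded_linear.pos_bounded[OF matrix_vector_mul_bounded_linear] by blast
  have NJ: "norm (Nm v) \<le> J * norm v" for v using J(2)[of v] by (simp add: mv_simps mult.commute)
  show ca: "dirichlet_conv ?\<mu> (a e)" unfolding a_def by (rule dirichlet_convI[OF cb[of _ 1] m]) simp_all
  show cv: "dirichlet_conv ?\<mu> (b e)" unfolding b_def by (rule dirichlet_convI[OF cb[of _ J] m]) (use NJ J in \<open>simp_all add: less_imp_le\<close>)
  define F where "F t = exp (\<theta>1 * of_real (T - t)) * dirichlet ?\<mu> (a e) (of_real (T - t))
      + dexp \<theta>1 \<theta>2 (of_real (T - t)) * dirichlet ?\<mu> (b e) (of_real (T - t))" for t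
  define g where "g t k = of_real (c k * exp (- (lam (e k) * (T - t)))) * cdot (Em (T - t) *v \<zeta> (e k)) (B *v w)" for t k
  have gF: "(\<lambda>k. g t k) sums F t" "summable (\<lambda>k. norm (g t k))" if "t < T" for t
  proof -
    have r: "Re (of_real (T - t)) > 0" using that by simp
    let ?E = "\<lambda>k. exp (- (of_real (lam (e k)) * complex_of_real (T - t)))"
    have g: "g t k = exp (\<theta>1 * of_real (T - t)) * (a e k * ?E k) + dexp \<theta>1 \<theta>2 (of_real (T - t)) * (b e k * ?E k)" for k
      unfolding g_def a_def b_def Em_apply cdot_add_left cdot_smult_left
      by (simp add: scaleR_conv_of_real algebra_simps flip: exp_of_real)
    show "(\<lambda>k. g t k) sums F t"
      unfolding g F_def dirichlet_def by (intro sums_add sums_mult summable_sums dirichlet_summable ca cv r)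
    show "summable (\<lambda>k. norm (g t k))"
    proof (rule summable_comparison_test'[where N = 0])
      show "summable (\<lambda>k. norm (exp (\<theta>1 * of_real (T - t))) * norm (a e k * ?E k) + norm (dexp \<theta>1 \<theta>2 (of_real (T - t))) * norm (b e k * ?E k))"
        by (intro summable_add summable_mult dirichlet_summable_norm ca cv r)
      show "norm (norm (g t k)) \<le> norm (exp (\<theta>1 * of_real (T - t))) * norm (a e k * ?E k) + norm (dexp \<theta>1 \<theta>2 (of_real (T - t))) * norm (b e k * ?E k)" for k
        unfolding g real_norm_def abs_norm_cancel norm_mult[symmetric] by (rule norm_triangle_ineq)
    qed
  qed
  \<comment> \<open>\<open>suminf\<close> is total, so measurability holds on the whole line
    although convergence is known only for \<open>t < T\<close>.\<close>
  have Fm: "F \<in> borel_measurable borel"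
    unfolding F_def[abs_def] dirichlet_def
    by (intro borel_measurable_add borel_measurable_times borel_measurable_suminf borel_measurable_continuous_onI continuous_intros
        continuous_on_compose2[OF continuous_exp_dexp(2)]) auto
  define \<phi> where "\<phi> t = sgn (F t)" for t
  have "\<phi> \<in> borel_measurable borel"
    using Fm unfolding \<phi>_def[abs_def] sgn_div_norm by measurable
  moreover have "\<forall>t. norm (\<phi> t) \<le> (1 :: real)" by (simp add: \<phi>_def norm_sgn)
  ultimately obtain L p q where ad: "admissible L p q" and src_e: "\<And>k t. src p q (e k) t = c k *\<^sub>R (B *v (\<phi> t *s w))"
    and src_0: "\<And>i t. i \<notin> range e \<Longrightarrow> src p q i t = 0" using ctl by blast
  let ?H = "\<lambda>t. \<integral>i. cdot (src p q i t) (flow i (T - t) (\<zeta> i)) \<partial>CS"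
  have \<zeta>L: "\<zeta> \<in> L2_space CS"
    unfolding \<zeta>_def
  proof (rule L2_space_bound[OF d, of _ "1 / sqrt (lam (0,0))"])
    fix i
    from mult_right_mono[OF inverse_sqrt_lam_le norm_ge_zero[of "d i"]]
    show "norm (d i /\<^sub>R sqrt (lam i)) \<le> 1 / sqrt (lam (0,0)) * norm (d i)" using lam_pos[of i] by (simp add: divide_inverse)
  qed simp
  note dual = ctrl_dual[OF ad \<zeta>L less_imp_le[OF T]]
  \<comment> \<open>The summed observation is \<open>\<phi> t * cnj (F t)\<close>, and
    \<open>sgn z * cnj z\<close> is \<open>norm z\<close>: the integrand is real and nonnegative, so
    the vanishing real part of the pairing determines it.\<close>
  have H: "?H t = of_real (norm (F t))" if "t < T" for t
  proof -
    have f: "cdot (src p q (e k) t) (flow (e k) (T - t) (\<zeta> (e k))) = \<phi> t * cnj (g t k)" for k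
      unfolding src_e g_def cdot_scaleR_left cdot_scaleR_right mv_smult cdot_smult_left
      by (simp add: cdot_commute[of "B *v w"] scaleR_conv_of_real mult_ac)
    have "?H t = (\<Sum>k. \<phi> t * cnj (g t k))"
      using integral_count_space_line[OF e, of "\<lambda>i. cdot (src p q i t) (flow i (T - t) (\<zeta> i))", unfolded f]
        summable_mult[OF gF(2)[OF that], of "norm (\<phi> t)"] by (simp add: src_0 norm_mult)
    also have "\<dots> = \<phi> t * cnj (F t)" by (rule sums_unique[symmetric]) (intro sums_mult sums_cnj[THEN iffD2] gF that)
    finally show ?thesis by (simp add: \<phi>_def sgn_mult_cnj)
  qed
  have sp: "t \<in> space ?I \<Longrightarrow> t < T" for t by (simp add: space_restrict_space)
  have iF: "integrable ?I (\<lambda>t. complex_of_real (norm (F t)))"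
    using dual(4) by (rule Bochner_Integration.integrable_cong[THEN iffD1, rotated 2]) (use H sp in auto)
  have "(\<integral>i. cdot (ctrl p q T i) (\<zeta> i) \<partial>CS) = (\<integral>t. complex_of_real (norm (F t)) \<partial>?I)"
    unfolding dual(1) by (rule Bochner_Integration.integral_cong[OF refl H[OF sp]])
  then have "(\<integral>t. norm (F t) \<partial>?I) = 0" using orth[OF ad] by simp
  then have "AE t in ?I. norm (F t) = 0"
    using integrable_norm[OF iF] by (subst (asm) integral_nonneg_eq_0_iff_AE) auto
  then have "AE t in ?I. F t = 0" by simp
  then show "s > 0 \<Longrightarrow> exp (\<theta>1 * of_real s) * dirichlet ?\<mu> (a e) (of_real s) + dexp \<theta>1 \<theta>2 (of_real s) * dirichlet ?\<mu> (b e) (of_real s) = 0"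
    unfolding F_def by (rule dirichlet_continuation[OF lam_pos ca cv T])
qed

section \<open>Controls acting on a single row or column of modes\<close>

lemma admissible_single:
  fixes w :: "complex^'n" and \<phi> :: "real \<Rightarrow> complex"
  assumes "\<phi> \<in> borel_measurable borel" "\<forall>t. norm (\<phi> t) \<le> 1"
  shows "admissible (Suc l) (\<lambda>j t. if j = l then \<phi> t *s w else 0) (\<lambda>j t. 0)"
    and "admissible (Suc l) (\<lambda>j t. 0) (\<lambda>j t. if j = l then \<phi> t *s w else 0)"
proof -
  have m: "(\<lambda>t. if j = l then \<phi> t *s w else 0) \<in> borel_measurable borel" for j
    using assms by (cases "j = l") (auto intro: borel_measurable_smult)
  have n: "norm (\<phi> t *s w) \<le> norm w" for t
    using assms(2) mult_right_mono[of "norm (\<phi> t)" 1 "norm w"] by (auto simp: norm_smult)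
  show "admissible (Suc l) (\<lambda>j t. if j = l then \<phi> t *s w else 0) (\<lambda>j t. 0)"
    "admissible (Suc l) (\<lambda>j t. 0) (\<lambda>j t. if j = l then \<phi> t *s w else 0)"
    unfolding admissible_def using m n by (auto intro!: exI[of _ "norm w"])
qed

lemma control_left:
  assumes "\<phi> \<in> borel_measurable borel" "\<forall>t. norm (\<phi> t) \<le> 1"
  shows "\<exists>L p q. admissible L p q \<and> (\<forall>k t. src p q (k, l) t = freq X1 k *\<^sub>R (B *v (\<phi> t *s w))) \<and>
    (\<forall>i t. i \<notin> range (\<lambda>k. (k, l)) \<longrightarrow> src p q i t = 0)"
  by (intro exI conjI, rule admissible_single(1)[OF assms, of l w]) (auto simp: src_def image_def)

lemma control_top:
  assumes "\<phi> \<in> borel_measurable borel" "\<forall>t. norm (\<phi> t) \<le> 1"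
  shows "\<exists>L p q. admissible L p q \<and> (\<forall>l t. src p q (k, l) t = ((-1) ^ l * freq X2 l) *\<^sub>R (B *v (\<phi> t *s w))) \<and>
    (\<forall>i t. i \<notin> range (\<lambda>l. (k, l)) \<longrightarrow> src p q i t = 0)"
  by (intro exI conjI, rule admissible_single(2)[OF assms, of k w]) (auto simp: src_def image_def)

lemma adjoint_kernelI:
  assumes "\<And>w. cdot v (B *v w) = 0"
  shows "conj_transpose B *v v = 0"
proof -
  have "cdot (conj_transpose B *v v) (conj_transpose B *v v) = 0" unfolding cdot_adjoint' by (rule assms)
  then show ?thesis by (metis Re_cdot inner_eq_zero_iff zero_complex.sel(1))
qed

text \<open>
  For distinct roots a nonzero \<open>\<theta>1\<close>-component at \<open>(k,l)\<close> forces a nonzero \<open>\<theta>2\<close>-component at some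
  \<open>(k',l)\<close> by the left edge, hence a nonzero \<open>\<theta>1\<close>-component at some \<open>(k',l')\<close> by the top edge.  Both
  eigenvalue gaps equal \<open>\<theta>2 - \<theta>1\<close>, so one of the two indices decreases strictly at each round.
\<close>

lemma orthogonal_imp_zero:
  assumes T: "T > 0" and ker: "\<And>\<theta> v. Ms *v v = \<theta> *s v \<Longrightarrow> conj_transpose B *v v = 0 \<Longrightarrow> v = 0" and d: "d \<in> L2_space CS"
    and orth: "\<And>L p q. admissible L p q \<Longrightarrow> Re (\<integral>i. cdot (ctrl p q T i) (d i /\<^sub>R sqrt (lam i)) \<partial>CS) = 0"
  shows "d i = 0"
proof -
  define \<zeta> where "\<zeta> i = d i /\<^sub>R sqrt (lam i)" for i
  have fp: "freq X1 k > 0" "freq X2 k > 0" for k using X1 X2 freq_pos by auto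
  have mono: "strict_mono (\<lambda>k. lam (k, l))" "strict_mono (\<lambda>l. lam (k, l))" for k l
    unfolding strict_mono_def lam_def using fp by (auto intro!: power_strict_mono freq_less X1 X2 less_imp_le)
  have sq: "freq X1 k \<le> sqrt (lam (k, l))" "freq X2 l \<le> sqrt (lam (k, l))" for k l
    by (intro real_le_rsqrt; simp add: lam_def)+
  have c: "\<bar>freq X1 k\<bar> \<le> sqrt (lam (k, l))" "\<bar>(-1) ^ l * freq X2 l\<bar> \<le> sqrt (lam (k, l))" for k l
    using sq(1)[of k l] sq(2)[of l k] fp by (simp_all add: abs_mult power_abs abs_of_pos)
  have m: "0 < (freq X1 k)\<^sup>2" "0 < (freq X2 k)\<^sup>2" "(freq X1 k)\<^sup>2 \<le> lam (k, l)" "(freq X2 l)\<^sup>2 \<le> lam (k, l)" for k l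
    using fp[of k] by (auto simp: lam_def)
  have inj: "inj (\<lambda>k. (k, l))" "inj (\<lambda>l. (k, l))" for k l :: nat by (auto simp: inj_on_def)
  have L: "dirichlet_conv (\<lambda>k. lam (k, l)) (\<lambda>k. freq X1 k *\<^sub>R cdot (\<zeta> (k, l)) (B *v w))"
    "dirichlet_conv (\<lambda>k. lam (k, l)) (\<lambda>k. freq X1 k *\<^sub>R cdot (Nm (\<zeta> (k, l))) (B *v w))"
    "s > 0 \<Longrightarrow> exp (\<theta>1 * of_real s) * dirichlet (\<lambda>k. lam (k, l)) (\<lambda>k. freq X1 k *\<^sub>R cdot (\<zeta> (k, l)) (B *v w)) (of_real s)
      + dexp \<theta>1 \<theta>2 (of_real s) * dirichlet (\<lambda>k. lam (k, l)) (\<lambda>k. freq X1 k *\<^sub>R cdot (Nm (\<zeta> (k, l))) (B *v w)) (of_real s) = 0" for l w s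
    unfolding \<zeta>_def by (rule line_vanish[OF T d inj(1) c(1) summable_inverse_freq_sq[OF X1] m(1) m(3) control_left orth]; assumption)+
  have U: "dirichlet_conv (\<lambda>l. lam (k, l)) (\<lambda>l. ((-1) ^ l * freq X2 l) *\<^sub>R cdot (\<zeta> (k, l)) (B *v w))"
    "dirichlet_conv (\<lambda>l. lam (k, l)) (\<lambda>l. ((-1) ^ l * freq X2 l) *\<^sub>R cdot (Nm (\<zeta> (k, l))) (B *v w))"
    "s > 0 \<Longrightarrow> exp (\<theta>1 * of_real s) * dirichlet (\<lambda>l. lam (k, l)) (\<lambda>l. ((-1) ^ l * freq X2 l) *\<^sub>R cdot (\<zeta> (k, l)) (B *v w)) (of_real s)
      + dexp \<theta>1 \<theta>2 (of_real s) * dirichlet (\<lambda>l. lam (k, l)) (\<lambda>l. ((-1) ^ l * freq X2 l) *\<^sub>R cdot (Nm (\<zeta> (k, l))) (B *v w)) (of_real s) = 0" for k w s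
    unfolding \<zeta>_def by (rule line_vanish[OF T d inj(2) c(2) summable_inverse_freq_sq[OF X2] m(2) m(4) control_top orth]; assumption)+
  have vanish: "cdot (\<zeta> i) (B *v w) = 0 \<and> cdot (Nm (\<zeta> i)) (B *v w) = 0" for w i
  proof (cases "\<theta>1 = \<theta>2")
    \<comment> \<open>With a double root the factor \<open>exp (\<theta>1 * of_real s)\<close>
      divides out and \<open>dexp\<close> contributes the extra factor \<open>s\<close>: the
      resonant case.\<close>
    case True
    have "dirichlet (\<lambda>k. lam (k, snd i)) (\<lambda>k. freq X1 k *\<^sub>R cdot (\<zeta> (k, snd i)) (B *v w)) (of_real s)
        + of_real s * dirichlet (\<lambda>k. lam (k, snd i)) (\<lambda>k. freq X1 k *\<^sub>R cdot (Nm (\<zeta> (k, snd i))) (B *v w)) (of_real s) = 0" if "s > 0" for s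
    proof -
      have "exp (\<theta>1 * complex_of_real s) * (x + of_real s * y) = exp (\<theta>1 * of_real s) * x + dexp \<theta>1 \<theta>2 (of_real s) * y" for x y
        using True by (simp add: dexp_def algebra_simps)
      from L(3)[OF that, of "snd i" w, folded this] show ?thesis by simp
    qed
    from dirichlet_resonant_eq_0[OF mono(1) L(1) L(2) this, of "fst i"] show ?thesis using fp(1)[of "fst i"] by simp
  next
    case False
    \<comment> \<open>Observations of the two spectral components: \<open>u\<close> belongs to
      \<open>\<theta>1\<close> and \<open>v\<close>, up to the factor
      \<open>\<theta>2 - \<theta>1\<close>, to \<open>\<theta>2\<close>.\<close>
    define u v where "u i = cdot (\<zeta> i) (B *v w) - cdot (Nm (\<zeta> i)) (B *v w) / (\<theta>2 - \<theta>1)" and "v i = cdot (Nm (\<zeta> i)) (B *v w)" for i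
    have r: "c *\<^sub>R x - c *\<^sub>R y / z = c *\<^sub>R (x - y / z)" for c :: real and x y z :: complex by (simp add: scaleR_conv_of_real algebra_simps)
    have uv: "\<exists>k'. \<theta>1 - of_real (lam (k, l)) = \<theta>2 - of_real (lam (k', l)) \<and> v (k', l) \<noteq> 0" if "u (k, l) \<noteq> 0" for k l
      using dexp_collision(1)[OF mono(1) L(1) L(2) L(3) False, of k, unfolded r] that fp(1)[of k] by (auto simp: u_def v_def)
    have vu: "\<exists>l'. \<theta>2 - of_real (lam (k, l)) = \<theta>1 - of_real (lam (k, l')) \<and> u (k, l') \<noteq> 0" if "v (k, l) \<noteq> 0" for k l
      using dexp_collision(2)[OF mono(2) U(1) U(2) U(3) False, of l, unfolded r] that fp(2)[of l] by (auto simp: u_def v_def)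
    define \<delta> where "\<delta> = Re (\<theta>2 - \<theta>1)"
    have less: "j < k" if "(freq X j)\<^sup>2 < (freq X k)\<^sup>2" "X > 0" for X j k
      using that freq_less[of X k j] freq_pos[of X k] power_mono[of "freq X k" "freq X j" 2]
      by (metis less_imp_le linorder_neqE_nat not_less order.irrefl)
    have u0: "u i = 0" for i
    \<comment> \<open>Which index drops is decided by the sign of \<open>\<delta>\<close>, fixed
      once for all, so a single natural number serves as measure.\<close>
    proof (induction i rule: measure_induct_rule[of "\<lambda>i. if \<delta> < 0 then fst i else snd i"])
      case (less i)
      show ?case
      proof (rule ccontr)
        assume "u i \<noteq> 0"
        then obtain k' where k': "\<theta>1 - of_real (lam (fst i, snd i)) = \<theta>2 - of_real (lam (k', snd i))" "v (k', snd i) \<noteq> 0" using uv[of "fst i" "snd i"] by auto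
        from vu[OF k'(2)] obtain l' where l': "\<theta>2 - of_real (lam (k', snd i)) = \<theta>1 - of_real (lam (k', l'))" "u (k', l') \<noteq> 0" by blast
        have e: "\<theta>2 - \<theta>1 = of_real (lam (k', snd i) - lam (fst i, snd i))" "\<theta>2 - \<theta>1 = of_real (lam (k', snd i) - lam (k', l'))"
          using k'(1) l'(1) by (simp_all add: algebra_simps)
        \<comment> \<open>Along the left edge only the first index moves, along the top edge only
          the second, so the common gap is each time a difference of squares of one
          frequency.\<close>
        have "\<delta> = (freq X1 k')\<^sup>2 - (freq X1 (fst i))\<^sup>2" "\<delta> = (freq X2 (snd i))\<^sup>2 - (freq X2 l')\<^sup>2"
          unfolding \<delta>_def by (simp only: e(1) Re_complex_of_real, simp add: lam_def, simp only: e(2) Re_complex_of_real, simp add: lam_def)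
        \<comment> \<open>The gap between the roots is real by the collision, so distinct roots have
          distinct real parts.\<close>
        moreover have "\<delta> \<noteq> 0" using e(1) False by (auto simp: \<delta>_def)
        ultimately have "(if \<delta> < 0 then k' else l') < (if \<delta> < 0 then fst i else snd i)"
          using \<open>\<And>X k j. (freq X j)\<^sup>2 < (freq X k)\<^sup>2 \<Longrightarrow> X > 0 \<Longrightarrow> j < k\<close>[OF _ X1, of k' "fst i"]
            \<open>\<And>X k j. (freq X j)\<^sup>2 < (freq X k)\<^sup>2 \<Longrightarrow> X > 0 \<Longrightarrow> j < k\<close>[OF _ X2, of l' "snd i"] by auto
        with less[of "(k', l')", unfolded fst_conv snd_conv] l'(2) show False by simp
      qed
    qed
    have "v i = 0" for i using vu[of "fst i" "snd i"] u0 by auto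
    then show ?thesis using u0[of i] by (simp add: u_def v_def)
  qed
  \<comment> \<open>\<open>Nm (\<zeta> i)\<close> is zero or an eigenvector for
    \<open>\<theta>2\<close>, and the kernel hypothesis excludes the latter; then
    \<open>\<zeta> i\<close> itself satisfies the eigenvalue equation for
    \<open>\<theta>1\<close>.\<close>
  have N0: "Nm (\<zeta> i) = 0" by (rule ker[OF char adjoint_kernelI]) (use vanish in simp)
  have "\<zeta> i = 0" by (rule ker[of _ \<theta>1, OF _ adjoint_kernelI]) (use N0 vanish in simp_all)
  then show ?thesis using lam_pos[of i] by (simp add: \<zeta>_def)
qed

lemma ctrl_integrable:
  assumes "admissible L p q" "T \<ge> 0"
  shows "integrable (lborel_on {0<..<T}) (\<lambda>t. dflow i (T - t) (src p q i t))"
proof -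
  obtain gam where gam: "\<And>i t. norm (src p q i t) \<le> gam i" by (rule src_bound[OF assms(1)]) blast
  obtain K where K: "K > 0" "\<And>s x. s \<in> {0..T} \<Longrightarrow> norm (conj_transpose (Em s) *v x) \<le> K * norm x"
    by (rule Em_adjoint_bound[of T]) blast
  show ?thesis by (rule ctrl_integrable_bound(1)[OF assms(1) gam _ K]) (use assms(2) in auto)
qed

text \<open>Scalars are real because the density criterion works with a real subspace and a real
  inner product.\<close>

lemma ctrl_linear:
  assumes "admissible L p q" "admissible L' p' q'" "T \<ge> 0"
  shows "admissible (max L L') (\<lambda>l t. p l t + r *\<^sub>R p' l t) (\<lambda>l t. q l t + r *\<^sub>R q' l t)"
    and "ctrl (\<lambda>l t. p l t + r *\<^sub>R p' l t) (\<lambda>l t. q l t + r *\<^sub>R q' l t) T i = ctrl p q T i + r *\<^sub>R ctrl p' q' T i"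
proof -
  obtain K K' where K: "\<And>l t. norm (p l t) \<le> K \<and> norm (q l t) \<le> K" "\<And>l t. norm (p' l t) \<le> K' \<and> norm (q' l t) \<le> K'"
    using assms(1,2) unfolding admissible_def by blast
  have "norm (x + r *\<^sub>R y) \<le> K + \<bar>r\<bar> * K'" if "norm x \<le> K" "norm y \<le> K'" for x y :: "complex^'m"
    using that by (intro norm_triangle_mono) (auto intro: mult_left_mono)
  then have "\<exists>C. \<forall>l t. norm (p l t + r *\<^sub>R p' l t) \<le> C \<and> norm (q l t + r *\<^sub>R q' l t) \<le> C" using K by blast
  then show "admissible (max L L') (\<lambda>l t. p l t + r *\<^sub>R p' l t) (\<lambda>l t. q l t + r *\<^sub>R q' l t)"
    using assms(1,2) unfolding admissible_def by (auto intro!: borel_measurable_add borel_measurable_scaleR)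
  have s: "src (\<lambda>l t. p l t + r *\<^sub>R p' l t) (\<lambda>l t. q l t + r *\<^sub>R q' l t) i t = src p q i t + r *\<^sub>R src p' q' i t" for t
    by (simp add: src_def matrix_vector_right_distrib linear_scale[OF bounded_linear.linear[OF matrix_vector_mul_bounded_linear]] scaleR_add_right mult.commute)
  have "e *\<^sub>R (N *v (x + r *\<^sub>R y)) = e *\<^sub>R (N *v x) + r *\<^sub>R (e *\<^sub>R (N *v y))" for e and N :: "complex^2^2" and x y
    by (simp add: matrix_vector_right_distrib linear_scale[OF bounded_linear.linear[OF matrix_vector_mul_bounded_linear]] scaleR_add_right mult.commute)
  note e = this
  show "ctrl (\<lambda>l t. p l t + r *\<^sub>R p' l t) (\<lambda>l t. q l t + r *\<^sub>R q' l t) T i = ctrl p q T i + r *\<^sub>R ctrl p' q' T i"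
    unfolding ctrl_def s e by (simp add: ctrl_integrable[OF assms(1,3)] ctrl_integrable[OF assms(2,3)] del: scaleR_scaleR)
qed

text \<open>Density in \<open>H^-1\<close> is restated in l2 after division by
  \<open>sqrt (lam i)\<close>, where the criterion by a trivial orthogonal complement
  applies.\<close>

lemma reachable_dense:
  assumes T: "T > 0" and ker: "\<And>\<theta> v. Ms *v v = \<theta> *s v \<Longrightarrow> conj_transpose B *v v = 0 \<Longrightarrow> v = 0"
    and x: "x \<in> L2_space CS" and \<epsilon>: "\<epsilon> > 0"
  shows "\<exists>L p q. admissible L p q \<and> L2_norm CS (\<lambda>i. x i - ctrl p q T i /\<^sub>R sqrt (lam i)) < \<epsilon>"
proof -
  define R where "R = {\<lambda>i. ctrl p q T i /\<^sub>R sqrt (lam i) |L p q. admissible L p q}"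
  have T0: "T \<ge> 0" using T by simp
  have z: "admissible 0 (\<lambda>l t. 0) (\<lambda>l t. 0)" by (auto simp: admissible_def)
  have c0: "ctrl (\<lambda>l t. 0) (\<lambda>l t. 0) T i = 0" for i by (simp add: ctrl_def src_def)
  have RL: "R \<subseteq> L2_space CS" unfolding R_def using ctrl_hm1[OF _ T0] by (auto simp: hm1_def)
  have lin: "(\<lambda>i. u i + r *\<^sub>R v i) \<in> R" if uR: "u \<in> R" "v \<in> R" for u v r
  proof -
    obtain L L' and p q p' q' :: "nat \<Rightarrow> real \<Rightarrow> complex^'m" where a: "admissible L p q" "admissible L' p' q'"
      and uv: "u = (\<lambda>i. ctrl p q T i /\<^sub>R sqrt (lam i))" "v = (\<lambda>i. ctrl p' q' T i /\<^sub>R sqrt (lam i))" using uR unfolding R_def by blast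
    show ?thesis unfolding R_def uv
      using ctrl_linear[OF a T0, of r] by (intro CollectI exI conjI) (auto simp: scaleR_add_right)
  qed
  have zR: "(\<lambda>i. 0) \<in> R" unfolding R_def using z c0 by (auto intro!: exI)
  have "\<exists>u\<in>R. L2_norm CS (\<lambda>i. x i - u i) < \<epsilon>"
  proof (rule L2_dense_if_orthogonal_trivial[OF RL _ _ _ _ x \<epsilon>])
    show "R \<noteq> {}" using zR by blast
    show "(\<lambda>i. u i + v i) \<in> R" if "u \<in> R" "v \<in> R" for u v using lin[OF that, of 1] by simp
    show "(\<lambda>i. c *\<^sub>R u i) \<in> R" if "u \<in> R" for c u using lin[OF zR that, of c] by simp
    fix d assume d: "d \<in> L2_space CS" and o: "\<And>u. u \<in> R \<Longrightarrow> (\<integral>i. u i \<bullet> d i \<partial>CS) = 0"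
    have "d i = 0" for i
    proof (rule orthogonal_imp_zero[OF T _ d])
      show "v = 0" if "Ms *v v = \<theta> *s v" "conj_transpose B *v v = 0" for \<theta> v by (rule ker[OF that])
      fix L and p q :: "nat \<Rightarrow> real \<Rightarrow> complex^'m" assume a: "admissible L p q"
      let ?u = "\<lambda>i. ctrl p q T i /\<^sub>R sqrt (lam i)"
      have u: "?u \<in> R" using a unfolding R_def by blast
      have "integrable CS (\<lambda>i. cdot (?u i) (d i))"
      proof (rule L2_bilinear(1)[of ?u _ d _ 1])
        show "norm (cdot (?u i) (d i)) \<le> 1 * (norm (?u i) * norm (d i))" for i by (simp only: mult_1 norm_cdot_le)
      qed (use u RL d in auto)
      \<comment> \<open>The real inner product of the criterion is the real part of the complex
        pairing.\<close>
      from integral_Re[OF this] have "Re (\<integral>i. cdot (?u i) (d i) \<partial>CS) = (\<integral>i. ?u i \<bullet> d i \<partial>CS)" by (simp only: Re_cdot)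
      then show "Re (\<integral>i. cdot (ctrl p q T i) (d i /\<^sub>R sqrt (lam i)) \<partial>CS) = 0" using o[OF u] by (simp add: cdot_scaleR_left cdot_scaleR_right)
    qed
    then show "L2_norm CS d = 0" by (simp add: L2_norm_def)
  qed
  then show ?thesis unfolding R_def by blast
qed

lemma heat_approximately_controllable:
  assumes ker: "\<And>\<theta> v. Ms *v v = \<theta> *s v \<Longrightarrow> conj_transpose B *v v = 0 \<Longrightarrow> v = 0"
  shows "approximately_controllable Om sg nu active_edges A B"
  unfolding approximately_controllable_def approximately_controllable_at_def
proof (intro allI impI ballI)
  fix T \<epsilon> :: real and y0 y1 :: "(plane \<Rightarrow> complex^2) \<Rightarrow> complex" assume T: "T > 0" and y0: "y0 \<in> Sobolev_Hm1 Om" and y1: "y1 \<in> Sobolev_Hm1 Om" and \<epsilon>: "\<epsilon> > 0"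
  obtain b0 where b0: "hm1 b0" "\<And>\<zeta>. \<zeta> \<in> H10 \<Longrightarrow> y0 \<zeta> = Fn b0 \<zeta>" by (rule Hm1_representation[OF y0]) blast
  obtain b1 where b1: "hm1 b1" "\<And>\<zeta>. \<zeta> \<in> H10 \<Longrightarrow> y1 \<zeta> = Fn b1 \<zeta>" by (rule Hm1_representation[OF y1]) blast
  let ?o = "\<lambda>l t. 0 :: complex^'m"
  have z: "admissible 0 ?o ?o" by (auto simp: admissible_def)
  \<comment> \<open>The control must reach the target minus the free evolution of the initial data;
    \<open>sol\<close> with zero controls stands for the latter.\<close>
  define x where "x i = (b1 i - sol b0 ?o ?o T i) /\<^sub>R sqrt (lam i)" for i
  have xL: "x \<in> L2_space CS" using hm1_diff[OF b1(1) sol_hm1[OF z b0(1)], of T] T by (simp add: hm1_def x_def[abs_def])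
  \<comment> \<open>The tolerance is scaled by \<open>sqrt Nn\<close> to offset the division by it
    in \<open>Hm1_norm_le\<close>.\<close>
  have e: "sqrt Nn * \<epsilon> > 0" using \<epsilon> Nn_pos by simp
  have "\<exists>L p q. admissible L p q \<and> L2_norm CS (\<lambda>i. x i - ctrl p q T i /\<^sub>R sqrt (lam i)) < sqrt Nn * \<epsilon>"
    by (rule reachable_dense[OF T ker xL e])
  then obtain L p q where ad: "admissible L p q" and near: "L2_norm CS (\<lambda>i. x i - ctrl p q T i /\<^sub>R sqrt (lam i)) < sqrt Nn * \<epsilon>" by blast
  have T0: "T \<ge> 0" using T by simp
  note sT = sol_hm1[OF ad b0(1) T0]
  have "ctrl ?o ?o T i = 0" for i by (simp add: ctrl_def src_def)
  then have "(sol b0 p q T i - b1 i) /\<^sub>R sqrt (lam i) = - (x i - ctrl p q T i /\<^sub>R sqrt (lam i))" for i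
    unfolding x_def sol_def by (simp add: scaleR_diff_right scaleR_add_right)
  then have hn: "hnorm (\<lambda>i. sol b0 p q T i - b1 i) < sqrt Nn * \<epsilon>" unfolding hnorm_def
    using near L2_norm_minus_commute[of CS x "\<lambda>i. ctrl p q T i /\<^sub>R sqrt (lam i)"] by simp
  have "Hm1_norm Om (\<lambda>\<zeta>. Fn (sol b0 p q T) \<zeta> - y1 \<zeta>) \<le> hnorm (\<lambda>i. sol b0 p q T i - b1 i) / sqrt Nn"
    by (rule Hm1_norm_le[OF hm1_diff[OF sT b1(1)]]) (simp add: Fn_diff[OF sT b1(1)] b1(2))
  also have "\<dots> \<le> \<epsilon>" using hn Nn_pos by (simp add: divide_le_eq mult.commute)
  finally show "\<exists>g\<in>boundary_L2 T sg. \<exists>y. transposition_solution Om sg nu active_edges A B T y0 g y \<and>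
      Hm1_norm Om (\<lambda>\<zeta>. y T \<zeta> - y1 \<zeta>) \<le> \<epsilon>"
    using transposition_solution_series[OF ad T b0] ctrl_fun_boundary_L2[OF ad] by blast
qed

end

theorem theorem2p16:
  fixes X1 X2 :: real and A :: "complex^2^2" and B :: "complex^'m^2"
  assumes "X1 > 0" and "X2 > 0"
    and "\<forall>\<theta>. matrix_eigenvalue (conj_transpose A) \<theta> \<longrightarrow>
           matrix_kernel (mat \<theta> - conj_transpose A) \<inter> matrix_kernel (conj_transpose B) = {0}"
  shows "approximately_controllable (rect X1 X2) (rect_surface X1 X2) (rect_normal X1 X2)
           (rect_left X1 X2 \<union> rect_top X1 X2) A B"
proof -
  obtain \<theta>1 \<theta>2 where char: "\<And>v. conj_transpose A *v (conj_transpose A *v v - \<theta>1 *s v) = \<theta>2 *s (conj_transpose A *v v - \<theta>1 *s v)"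
    by (rule characteristic_roots_2[of "conj_transpose A"]) blast
  interpret heat_system X1 X2 A B \<theta>1 \<theta>2 by unfold_locales (fact assms(1,2) char)+
  \<comment> \<open>A nonzero \<open>v\<close> would make \<open>\<theta>\<close> an eigenvalue, so
    the hypothesis about eigenvalues settles every \<open>\<theta>\<close>.\<close>
  have "v = 0" if v: "conj_transpose A *v v = \<theta> *s v" "conj_transpose B *v v = 0" for \<theta> v
  proof (rule ccontr)
    assume "v \<noteq> 0"
    then have "matrix_eigenvalue (conj_transpose A) \<theta>" using v(1) by (auto simp: matrix_eigenvalue_def)
    moreover have "v \<in> matrix_kernel (mat \<theta> - conj_transpose A) \<inter> matrix_kernel (conj_transpose B)"
      using v by (simp add: matrix_kernel_def mv_simps)
    ultimately show False using assms(3) \<open>v \<noteq> 0\<close> by blast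
  qed
  then show ?thesis by (rule heat_approximately_controllable)
qed

end
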